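(* There is a linear-time algorithm which, given an orientation $\overrightarrow{U}$ of a unicyclic graph $U$, computes a metric basis of $\overrightarrow{U}$.
   Context: A unicyclic graph is a connected simple undirected graph containing exactly one cycle. An orientation of an undirected graph is a digraph obtained by replacing each edge $uv$ by exactly one of the arcs $\overrightarrow{uv}$, $\overrightarrow{vu}$. For vertices $x,y$ of a digraph, $\mathrm{dist}(x,y)$ is the length of a shortest directed path from $x$ to $y$, and $\infty$ if none exists. A set $S$ of vertices of a digraph $G$ is a resolving set if (1) for every pair of distinct vertices $v,w$ there is $x\in S$ with $\mathrm{dist}(x,v)\neq\mathrm{dist}(x,w)$, and (2) every vertex of $G$ is reachable from at least one vertex of $S$ (a vertex is reachable from itself). A metric basis is a resolving set of minimum size. Linear time means linear in the number of vertices plus arcs. *)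

theory Defs
  imports "Graph_Theory.Digraph_Component" "HOL-Library.Extended_Nat"
begin

section \<open>Unicyclic graphs, orientations, metric bases\<close>

text \<open>
  A finite simple undirected graph is a \<^locale>\<open>pair_graph\<close>: a finite, loopless, symmetric digraph
  without parallel arcs, the edge \<open>uv\<close> being the pair of arcs \<open>(u,v)\<close>, \<open>(v,u)\<close>.

  A cycle is identified with its edge set, so that neither the starting vertex nor the direction of
  traversal counts. The bound on the length excludes the closed walks \<open>u, v, u\<close> along a single edge,
  which are cycles of the symmetric digraph but not of the undirected graph.
\<close>

definition cycle_edge_sets :: "'a pair_pre_digraph \<Rightarrow> 'a set set set" where
  "cycle_edge_sets U =
     {(\<lambda>(u, v). {u, v}) ` set p | p. pre_digraph.cycle (with_proj U) p \<and> 3 \<le> length p}"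

definition unicyclic :: "'a pair_pre_digraph \<Rightarrow> bool" where
  "unicyclic U \<longleftrightarrow>
     pair_graph U \<and> Digraph_Component.connected (with_proj U) \<and> (\<exists>!C. C \<in> cycle_edge_sets U)"

definition orientation :: "'a pair_pre_digraph \<Rightarrow> 'a pair_pre_digraph \<Rightarrow> bool" where
  "orientation U D \<longleftrightarrow>
     pverts D = pverts U \<and> parcs D \<subseteq> parcs U \<and>
     (\<forall>(u, v) \<in> parcs U. ((u, v) \<in> parcs D) \<noteq> ((v, u) \<in> parcs D))"

text \<open>The infimum of the empty set is \<open>\<infinity>\<close>.\<close>

definition ddist :: "'a pair_pre_digraph \<Rightarrow> 'a \<Rightarrow> 'a \<Rightarrow> enat" where
  "ddist D x y = (INF p \<in> {p. pre_digraph.apath (with_proj D) x p y}. enat (length p))"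

definition resolving_set :: "'a pair_pre_digraph \<Rightarrow> 'a set \<Rightarrow> bool" where
  "resolving_set D S \<longleftrightarrow>
     S \<subseteq> pverts D \<and>
     (\<forall>v \<in> pverts D. \<forall>w \<in> pverts D. v \<noteq> w \<longrightarrow> (\<exists>x \<in> S. ddist D x v \<noteq> ddist D x w)) \<and>
     (\<forall>v \<in> pverts D. \<exists>x \<in> S. x \<rightarrow>\<^sup>*\<^bsub>with_proj D\<^esub> v)"

definition metric_basis :: "'a pair_pre_digraph \<Rightarrow> 'a set \<Rightarrow> bool" where
  "metric_basis D S \<longleftrightarrow> resolving_set D S \<and> (\<forall>T. resolving_set D T \<longrightarrow> card S \<le> card T)"


section \<open>Random access machine programs\<close>

text \<open>
  Programs of a random access machine, in structured form. A program mentions finitely many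
  registers and finitely many arrays of natural numbers. Its elementary operations are addition,
  truncated subtraction, comparison and indirect addressing; each costs one time unit.

  To rule out the well-known abuse of unit costs on huge numbers, the machine has a largest word
  \<open>W\<close>: a computation in which any value or any array index exceeds \<open>W\<close> is stuck. If \<open>W\<close> is
  proportional to the input size, words have logarithmic length.
\<close>

datatype expr =
    Num nat
  | Reg string
  | Read string expr
  | Plus expr expr
  | Minus expr expr

datatype cond =
    Less expr expr
  | Neg cond
  | Conj cond cond

datatype com =
    Skip
  | Assign string expr
  | Write string expr expr  \<comment> \<open>array, index, new value\<close>
  | Seq com com
  | Branch cond com com
  | While cond com

record memory =
  reg :: "string \<Rightarrow> nat"
  arr :: "string \<Rightarrow> nat \<Rightarrow> nat"

primrec val :: "memory \<Rightarrow> expr \<Rightarrow> nat" where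
  "val s (Num k) = k"
| "val s (Reg x) = reg s x"
| "val s (Read a e) = arr s a (val s e)"
| "val s (Plus e f) = val s e + val s f"
| "val s (Minus e f) = val s e - val s f"

primrec fits :: "nat \<Rightarrow> memory \<Rightarrow> expr \<Rightarrow> bool" where
  "fits W s (Num k) \<longleftrightarrow> k \<le> W"
| "fits W s (Reg x) \<longleftrightarrow> reg s x \<le> W"
| "fits W s (Read a e) \<longleftrightarrow> fits W s e \<and> arr s a (val s e) \<le> W"
| "fits W s (Plus e f) \<longleftrightarrow> fits W s e \<and> fits W s f \<and> val s e + val s f \<le> W"
| "fits W s (Minus e f) \<longleftrightarrow> fits W s e \<and> fits W s f"

primrec cost :: "expr \<Rightarrow> nat" where
  "cost (Num k) = 1"
| "cost (Reg x) = 1"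
| "cost (Read a e) = 1 + cost e"
| "cost (Plus e f) = 1 + cost e + cost f"
| "cost (Minus e f) = 1 + cost e + cost f"

primrec holds :: "memory \<Rightarrow> cond \<Rightarrow> bool" where
  "holds s (Less e f) \<longleftrightarrow> val s e < val s f"
| "holds s (Neg b) \<longleftrightarrow> \<not> holds s b"
| "holds s (Conj b c) \<longleftrightarrow> holds s b \<and> holds s c"

primrec cond_fits :: "nat \<Rightarrow> memory \<Rightarrow> cond \<Rightarrow> bool" where
  "cond_fits W s (Less e f) \<longleftrightarrow> fits W s e \<and> fits W s f"
| "cond_fits W s (Neg b) \<longleftrightarrow> cond_fits W s b"
| "cond_fits W s (Conj b c) \<longleftrightarrow> cond_fits W s b \<and> cond_fits W s c"

primrec cond_cost :: "cond \<Rightarrow> nat" where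
  "cond_cost (Less e f) = 1 + cost e + cost f"
| "cond_cost (Neg b) = 1 + cond_cost b"
| "cond_cost (Conj b c) = 1 + cond_cost b + cond_cost c"

text \<open>
  \<open>exec W c s t s'\<close>: with largest word \<open>W\<close>, the program \<open>c\<close> started in memory \<open>s\<close> halts after
  exactly \<open>t\<close> time units in memory \<open>s'\<close>.
\<close>

inductive exec :: "nat \<Rightarrow> com \<Rightarrow> memory \<Rightarrow> nat \<Rightarrow> memory \<Rightarrow> bool" for W where
  Skip: "exec W Skip s 1 s"
| Assign: "fits W s e \<Longrightarrow>
    exec W (Assign x e) s (1 + cost e) (s\<lparr>reg := (reg s)(x := val s e)\<rparr>)"
| Write: "fits W s i \<Longrightarrow> fits W s e \<Longrightarrow>
    exec W (Write a i e) s (1 + cost i + cost e)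
      (s\<lparr>arr := (arr s)(a := (arr s a)(val s i := val s e))\<rparr>)"
| Seq: "exec W c s t s' \<Longrightarrow> exec W d s' t' s'' \<Longrightarrow> exec W (Seq c d) s (t + t') s''"
| BranchTrue: "cond_fits W s b \<Longrightarrow> holds s b \<Longrightarrow> exec W c s t s' \<Longrightarrow>
    exec W (Branch b c d) s (1 + cond_cost b + t) s'"
| BranchFalse: "cond_fits W s b \<Longrightarrow> \<not> holds s b \<Longrightarrow> exec W d s t s' \<Longrightarrow>
    exec W (Branch b c d) s (1 + cond_cost b + t) s'"
| WhileFalse: "cond_fits W s b \<Longrightarrow> \<not> holds s b \<Longrightarrow>
    exec W (While b c) s (1 + cond_cost b) s"
| WhileTrue: "cond_fits W s b \<Longrightarrow> holds s b \<Longrightarrow> exec W c s t s' \<Longrightarrow>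
    exec W (While b c) s' t' s'' \<Longrightarrow>
    exec W (While b c) s (1 + cond_cost b + t + t') s''"

inductive_cases exec_SkipE: "exec W Skip s t s'"
inductive_cases exec_AssignE: "exec W (Assign x e) s t s'"
inductive_cases exec_WriteE: "exec W (Write a i e) s t s'"
inductive_cases exec_SeqE: "exec W (Seq c d) s t s'"
inductive_cases exec_BranchE: "exec W (Branch b c d) s t s'"
inductive_cases exec_WhileE: "exec W (While b c) s t s'"

lemma exec_deterministic:
  "exec W c s t s' \<Longrightarrow> exec W c s u s'' \<Longrightarrow> u = t \<and> s'' = s'"
proof (induction arbitrary: u s'' rule: exec.induct)
  case (Skip s)
  then show ?case by (rule exec_SkipE) simp
next
  case (Assign s e x)
  from Assign.prems show ?case by (rule exec_AssignE) simp
next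
  case (Write s i e a)
  from Write.prems show ?case by (rule exec_WriteE) simp
next
  case (Seq c s t s' d t' s2)
  from Seq.prems show ?case
    by (rule exec_SeqE) (metis Seq.IH)
next
  case (BranchTrue s b c t s' d)
  from BranchTrue.prems show ?case
    by (rule exec_BranchE) (fastforce dest: BranchTrue.IH, simp add: BranchTrue.hyps)
next
  case (BranchFalse s b d t s' c)
  from BranchFalse.prems show ?case
    by (rule exec_BranchE) (simp add: BranchFalse.hyps, fastforce dest: BranchFalse.IH)
next
  case (WhileFalse s b c)
  from WhileFalse.prems show ?case
    by (rule exec_WhileE) (simp_all add: WhileFalse.hyps)
next
  case (WhileTrue s b c t s' t' s2)
  from WhileTrue.prems show ?case
    by (rule exec_WhileE) (simp add: WhileTrue.hyps, fastforce dest: WhileTrue.IH)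
qed

text \<open>
  A digraph with vertices \<open>0, \<dots>, n - 1\<close> is given as a list of its arcs in arbitrary order: arc
  number \<open>i\<close> leads from \<open>tail[i]\<close> to \<open>head[i]\<close>. The rest of the memory is zero.
\<close>

definition ram_input :: "nat \<Rightarrow> (nat \<times> nat) list \<Rightarrow> memory" where
  "ram_input n as =
     \<lparr>reg = (\<lambda>_. 0)(''n'' := n, ''m'' := length as),
      arr = (\<lambda>_ _. 0)
        (''tail'' := (\<lambda>i. if i < length as then fst (as ! i) else 0),
         ''head'' := (\<lambda>i. if i < length as then snd (as ! i) else 0))\<rparr>"

definition ram_output :: "memory \<Rightarrow> nat list" where
  "ram_output s = map (arr s ''out'') [0..<reg s ''k'']"

end

theory Submission
  imports Defs
begin

text \<open>
  A resolving set contains every source and, for every vertex \<open>u\<close>, all but at most one of the vertices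
  whose only predecessor is \<open>u\<close>, since two such vertices are at the same distance from everywhere else.
  A base set satisfies these conditions tightly; all base sets have the same size, and every resolving
  set contains one.

  If a set meeting these conditions does not resolve, then stepping back along predecessors from an
  unresolved pair ends on the cycle, the ring. Either the ring is directed, is disjoint from the set and
  has at most one entering arc, or the pair involves a sink of the ring, entered by its two ring
  neighbours only, whose two sides carry the same information: both lead to the same source of the ring
  or to two sources with a common sink opposite. In all cases one more ring vertex repairs the set. So a
  metric basis is a resolving base set if there is one, and otherwise any base set with that vertex added.

  Although there may be exponentially many base sets, a single one, chosen to leave out vertices off the
  ring and to minimize the lengths of the paths of left out vertices hanging from the ring, decides
  which case holds; only with a single sink one exchange at the source of the ring has to be tried as
  well. The algorithm finds the ring by peeling off leaves, computes the path lengths while going through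
  the peeled vertices, and tests the sinks by walking along their sides.
\<close>

text \<open>Stepping back is licensed by minimality: among the unresolved pairs one nearest to the
  set is taken, so single predecessors of its two vertices cannot form another unresolved pair. As
  twins are excluded, one of the two vertices has two predecessors, and a separation argument in the
  trees puts it on the ring. The two directions of the ring produce many mirror cases. Ring
  coordinates can be rotated and reflected at will, so every sink becomes \<open>c 0\<close> and a
  claim about a side is proved for one side only. One base set speaks for all because a set that
  avoids leaving out ring vertices does so only if all candidates lie on the ring. Inside a side
  there is just one candidate, which every base set must leave out. The source is the exception: it
  may be the sole predecessor of both its ring neighbours. With two sources the opposite sink
  removes one of these candidates, so the exchange is confined to the case of one source. The
  algorithm keeps no adjacency lists: degrees and sums of neighbours modulo \<open>n\<close> suffice
  for the peeling and keep all numbers within a word.\<close>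

declare not_infinity_eq [simp del]

section \<open>Distances in a relation\<close>

text \<open>Walks instead of paths: they concatenate by \<open>relpow_add\<close> and extend by an
  arc without any care for repeated vertices. \<open>ddist_eq_rdist\<close> shows that the infimum
  is the same.\<close>

definition rdist :: "('a \<times> 'a) set \<Rightarrow> 'a \<Rightarrow> 'a \<Rightarrow> enat" where
  "rdist A x y = (INF k \<in> {k. (x, y) \<in> A ^^ k}. enat k)"

lemma rdist_le: "(x, y) \<in> A ^^ k \<Longrightarrow> rdist A x y \<le> enat k"
  unfolding rdist_def by (rule INF_lower) simp

lemma rdist_attained:
  assumes "rdist A x y = enat k"
  shows "(x, y) \<in> A ^^ k"
proof -
  let ?E = "enat ` {k. (x, y) \<in> A ^^ k}"
  have ne: "?E \<noteq> {}"
    using assms unfolding rdist_def by (auto simp: Inf_enat_def split: if_splits)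
  then have "Inf ?E \<in> ?E"
    unfolding Inf_enat_def by (metis (mono_tags, lifting) LeastI ex_in_conv)
  moreover have "Inf ?E = enat k" using assms unfolding rdist_def by simp
  ultimately have "enat k \<in> ?E" by (simp only:)
  then show ?thesis by auto
qed

lemma rdist_infinite_iff: "rdist A x y = \<infinity> \<longleftrightarrow> (x, y) \<notin> A\<^sup>*"
proof
  assume "rdist A x y = \<infinity>"
  then show "(x, y) \<notin> A\<^sup>*"
    by (metis Extended_Nat.not_infinity_eq infinity_ileE rdist_le rtrancl_imp_relpow)
next
  assume *: "(x, y) \<notin> A\<^sup>*"
  show "rdist A x y = \<infinity>"
  proof (cases "rdist A x y")
    case (enat k)
    then show ?thesis using * by (metis rdist_attained relpow_imp_rtrancl)
  qed simp
qed

lemma rdist_self [simp]: "rdist A x x = 0"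
proof -
  have "(x, x) \<in> A ^^ 0" by simp
  from rdist_le[OF this] show ?thesis by (metis ile0_eq zero_enat_def)
qed

lemma rdist_eq_0_iff: "rdist A x y = 0 \<longleftrightarrow> x = y"
proof
  assume "rdist A x y = 0"
  then have "(x, y) \<in> A ^^ 0" by (metis rdist_attained zero_enat_def)
  then show "x = y" by simp
qed simp

lemma rdist_trans: "rdist A x z \<le> rdist A x y + rdist A y z"
proof (cases "rdist A x y")
  case (enat i)
  show ?thesis
  proof (cases "rdist A y z")
    case j: (enat j)
    have "(x, z) \<in> A ^^ (i + j)"
      using rdist_attained[OF enat] rdist_attained[OF j] by (metis relcomp.relcompI relpow_add)
    then show ?thesis using rdist_le[of x z "i + j" A] enat j by simp
  qed simp
qed simp

lemma rdist_arc: "(u, v) \<in> A \<Longrightarrow> rdist A u v \<le> 1"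
  using rdist_le[of u v 1 A] by (simp add: one_enat_def One_nat_def[symmetric] del: One_nat_def)

lemma rdist_step: "(u, v) \<in> A \<Longrightarrow> rdist A x v \<le> rdist A x u + 1"
  by (meson add_left_mono order_trans rdist_arc rdist_trans)

lemma rdist_pred:
  assumes "x \<noteq> v" "rdist A x v \<noteq> \<infinity>"
  shows "\<exists>u. (u, v) \<in> A \<and> rdist A x v = rdist A x u + 1"
proof -
  obtain k where k: "rdist A x v = enat k" using assms(2) by (cases "rdist A x v") auto
  then have r: "(x, v) \<in> A ^^ k" by (rule rdist_attained)
  obtain j where j: "k = Suc j" using r assms(1) by (cases k) auto
  obtain u where u: "(x, u) \<in> A ^^ j" "(u, v) \<in> A" using r j by auto
  have "rdist A x u + 1 \<le> enat k"
    using rdist_le[OF u(1)] j by (cases "rdist A x u") (auto simp: one_enat_def)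
  then show ?thesis using u(2) k rdist_step[OF u(2), of x] by auto
qed

lemma rdist_unique_pred:
  assumes "x \<noteq> v" "{u. (u, v) \<in> A} = {p}"
  shows "rdist A x v = rdist A x p + 1"
proof (cases "rdist A x v = \<infinity>")
  case True
  have "(p, v) \<in> A" using assms(2) by auto
  then show ?thesis using rdist_step[of p v A x] True by auto
next
  case False
  then show ?thesis using rdist_pred[OF assms(1) False] assms(2) by auto
qed

lemma rdist_two_preds:
  assumes "x \<noteq> v" "{u. (u, v) \<in> A} = {p, q}"
  shows "rdist A x v = min (rdist A x p) (rdist A x q) + 1"
proof -
  have pq: "(p, v) \<in> A" "(q, v) \<in> A" using assms(2) by auto
  have le: "rdist A x v \<le> min (rdist A x p) (rdist A x q) + 1"
    using rdist_step[OF pq(1), of x] rdist_step[OF pq(2), of x] by (auto simp: min_def)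
  show ?thesis
  proof (cases "rdist A x v = \<infinity>")
    case True
    then show ?thesis using le by auto
  next
    case False
    then obtain u where "(u, v) \<in> A" "rdist A x v = rdist A x u + 1"
      using rdist_pred[OF assms(1)] by blast
    then have "min (rdist A x p) (rdist A x q) + 1 \<le> rdist A x v"
      using assms(2) by (metis (mono_tags, lifting) add_right_mono insert_iff mem_Collect_eq min.cobounded1
          min.cobounded2 singleton_iff)
    then show ?thesis using le by simp
  qed
qed

lemma rtrancl_closed:
  assumes "(x, y) \<in> A\<^sup>*" "x \<in> M" "\<And>u v. (u, v) \<in> A \<Longrightarrow> u \<in> M \<Longrightarrow> v \<in> M"
  shows "y \<in> M"
  using assms by (induction rule: rtrancl_induct) auto

text \<open>Every walk from \<open>M\<close> to a vertex beyond \<open>q\<close> passes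
  \<open>q\<close> earlier. This strictness is what contradicts equality of distances in the
  separation arguments below.\<close>

lemma rdist_exit_less:
  assumes exit: "\<And>u t. (u, t) \<in> A \<Longrightarrow> u \<in> M \<Longrightarrow> t \<in> M \<or> t = q"
    and x: "x \<in> M" and v: "v \<notin> M" "v \<noteq> q" and fin: "rdist A x v \<noteq> \<infinity>"
  shows "rdist A x q < rdist A x v"
proof -
  have "\<exists>j<k. (x, q) \<in> A ^^ j" if "(x, v) \<in> A ^^ k" "v \<notin> M" "v \<noteq> q" for k v
    using that
  proof (induction k arbitrary: v)
    case 0
    then show ?case using x by simp
  next
    case (Suc k)
    then obtain u where u: "(x, u) \<in> A ^^ k" "(u, v) \<in> A" by auto
    show ?case
    proof (cases "u \<in> M")
      case True
      then show ?thesis using exit[OF u(2)] Suc.prems by blast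
    next
      case False
      then show ?thesis using Suc.IH[OF u(1)] u(1) by (cases "u = q") (auto intro: less_SucI)
    qed
  qed
  moreover obtain k where k: "rdist A x v = enat k" using fin by (cases "rdist A x v") auto
  ultimately obtain j where "j < k" "(x, q) \<in> A ^^ j" using rdist_attained[OF k] v by blast
  then show ?thesis using rdist_le[of x q j A] k
    by (metis enat_ord_simps(2) le_less_trans)
qed

text \<open>Shortcutting a walk to a path by \<open>awalk_to_apath\<close> never lengthens it. The
  start has to be a vertex, because \<open>rdist\<close> gives \<open>0\<close> from a non-vertex to
  itself, where no path exists.\<close>

lemma ddist_eq_rdist:
  assumes "pair_wf_digraph D" "x \<in> pverts D"
  shows "ddist D x y = rdist (parcs D) x y"
proof -
  interpret pair_wf_digraph D by fact
  have relpow: "(u, y) \<in> parcs D ^^ k \<longleftrightarrow> (\<exists>p. awalk u p y \<and> length p = k)" if "u \<in> pverts D" for u k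
    using that
  proof (induction k arbitrary: u)
    case 0
    then show ?case by (auto simp: awalk_Nil_iff)
  next
    case (Suc k)
    have "(u, y) \<in> parcs D ^^ Suc k \<longleftrightarrow> (\<exists>w. (u, w) \<in> parcs D \<and> (w, y) \<in> parcs D ^^ k)"
      by (metis relpow_Suc_D2 relpow_Suc_I2)
    also have "\<dots> \<longleftrightarrow> (\<exists>w. (u, w) \<in> parcs D \<and> (\<exists>p. awalk w p y \<and> length p = k))"
      using Suc.IH in_arcsD2 by blast
    also have "\<dots> \<longleftrightarrow> (\<exists>p. awalk u p y \<and> length p = Suc k)"
    proof
      assume "\<exists>w. (u, w) \<in> parcs D \<and> (\<exists>p. awalk w p y \<and> length p = k)"
      then obtain w p where "(u, w) \<in> parcs D" "awalk w p y" "length p = k" by blast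
      then have "awalk u ((u, w) # p) y \<and> length ((u, w) # p) = Suc k" by (simp add: awalk_Cons_iff)
      then show "\<exists>p. awalk u p y \<and> length p = Suc k" by blast
    next
      assume "\<exists>p. awalk u p y \<and> length p = Suc k"
      then obtain p where p: "awalk u p y" "length p = Suc k" by blast
      then obtain e q where "p = e # q" by (cases p) auto
      then have "(u, snd e) \<in> parcs D \<and> awalk (snd e) q y \<and> length q = k"
        using p by (cases e) (auto simp: awalk_Cons_iff)
      then show "\<exists>w. (u, w) \<in> parcs D \<and> (\<exists>p. awalk w p y \<and> length p = k)" by blast
    qed
    finally show ?case .
  qed
  show ?thesis
  proof (rule antisym)
    show "ddist D x y \<le> rdist (parcs D) x y"
      unfolding rdist_def
    proof (rule INF_greatest)
      fix k assume "k \<in> {k. (x, y) \<in> parcs D ^^ k}"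
      then obtain p where p: "awalk x p y" "length p = k" using relpow assms(2) by auto
      let ?q = "awalk_to_apath p"
      have q: "apath x ?q y" using p(1) by (rule apath_awalk_to_apath)
      have "length ?q \<le> length p" using p(1)
      proof (induct rule: awalk_to_apath_induct)
        case (path p)
        then show ?case by (auto simp: awalk_to_apath.simps apath_def)
      next
        case (decomp p q r s)
        have "is_awalk_cyc_decomp p (q, r, s)"
          using awalk_cyc_decomp_has_prop[OF decomp(1,3)] decomp(2) by simp
        then show ?case using step_awalk_to_apath[OF decomp(1,2,3)] decomp(4) by auto
      qed
      then have "enat (length ?q) \<le> enat k" using p(2) by simp
      moreover have "ddist D x y \<le> enat (length ?q)"
        unfolding ddist_def by (rule INF_lower) (use q in simp)
      ultimately show "ddist D x y \<le> enat k" by (rule order_trans[rotated])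
    qed
  next
    show "rdist (parcs D) x y \<le> ddist D x y"
      unfolding ddist_def
    proof (rule INF_greatest)
      fix p assume "p \<in> {p. apath x p y}"
      then have "(x, y) \<in> parcs D ^^ length p" using relpow assms(2) by (auto simp: apath_def)
      then show "rdist (parcs D) x y \<le> enat (length p)" by (rule rdist_le)
    qed
  qed
qed

definition resolves :: "'a set \<Rightarrow> ('a \<times> 'a) set \<Rightarrow> 'a set \<Rightarrow> bool" where
  "resolves V A S \<longleftrightarrow> S \<subseteq> V \<and>
     (\<forall>v\<in>V. \<forall>w\<in>V. v \<noteq> w \<longrightarrow> (\<exists>x\<in>S. rdist A x v \<noteq> rdist A x w)) \<and>
     (\<forall>v\<in>V. \<exists>x\<in>S. (x, v) \<in> A\<^sup>*)"

lemma reachable_iff_rtrancl: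
  assumes "pair_wf_digraph D" "x \<in> pverts D"
  shows "x \<rightarrow>\<^sup>*\<^bsub>with_proj D\<^esub> v \<longleftrightarrow> (x, v) \<in> (parcs D)\<^sup>*"
proof -
  interpret pair_wf_digraph D by fact
  show ?thesis
  proof
    assume "x \<rightarrow>\<^sup>*\<^bsub>with_proj D\<^esub> v"
    then show "(x, v) \<in> (parcs D)\<^sup>*" unfolding reachable_def by (auto dest: rtrancl_on_rtranclI)
  next
    assume "(x, v) \<in> (parcs D)\<^sup>*"
    then show "x \<rightarrow>\<^sup>*\<^bsub>with_proj D\<^esub> v"
    proof (induction rule: rtrancl_induct)
      case base
      then show ?case using assms(2) by (simp add: reachable_refl)
    next
      case (step y z)
      then show ?case by (metis reachable_adj_trans with_proj_simps(3))
    qed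
  qed
qed

lemma resolving_set_iff_resolves:
  assumes "pair_wf_digraph D"
  shows "resolving_set D S \<longleftrightarrow> resolves (pverts D) (parcs D) S"
  unfolding resolving_set_def resolves_def subset_iff
  using ddist_eq_rdist[OF assms] reachable_iff_rtrancl[OF assms]
  by (intro conj_cong refl ball_cong bex_cong imp_cong) simp_all

section \<open>Oriented rings with trees attached\<close>

text \<open>
  The ring is \<open>c 0, \<dots>, c (N - 1)\<close>; the parent map \<open>f\<close> leads from every other vertex towards it.
\<close>

locale oriented_ring =
  fixes V :: "'a set" and A :: "('a \<times> 'a) set" and f :: "'a \<Rightarrow> 'a" and N :: nat and c :: "nat \<Rightarrow> 'a"
  assumes finite_V: "finite V"
    and arcs_V: "A \<subseteq> V \<times> V"
    and N_ge_3: "3 \<le> N"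
    and c_inj: "inj_on c {..<N}"
    and c_closed: "c N = c 0"
    and c_V: "c ` {..<N} \<subseteq> V"
    and ring_arc: "i < N \<Longrightarrow> (c i, c (Suc i)) \<in> A \<longleftrightarrow> (c (Suc i), c i) \<notin> A"
    and tree_V: "v \<in> V - c ` {..<N} \<Longrightarrow> f v \<in> V"
    and tree_arc: "v \<in> V - c ` {..<N} \<Longrightarrow> (v, f v) \<in> A \<longleftrightarrow> (f v, v) \<notin> A"
    and arc_shape: "(u, v) \<in> A \<Longrightarrow> (u \<notin> c ` {..<N} \<and> v = f u) \<or> (v \<notin> c ` {..<N} \<and> u = f v) \<or>
      (\<exists>i<N. u = c i \<and> v = c (Suc i) \<or> u = c (Suc i) \<and> v = c i)"
    and root_ex: "v \<in> V \<Longrightarrow> \<exists>k. (f ^^ k) v \<in> c ` {..<N}"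
begin

definition C :: "'a set" where "C = c ` {..<N}"

definition depth :: "'a \<Rightarrow> nat" where "depth v = (LEAST k. (f ^^ k) v \<in> C)"

definition root :: "'a \<Rightarrow> 'a" where "root v = (f ^^ depth v) v"

definition anc :: "'a \<Rightarrow> 'a set" where "anc v = {(f ^^ k) v | k. k \<le> depth v}"

definition down :: "'a \<Rightarrow> 'a set" where "down b = {x \<in> V. b \<in> anc x}"

definition pos :: "'a \<Rightarrow> nat" where "pos v = (THE i. i < N \<and> c i = root v)"

lemma N_pos: "0 < N" using N_ge_3 by simp

lemma C_V: "C \<subseteq> V" using c_V by (simp add: C_def)

lemma c_C [simp]: "i \<le> N \<Longrightarrow> c i \<in> C"
  using N_pos c_closed by (cases "i = N") (auto simp: C_def)

lemma c_in_V [simp]: "i \<le> N \<Longrightarrow> c i \<in> V" using c_C C_V by blast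

lemma c_eq_iff: "i < N \<Longrightarrow> j < N \<Longrightarrow> c i = c j \<longleftrightarrow> i = j"
  using c_inj by (auto simp: inj_on_def)

text \<open>The positions from \<open>1\<close> to \<open>N\<close> index the ring as well, with
  \<open>N\<close> in the role of \<open>0\<close>. This is the range of \<open>Suc i\<close> for an
  edge \<open>c i\<close>, \<open>c (Suc i)\<close>, and of \<open>N - i\<close> after a
  reflection.\<close>

lemma c_eq_iff': "0 < i \<Longrightarrow> i \<le> N \<Longrightarrow> 0 < j \<Longrightarrow> j \<le> N \<Longrightarrow> c i = c j \<longleftrightarrow> i = j"
  using c_eq_iff[of i j] c_eq_iff[of 0 j] c_eq_iff[of i 0] c_closed N_pos
  by (metis gr_implies_not0 le_neq_implies_less)

lemma C_cases: assumes "v \<in> C" obtains i where "i < N" "v = c i"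
  using assms by (auto simp: C_def)

lemma c_Suc_mod: "i < N \<Longrightarrow> c (Suc i mod N) = c (Suc i)"
  using c_closed by (cases "Suc i = N") auto

lemma arc_V: "(u, v) \<in> A \<Longrightarrow> u \<in> V" "(u, v) \<in> A \<Longrightarrow> v \<in> V" using arcs_V by auto

lemma arc_cases:
  assumes "(u, v) \<in> A"
  obtains (up) "u \<notin> C" "v = f u" | (down) "v \<notin> C" "u = f v"
    | (ring) i where "i < N" "u = c i" "v = c (Suc i)"
    | (gnir) i where "i < N" "u = c (Suc i)" "v = c i"
  using arc_shape[OF assms] unfolding C_def[symmetric] by metis

lemma arc_asym: assumes "(u, v) \<in> A" shows "(v, u) \<notin> A"
  using assms
proof (cases rule: arc_cases)
  case up
  then show ?thesis using tree_arc[of u] assms arc_V[OF assms] by (auto simp: C_def)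
next
  case down
  then show ?thesis using tree_arc[of v] assms arc_V[OF assms] by (auto simp: C_def)
next
  case (ring i)
  then show ?thesis using ring_arc[of i] assms by auto
next
  case (gnir i)
  then show ?thesis using ring_arc[of i] assms by auto
qed

lemma arc_irrefl: "(u, v) \<in> A \<Longrightarrow> u \<noteq> v" using arc_asym by blast

lemma tree_arc': "v \<in> V \<Longrightarrow> v \<notin> C \<Longrightarrow> (v, f v) \<in> A \<longleftrightarrow> (f v, v) \<notin> A"
  using tree_arc by (auto simp: C_def)

lemma f_V: "v \<in> V \<Longrightarrow> v \<notin> C \<Longrightarrow> f v \<in> V" using tree_V by (auto simp: C_def)

lemma depth_ring [simp]: "v \<in> C \<Longrightarrow> depth v = 0"
  unfolding depth_def by (rule Least_eq_0) simp

lemma depth_off: assumes "v \<in> V" "v \<notin> C" shows "depth v = Suc (depth (f v))"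
proof -
  obtain k where "(f ^^ k) v \<in> C" using root_ex[OF assms(1)] by (auto simp: C_def)
  then have "(LEAST k. (f ^^ k) v \<in> C) = Suc (LEAST k. (f ^^ Suc k) v \<in> C)"
    by (rule Least_Suc) (use assms in simp)
  then show ?thesis by (simp add: depth_def funpow_swap1)
qed

lemma root_ring [simp]: "v \<in> C \<Longrightarrow> root v = v" by (simp add: root_def)

lemma root_off: "v \<in> V \<Longrightarrow> v \<notin> C \<Longrightarrow> root v = root (f v)"
  by (simp add: root_def depth_off funpow_swap1)

lemma root_C: assumes "v \<in> V" shows "root v \<in> C"
  unfolding root_def depth_def using root_ex[OF assms] unfolding C_def by (rule LeastI_ex)

lemma tree_induct [consumes 1, case_names ring off]:
  assumes "v \<in> V" "\<And>v. v \<in> C \<Longrightarrow> P v"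
    "\<And>v. v \<in> V \<Longrightarrow> v \<notin> C \<Longrightarrow> P (f v) \<Longrightarrow> P v"
  shows "P v"
  using assms(1)
proof (induction "depth v" arbitrary: v rule: less_induct)
  case less
  show ?case
  proof (cases "v \<in> C")
    case False
    then show ?thesis using assms(3) less f_V depth_off by (metis lessI)
  qed (rule assms(2))
qed

lemma anc_ring: "v \<in> C \<Longrightarrow> anc v = {v}" by (auto simp: anc_def)

lemma anc_off: assumes "v \<in> V" "v \<notin> C" shows "anc v = insert v (anc (f v))"
proof -
  have img: "anc x = (\<lambda>k. (f ^^ k) x) ` {..depth x}" for x by (auto simp: anc_def)
  show ?thesis
    unfolding img depth_off[OF assms] atMost_Suc_eq_insert_0
    by (simp add: image_image funpow_swap1)
qed

lemma anc_refl [simp]: "v \<in> anc v" unfolding anc_def by (auto intro!: exI[of _ 0])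

lemma down_refl: "b \<in> V \<Longrightarrow> b \<in> down b" by (simp add: down_def)

lemma anc_depth_le: "v \<in> V \<Longrightarrow> b \<in> anc v \<Longrightarrow> depth b \<le> depth v"
  by (induction v rule: tree_induct) (auto simp: anc_ring anc_off depth_off)

lemma anc_unique: "v \<in> V \<Longrightarrow> b \<in> anc v \<Longrightarrow> b' \<in> anc v \<Longrightarrow> depth b = depth b' \<Longrightarrow> b = b'"
proof (induction v rule: tree_induct)
  case (off v)
  have "depth x \<noteq> depth v" if "x \<in> anc (f v)" for x
    using anc_depth_le[OF f_V[OF off(1,2)] that] depth_off[OF off(1,2)] by simp
  then show ?case using off anc_off[OF off(1,2)] by (metis insert_iff)
qed (simp add: anc_ring)

lemma anc_root: "v \<in> V \<Longrightarrow> b \<in> anc v \<Longrightarrow> root b = root v"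
  by (induction v rule: tree_induct) (auto simp: anc_ring anc_off root_off)

lemma anc_trans: "v \<in> V \<Longrightarrow> b \<in> anc v \<Longrightarrow> a \<in> anc b \<Longrightarrow> a \<in> anc v"
  by (induction v rule: tree_induct) (auto simp: anc_ring anc_off)

lemma down_V: "down b \<subseteq> V" by (auto simp: down_def)

text \<open>The arc between \<open>b\<close> and its parent is the only link between the subtree
  \<open>down b\<close> and the rest.\<close>

lemma arc_leaving_down:
  assumes "(u, v) \<in> A" "b \<notin> C" "u \<in> down b" "v \<notin> down b"
  shows "u = b \<and> v = f b"
  using assms(1)
proof (cases rule: arc_cases)
  case up
  then show ?thesis using assms arc_V[OF assms(1)] by (auto simp: down_def anc_off)
next
  case down
  then show ?thesis using assms arc_V[OF assms(1)] by (auto simp: down_def anc_off)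
qed (use assms in \<open>auto simp: down_def anc_ring\<close>)

lemma arc_entering_down:
  assumes "(u, v) \<in> A" "b \<notin> C" "u \<notin> down b" "v \<in> down b"
  shows "v = b \<and> u = f b"
  using assms(1)
proof (cases rule: arc_cases)
  case up
  then show ?thesis using assms arc_V[OF assms(1)] by (auto simp: down_def anc_off)
next
  case down
  then show ?thesis using assms arc_V[OF assms(1)] by (auto simp: down_def anc_off)
qed (use assms in \<open>auto simp: down_def anc_ring\<close>)

lemma down_disjoint:
  assumes "b \<in> V" "b' \<in> V" "b \<notin> C" "b' \<notin> C" "f b = f b'" "b \<noteq> b'"
  shows "down b \<inter> down b' = {}"
  using anc_unique[of _ b b'] assms depth_off[of b] depth_off[of b'] by (auto simp: down_def)

lemma down_root: "x \<in> down b \<Longrightarrow> root x = root b"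
  using anc_root[of x b] by (simp add: down_def)

lemma down_off_ring: assumes "b \<in> V" "b \<notin> C" shows "down b \<inter> C = {}"
  using assms by (auto simp: down_def anc_ring)

lemma parent_not_down: assumes "b \<in> V" "b \<notin> C" shows "f b \<notin> down b"
  using anc_depth_le[of "f b" b] depth_off[OF assms] by (auto simp: down_def)

text \<open>The only link points outwards, so the subtree has no way in.\<close>

lemma reach_into_down:
  assumes "(x, y) \<in> A\<^sup>*" "y \<in> down b" "b \<notin> C" "(b, f b) \<in> A"
  shows "x \<in> down b"
proof (rule ccontr)
  assume "x \<notin> down b"
  have "y \<in> - down b"
  proof (rule rtrancl_closed[OF assms(1)])
    fix u v assume "(u, v) \<in> A" "u \<in> - down b"
    then show "v \<in> - down b" using arc_entering_down[of u v b] assms arc_asym by auto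
  qed (use \<open>x \<notin> down b\<close> in simp)
  then show False using assms by simp
qed

lemma reach_from_down:
  assumes "(x, y) \<in> A\<^sup>*" "x \<in> down b" "b \<notin> C" "(f b, b) \<in> A"
  shows "y \<in> down b"
proof (rule rtrancl_closed[OF assms(1,2)])
  fix u v assume "(u, v) \<in> A" "u \<in> down b"
  then show "v \<in> down b" using arc_leaving_down[of u v b] assms(3,4) arc_asym by blast
qed

lemma pos_c [simp]: "i < N \<Longrightarrow> pos (c i) = i"
  unfolding pos_def by (rule the_equality) (auto simp: c_eq_iff)

lemma pos_eqI: "root v = c i \<Longrightarrow> i < N \<Longrightarrow> pos v = i"
  unfolding pos_def by (rule the_equality) (auto simp: c_eq_iff)

lemma c_pos: assumes "v \<in> V" shows "c (pos v) = root v" and pos_less: "pos v < N"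
proof -
  obtain i where "i < N" "root v = c i" using root_C[OF assms] C_cases by metis
  then show "c (pos v) = root v" "pos v < N" using pos_eqI by auto
qed

lemma pos_off: "v \<in> V \<Longrightarrow> v \<notin> C \<Longrightarrow> pos v = pos (f v)"
  by (simp add: pos_def root_off)

lemma pos_down: "x \<in> down b \<Longrightarrow> pos x = pos b"
  by (simp add: pos_def down_root)

text \<open>Tree arcs keep the position, so invariance of a set of positions has to be checked for
  ring arcs only. With intervals of positions this bounds how far a walk can get around the
  ring.\<close>

lemma pos_closed:
  assumes "(x, y) \<in> A\<^sup>*" "pos x \<in> I"
    "\<And>i. i < N \<Longrightarrow> (c i, c (Suc i)) \<in> A \<Longrightarrow> i \<in> I \<Longrightarrow> Suc i mod N \<in> I"
    "\<And>i. i < N \<Longrightarrow> (c (Suc i), c i) \<in> A \<Longrightarrow> Suc i mod N \<in> I \<Longrightarrow> i \<in> I"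
  shows "pos y \<in> I"
proof -
  have "y \<in> {y. pos y \<in> I}"
  proof (rule rtrancl_closed[OF assms(1)])
    fix u v assume uv: "(u, v) \<in> A" "u \<in> {y. pos y \<in> I}"
    from uv(1) show "v \<in> {y. pos y \<in> I}"
    proof (cases rule: arc_cases)
      case up
      then show ?thesis using uv pos_off[of u] arc_V[OF uv(1)] by auto
    next
      case down
      then show ?thesis using uv pos_off[of v] arc_V[OF uv(1)] by auto
    next
      case (ring i)
      then show ?thesis using assms(3)[of i] uv
        by (metis c_Suc_mod mem_Collect_eq mod_less_divisor N_pos pos_c)
    next
      case (gnir i)
      then show ?thesis using assms(4)[of i] uv
        by (metis c_Suc_mod mem_Collect_eq mod_less_divisor N_pos pos_c)
    qed
  qed (use assms in simp)
  then show ?thesis by simp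
qed

lemma pred_of_ring:
  assumes "(u, c i) \<in> A" "0 < i" "i < N"
  shows "(u \<in> V \<and> u \<notin> C \<and> f u = c i) \<or> u = c (i - 1) \<or> u = c (Suc i)"
  using assms(1)
proof (cases rule: arc_cases)
  case up
  then show ?thesis using arc_V[OF assms(1)] by auto
next
  case down
  then show ?thesis using assms by auto
next
  case (ring j)
  have "i = Suc j" using ring assms c_eq_iff'[of i "Suc j"] by auto
  then show ?thesis using ring by auto
next
  case (gnir j)
  then show ?thesis using assms c_eq_iff by auto
qed

lemma pred_of_c0:
  assumes "(u, c 0) \<in> A"
  shows "(u \<in> V \<and> u \<notin> C \<and> f u = c 0) \<or> u = c (N - 1) \<or> u = c 1"
  using assms
proof (cases rule: arc_cases)
  case up
  then show ?thesis using arc_V[OF assms(1)] by auto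
next
  case down
  then show ?thesis using assms by auto
next
  case (ring j)
  have "Suc j = N" using ring c_closed c_eq_iff'[of N "Suc j"] N_pos by auto
  then show ?thesis using ring by auto
next
  case (gnir j)
  then show ?thesis using assms c_eq_iff[of 0 j] N_pos by auto
qed

lemma pred_of_off:
  assumes "(u, v) \<in> A" "v \<notin> C"
  shows "(u \<in> V \<and> u \<notin> C \<and> f u = v) \<or> u = f v"
  using assms(1) by (cases rule: arc_cases) (use assms arc_V[OF assms(1)] in auto)

text \<open>Any ring vertex may serve as \<open>c 0\<close>. Only the coordinates change;
  \<open>f\<close> and the set \<open>C\<close> stay, so coordinate-free notions carry over.\<close>

lemma rotate:
  assumes "j < N"
  shows "oriented_ring V A f N (\<lambda>i. c ((i + j) mod N))" (is "oriented_ring V A f N ?c")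
    and "(\<lambda>i. c ((i + j) mod N)) ` {..<N} = C"
proof -
  have "inj_on (\<lambda>i. (i + j) mod N) {..<N}"
    using assms by (auto simp: inj_on_def mod_if)
  then have bij: "(\<lambda>i. (i + j) mod N) ` {..<N} = {..<N}"
    by (intro endo_inj_surj) (use N_pos in auto)
  then have img: "?c ` {..<N} = c ` {..<N}" by (metis image_image)
  then show "?c ` {..<N} = C" by (simp add: C_def)
  have suc: "?c (Suc i) = c (Suc ((i + j) mod N))" for i
    using c_Suc_mod[of "(i + j) mod N"] N_pos by (simp add: mod_Suc_eq)
  show "oriented_ring V A f N ?c"
  proof
    show "inj_on ?c {..<N}"
      using \<open>inj_on (\<lambda>i. (i + j) mod N) {..<N}\<close> c_inj bij by (metis comp_inj_on comp_def inj_on_cong)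
    show "?c N = ?c 0" by simp
  next
    fix i assume "i < N"
    show "(?c i, ?c (Suc i)) \<in> A \<longleftrightarrow> (?c (Suc i), ?c i) \<notin> A"
      unfolding suc using ring_arc[of "(i + j) mod N"] N_pos by simp
  next
    fix u v assume "(u, v) \<in> A"
    moreover have "\<exists>i'<N. ?c i' = c i \<and> ?c (Suc i') = c (Suc i)" if "i < N" for i
    proof -
      have "i \<in> (\<lambda>i. (i + j) mod N) ` {..<N}" unfolding bij using that by simp
      then obtain i' where "i' < N" "i = (i' + j) mod N" by (elim imageE) simp
      then show ?thesis using suc[of i'] by (intro exI[of _ i']) simp
    qed
    ultimately show "(u \<notin> ?c ` {..<N} \<and> v = f u) \<or> (v \<notin> ?c ` {..<N} \<and> u = f v) \<or>
      (\<exists>i<N. u = ?c i \<and> v = ?c (Suc i) \<or> u = ?c (Suc i) \<and> v = ?c i)"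
      unfolding img using arc_shape[of u v] by metis
  qed (unfold img, use finite_V arcs_V N_ge_3 c_V tree_V tree_arc root_ex in auto)
qed

text \<open>At \<open>0\<close> this is \<open>c N = c 0\<close>, so reversing the ring keeps its
  base point.\<close>

lemma reflect:
  shows "oriented_ring V A f N (\<lambda>i. c (N - i))" (is "oriented_ring V A f N ?c")
    and "(\<lambda>i. c (N - i)) ` {..<N} = C"
proof -
  have img: "?c ` {..<N} = c ` {..<N}"
  proof
    show "?c ` {..<N} \<subseteq> c ` {..<N}" using c_C by (auto simp: C_def[symmetric])
    show "c ` {..<N} \<subseteq> ?c ` {..<N}"
    proof
      fix v assume "v \<in> c ` {..<N}"
      then obtain i where i: "i < N" "v = c i" by auto
      then show "v \<in> ?c ` {..<N}"
        using c_closed N_pos image_eqI[of v ?c "N - i" "{..<N}"] image_eqI[of v ?c 0 "{..<N}"]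
        by (cases "i = 0") auto
    qed
  qed
  then show "?c ` {..<N} = C" by (simp add: C_def)
  show "oriented_ring V A f N ?c"
  proof
    show "inj_on ?c {..<N}"
    proof (rule inj_onI)
      fix i j assume "i \<in> {..<N}" "j \<in> {..<N}" "?c i = ?c j"
      then show "i = j" using c_eq_iff'[of "N - i" "N - j"] by auto
    qed
    show "?c N = ?c 0" using c_closed by simp
  next
    fix i assume "i < N"
    then show "(?c i, ?c (Suc i)) \<in> A \<longleftrightarrow> (?c (Suc i), ?c i) \<notin> A"
      using ring_arc[of "N - Suc i"] by (simp add: Suc_diff_Suc)
  next
    fix u v assume "(u, v) \<in> A"
    moreover have "\<exists>i'<N. ?c i' = c (Suc i) \<and> ?c (Suc i') = c i" if "i < N" for i
      using that by (intro exI[of _ "N - Suc i"]) (auto simp: Suc_diff_Suc)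
    ultimately show "(u \<notin> ?c ` {..<N} \<and> v = f u) \<or> (v \<notin> ?c ` {..<N} \<and> u = f v) \<or>
      (\<exists>i<N. u = ?c i \<and> v = ?c (Suc i) \<or> u = ?c (Suc i) \<and> v = ?c i)"
      unfolding img using arc_shape[of u v] by metis
  qed (unfold img, use finite_V arcs_V N_ge_3 c_V tree_V tree_arc root_ex in auto)
qed

end

section \<open>Ambiguous pairs\<close>

abbreviation preds :: "('a \<times> 'a) set \<Rightarrow> 'a \<Rightarrow> 'a set" where
  "preds A v \<equiv> {u. (u, v) \<in> A}"

definition sole_succs :: "('a \<times> 'a) set \<Rightarrow> 'a \<Rightarrow> 'a set" where
  "sole_succs A u = {v. preds A v = {u}}"

text \<open>Two vertices outside \<open>S\<close> with the same only predecessor are not told apart by \<open>S\<close>.\<close>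

definition twin_free :: "'a set \<Rightarrow> ('a \<times> 'a) set \<Rightarrow> 'a set \<Rightarrow> bool" where
  "twin_free V A S \<longleftrightarrow> S \<subseteq> V \<and> (\<forall>v\<in>V. preds A v = {} \<longrightarrow> v \<in> S) \<and>
     (\<forall>u v w. v \<in> sole_succs A u - S \<longrightarrow> w \<in> sole_succs A u - S \<longrightarrow> v = w)"

definition confused :: "('a \<times> 'a) set \<Rightarrow> 'a set \<Rightarrow> 'a \<Rightarrow> 'a \<Rightarrow> bool" where
  "confused A S v w \<longleftrightarrow> v \<noteq> w \<and> (\<forall>x\<in>S. rdist A x v = rdist A x w)"

lemma confused_sym: "confused A S v w \<Longrightarrow> confused A S w v"
  by (auto simp: confused_def)

lemma confused_notin: "confused A S v w \<Longrightarrow> v \<notin> S \<and> w \<notin> S"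
  by (metis confused_def rdist_eq_0_iff rdist_self)

lemma not_resolvesI:
  "confused A S v w \<Longrightarrow> v \<in> V \<Longrightarrow> w \<in> V \<Longrightarrow> \<not> resolves V A S"
  by (auto simp: confused_def resolves_def)

lemma sole_succs_rdist:
  "v \<in> sole_succs A u \<Longrightarrow> x \<noteq> v \<Longrightarrow> rdist A x v = rdist A x u + 1"
  by (auto simp: sole_succs_def intro!: rdist_unique_pred)

lemma resolves_twin_free:
  assumes "resolves V A S" "A \<subseteq> V \<times> V"
  shows "twin_free V A S"
  unfolding twin_free_def
proof (intro conjI ballI impI allI)
  show "S \<subseteq> V" using assms by (simp add: resolves_def)
next
  fix v assume v: "v \<in> V" "preds A v = {}"
  then obtain x where "x \<in> S" "(x, v) \<in> A\<^sup>*" using assms by (auto simp: resolves_def)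
  then show "v \<in> S" using v(2) by (metis (mono_tags, lifting) Collect_empty_eq rtranclE)
next
  fix u v w assume vw: "v \<in> sole_succs A u - S" "w \<in> sole_succs A u - S"
  then have "v \<in> V" "w \<in> V" using assms(2) by (auto simp: sole_succs_def)
  moreover have "rdist A x v = rdist A x w" if "x \<in> S" for x
  proof -
    have "x \<noteq> v" "x \<noteq> w" using vw that by auto
    then show ?thesis using sole_succs_rdist[of v A u x] sole_succs_rdist[of w A u x] vw by auto
  qed
  ultimately show "v = w" using assms(1) unfolding resolves_def by blast
qed

definition nearest :: "('a \<times> 'a) set \<Rightarrow> 'a set \<Rightarrow> 'a \<Rightarrow> enat" where
  "nearest A S v = (INF x\<in>S. rdist A x v)"

text \<open>Comparing \<open>v\<close> with \<open>v'\<close> is enough, since the two vertices of a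
  confused pair have a common \<open>nearest\<close> value.\<close>

definition ambiguous :: "'a set \<Rightarrow> ('a \<times> 'a) set \<Rightarrow> 'a set \<Rightarrow> 'a \<Rightarrow> 'a \<Rightarrow> bool" where
  "ambiguous V A S v w \<longleftrightarrow> v \<in> V \<and> w \<in> V \<and> confused A S v w \<and>
     (\<forall>v'\<in>V. \<forall>w'\<in>V. confused A S v' w' \<longrightarrow> nearest A S v \<le> nearest A S v')"

lemma nearest_confused: "confused A S v w \<Longrightarrow> nearest A S v = nearest A S w"
  by (auto simp: nearest_def confused_def intro!: INF_cong)

lemma ambiguous_sym: "ambiguous V A S v w \<Longrightarrow> ambiguous V A S w v"
  unfolding ambiguous_def using confused_sym nearest_confused by metis

lemma ambiguous_exists:
  assumes "v \<in> V" "w \<in> V" "confused A S v w"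
  shows "\<exists>v w. ambiguous V A S v w"
proof -
  let ?P = "\<lambda>d. \<exists>v\<in>V. \<exists>w\<in>V. confused A S v w \<and> nearest A S v = d"
  have "?P (nearest A S v)" using assms by blast
  then have *: "?P (LEAST d. ?P d)" by (rule LeastI)
  have "(LEAST d. ?P d) \<le> nearest A S v'" if "v' \<in> V" "w' \<in> V" "confused A S v' w'" for v' w'
    by (rule Least_le) (use that in blast)
  then show ?thesis using * unfolding ambiguous_def by metis
qed

section \<open>Ambiguous pairs force a vertex with two predecessors onto the ring\<close>

lemma (in oriented_ring) off_ring_pred:
  assumes "(b, w) \<in> A" "w \<in> C" "b \<notin> C"
  shows "b \<in> V \<and> f b = w"
  using assms(1) by (cases rule: arc_cases) (use assms arc_V[OF assms(1)] in auto)

text \<open>Reachability is a separate assumption because containing all sources does not give it: a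
  directed ring without entries has no source. \<open>reach_dichotomy\<close> shows that nothing
  else can go wrong.\<close>

locale unresolved = oriented_ring +
  fixes S :: "'a set"
  assumes twin_free: "twin_free V A S"
    and reaches_all: "v \<in> V \<Longrightarrow> \<exists>x\<in>S. (x, v) \<in> A\<^sup>*"
begin

lemma S_V: "S \<subseteq> V" using twin_free by (simp add: twin_free_def)

lemma nearest_attained:
  assumes "v \<in> V"
  obtains x where "x \<in> S" "nearest A S v = rdist A x v" "rdist A x v \<noteq> \<infinity>"
proof -
  obtain y where y: "y \<in> S" "rdist A y v \<noteq> \<infinity>"
    using reaches_all[OF assms] by (auto simp: rdist_infinite_iff)
  let ?D = "(\<lambda>x. rdist A x v) ` S"
  have "?D \<noteq> {}" using y(1) by blast
  then have "Inf ?D \<in> ?D" unfolding Inf_enat_def by (metis (mono_tags, lifting) LeastI ex_in_conv)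
  then obtain x where x: "x \<in> S" "Inf ?D = rdist A x v" by auto
  moreover have "Inf ?D \<le> rdist A y v" using y(1) by (intro Inf_lower) simp
  ultimately have "rdist A x v \<le> rdist A y v" by simp
  then have "rdist A x v \<noteq> \<infinity>" using y(2) by (metis enat_ord_simps(5))
  then show thesis using that[OF x(1)] x(2) unfolding nearest_def by simp
qed

text \<open>Minimality lets one step back from an ambiguous pair to predecessors, which must coincide.\<close>

lemma ambiguous_step_back:
  assumes "ambiguous V A S v w" "u \<in> V" "u' \<in> V"
    "\<And>x. x \<in> S \<Longrightarrow> rdist A x v = rdist A x u + 1"
    "\<And>x. x \<in> S \<Longrightarrow> rdist A x u = rdist A x u'"
  shows "u = u'"
proof (rule ccontr)
  assume "u \<noteq> u'"
  then have "confused A S u u'" using assms(5) by (simp add: confused_def)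
  then have le: "nearest A S v \<le> nearest A S u" using assms(1-3) by (auto simp: ambiguous_def)
  have "v \<in> V" using assms(1) by (simp add: ambiguous_def)
  then obtain x where x: "x \<in> S" "nearest A S v = rdist A x v" "rdist A x v \<noteq> \<infinity>"
    by (rule nearest_attained)
  have "nearest A S u \<le> rdist A x u" unfolding nearest_def using x(1) by (rule INF_lower)
  then have "rdist A x u + 1 \<le> rdist A x u" using le x(2) assms(4)[OF x(1)] by (metis order_trans)
  moreover have "rdist A x u \<noteq> \<infinity>" using x(3) assms(4)[OF x(1)] by (metis plus_enat_simps(2))
  ultimately show False by (cases "rdist A x u") (auto simp: one_enat_def)
qed

lemma preds_nonempty: "v \<in> V \<Longrightarrow> v \<notin> S \<Longrightarrow> preds A v \<noteq> {}"
  using twin_free by (auto simp: twin_free_def)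

text \<open>If both vertices had a single predecessor, these predecessors would be equally far from
  all of \<open>S\<close>, hence equal by the step back, and \<open>v\<close> and \<open>w\<close>
  would be twins outside \<open>S\<close>.\<close>

lemma ambiguous_two_preds:
  assumes "ambiguous V A S v w"
  shows "(\<exists>p q. p \<noteq> q \<and> p \<in> preds A v \<and> q \<in> preds A v) \<or> (\<exists>p q. p \<noteq> q \<and> p \<in> preds A w \<and> q \<in> preds A w)"
proof (rule ccontr)
  assume neg: "\<not> ?thesis"
  have vw: "v \<in> V" "w \<in> V" "confused A S v w" using assms by (auto simp: ambiguous_def)
  then have nS: "v \<notin> S" "w \<notin> S" using confused_notin by metis+
  obtain p where p: "preds A v = {p}" using neg preds_nonempty[OF vw(1) nS(1)] by blast
  obtain q where q: "preds A w = {q}" using neg preds_nonempty[OF vw(2) nS(2)] by blast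
  have dv: "rdist A x v = rdist A x p + 1" if "x \<in> S" for x
    by (rule rdist_unique_pred[OF _ p]) (use that nS in blast)
  have dw: "rdist A x w = rdist A x q + 1" if "x \<in> S" for x
    by (rule rdist_unique_pred[OF _ q]) (use that nS in blast)
  have "rdist A x p = rdist A x q" if "x \<in> S" for x
    using dv[OF that] dw[OF that] vw(3) that
    by (cases "rdist A x p"; cases "rdist A x q") (auto simp: confused_def one_enat_def)
  moreover have "p \<in> V" "q \<in> V" using p q arc_V by blast+
  ultimately have "p = q" using ambiguous_step_back[OF assms _ _ dv] by blast
  then have "v \<in> sole_succs A p - S" "w \<in> sole_succs A p - S" using p q nS by (auto simp: sole_succs_def)
  then have "v = w" using twin_free unfolding twin_free_def by blast
  then show False using vw(3) by (simp add: confused_def)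
qed

text \<open>The subtree of \<open>b\<close> cannot be entered, so it contains a vertex of
  \<open>S\<close>. From there \<open>w\<close> is the only exit, hence strictly nearer than
  anything else outside.\<close>

lemma confused_up:
  assumes "confused A S v w" "b \<in> V" "b \<notin> C" "f b = w" "(b, w) \<in> A"
  shows "v \<in> down b"
proof (rule ccontr)
  assume v: "v \<notin> down b"
  obtain x where x: "x \<in> S" "(x, b) \<in> A\<^sup>*" using reaches_all[OF assms(2)] by blast
  have xd: "x \<in> down b" using reach_into_down[OF x(2) down_refl] assms by simp
  have "(x, w) \<in> A\<^sup>*" using x(2) assms(5) by simp
  then have "rdist A x w \<noteq> \<infinity>" by (simp add: rdist_infinite_iff)
  moreover have eq: "rdist A x v = rdist A x w" using assms(1) x(1) by (simp add: confused_def)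
  ultimately have "rdist A x w < rdist A x v"
    by (intro rdist_exit_less[OF _ xd v])
      (use arc_leaving_down[of _ _ b] assms in \<open>auto simp: confused_def\<close>)
  then show False using eq by simp
qed

text \<open>The mirror image of \<open>confused_up\<close>: the parent is reached from outside the
  subtree of \<open>w\<close>, and \<open>w\<close> is its only entrance.\<close>

lemma confused_down:
  assumes "confused A S v w" "w \<in> V" "w \<notin> C" "(f w, w) \<in> A"
  shows "v \<notin> down w"
proof
  assume v: "v \<in> down w"
  obtain x where x: "x \<in> S" "(x, f w) \<in> A\<^sup>*" using reaches_all f_V assms by blast
  have xd: "x \<in> - down w"
    using reach_from_down[OF x(2) _ assms(3,4)] parent_not_down[OF assms(2,3)] by auto
  have "(x, w) \<in> A\<^sup>*" using x(2) assms(4) by simp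
  then have "rdist A x w \<noteq> \<infinity>" by (simp add: rdist_infinite_iff)
  moreover have eq: "rdist A x v = rdist A x w" using assms(1) x(1) by (simp add: confused_def)
  ultimately have "rdist A x w < rdist A x v"
    by (intro rdist_exit_less[OF _ xd])
      (use v arc_entering_down[of _ _ w] assms in \<open>auto simp: confused_def\<close>)
  then show False using eq by simp
qed

text \<open>Off the ring each predecessor of \<open>w\<close> confines \<open>v\<close> to a region,
  the subtree of a child or the complement of \<open>down w\<close>. Two predecessors give disjoint
  regions. On the ring the same argument excludes two predecessors in trees.\<close>

lemma two_preds_on_ring:
  assumes "confused A S v w" "w \<in> V" "p \<in> preds A w" "q \<in> preds A w" "p \<noteq> q"
  shows "w \<in> C" and "p \<in> C \<or> q \<in> C"
proof -
  show "w \<in> C"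
  proof (rule ccontr)
    assume w: "w \<notin> C"
    have *: "(b \<in> V \<and> b \<notin> C \<and> f b = w \<and> v \<in> down b) \<or> (b = f w \<and> v \<notin> down w)"
      if "b \<in> preds A w" for b
      using pred_of_off[of b w] that w confused_up[OF assms(1), of b] confused_down[OF assms(1,2) w] by auto
    have "down b \<subseteq> down w" if "b \<in> V" "b \<notin> C" "f b = w" for b
      using anc_trans[of _ b w] anc_off[OF that(1,2)] that by (auto simp: down_def)
    then have up: "v \<in> down w" if "b \<in> V" "b \<notin> C" "f b = w" "v \<in> down b" for b
      using that by blast
    show False
      using *[OF assms(3)] *[OF assms(4)] assms(5) down_disjoint[of p q] up[of p] up[of q]
      by (metis disjoint_iff)
  qed
  show "p \<in> C \<or> q \<in> C"
  proof (rule ccontr)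
    assume neg: "\<not> (p \<in> C \<or> q \<in> C)"
    then have "p \<in> V" "f p = w" "q \<in> V" "f q = w" using assms(3,4) off_ring_pred[OF _ \<open>w \<in> C\<close>] by auto
    moreover have "v \<in> down p" "v \<in> down q"
      using confused_up[OF assms(1)] neg assms(3,4) calculation by auto
    ultimately show False using down_disjoint[of p q] neg assms(5) by auto
  qed
qed

end

subsection \<open>Directed rings\<close>

context oriented_ring
begin

definition directed_ring :: bool where
  "directed_ring \<longleftrightarrow> (\<forall>i<N. (c i, c (Suc i)) \<in> A)"

text \<open>Every path into the ring passes \<open>c 0\<close>, which has the only entry \<open>a\<close>.\<close>

definition blind_directed :: "'a set \<Rightarrow> bool" where
  "blind_directed S \<longleftrightarrow> directed_ring \<and> S \<inter> C = {} \<and>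
     (\<forall>i. 0 < i \<and> i < N \<longrightarrow> preds A (c i) = {c (i - 1)}) \<and>
     (\<exists>a. a \<in> V - C \<and> preds A (c 0) = {a, c (N - 1)} \<and> sole_succs A a - S \<noteq> {})"

text \<open>Going round the ring never pays: \<open>c 0\<close> is reached one step after
  \<open>a\<close>, just as a left out sole successor of \<open>a\<close> is.\<close>

lemma blind_directed_not_resolves:
  assumes "blind_directed S"
  shows "\<not> resolves V A S"
proof -
  obtain a v where a: "a \<in> V - C" "preds A (c 0) = {a, c (N - 1)}" "v \<in> sole_succs A a" "v \<notin> S"
    using assms by (auto simp: blind_directed_def)
  have S: "x \<noteq> c i" if "x \<in> S" "i < N" for x i
    using assms that by (auto simp: blind_directed_def C_def)
  have step: "rdist A x (c i) = rdist A x (c 0) + enat i" if "x \<in> S" "i < N" for x i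
    using that(2)
  proof (induction i)
    case (Suc i)
    have "preds A (c (Suc i)) = {c i}" using assms Suc.prems by (auto simp: blind_directed_def)
    then have "rdist A x (c (Suc i)) = rdist A x (c i) + 1"
      using rdist_unique_pred S[OF that(1) Suc.prems] by metis
    then show ?case using Suc by (simp add: one_enat_def add.assoc)
  qed (simp add: zero_enat_def[symmetric])
  \<comment> \<open>The second argument of \<open>min\<close> belongs to a full turn, which returns
    to \<open>c 0\<close> later than it left; it can attain the minimum only if all is
    infinite.\<close>
  have loop: "d = a + 1" if "d = min a (d + enat k) + 1" for d a :: enat and k
    using that by (cases d; cases a) (auto simp: one_enat_def min_def split: if_splits)
  have "rdist A x (c 0) = rdist A x v" if x: "x \<in> S" for x
  proof -
    have "rdist A x (c 0) = min (rdist A x a) (rdist A x (c (N - 1))) + 1"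
      by (rule rdist_two_preds[OF S[OF x N_pos] a(2)])
    moreover have "rdist A x (c (N - 1)) = rdist A x (c 0) + enat (N - 1)"
      by (rule step[OF x]) (use N_pos in simp)
    moreover have "rdist A x v = rdist A x a + 1"
      using sole_succs_rdist[OF a(3)] x a(4) by metis
    ultimately show ?thesis using loop[of "rdist A x (c 0)"] by metis
  qed
  moreover have "c 0 \<noteq> v"
  proof
    assume "c 0 = v"
    then have "{a, c (N - 1)} = {a}" using a(2,3) by (simp add: sole_succs_def)
    then show False using a(1) c_C[of "N - 1"] by auto
  qed
  ultimately have "confused A S (c 0) v" by (simp add: confused_def)
  moreover have "(a, v) \<in> A" using a(3) unfolding sole_succs_def by blast
  then have "v \<in> V" by (rule arc_V)
  ultimately show ?thesis using not_resolvesI[of A S "c 0" v V] c_in_V[of 0] by simp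
qed

end

context unresolved
begin

text \<open>By \<open>confused_up\<close> the vertex \<open>v\<close> lies in the subtree of
  \<open>a\<close>. Whatever reaches \<open>c (N - 1)\<close> reaches \<open>c 0\<close>, hence
  \<open>v\<close>, and therefore starts in that subtree. This leaves no room for another entry, for
  a vertex of \<open>S\<close> on the ring or for an arc against the direction.\<close>

lemma entry_blind_directed:
  assumes amb: "ambiguous V A S v (c 0)" and a: "(a, c 0) \<in> A" "a \<notin> C" and p: "(c (N - 1), c 0) \<in> A"
  shows "blind_directed S"
proof -
  have conf: "confused A S v (c 0)" and vV: "v \<in> V" using amb by (auto simp: ambiguous_def)
  have a': "a \<in> V" "f a = c 0" using pred_of_c0[OF a(1)] a(2) arc_V[OF a(1)] c_C[of 1] c_C[of "N - 1"] N_pos by auto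
  have v: "v \<in> down a" using confused_up[OF conf] a a' by simp
  have from_a: "x \<in> down a" if "x \<in> S" "(x, c (N - 1)) \<in> A\<^sup>*" for x
  proof -
    have "(x, c 0) \<in> A\<^sup>*" using that(2) p by simp
    then have "(x, v) \<in> A\<^sup>*" using conf that(1) by (metis confused_def rdist_infinite_iff)
    then show ?thesis using reach_into_down[OF _ v] a a' by simp
  qed
  obtain x where x: "x \<in> S" "(x, c (N - 1)) \<in> A\<^sup>*" using reaches_all[of "c (N - 1)"] N_pos by auto
  have px: "pos x = 0" using from_a[OF x] pos_down[of x a] pos_off[of a] a a' pos_c[of 0] N_pos by simp
  have fwd: "(c i, c (Suc i)) \<in> A" if "i < N" for i
  proof (cases "Suc i = N")
    case True
    then show ?thesis using p c_closed by (metis diff_Suc_1)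
  next
    case False
    show ?thesis
    proof (rule ccontr)
      assume bad: "(c i, c (Suc i)) \<notin> A"
      have "pos (c (N - 1)) \<in> {..i}"
      proof (rule pos_closed[OF x(2)])
        fix j assume "j < N" "(c j, c (Suc j)) \<in> A" "j \<in> {..i}"
        then show "Suc j mod N \<in> {..i}" using bad False that by (cases "j = i") auto
      next
        fix j assume j: "j < N" "(c (Suc j), c j) \<in> A" "Suc j mod N \<in> {..i}"
        have "Suc j \<noteq> N" using j p c_closed arc_asym by (metis diff_Suc_1)
        then show "j \<in> {..i}" using j by simp
      qed (use px in simp)
      then show False using False that by simp
    qed
  qed
  have to_last: "(c i, c (N - 1)) \<in> A\<^sup>*" if "i < N" for i
  proof -
    have "(c i, c (i + k)) \<in> A\<^sup>*" if "i + k < N" for k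
      using that fwd by (induction k) (auto intro: rtrancl_into_rtrancl)
    from this[of "N - 1 - i"] show ?thesis using that by simp
  qed
  have noC: "S \<inter> C = {}"
  proof (rule ccontr)
    assume "S \<inter> C \<noteq> {}"
    then obtain i where "i < N" "c i \<in> S" by (auto simp: C_def)
    then have "c i \<in> down a" using from_a to_last by simp
    then show False using down_off_ring[OF a'(1) a(2)] c_C[of i] \<open>i < N\<close> by auto
  qed
  \<comment> \<open>Another entry would have its own vertex of \<open>S\<close> above it, which also
    reaches \<open>c (N - 1)\<close> and so would lie in two disjoint subtrees.\<close>
  have entry: "b = a" if b: "(b, c i) \<in> A" "b \<notin> C" "i < N" for b i
  proof -
    have b': "b \<in> V" "f b = c i" using off_ring_pred[OF b(1) _ b(2)] b(3) by auto
    obtain y where y: "y \<in> S" "(y, b) \<in> A\<^sup>*" using reaches_all[OF b'(1)] by blast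
    have "y \<in> down b" using reach_into_down[OF y(2) down_refl] b b' by simp
    moreover have "(y, c (N - 1)) \<in> A\<^sup>*" using y(2) b(1) to_last[OF b(3)] by (meson rtrancl.rtrancl_into_rtrancl rtrancl_trans)
    then have "y \<in> down a" using from_a y(1) by simp
    ultimately have "c i = c 0" "y \<in> down a \<inter> down b"
      using pos_down[of y a] pos_down[of y b] pos_off a a' b b' pos_c N_pos by (metis, blast)
    then show ?thesis using down_disjoint[of a b] a a' b b' by auto
  qed
  have preds0: "preds A (c 0) = {a, c (N - 1)}"
  proof -
    have "(c 1, c 0) \<notin> A" using fwd[of 0] N_pos arc_asym by auto
    then show ?thesis using a(1) p entry[of _ 0] pred_of_c0 N_pos by auto
  qed
  have predsi: "preds A (c i) = {c (i - 1)}" if i: "0 < i" "i < N" for i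
  proof -
    have "(c (i - 1), c i) \<in> A" using fwd[of "i - 1"] i by simp
    moreover have "(c (Suc i), c i) \<notin> A" using fwd[of i] i arc_asym by blast
    moreover have "\<not> (b \<notin> C \<and> (b, c i) \<in> A)" for b
    proof
      assume b: "b \<notin> C \<and> (b, c i) \<in> A"
      then have "b = a" using entry[of b i] i by blast
      then have "c i = c 0" using b pred_of_ring[of b i] i a' c_C[of "i - 1"] c_C[of "Suc i"] by auto
      then show False using c_eq_iff i N_pos by auto
    qed
    ultimately show ?thesis using pred_of_ring[of _ i] i by blast
  qed
  have nS: "v \<notin> S" "c 0 \<notin> S" using confused_notin[OF conf] by auto
  obtain u where u: "preds A v = {u}"
  proof -
    have "v \<notin> C" using v down_off_ring[OF a'(1) a(2)] by auto
    then have "\<exists>u. preds A v = {u}"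
      using two_preds_on_ring(1)[OF confused_sym[OF conf] vV] preds_nonempty[OF vV nS(1)] by blast
    then show thesis using that by blast
  qed
  have dv: "rdist A x v = rdist A x u + 1" if "x \<in> S" for x
    by (rule rdist_unique_pred[OF _ u]) (use that nS in blast)
  \<comment> \<open>From the subtree of \<open>a\<close> the way to \<open>c (N - 1)\<close> leads
    through \<open>c 0\<close>, so the minimum over the two predecessors of \<open>c 0\<close> is
    attained at \<open>a\<close>.\<close>
  have "rdist A x u = rdist A x a" if x: "x \<in> S" for x
  proof -
    have "rdist A x a \<le> rdist A x (c (N - 1))"
    proof (cases "rdist A x (c (N - 1)) = \<infinity>")
      case False
      then have "x \<in> down a" using from_a x by (simp add: rdist_infinite_iff)
      have "c 0 \<notin> down a" "c (N - 1) \<notin> down a" using down_off_ring[OF a'(1) a(2)] N_pos by auto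
      moreover have "c (N - 1) \<noteq> c 0" using c_eq_iff N_ge_3 by auto
      ultimately have "rdist A x (c 0) < rdist A x (c (N - 1))"
        using rdist_exit_less[of A "down a" "c 0" x, OF _ \<open>x \<in> down a\<close> _ _ False]
          arc_leaving_down[of _ _ a] a a' by metis
      moreover have "rdist A x (c 0) = min (rdist A x a) (rdist A x (c (N - 1))) + 1"
        by (rule rdist_two_preds[OF _ preds0]) (use x nS in blast)
      ultimately show ?thesis
        by (cases "rdist A x (c (N - 1))"; cases "rdist A x a") (auto simp: one_enat_def min_def split: if_splits)
    qed simp
    moreover have "rdist A x (c 0) = min (rdist A x a) (rdist A x (c (N - 1))) + 1"
      by (rule rdist_two_preds[OF _ preds0]) (use x nS in blast)
    ultimately have "rdist A x (c 0) = rdist A x a + 1" by (simp add: min_absorb1)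
    then have "rdist A x u + 1 = rdist A x a + 1" using dv[OF x] conf x by (simp add: confused_def)
    then show ?thesis by (cases "rdist A x u"; cases "rdist A x a") (auto simp: one_enat_def)
  qed
  moreover have "u \<in> V" using u arc_V by blast
  ultimately have "u = a" using ambiguous_step_back[OF amb _ a'(1) dv] by blast
  then have "v \<in> sole_succs A a - S" using u nS by (simp add: sole_succs_def)
  then show ?thesis
    unfolding blind_directed_def directed_ring_def using fwd noC predsi preds0 a a' by blast
qed

end

section \<open>Sinks of the ring\<close>

text \<open>The sink \<open>c 0\<close> is fed along this side by the ring source
  \<open>c L\<close>; the arc leaving \<open>c L\<close> on its far side marks the end.\<close>

definition side :: "('a \<times> 'a) set \<Rightarrow> (nat \<Rightarrow> 'a) \<Rightarrow> nat \<Rightarrow> bool" where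
  "side A c L \<longleftrightarrow> (\<forall>i<L. (c (Suc i), c i) \<in> A) \<and> (c L, c (Suc L)) \<in> A"

definition clean :: "('a \<times> 'a) set \<Rightarrow> 'a set \<Rightarrow> (nat \<Rightarrow> 'a) \<Rightarrow> nat \<Rightarrow> bool" where
  "clean A S c L \<longleftrightarrow> (\<forall>i. 0 < i \<and> i < L \<longrightarrow> c i \<notin> S \<and> preds A (c i) = {c (Suc i)})"

text \<open>Vertices that are, seen from all of \<open>S\<close>, exactly \<open>k\<close> steps
  farther than \<open>t\<close> because every step is forced.\<close>

primrec trail :: "('a \<times> 'a) set \<Rightarrow> 'a set \<Rightarrow> 'a \<Rightarrow> nat \<Rightarrow> 'a set" where
  "trail A S t 0 = {t}"
| "trail A S t (Suc k) = (\<Union>w\<in>trail A S t k. sole_succs A w - S)"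

lemma clean_rdist:
  assumes "clean A S c L" "x \<in> S" "0 < i" "i \<le> L"
  shows "rdist A x (c i) = rdist A x (c L) + enat (L - i)"
  using assms(4,3)
proof (induction i rule: inc_induct)
  case base
  then show ?case by (simp add: zero_enat_def[symmetric])
next
  case (step i)
  then have ci: "c i \<notin> S" "preds A (c i) = {c (Suc i)}" using assms(1) by (auto simp: clean_def)
  have "rdist A x (c i) = rdist A x (c (Suc i)) + 1"
    by (rule rdist_unique_pred[OF _ ci(2)]) (use ci(1) assms(2) in blast)
  also have "\<dots> = rdist A x (c L) + (enat (L - Suc i) + 1)" using step by (simp add: add.assoc)
  also have "enat (L - Suc i) + 1 = enat (L - i)" using step by (simp add: one_enat_def)
  finally show ?case .
qed

lemma side_rdist_le:
  assumes "\<And>i. i < L \<Longrightarrow> (c (Suc i), c i) \<in> A" "i \<le> L"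
  shows "rdist A x (c i) \<le> rdist A x (c L) + enat (L - i)"
  using assms(2)
proof (induction i rule: inc_induct)
  case base
  then show ?case by (simp add: zero_enat_def[symmetric])
next
  case (step i)
  then have "rdist A x (c i) \<le> rdist A x (c (Suc i)) + 1"
    using assms(1) by (intro rdist_step) auto
  also have "\<dots> \<le> rdist A x (c L) + enat (L - Suc i) + 1" using step by (intro add_right_mono) auto
  also have "enat (L - Suc i) + 1 = enat (L - i)" using step by (simp add: one_enat_def)
  then have "rdist A x (c L) + enat (L - Suc i) + 1 = rdist A x (c L) + enat (L - i)" by (simp add: add.assoc)
  finally show ?case .
qed

lemma trail_rdist:
  assumes "v \<in> trail A S t k" "x \<in> S"
  shows "rdist A x v = rdist A x t + enat k"
  using assms(1)
proof (induction k arbitrary: v)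
  case (Suc k)
  then obtain w where w: "w \<in> trail A S t k" "v \<in> sole_succs A w" "v \<notin> S" by auto
  then have "rdist A x v = rdist A x w + 1" using sole_succs_rdist[OF w(2)] assms(2) by metis
  then show ?case using Suc.IH[OF w(1)] by (simp add: one_enat_def add.assoc)
qed (simp add: zero_enat_def[symmetric])

context oriented_ring
begin

abbreviation c' :: "nat \<Rightarrow> 'a" where "c' i \<equiv> c (N - i)"

definition ring_sink :: "nat \<Rightarrow> nat \<Rightarrow> bool" where
  "ring_sink L1 L2 \<longleftrightarrow> preds A (c 0) = {c 1, c (N - 1)} \<and>
     0 < L1 \<and> L1 < N \<and> side A c L1 \<and> 0 < L2 \<and> L2 < N \<and> side A c' L2"

text \<open>\<open>L1 + L2 = N\<close> says that both sides come from one source. If the longer side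
  is clean, it brings nobody to \<open>c 0\<close> earlier than the shorter one, so
  \<open>c 0\<close> looks like a left out sole successor of the last vertex of the shorter side.
  The shorter side need not be clean.\<close>

definition blind_single :: "'a set \<Rightarrow> nat \<Rightarrow> nat \<Rightarrow> bool" where
  "blind_single S L1 L2 \<longleftrightarrow> L1 + L2 = N \<and> c 0 \<notin> S \<and>
     (L2 \<le> L1 \<and> clean A S c L1 \<and> sole_succs A (c' 1) - S \<noteq> {} \<or>
      L1 \<le> L2 \<and> clean A S c' L2 \<and> sole_succs A (c 1) - S \<noteq> {})"

text \<open>Two sources with the two common sinks \<open>c 0\<close> and \<open>c (Suc L1)\<close>.
  The former is \<open>L1\<close> steps from each source, the latter one step, so a trail of
  \<open>L1 - 1\<close> further steps makes up for the difference.\<close>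

definition blind_double :: "'a set \<Rightarrow> nat \<Rightarrow> nat \<Rightarrow> bool" where
  "blind_double S L1 L2 \<longleftrightarrow> L1 = L2 \<and> L1 + L2 + 2 = N \<and> c 0 \<notin> S \<and> clean A S c L1 \<and> clean A S c' L2 \<and>
     c (Suc L1) \<notin> S \<and> preds A (c (Suc L1)) = {c L1, c' L2} \<and> trail A S (c (Suc L1)) (L1 - 1) \<noteq> {}"

lemma reflect_fun: "i \<le> N \<Longrightarrow> N - (N - i) = i" by simp

lemma side_reflect2: "L < N \<Longrightarrow> side A (\<lambda>i. c (N - (N - i))) L \<longleftrightarrow> side A c L"
  unfolding side_def by (auto simp: reflect_fun)

lemma clean_reflect2: "L < N \<Longrightarrow> clean A S (\<lambda>i. c (N - (N - i))) L \<longleftrightarrow> clean A S c L"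
  unfolding clean_def by (auto simp: reflect_fun)

lemma ring_sink_reflect:
  "ring_sink L1 L2 \<Longrightarrow> oriented_ring.ring_sink A N c' L2 L1"
  unfolding oriented_ring.ring_sink_def[OF reflect(1)] ring_sink_def
  using side_reflect2[of L1] c_closed N_ge_3 by (auto simp: reflect_fun)

lemma blind_single_reflect:
  assumes "oriented_ring.blind_single A N c' S L2 L1" "ring_sink L1 L2"
  shows "blind_single S L1 L2"
  using assms clean_reflect2[of L1 S] c_closed N_ge_3
  unfolding oriented_ring.blind_single_def[OF reflect(1)] blind_single_def ring_sink_def
  by (auto simp: reflect_fun)

lemma half_single_not_resolves:
  assumes sink: "ring_sink L1 L2" and L: "L1 + L2 = N" "L2 \<le> L1" and y: "c 0 \<notin> S"
    and clean: "clean A S c L1" and v: "v \<in> sole_succs A (c' 1) - S"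
  shows "\<not> resolves V A S"
proof -
  have s: "preds A (c 0) = {c 1, c' 1}" "0 < L1" "0 < L2" "side A c' L2"
    using sink by (auto simp: ring_sink_def)
  have z: "c' L2 = c L1" using L by (metis diff_add_inverse2)
  have "rdist A x v = rdist A x (c 0)" if x: "x \<in> S" for x
  proof -
    have "rdist A x (c 0) = min (rdist A x (c 1)) (rdist A x (c' 1)) + 1"
      by (rule rdist_two_preds[OF _ s(1)]) (use x y in blast)
    moreover have "rdist A x (c 1) = rdist A x (c L1) + enat (L1 - 1)"
      using clean_rdist[OF clean x, of 1] s by simp
    moreover have "rdist A x (c' 1) \<le> rdist A x (c L1) + enat (L2 - 1)"
      using side_rdist_le[of L2 c' A 1 x] s(3,4) z by (simp add: side_def)
    moreover have "rdist A x (c L1) + enat (L2 - 1) \<le> rdist A x (c L1) + enat (L1 - 1)"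
      using L(2) by (intro add_left_mono) simp
    ultimately have "rdist A x (c 0) = rdist A x (c' 1) + 1" by (metis min_absorb2 order_trans)
    then show ?thesis using sole_succs_rdist[of v A "c' 1" x] v x by auto
  qed
  moreover have "v \<noteq> c 0"
  proof
    assume "v = c 0"
    then have "c 1 = c' 1" using v s(1) by (auto simp: sole_succs_def)
    then show False using c_eq_iff[of 1 "N - 1"] N_ge_3 by auto
  qed
  ultimately have "confused A S v (c 0)" by (simp add: confused_def)
  moreover have "(c' 1, v) \<in> A" using v unfolding sole_succs_def by blast
  then have "v \<in> V" by (rule arc_V)
  ultimately show ?thesis using not_resolvesI[of A S v "c 0" V] c_in_V[of 0] by simp
qed

lemma blind_single_not_resolves:
  assumes "ring_sink L1 L2" "blind_single S L1 L2"
  shows "\<not> resolves V A S"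
proof -
  interpret r: oriented_ring V A f N c' by (rule reflect(1))
  have L: "L1 < N" "L1 + L2 = N" "c 0 \<notin> S" using assms by (auto simp: ring_sink_def blind_single_def)
  from assms(2) consider v where "L2 \<le> L1" "clean A S c L1" "v \<in> sole_succs A (c' 1) - S"
    | v where "L1 \<le> L2" "clean A S c' L2" "v \<in> sole_succs A (c 1) - S"
    unfolding blind_single_def by blast
  then show ?thesis
  proof cases
    case 1
    then show ?thesis using half_single_not_resolves[OF assms(1)] L by blast
  next
    case 2
    then show ?thesis using r.half_single_not_resolves[OF ring_sink_reflect[OF assms(1)], of S v] L c_closed N_ge_3
      by (simp add: add.commute reflect_fun)
  qed
qed

lemma blind_double_not_resolves:
  assumes sink: "ring_sink L1 L2" and bl: "blind_double S L1 L2"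
  shows "\<not> resolves V A S"
proof -
  have s: "preds A (c 0) = {c 1, c' 1}" "0 < L1" "0 < L2"
    using sink by (auto simp: ring_sink_def)
  let ?t = "c (Suc L1)"
  have b: "L1 = L2" "L1 + L2 + 2 = N" "c 0 \<notin> S" "clean A S c L1" "clean A S c' L2"
    "?t \<notin> S" "preds A ?t = {c L1, c' L2}" using bl by (auto simp: blind_double_def)
  obtain v where v: "v \<in> trail A S ?t (L1 - 1)" using bl by (auto simp: blind_double_def)
  have "rdist A x v = rdist A x (c 0)" if x: "x \<in> S" for x
  proof -
    have "rdist A x (c 0) = min (rdist A x (c 1)) (rdist A x (c' 1)) + 1"
      by (rule rdist_two_preds[OF _ s(1)]) (use x b(3) in blast)
    moreover have "rdist A x (c 1) = rdist A x (c L1) + enat (L1 - 1)"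
      using clean_rdist[OF b(4) x, of 1] s by simp
    moreover have "rdist A x (c' 1) = rdist A x (c' L2) + enat (L1 - 1)"
      using clean_rdist[OF b(5) x, of 1] s b(1) by simp
    moreover have "rdist A x ?t = min (rdist A x (c L1)) (rdist A x (c' L2)) + 1"
      by (rule rdist_two_preds[OF _ b(7)]) (use x b(6) in blast)
    moreover have "rdist A x v = rdist A x ?t + enat (L1 - 1)" by (rule trail_rdist[OF v x])
    moreover have "min (a + enat k) (b + enat k) + 1 = min a b + 1 + enat k" for a b k
      by (cases a; cases b) (auto simp: one_enat_def min_def)
    ultimately show ?thesis by metis
  qed
  moreover have "v \<noteq> c 0"
  proof (cases "L1 - 1")
    case 0
    then have "v = ?t" using v by simp
    then show ?thesis using c_eq_iff[of 0 "Suc L1"] b(2) by auto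
  next
    case (Suc k)
    then obtain w where "preds A v = {w}" using v by (auto simp: sole_succs_def)
    then have "c 1 = c' 1" if "v = c 0" using s(1) that by auto
    then show ?thesis using c_eq_iff[of 1 "N - 1"] N_ge_3 by auto
  qed
  ultimately have conf: "confused A S v (c 0)" by (simp add: confused_def)
  have "v \<in> V"
  proof (cases "L1 - 1")
    case 0
    then show ?thesis using v b(2) c_in_V[of "Suc L1"] by simp
  next
    case (Suc k)
    then obtain w where "preds A v = {w}" using v by (auto simp: sole_succs_def)
    then have "(w, v) \<in> A" by blast
    then show ?thesis by (rule arc_V)
  qed
  then show ?thesis using not_resolvesI[OF conf] c_in_V[of 0] by simp
qed

text \<open>These notions depend on the coordinates through the set \<open>C\<close> only. The
  position does not; it is treated in \<open>pos_reflect\<close>.\<close>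

lemma reflect_structure:
  "oriented_ring.C N c' = C" "oriented_ring.depth f N c' = depth" "oriented_ring.root f N c' = root"
  "oriented_ring.anc f N c' = anc" "oriented_ring.down V f N c' = down"
proof -
  interpret r: oriented_ring V A f N c' by (rule reflect(1))
  show 1: "r.C = C" using reflect(2) by (simp add: r.C_def)
  show 2: "r.depth = depth" by (simp add: r.depth_def depth_def 1 fun_eq_iff)
  show "r.root = root" by (simp add: r.root_def root_def 2 fun_eq_iff)
  show 3: "r.anc = anc" by (simp add: r.anc_def anc_def 2 fun_eq_iff)
  show "r.down = down" by (simp add: r.down_def down_def 3 fun_eq_iff)
qed

lemma last_off:
  "v \<in> V \<Longrightarrow> v \<notin> C \<Longrightarrow> \<exists>b. b \<in> V \<and> b \<notin> C \<and> v \<in> down b \<and> f b = root v"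
proof (induction v rule: tree_induct)
  case (off v)
  show ?case
  proof (cases "f v \<in> C")
    case True
    then show ?thesis using off root_off[OF off(1,2)] by (intro exI[of _ v]) (simp add: down_refl)
  next
    case False
    then obtain b where "b \<in> V" "b \<notin> C" "f v \<in> down b" "f b = root (f v)" using off by blast
    then show ?thesis using off anc_off[OF off(1,2)] root_off[OF off(1,2)]
      by (intro exI[of _ b]) (auto simp: down_def)
  qed
qed simp

text \<open>A walk from elsewhere enters the tree of \<open>v\<close> at its root and arrives at
  every vertex from the parent, since a child with an arc upwards is reached only from within its
  own subtree.\<close>

lemma tree_rdist:
  assumes "v \<in> V" "x \<in> V" "(x, v) \<in> A\<^sup>*" "root x \<noteq> root v"
  shows "\<exists>k. (root v, v) \<in> A ^^ k \<and> rdist A x v = rdist A x (root v) + enat k"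
  using assms(1,3,4)
proof (induction v rule: tree_induct)
  case (ring v)
  then show ?case by (intro exI[of _ 0]) (simp add: zero_enat_def[symmetric])
next
  case (off v)
  have "x \<noteq> v" using off by auto
  moreover have fin: "rdist A x v \<noteq> \<infinity>" using off by (simp add: rdist_infinite_iff)
  ultimately obtain u where u: "(u, v) \<in> A" "rdist A x v = rdist A x u + 1" using rdist_pred by metis
  have ru: "(x, u) \<in> A\<^sup>*" using u(2) fin by (cases "rdist A x u = \<infinity>") (auto simp: rdist_infinite_iff)
  have "u = f v"
  proof (rule ccontr)
    assume "u \<noteq> f v"
    then have "u \<in> V" "u \<notin> C" "f u = v" using pred_of_off[OF u(1) off(2)] by auto
    then have "x \<in> down u" using reach_into_down[OF ru down_refl] u(1) by simp
    then show False using down_root[of x u] root_off[of u] \<open>u \<in> V\<close> \<open>u \<notin> C\<close> \<open>f u = v\<close> off by simp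
  qed
  then obtain k where "(root v, f v) \<in> A ^^ k" "rdist A x (f v) = rdist A x (root v) + enat k"
    using off ru root_off[OF off(1,2)] by metis
  then show ?case using u \<open>u = f v\<close>
    by (intro exI[of _ "Suc k"]) (auto simp: one_enat_def add.assoc)
qed

end

section \<open>Ambiguous pairs that contain a sink of the ring\<close>

locale ambiguous_sink = unresolved +
  fixes v :: 'a and L1 L2 :: nat
  assumes amb: "ambiguous V A S v (c 0)"
    and sink: "ring_sink L1 L2"
begin

lemma reflect_sink: "ambiguous_sink V A f N c' S v L2 L1"
proof -
  interpret r: oriented_ring V A f N c' by (rule reflect(1))
  show ?thesis
    by unfold_locales (use twin_free reaches_all amb ring_sink_reflect[OF sink] c_closed in auto)
qed

lemma
  shows preds0: "preds A (c 0) = {c 1, c (N - 1)}"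
    and L1: "0 < L1" "L1 < N" and L2: "0 < L2" "L2 < N"
    and side1: "side A c L1" and side2: "side A c' L2"
  using sink by (auto simp: ring_sink_def)

lemma bwd: "i < L1 \<Longrightarrow> (c (Suc i), c i) \<in> A"
  using side1 by (simp add: side_def)

lemma no_fwd: "i < L1 \<Longrightarrow> (c i, c (Suc i)) \<notin> A"
  using bwd arc_asym by blast

lemma z1: "(c L1, c (Suc L1)) \<in> A" "(c (Suc L1), c L1) \<notin> A"
  using side1 arc_asym by (auto simp: side_def)

lemma fwd: assumes "N - L2 \<le> i" "i < N" shows "(c i, c (Suc i)) \<in> A" "(c (Suc i), c i) \<notin> A"
proof -
  have "N - Suc i < L2" using assms L2 by linarith
  then have "(c' (Suc (N - Suc i)), c' (N - Suc i)) \<in> A" using side2 by (simp add: side_def)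
  moreover have "N - Suc (N - Suc i) = i" "N - (N - Suc i) = Suc i" using assms by auto
  ultimately show "(c i, c (Suc i)) \<in> A" by simp
  then show "(c (Suc i), c i) \<notin> A" using arc_asym by blast
qed

lemma z2: "(c (N - L2), c (N - Suc L2)) \<in> A" "(c (N - Suc L2), c (N - L2)) \<notin> A"
  using side2 arc_asym by (auto simp: side_def)

lemma L12: "L1 + L2 \<le> N"
proof (rule ccontr)
  assume "\<not> L1 + L2 \<le> N"
  then have "N - L2 < L1" using L2 by linarith
  then show False using bwd[of "N - L2"] fwd(2)[of "N - L2"] L2 by simp
qed

lemma conf: "confused A S v (c 0)" and v_V: "v \<in> V"
  using amb by (auto simp: ambiguous_def)

lemma notin_S: "v \<notin> S" "c 0 \<notin> S" using confused_notin[OF conf] by auto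

lemma reaches_iff: "x \<in> S \<Longrightarrow> (x, v) \<in> A\<^sup>* \<longleftrightarrow> (x, c 0) \<in> A\<^sup>*"
  using conf by (metis confused_def rdist_infinite_iff)

lemma rdist_eq: "x \<in> S \<Longrightarrow> rdist A x v = rdist A x (c 0)"
  using conf by (simp add: confused_def)

text \<open>On the side all ring arcs point to \<open>c 0\<close>, and \<open>c 0\<close> has no
  outgoing ring arc, so positions can only decrease.\<close>

lemma cone: assumes "(x, u) \<in> A\<^sup>*" "pos x \<le> j" "j < L1" shows "pos u \<le> j"
proof -
  have "pos u \<in> {..j}"
  proof (rule pos_closed[OF assms(1)])
    fix i assume "i < N" "(c i, c (Suc i)) \<in> A" "i \<in> {..j}"
    then show "Suc i mod N \<in> {..j}" using no_fwd[of i] assms by simp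
  next
    fix i assume i: "i < N" "(c (Suc i), c i) \<in> A" "Suc i mod N \<in> {..j}"
    have "N - L2 \<le> i" if "Suc i = N" using that L2 by linarith
    then have "Suc i \<noteq> N" using fwd(2)[of i] i by auto
    then show "i \<in> {..j}" using i by simp
  qed (use assms in simp)
  then show ?thesis by simp
qed

text \<open>The trees at \<open>c 0\<close> can be entered only through \<open>c 0\<close>, which is
  then nearer than any of their vertices.\<close>

lemma pos_v: "pos v \<noteq> 0"
proof
  assume "pos v = 0"
  then have root: "root v = c 0" using c_pos[OF v_V] by simp
  have "v \<noteq> c 0" using conf by (simp add: confused_def)
  then have "v \<notin> C" using root root_ring by auto
  then obtain b where b: "b \<in> V" "b \<notin> C" "v \<in> down b" "f b = c 0" using last_off[OF v_V] root by auto
  have "(b, c 0) \<notin> A"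
  proof
    assume "(b, c 0) \<in> A"
    then have "b \<in> {c 1, c (N - 1)}" using preds0 by blast
    then show False using b(2) c_C[of 1] c_C[of "N - 1"] N_ge_3 by auto
  qed
  then have cb: "(c 0, b) \<in> A" using tree_arc'[OF b(1,2)] b(4) by simp
  obtain x where x: "x \<in> S" "(x, c 0) \<in> A\<^sup>*" using reaches_all[of "c 0"] by auto
  have "x \<notin> down b"
    using reach_from_down[OF x(2) _ b(2)] cb b(4) down_off_ring[OF b(1,2)] c_C[of 0] by auto
  then have xM: "x \<in> - down b - {c 0}" using x(1) notin_S by auto
  have "rdist A x v \<noteq> \<infinity>" using x reaches_iff by (simp add: rdist_infinite_iff)
  then have "rdist A x (c 0) < rdist A x v"
    by (intro rdist_exit_less[OF _ xM])
      (use b \<open>v \<noteq> c 0\<close> arc_entering_down[of _ _ b] in auto)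
  then show False using rdist_eq[OF x(1)] by simp
qed

text \<open>No ring arc leads into the source \<open>c L1\<close>, so only its own trees reach
  it.\<close>

lemma source_pos: assumes "(x, c L1) \<in> A\<^sup>*" shows "pos x = L1"
proof (rule ccontr)
  assume "pos x \<noteq> L1"
  have "pos (c L1) \<in> - {L1}"
  proof (rule pos_closed[OF assms])
    fix i assume i: "i < N" "(c i, c (Suc i)) \<in> A" "i \<in> - {L1}"
    have "Suc i mod N = L1 \<Longrightarrow> Suc i = L1" using i L1 by (cases "Suc i = N") auto
    then show "Suc i mod N \<in> - {L1}" using no_fwd[of i] i by auto
  next
    fix i assume "i < N" "(c (Suc i), c i) \<in> A" "Suc i mod N \<in> - {L1}"
    then show "i \<in> - {L1}" using z1(2) by auto
  qed (use \<open>pos x \<noteq> L1\<close> in simp)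
  then show False using L1 by simp
qed

lemma source_witness: obtains x where "x \<in> S" "(x, c L1) \<in> A\<^sup>*" "pos x = L1" "(x, c 0) \<in> A\<^sup>*"
proof -
  obtain x where x: "x \<in> S" "(x, c L1) \<in> A\<^sup>*" using reaches_all[of "c L1"] L1 by auto
  have "(c i, c 0) \<in> A\<^sup>*" if "i \<le> L1" for i
    using that by (induction i) (auto intro: converse_rtrancl_into_rtrancl[OF bwd])
  then have "(x, c 0) \<in> A\<^sup>*" using x(2) by (meson order_refl rtrancl_trans)
  then show thesis using that x source_pos by blast
qed

lemma side_to_0: "i \<le> L1 \<Longrightarrow> (c i, c 0) \<in> A\<^sup>*"
  by (induction i) (auto intro: converse_rtrancl_into_rtrancl[OF bwd])

lemma not_clean_witness:
  assumes "\<not> clean A S c L1"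
  obtains i x where "0 < i" "i < L1" "x \<in> S" "pos x = i" "(x, c i) \<in> A\<^sup>*"
proof -
  obtain i where i: "0 < i" "i < L1" "c i \<in> S \<or> preds A (c i) \<noteq> {c (Suc i)}"
    using assms by (auto simp: clean_def)
  show thesis
  proof (cases "c i \<in> S")
    case True
    then show ?thesis using that[of i "c i"] i L1 by simp
  next
    case False
    have "(c (Suc i), c i) \<in> A" using bwd i by simp
    moreover have "(c (i - 1), c i) \<notin> A" using no_fwd[of "i - 1"] i by simp
    ultimately obtain b where b: "(b, c i) \<in> A" "b \<in> V" "b \<notin> C" "f b = c i"
      using i False pred_of_ring[of _ i] L1 by auto
    obtain x where x: "x \<in> S" "(x, b) \<in> A\<^sup>*" using reaches_all[OF b(2)] by blast
    have "x \<in> down b" using reach_into_down[OF x(2) down_refl] b by simp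
    then have "pos x = i" using pos_down[of x b] pos_off[OF b(2,3)] b(4) i L1 by simp
    then show ?thesis using that[of i x] i x b(1) by (simp add: rtrancl_into_rtrancl)
  qed
qed

text \<open>An unclean side provides a vertex of \<open>S\<close> at an inner position. It reaches
  \<open>c 0\<close>, hence \<open>v\<close>, but by \<open>cone\<close> it stays on the
  side.\<close>

lemma clean_unless_root:
  assumes "\<not> (0 < pos v \<and> pos v < L1)"
  shows "clean A S c L1"
proof (rule ccontr)
  assume "\<not> clean A S c L1"
  then obtain i x where i: "0 < i" "i < L1" "x \<in> S" "pos x = i" "(x, c i) \<in> A\<^sup>*"
    by (rule not_clean_witness)
  then have "(x, v) \<in> A\<^sup>*" using side_to_0[of i] reaches_iff by (meson less_imp_le rtrancl_trans)
  then have "pos v \<le> i" using cone[of x v i] i by simp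
  then show False using assms i pos_v by simp
qed

text \<open>The walk can only come down the side step by step. The condition on \<open>i\<close> and
  \<open>j\<close> excludes the source together with \<open>c 0\<close>, which the other side may
  join as well.\<close>

lemma side_rdist_ge:
  assumes x: "x \<in> V" "pos x = j" and i: "i \<le> j" "j \<le> L1" "0 < i \<or> j < L1" and fin: "(x, c i) \<in> A\<^sup>*"
  shows "rdist A x (c j) + enat (j - i) \<le> rdist A x (c i)"
  using i(1,3) fin
proof (induction i rule: inc_induct)
  case base
  then show ?case by (simp add: zero_enat_def[symmetric])
next
  case (step i)
  have iN: "i < N" using step L1 i(2) by simp
  have "x \<noteq> c i" using x step iN by auto
  moreover have fin: "rdist A x (c i) \<noteq> \<infinity>" using step by (simp add: rdist_infinite_iff)
  ultimately obtain u where u: "(u, c i) \<in> A" "rdist A x (c i) = rdist A x u + 1" using rdist_pred by metis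
  have ru: "(x, u) \<in> A\<^sup>*" using u(2) fin by (cases "rdist A x u = \<infinity>") (auto simp: rdist_infinite_iff)
  have notree: "\<not> (u \<in> V \<and> u \<notin> C \<and> f u = c i)"
  proof
    assume b: "u \<in> V \<and> u \<notin> C \<and> f u = c i"
    then have "x \<in> down u" using reach_into_down[OF ru down_refl] u(1) by simp
    then have "pos x = i" using pos_down[of x u] pos_off[of u] b iN by simp
    then show False using x step by simp
  qed
  have "u = c (Suc i)"
  proof (cases "i = 0")
    case True
    have "u \<noteq> c (N - 1)"
    proof
      assume "u = c (N - 1)"
      then have "N - 1 \<le> j" using cone[OF ru, of j] x(2) step True i pos_c[of "N - 1"] N_pos by simp
      then show False using step True L1 by simp
    qed
    then show ?thesis using pred_of_c0 u(1) notree True by auto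
  next
    case False
    have "(c (i - 1), c i) \<notin> A" using no_fwd[of "i - 1"] False step i(2) by simp
    then show ?thesis using pred_of_ring[of u i] u(1) notree False iN by auto
  qed
  then have "rdist A x (c j) + enat (j - Suc i) \<le> rdist A x u" using step ru by auto
  then have "rdist A x (c j) + enat (j - Suc i) + 1 \<le> rdist A x (c i)" using u(2) by (simp add: add_right_mono)
  moreover have "enat (j - Suc i) + 1 = enat (j - i)" using step by (simp add: one_enat_def)
  ultimately show ?case by (metis add.assoc)
qed

lemma rdist_0: "x \<in> S \<Longrightarrow> rdist A x (c 0) = min (rdist A x (c 1)) (rdist A x (c (N - 1))) + 1"
  by (rule rdist_two_preds[OF _ preds0]) (use notin_S in blast)

text \<open>A predecessor in a tree would force \<open>c 0\<close> into its subtree by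
  \<open>confused_up\<close>.\<close>

lemma v_preds_ring:
  assumes "v \<in> C" "(b, v) \<in> A"
  shows "b \<in> C"
proof (rule ccontr)
  assume b: "b \<notin> C"
  then have "b \<in> V" "f b = v" using off_ring_pred assms by auto
  then have "c 0 \<in> down b" using confused_up[OF confused_sym[OF conf]] b assms by simp
  then show False using down_off_ring \<open>b \<in> V\<close> b c_C[of 0] by blast
qed

end

section \<open>One common source or two sources\<close>

context ambiguous_sink
begin

text \<open>Where \<open>c 0\<close> always gets its distance through the same vertex
  \<open>p\<close>, it behaves as if \<open>p\<close> were its only predecessor, and the step back
  applies to \<open>u\<close> and \<open>p\<close>.\<close>

lemma step_to_pred:
  assumes u: "preds A v = {u}" and p: "p \<in> V" "\<And>x. x \<in> S \<Longrightarrow> rdist A x (c 0) = rdist A x p + 1"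
  shows "v \<in> sole_succs A p - S"
proof -
  have dv: "rdist A x v = rdist A x u + 1" if "x \<in> S" for x
    by (rule rdist_unique_pred[OF _ u]) (use that notin_S in blast)
  have "rdist A x u = rdist A x p" if "x \<in> S" for x
  proof -
    have "rdist A x u + 1 = rdist A x p + 1" using dv[OF that] p(2)[OF that] rdist_eq[OF that] by simp
    then show ?thesis by (cases "rdist A x u"; cases "rdist A x p") (auto simp: one_enat_def)
  qed
  moreover have "u \<in> V" using u arc_V by blast
  ultimately have "u = p" using ambiguous_step_back[OF amb _ p(1) dv] by blast
  then show ?thesis using u notin_S by (simp add: sole_succs_def)
qed

text \<open>With a single source, every ring vertex other than \<open>c 0\<close> has at most one
  ring predecessor, and on the ring \<open>v\<close> has no other predecessors.\<close>

lemma v_unique_pred: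
  assumes "L1 + L2 = N"
  shows "\<exists>u. preds A v = {u}"
proof (rule ccontr)
  assume neg: "\<not> ?thesis"
  obtain p where p: "p \<in> preds A v" using preds_nonempty[OF v_V] notin_S by blast
  with neg obtain q where q: "q \<in> preds A v" "q \<noteq> p" by blast
  have "v \<in> C" using two_preds_on_ring(1)[OF confused_sym[OF conf] v_V p q(1)] q(2) by simp
  then obtain i where i: "i < N" "v = c i" by (rule C_cases)
  then have i0: "0 < i" using conf by (cases "i = 0") (auto simp: confused_def)
  have *: "b = c (i - 1) \<or> b = c (Suc i)" if "b \<in> preds A v" for b
    using pred_of_ring[of b i] v_preds_ring[OF \<open>v \<in> C\<close>, of b] that i i0 by auto
  show False
  proof (cases "i \<le> L1")
    case True
    then have "(c (i - 1), v) \<notin> A" using no_fwd[of "i - 1"] i i0 by simp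
    then show False using *[of p] *[of q] p q by auto
  next
    case False
    then have "(c (Suc i), v) \<notin> A" using fwd(2)[of i] i assms by auto
    then show False using *[of p] *[of q] p q by auto
  qed
qed

lemma single_if_clean:
  assumes "L1 + L2 = N" "L2 \<le> L1" "clean A S c L1"
  shows "blind_single S L1 L2"
proof -
  obtain u where u: "preds A v = {u}" using v_unique_pred[OF assms(1)] by blast
  have z: "c' L2 = c L1" using assms(1) by (metis diff_add_inverse2)
  have "rdist A x (c 0) = rdist A x (c (N - 1)) + 1" if x: "x \<in> S" for x
  proof -
    have "rdist A x (c (N - 1)) \<le> rdist A x (c L1) + enat (L2 - 1)"
      using side_rdist_le[of L2 c' A 1 x] side2 L2 z by (simp add: side_def)
    also have "\<dots> \<le> rdist A x (c L1) + enat (L1 - 1)"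
      using assms(2) by (intro add_left_mono) simp
    also have "\<dots> = rdist A x (c 1)"
      using clean_rdist[OF assms(3) x, of 1] L1 by simp
    finally show ?thesis using rdist_0[OF x] by (simp add: min_absorb2)
  qed
  then have "v \<in> sole_succs A (c (N - 1)) - S" using step_to_pred[OF u, of "c (N - 1)"] by simp
  then show ?thesis unfolding blind_single_def using assms notin_S by blast
qed

text \<open>The vertex \<open>v\<close> hangs at some \<open>c i\<close> of the longer side,
  \<open>k\<close> steps down. The source sees \<open>c 0\<close> through the shorter side, and
  equality of distances forces \<open>k < i\<close>. A vertex of \<open>S\<close> at an inner
  position \<open>j\<close> sees \<open>c 0\<close> only along the longer side, \<open>j\<close>
  steps away, and therefore meets \<open>v\<close> earlier.\<close>

lemma no_short_dirty:
  assumes "L1 + L2 = N" "L2 < L1" "\<not> clean A S c L1"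
  shows False
proof -
  obtain j x0 where j: "0 < j" "j < L1" "x0 \<in> S" "pos x0 = j" "(x0, c j) \<in> A\<^sup>*"
    using not_clean_witness[OF assms(3)] by metis
  define i where "i = pos v"
  have i: "0 < i" "i < L1" "root v = c i"
    using clean_unless_root assms(3) c_pos[OF v_V] pos_v by (auto simp: i_def)
  have x0_0: "(x0, c 0) \<in> A\<^sup>*" using j side_to_0[of j] by (meson less_imp_le rtrancl_trans)
  then have x0_v: "(x0, v) \<in> A\<^sup>*" using reaches_iff j(3) by blast
  have ij: "i \<le> j" using cone[OF x0_v, of j] j by (simp add: i_def)
  obtain x1 where x1: "x1 \<in> S" "(x1, c L1) \<in> A\<^sup>*" "pos x1 = L1" "(x1, c 0) \<in> A\<^sup>*"
    by (rule source_witness)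
  have x1_v: "(x1, v) \<in> A\<^sup>*" using reaches_iff x1 by blast
  have "root x1 \<noteq> root v" using c_pos[of x1] x1 S_V i(2,3) c_eq_iff[of L1 i] L1 by auto
  then obtain k where k: "(c i, v) \<in> A ^^ k" "rdist A x1 v = rdist A x1 (c i) + enat k"
    using tree_rdist[OF v_V _ x1_v] x1(1) S_V i(3) by auto
  have fin1: "rdist A x1 v \<noteq> \<infinity>" using x1_v by (simp add: rdist_infinite_iff)
  then have "(x1, c i) \<in> A\<^sup>*" using k(2) by (cases "rdist A x1 (c i) = \<infinity>") (auto simp: rdist_infinite_iff)
  then have ge: "rdist A x1 (c L1) + enat (L1 - i) \<le> rdist A x1 (c i)"
    using side_rdist_ge[of x1 L1 i] x1 S_V i by auto
  have "c' L2 = c L1" using assms(1) by (metis diff_add_inverse2)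
  then have le: "rdist A x1 (c 0) \<le> rdist A x1 (c L1) + enat L2"
    using side_rdist_le[of L2 c' A 0 x1] side2 c_closed by (simp add: side_def)
  have "rdist A x1 (c L1) \<noteq> \<infinity>" using x1 by (simp add: rdist_infinite_iff)
  then obtain d where d: "rdist A x1 (c L1) = enat d" by (cases "rdist A x1 (c L1)") auto
  have "rdist A x1 (c L1) + enat (L1 - i) + enat k \<le> rdist A x1 (c L1) + enat L2"
    using ge le k(2) rdist_eq[OF x1(1)] by (metis add_right_mono order_trans)
  \<comment> \<open>From \<open>L1 - i + k <= L2 < L1\<close>.\<close>
  then have "k < i" using d i assms by simp
  have "rdist A x0 (c j) \<noteq> \<infinity>" using j by (simp add: rdist_infinite_iff)
  then obtain e where e: "rdist A x0 (c j) = enat e" by (cases "rdist A x0 (c j)") auto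
  have "rdist A x0 v \<le> rdist A x0 (c i) + enat k"
    using rdist_trans[of A x0 v "c i"] rdist_le[OF k(1)] by (meson add_left_mono order_trans)
  also have "\<dots> \<le> rdist A x0 (c j) + enat (j - i) + enat k"
    using side_rdist_le[of j c A i x0] bwd j ij by (intro add_right_mono) auto
  finally have "rdist A x0 v \<le> enat (e + (j - i) + k)" using e by simp
  moreover have "rdist A x0 (c j) + enat (j - 0) \<le> rdist A x0 (c 0)"
    using side_rdist_ge[of x0 j 0] j S_V x0_0 by auto
  then have "enat (e + j) \<le> rdist A x0 v" using e rdist_eq[OF j(3)] by simp
  ultimately have "enat (e + j) \<le> enat (e + (j - i) + k)" by (rule order_trans[rotated])
  then show False using \<open>k < i\<close> ij by simp
qed

lemma pos_reflect:
  assumes "u \<in> V" "0 < pos u"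
  shows "oriented_ring.pos f N c' u = N - pos u"
proof -
  interpret r: oriented_ring V A f N c' by (rule reflect(1))
  show ?thesis
    by (rule r.pos_eqI) (use assms c_pos[OF assms(1)] pos_less[OF assms(1)] reflect_structure in auto)
qed

lemma single:
  assumes "L1 + L2 = N"
  shows "blind_single S L1 L2"
proof -
  interpret r: ambiguous_sink V A f N c' S v L2 L1 by (rule reflect_sink)
  have flip: "blind_single S L1 L2" if "r.blind_single S L2 L1"
    using blind_single_reflect[OF that sink] .
  \<comment> \<open>\<open>v\<close> hangs strictly inside at most one of the sides, so the other
    one is clean. As an unclean side is never the longer one, some clean side is at least as long as
    its opposite.\<close>
  have "clean A S c L1 \<or> clean A S c' L2"
  proof (cases "pos v < L1")
    case True
    then have "\<not> r.pos v < L2" using pos_reflect[OF v_V] pos_v assms L1 by simp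
    then show ?thesis using r.clean_unless_root by blast
  qed (use clean_unless_root in blast)
  moreover have eq: "clean A S r.c' L1 \<longleftrightarrow> clean A S c L1" using clean_reflect2 L1 by simp
  moreover have assms': "L2 + L1 = N" using assms by simp
  ultimately have "clean A S c L1 \<and> L2 \<le> L1 \<or> clean A S c' L2 \<and> L1 \<le> L2"
    using no_short_dirty[OF assms] r.no_short_dirty[OF assms'] by (meson le_less_linear less_imp_le)
  then show ?thesis
    using single_if_clean[OF assms] r.single_if_clean[OF assms'] flip by blast
qed

text \<open>\<open>v\<close> is reached from the source at the end of the other side. From there no
  ring arc leads into the positions \<open>1\<close> to \<open>L1\<close>: \<open>c 0\<close> is a
  sink, and \<open>c L1\<close> sends its arc outwards.\<close>

lemma beyond_source:
  assumes "L1 + L2 < N"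
  shows "L1 < pos v"
proof -
  interpret r: ambiguous_sink V A f N c' S v L2 L1 by (rule reflect_sink)
  obtain x where x: "x \<in> S" "r.pos x = L2" "(x, c' 0) \<in> A\<^sup>*" by (rule r.source_witness)
  then have xV: "x \<in> V" using S_V by blast
  have "root x = c' L2" using r.c_pos[OF xV] x(2) reflect_structure by simp
  then have px: "pos x = N - L2" by (rule pos_eqI) (use L2 in simp)
  have "(x, v) \<in> A\<^sup>*" using x reaches_iff c_closed by simp
  then have "pos v \<in> - {1..L1}"
  proof (rule pos_closed)
    fix i assume i: "i < N" "(c i, c (Suc i)) \<in> A" "i \<in> - {1..L1}"
    have "i \<noteq> 0" using no_fwd[of 0] L1 i(2) by (cases i) auto
    then show "Suc i mod N \<in> - {1..L1}" using i by (cases "Suc i = N") auto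
  next
    fix i assume i: "i < N" "(c (Suc i), c i) \<in> A" "Suc i mod N \<in> - {1..L1}"
    have "i = L1" if "i \<in> {1..L1}" using that i assms L2 by (cases "Suc i = N") auto
    then show "i \<in> - {1..L1}" using z1(2) i by auto
  qed (use px assms in auto)
  then show ?thesis using pos_v by auto
qed

text \<open>An arc in the other direction would block everything that starts at the source
  \<open>c L1\<close>, although it reaches \<open>c 0\<close> and hence \<open>v\<close>.\<close>

lemma ahead:
  assumes "L1 + L2 < N" "L1 \<le> i" "i < pos v"
  shows "(c i, c (Suc i)) \<in> A"
proof (rule ccontr)
  assume no: "(c i, c (Suc i)) \<notin> A"
  obtain x where x: "x \<in> S" "pos x = L1" "(x, c 0) \<in> A\<^sup>*" by (rule source_witness)
  then have "(x, v) \<in> A\<^sup>*" using reaches_iff by blast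
  then have "pos v \<in> {..i}"
  proof (rule pos_closed)
    fix j assume j: "j < N" "(c j, c (Suc j)) \<in> A" "j \<in> {..i}"
    then show "Suc j mod N \<in> {..i}" using no pos_less[OF v_V] assms by (cases "j = i") auto
  next
    fix j assume j: "j < N" "(c (Suc j), c j) \<in> A" "Suc j mod N \<in> {..i}"
    have "N - L2 \<le> j" if "Suc j = N" using that L2 by linarith
    then have "Suc j \<noteq> N" using fwd(2)[of j] j by auto
    then show "j \<in> {..i}" using j by simp
  qed (use x assms in simp)
  then show False using assms by simp
qed

text \<open>The sources at both ends of the gap send their arcs into it, so nothing leaves the gap
  towards \<open>c 0\<close>.\<close>

lemma gap:
  assumes "x \<in> S" "L1 < pos x" "pos x < N - L2"
  shows "(x, v) \<notin> A\<^sup>*"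
proof
  assume "(x, v) \<in> A\<^sup>*"
  then have "(x, c 0) \<in> A\<^sup>*" using reaches_iff assms by blast
  then have "pos (c 0) \<in> {L1<..<N - L2}"
  proof (rule pos_closed)
    fix i assume i: "i < N" "(c i, c (Suc i)) \<in> A" "i \<in> {L1<..<N - L2}"
    have "Suc i \<noteq> N - L2"
    proof
      assume "Suc i = N - L2"
      then show False using z2(2) i by (metis Suc_inject Suc_diff_Suc L2(2))
    qed
    then have "Suc i < N - L2" using i by auto
    moreover from this have "Suc i < N" by linarith
    ultimately show "Suc i mod N \<in> {L1<..<N - L2}" using i by simp
  next
    fix i assume i: "i < N" "(c (Suc i), c i) \<in> A" "Suc i mod N \<in> {L1<..<N - L2}"
    then have "i \<noteq> L1" using z1(2) by auto
    moreover have "Suc i \<noteq> N" using i by auto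
    ultimately show "i \<in> {L1<..<N - L2}" using i by auto
  qed (use assms in simp)
  then show False using N_pos by simp
qed

lemma pos_v_gap:
  assumes "L1 + L2 < N"
  shows "L1 < pos v" "pos v < N - L2"
proof -
  interpret r: ambiguous_sink V A f N c' S v L2 L1 by (rule reflect_sink)
  show "L1 < pos v" by (rule beyond_source[OF assms])
  have "L2 < r.pos v" using r.beyond_source assms by simp
  then show "pos v < N - L2" using pos_reflect[OF v_V] pos_v by simp
qed

text \<open>A vertex of \<open>S\<close> in the tree of \<open>v\<close>, or a child with an upward
  arc, would bring a vertex of the gap in \<open>S\<close> to \<open>v\<close>. So every vertex on
  the way from the root is outside \<open>S\<close> with its parent as only predecessor.\<close>

lemma gap_trail:
  assumes "L1 + L2 < N" "w \<in> V" "root w = root v" "(w, v) \<in> A\<^sup>*"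
  shows "\<exists>k. w \<in> trail A S (root v) k \<and> (root v, w) \<in> A\<^sup>*"
  using assms(2-4)
proof (induction w rule: tree_induct)
  case (ring w)
  then show ?case by (intro exI[of _ 0]) simp
next
  case (off w)
  have gapw: "x \<notin> S \<or> (x, v) \<notin> A\<^sup>*" if "pos x = pos w" for x
    using gap[of x] pos_v_gap[OF assms(1)] that off(4) by (auto simp: pos_def)
  have wS: "w \<notin> S" using gapw off(5) by blast
  have "b = f w" if b: "(b, w) \<in> A" for b
  proof (rule ccontr)
    assume "b \<noteq> f w"
    then have b': "b \<in> V" "b \<notin> C" "f b = w" using pred_of_off[OF b off(2)] by auto
    obtain x where x: "x \<in> S" "(x, b) \<in> A\<^sup>*" using reaches_all[OF b'(1)] by blast
    have "x \<in> down b" using reach_into_down[OF x(2) down_refl] b b' by simp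
    then have "pos x = pos w" using pos_down[of x b] pos_off[of b] b' by simp
    moreover have "(x, v) \<in> A\<^sup>*" using x(2) b off(5) by (meson rtrancl.rtrancl_into_rtrancl rtrancl_trans)
    ultimately show False using gapw x(1) by blast
  qed
  then have fw: "preds A w = {f w}" using preds_nonempty[OF off(1) wS] by blast
  then have "(f w, w) \<in> A" by blast
  then obtain k where k: "f w \<in> trail A S (root v) k" "(root v, f w) \<in> A\<^sup>*"
    using off root_off[OF off(1,2)] by (metis converse_rtrancl_into_rtrancl)
  have "w \<in> sole_succs A (f w) - S" using fw wS by (simp add: sole_succs_def)
  then show ?case using k \<open>(f w, w) \<in> A\<close> by (intro exI[of _ "Suc k"]) auto
qed

lemma gap_preds:
  assumes i: "L1 < i" "i < N - L2" and r: "(c i, v) \<in> A\<^sup>*"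
  shows "c i \<notin> S" "(b, c i) \<in> A \<Longrightarrow> b = c (i - 1) \<or> b = c (Suc i)"
proof -
  show "c i \<notin> S" using gap[of "c i"] i r by auto
  assume b: "(b, c i) \<in> A"
  show "b = c (i - 1) \<or> b = c (Suc i)"
  proof (rule ccontr)
    assume "\<not> ?thesis"
    then have b': "b \<in> V" "b \<notin> C" "f b = c i" using pred_of_ring[OF b] i by auto
    obtain x where x: "x \<in> S" "(x, b) \<in> A\<^sup>*" using reaches_all[OF b'(1)] by blast
    have "x \<in> down b" using reach_into_down[OF x(2) down_refl] b b' by simp
    then have "pos x = i" using pos_down[of x b] pos_off[of b] b' i by simp
    moreover have "(x, v) \<in> A\<^sup>*" using x(2) b r by (meson rtrancl.rtrancl_into_rtrancl rtrancl_trans)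
    ultimately show False using gap[of x] x(1) i by blast
  qed
qed

lemma root_reaches_v: assumes "L1 + L2 < N" shows "(root v, v) \<in> A\<^sup>*"
  using gap_trail[OF assms v_V] by blast

text \<open>Were the root of \<open>v\<close> farther away, \<open>c (Suc L1)\<close> would have the
  source as only predecessor. For \<open>L1 > 1\<close> it would be a twin of
  \<open>c (L1 - 1)\<close>.\<close>

lemma next_sink:
  assumes "L1 + L2 < N"
  shows "pos v = Suc L1"
proof (rule ccontr)
  assume "pos v \<noteq> Suc L1"
  then have lt: "Suc L1 < pos v" using pos_v_gap[OF assms] by simp
  let ?q = "c (Suc L1)"
  have "(?q, c (Suc L1 + k)) \<in> A\<^sup>*" if "Suc L1 + k \<le> pos v" for k
    using that
  proof (induction k)
    case (Suc k)
    then have "(c (Suc L1 + k), c (Suc (Suc L1 + k))) \<in> A" by (intro ahead[OF assms]) auto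
    then show ?case using Suc by (auto intro: rtrancl_into_rtrancl)
  qed simp
  from this[of "pos v - Suc L1"] have "(?q, root v) \<in> A\<^sup>*" using lt c_pos[OF v_V] by simp
  then have qv: "(?q, v) \<in> A\<^sup>*" using root_reaches_v[OF assms] by (rule rtrancl_trans)
  note q = gap_preds[of "Suc L1", OF _ _ qv]
  have "(c (Suc (Suc L1)), ?q) \<notin> A" using ahead[OF assms, of "Suc L1"] lt arc_asym by simp
  then have "preds A ?q = {c L1}" using q(2) z1(1) pos_v_gap[OF assms] lt by auto
  moreover have "?q \<notin> S" using q(1) pos_v_gap[OF assms] lt by simp
  ultimately have qs: "?q \<in> sole_succs A (c L1) - S" by (simp add: sole_succs_def)
  show False
  proof (cases "L1 = 1")
    case False
    have "clean A S c L1" using clean_unless_root pos_v_gap[OF assms] by simp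
    then have "c (L1 - 1) \<in> sole_succs A (c L1) - S"
      using False L1 by (auto simp: clean_def sole_succs_def)
    then have "c (L1 - 1) = ?q" using qs twin_free unfolding twin_free_def by blast
    moreover have "L1 - 1 < N" "Suc L1 < N" using pos_v_gap[OF assms] by linarith+
    ultimately show False using c_eq_iff[of "L1 - 1" "Suc L1"] by auto
  next
    case True
    obtain x where x: "x \<in> S" "pos x = L1" "(x, c 0) \<in> A\<^sup>*" by (rule source_witness)
    have xM: "x \<in> {u. pos u \<le> L1}" using x by simp
    have vfin: "rdist A x v \<noteq> \<infinity>" using x reaches_iff by (simp add: rdist_infinite_iff)
    have "rdist A x ?q < rdist A x v"
    proof (rule rdist_exit_less[OF _ xM _ _ vfin])
      show "v \<notin> {u. pos u \<le> L1}" using pos_v_gap[OF assms] by simp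
      have "Suc L1 < N" using lt pos_less[OF v_V] by linarith
      then show "v \<noteq> ?q" using lt pos_c[of "Suc L1"] by auto
    next
      fix a b assume ab: "(a, b) \<in> A" "a \<in> {u. pos u \<le> L1}"
      from ab(1) show "b \<in> {u. pos u \<le> L1} \<or> b = ?q"
      proof (cases rule: arc_cases)
        case up
        then show ?thesis using ab pos_off[of a] arc_V[OF ab(1)] by auto
      next
        case down
        then show ?thesis using ab pos_off[of b] arc_V[OF ab(1)] by auto
      next
        case (ring i)
        then show ?thesis using ab c_closed N_pos by (cases "Suc i = N"; cases "i = L1") auto
      next
        case (gnir i)
        have "N - L2 \<le> i" if "Suc i = N" using that L2 by linarith
        then have "Suc i \<noteq> N" using fwd(2)[of i] gnir ab by auto
        then show ?thesis using gnir ab by simp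
      qed
    qed
    moreover have "x \<noteq> ?q" using x(1) qs by auto
    then have "rdist A x ?q = rdist A x (c L1) + 1" using sole_succs_rdist[of ?q A "c L1" x] qs by simp
    moreover have "rdist A x (c 0) \<le> rdist A x (c L1) + 1" using bwd[of 0] True rdist_step by auto
    ultimately show False using rdist_eq[OF x(1)] by simp
  qed
qed

text \<open>The vertex of \<open>S\<close> above one source does not reach the other source, and
  thereby measures the length of its own clean side exactly.\<close>

lemma source_rdist:
  assumes "L1 + L2 < N" "clean A S c L1" "clean A S c' L2"
  obtains x where "x \<in> S" "rdist A x (c 0) = rdist A x (c L1) + enat L1" "rdist A x (c' L2) = \<infinity>"
    "rdist A x (c L1) \<noteq> \<infinity>"
proof -
  interpret r: ambiguous_sink V A f N c' S v L2 L1 by (rule reflect_sink)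
  obtain x where x: "x \<in> S" "(x, c L1) \<in> A\<^sup>*" "pos x = L1" by (rule source_witness)
  have "r.pos x = N - L1" using pos_reflect[of x] x S_V L1 by auto
  then have "(x, c' L2) \<notin> A\<^sup>*" using r.source_pos[of x] assms(1) by auto
  then have inf: "rdist A x (c' L2) = \<infinity>" by (simp add: rdist_infinite_iff)
  have "rdist A x (c 1) = rdist A x (c L1) + enat (L1 - 1)"
    using clean_rdist[OF assms(2) x(1), of 1] L1 by simp
  moreover have "rdist A x (c (N - 1)) = \<infinity>"
    using clean_rdist[OF assms(3) x(1), of 1] L2 inf by simp
  ultimately have "rdist A x (c 0) = rdist A x (c L1) + enat (L1 - 1) + 1"
    using rdist_0[OF x(1)] by simp
  also have "\<dots> = rdist A x (c L1) + enat L1" using L1 by (simp add: one_enat_def add.assoc)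
  finally show thesis using that x inf by (simp add: rdist_infinite_iff)
qed

lemma double:
  assumes lt: "L1 + L2 < N"
  shows "blind_double S L1 L2"
proof -
  interpret r: ambiguous_sink V A f N c' S v L2 L1 by (rule reflect_sink)
  have lt': "L2 + L1 < N" using lt by simp
  have p: "pos v = Suc L1" by (rule next_sink[OF lt])
  have "r.pos v = Suc L2" by (rule r.next_sink[OF lt'])
  \<comment> \<open>Seen from both ends \<open>v\<close> hangs next to the source, so just one
    vertex lies between the two sources.\<close>
  then have N: "L1 + L2 + 2 = N" using pos_reflect[OF v_V] p pos_less[OF v_V] by simp
  have root: "root v = c (Suc L1)" using c_pos[OF v_V] p by simp
  have cl1: "clean A S c L1" by (rule clean_unless_root) (use p in simp)
  have cl2: "clean A S c' L2" by (rule r.clean_unless_root) (use \<open>r.pos v = Suc L2\<close> in simp)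
  have rv: "(c (Suc L1), v) \<in> A\<^sup>*" using root_reaches_v[OF lt] root by simp
  note t = gap_preds[of "Suc L1", OF _ _ rv]
  have idx: "N - L2 = Suc (Suc L1)" "N - Suc L2 = Suc L1" using N by auto
  have "(c (Suc (Suc L1)), c (Suc L1)) \<in> A" using z2(1) unfolding idx .
  then have tp: "preds A (c (Suc L1)) = {c L1, c' L2}" using t(2) z1(1) idx by auto
  have tS: "c (Suc L1) \<notin> S" using t(1) idx by simp
  obtain k where k: "v \<in> trail A S (c (Suc L1)) k" using gap_trail[OF lt v_V] root by auto
  have dist: "rdist A x (c 0) = min (rdist A x (c L1)) (rdist A x (c' L2)) + enat (Suc k)" if x: "x \<in> S" for x
  proof -
    have "rdist A x v = min (rdist A x (c L1)) (rdist A x (c' L2)) + 1 + enat k"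
      using trail_rdist[OF k x] rdist_two_preds[OF _ tp, of x] tS x by metis
    then show ?thesis using rdist_eq[OF x] by (simp add: one_enat_def add.assoc)
  qed
  obtain x where x: "x \<in> S" "rdist A x (c 0) = rdist A x (c L1) + enat L1" "rdist A x (c' L2) = \<infinity>"
    "rdist A x (c L1) \<noteq> \<infinity>" using source_rdist[OF lt cl1 cl2] by blast
  \<comment> \<open>The witness at each source equates the length of its side with the length of the
    trail plus one, so the two sides are equally long.\<close>
  have "L1 = Suc k" using dist[OF x(1)] x(2-4) by (cases "rdist A x (c L1)") auto
  have cl1': "clean A S r.c' L1" using cl1 clean_reflect2 L1 by simp
  obtain y where y: "y \<in> S" "rdist A y (c' 0) = rdist A y (c' L2) + enat L2" "rdist A y (c L1) = \<infinity>"
    "rdist A y (c' L2) \<noteq> \<infinity>" using r.source_rdist[OF lt' cl2 cl1'] L1 by (metis reflect_fun less_imp_le)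
  have "L2 = Suc k" using dist[OF y(1)] y(2-4) c_closed by (cases "rdist A y (c' L2)") auto
  then show ?thesis
    unfolding blind_double_def using \<open>L1 = Suc k\<close> N notin_S cl1 cl2 tS tp k by auto
qed

theorem blind: "blind_single S L1 L2 \<or> blind_double S L1 L2"
  using single double L12 by (metis le_neq_implies_less)

end

section \<open>Base sets\<close>

text \<open>Every resolving set contains a base set, and all base sets have the same size.\<close>

definition base_set :: "'a set \<Rightarrow> ('a \<times> 'a) set \<Rightarrow> 'a set \<Rightarrow> bool" where
  "base_set V A B \<longleftrightarrow> B \<subseteq> V \<and> (\<forall>v\<in>V. preds A v = {} \<longrightarrow> v \<in> B) \<and>
     (\<forall>v\<in>B. preds A v = {} \<or> (\<exists>u. v \<in> sole_succs A u)) \<and>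
     (\<forall>u. sole_succs A u \<noteq> {} \<longrightarrow> (\<exists>!v. v \<in> sole_succs A u - B))"

definition basis :: "'a set \<Rightarrow> ('a \<times> 'a) set \<Rightarrow> 'a set \<Rightarrow> bool" where
  "basis V A S \<longleftrightarrow> resolves V A S \<and> (\<forall>T. resolves V A T \<longrightarrow> card S \<le> card T)"

lemma base_set_twin_free: "base_set V A B \<Longrightarrow> twin_free V A B"
  unfolding base_set_def twin_free_def by blast

lemma twin_free_insert: "twin_free V A S \<Longrightarrow> v \<in> V \<Longrightarrow> twin_free V A (insert v S)"
  unfolding twin_free_def by blast

lemma sole_succs_inj: "v \<in> sole_succs A u \<Longrightarrow> v \<in> sole_succs A u' \<Longrightarrow> u = u'"
  by (auto simp: sole_succs_def)

text \<open>\<open>V\<close> is partitioned into \<open>B\<close>, the vertices with several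
  predecessors and the vertices left out, one for each \<open>u\<close> with sole successors. The
  last two numbers do not depend on \<open>B\<close>.\<close>

lemma base_set_card:
  assumes "finite V" "A \<subseteq> V \<times> V" "base_set V A B"
  shows "card B + card {v\<in>V. preds A v \<noteq> {} \<and> (\<nexists>u. v \<in> sole_succs A u)} + card {u. sole_succs A u \<noteq> {}} = card V"
proof -
  let ?M = "{v\<in>V. preds A v \<noteq> {} \<and> (\<nexists>u. v \<in> sole_succs A u)}"
  let ?U = "{u. sole_succs A u \<noteq> {}}"
  let ?Q = "{v\<in>V. v \<notin> B \<and> (\<exists>u. v \<in> sole_succs A u)}"
  define l where "l u = (THE v. v \<in> sole_succs A u - B)" for u
  have l: "l u \<in> sole_succs A u - B" if "u \<in> ?U" for u
    unfolding l_def
  proof (rule theI')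
    show "\<exists>!v. v \<in> sole_succs A u - B" using that assms(3) by (simp add: base_set_def)
  qed
  have "l ` ?U = ?Q"
  proof (intro equalityI subsetI)
    fix v assume "v \<in> l ` ?U"
    then obtain u where u: "u \<in> ?U" "v = l u" by blast
    then have v: "v \<in> sole_succs A u - B" using l by blast
    then have "(u, v) \<in> A" unfolding sole_succs_def by blast
    then have "v \<in> V" using assms(2) by blast
    then show "v \<in> ?Q" using v by auto
  next
    fix v assume "v \<in> ?Q"
    then obtain u where "v \<in> sole_succs A u" "v \<notin> B" by blast
    then have u: "v \<in> sole_succs A u - B" by simp
    then have uU: "u \<in> ?U" by auto
    then have "\<exists>!v. v \<in> sole_succs A u - B" using assms(3) by (simp add: base_set_def)
    then have "v = l u" using l[OF uU] u by blast
    then show "v \<in> l ` ?U" using uU by blast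
  qed
  moreover have "inj_on l ?U"
  proof (rule inj_onI)
    fix u u' assume u: "u \<in> ?U" "u' \<in> ?U" "l u = l u'"
    have "l u \<in> sole_succs A u" using l[OF u(1)] by simp
    moreover have "l u \<in> sole_succs A u'" unfolding u(3) using l[OF u(2)] by simp
    ultimately show "u = u'" by (rule sole_succs_inj)
  qed
  then have "card (l ` ?U) = card ?U" by (rule card_image)
  ultimately have "card ?Q = card ?U" by simp
  moreover have "V = B \<union> (?M \<union> ?Q)" using assms(3) by (auto simp: base_set_def)
  then have "card V = card B + (card ?M + card ?Q)"
  proof -
    have fin: "finite B" "finite ?M" "finite ?Q" using assms finite_subset by (auto simp: base_set_def)
    have "B \<inter> (?M \<union> ?Q) = {}" using assms(3) by (auto simp: base_set_def)
    moreover have "?M \<inter> ?Q = {}" by blast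
    ultimately show ?thesis using \<open>V = B \<union> (?M \<union> ?Q)\<close> fin card_Un_disjoint
      by (metis (no_types, lifting) finite_UnI)
  qed
  ultimately show ?thesis by simp
qed

text \<open>From \<open>T\<close> are removed all vertices with several predecessors and, for each
  \<open>u\<close> whose sole successors all belong to \<open>T\<close>, one of these,
  \<open>g u\<close>.\<close>

lemma resolves_contains_base_set:
  assumes "resolves V A T" "A \<subseteq> V \<times> V"
  shows "\<exists>B\<subseteq>T. base_set V A B"
proof -
  have tf: "twin_free V A T" by (rule resolves_twin_free[OF assms])
  define g where "g u = (SOME v. v \<in> sole_succs A u)" for u
  have g: "g u \<in> sole_succs A u" if "sole_succs A u \<noteq> {}" for u
    unfolding g_def using that by (simp add: some_in_eq)
  let ?B = "{v\<in>T. preds A v = {} \<or> (\<exists>u. v \<in> sole_succs A u \<and> \<not> (sole_succs A u \<subseteq> T \<and> v = g u))}"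
  have "base_set V A ?B"
    unfolding base_set_def
  proof (intro conjI ballI allI impI)
    show "?B \<subseteq> V" using assms by (auto simp: resolves_def)
  next
    fix v assume "v \<in> V" "preds A v = {}"
    then show "v \<in> ?B" using tf by (simp add: twin_free_def)
  next
    fix v assume "v \<in> ?B"
    then show "preds A v = {} \<or> (\<exists>u. v \<in> sole_succs A u)" by blast
  next
    fix u assume u: "sole_succs A u \<noteq> {}"
    have mem: "v \<in> ?B \<longleftrightarrow> v \<in> T \<and> \<not> (sole_succs A u \<subseteq> T \<and> v = g u)" if "v \<in> sole_succs A u" for v
    proof -
      have "preds A v \<noteq> {}" using that by (simp add: sole_succs_def)
      moreover have "u' = u" if "v \<in> sole_succs A u'" for u'
        using sole_succs_inj[OF that \<open>v \<in> sole_succs A u\<close>] .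
      then have "(\<exists>u'. v \<in> sole_succs A u' \<and> \<not> (sole_succs A u' \<subseteq> T \<and> v = g u')) \<longleftrightarrow>
          \<not> (sole_succs A u \<subseteq> T \<and> v = g u)" using that by metis
      ultimately show ?thesis by auto
    qed
    show "\<exists>!v. v \<in> sole_succs A u - ?B"
    proof (cases "sole_succs A u \<subseteq> T")
      case True
      show ?thesis
        by (rule ex1I[of _ "g u"]) (use g[OF u] mem True in blast)+
    next
      case False
      then obtain v where v: "v \<in> sole_succs A u" "v \<notin> T" by blast
      have w: "w = v" if "w \<in> sole_succs A u - T" for w
      proof -
        have "v \<in> sole_succs A u - T" using v by simp
        then show ?thesis using that tf unfolding twin_free_def by metis
      qed
      have mem': "x \<in> ?B \<longleftrightarrow> x \<in> T" if "x \<in> sole_succs A u" for x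
        using mem[OF that] False by simp
      show ?thesis
      proof (rule ex1I[of _ v])
        show "v \<in> sole_succs A u - ?B" using mem'[OF v(1)] v by simp
      next
        fix x assume "x \<in> sole_succs A u - ?B"
        then have x: "x \<in> sole_succs A u" "x \<notin> ?B" by simp_all
        then have "x \<notin> T" using mem' by blast
        then show "x = v" using w x by simp
      qed
    qed
  qed
  moreover have "?B \<subseteq> T" by (rule subsetI) (elim CollectE conjE)
  ultimately show ?thesis by (intro exI[of _ ?B] conjI)
qed

lemma base_set_sole_nonempty:
  "base_set V A B \<Longrightarrow> sole_succs A u - B \<noteq> {} \<longleftrightarrow> sole_succs A u \<noteq> {}"
  unfolding base_set_def by blast

lemma base_set_card_eq:
  assumes "finite V" "A \<subseteq> V \<times> V" "base_set V A B" "base_set V A B'"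
  shows "card B = card B'"
  using base_set_card[OF assms(1-3)] base_set_card[OF assms(1,2,4)] by simp

lemma basis_base_set:
  assumes "finite V" "A \<subseteq> V \<times> V" "base_set V A B" "resolves V A B"
  shows "basis V A B"
  unfolding basis_def
proof (intro conjI allI impI)
  fix T assume T: "resolves V A T"
  then obtain B' where "B' \<subseteq> T" "base_set V A B'" using resolves_contains_base_set assms(2) by blast
  moreover have "finite T" using T assms(1) finite_subset by (auto simp: resolves_def)
  ultimately show "card B \<le> card T" using base_set_card_eq[OF assms(1-3)] card_mono by metis
qed (rule assms)

text \<open>If no base set resolves, every resolving set contains a base set properly, so a single
  additional vertex is optimal.\<close>

lemma basis_insert:
  assumes "finite V" "A \<subseteq> V \<times> V" "base_set V A B" "resolves V A (insert v B)"
    and none: "\<And>B'. base_set V A B' \<Longrightarrow> \<not> resolves V A B'"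
  shows "basis V A (insert v B)"
  unfolding basis_def
proof (intro conjI allI impI)
  fix T assume T: "resolves V A T"
  then obtain B' where B': "B' \<subseteq> T" "base_set V A B'" using resolves_contains_base_set assms(2) by blast
  then have "B' \<subset> T" using none T by blast
  moreover have "finite T" using T assms(1) finite_subset by (auto simp: resolves_def)
  ultimately have "card B' < card T" by (simp add: psubset_card_mono)
  moreover have "card (insert v B) \<le> Suc (card B)" by (rule card_insert_le_m1) simp_all
  ultimately show "card (insert v B) \<le> card T" using base_set_card_eq[OF assms(1-3) B'(2)] by simp
qed (rule assms)

section \<open>Recognizing metric bases\<close>

text \<open>Stated for the set of ring vertices, so that all coordinates share the same
  sinks.\<close>

definition sinks_in :: "('a \<times> 'a) set \<Rightarrow> 'a set \<Rightarrow> 'a set" where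
  "sinks_in A C = {w\<in>C. \<exists>p q. p \<noteq> q \<and> p \<in> C \<and> q \<in> C \<and> (p, w) \<in> A \<and> (q, w) \<in> A}"

definition entries :: "('a \<times> 'a) set \<Rightarrow> 'a set \<Rightarrow> 'a set" where
  "entries A C = {b. b \<notin> C \<and> (\<exists>u\<in>C. (b, u) \<in> A)}"

text \<open>The choice of the missing vertices that leaves as few ring vertices out as possible.\<close>

definition ring_averse :: "('a \<times> 'a) set \<Rightarrow> 'a set \<Rightarrow> 'a set \<Rightarrow> bool" where
  "ring_averse A C B \<longleftrightarrow> (\<forall>u v. v \<in> sole_succs A u - B \<longrightarrow> v \<in> C \<longrightarrow> sole_succs A u \<subseteq> C)"

context oriented_ring
begin

abbreviation sinks :: "'a set" where "sinks \<equiv> sinks_in A C"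

lemma in_C_pred_c0: "(p, c 0) \<in> A \<Longrightarrow> p \<in> C \<Longrightarrow> p = c 1 \<or> p = c (N - 1)"
  using pred_of_c0 by blast

lemma c1_neq: "c 1 \<noteq> c (N - 1)" using c_eq_iff[of 1 "N - 1"] N_ge_3 by auto

lemma sink_c0: "c 0 \<in> sinks \<longleftrightarrow> (c 1, c 0) \<in> A \<and> (c (N - 1), c 0) \<in> A"
proof
  assume "c 0 \<in> sinks"
  then obtain p q where "p \<noteq> q" "p \<in> C" "q \<in> C" "(p, c 0) \<in> A" "(q, c 0) \<in> A"
    by (auto simp: sinks_in_def)
  then show "(c 1, c 0) \<in> A \<and> (c (N - 1), c 0) \<in> A" using in_C_pred_c0 by metis
next
  assume "(c 1, c 0) \<in> A \<and> (c (N - 1), c 0) \<in> A"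
  moreover have "c 0 \<in> C" "c 1 \<in> C" "c (N - 1) \<in> C" using N_ge_3 by simp_all
  ultimately show "c 0 \<in> sinks" using c1_neq unfolding sinks_in_def by blast
qed

lemma sink_ci:
  assumes "0 < i" "i < N" "c i \<in> sinks"
  shows "(c (i - 1), c i) \<in> A \<and> (c (Suc i), c i) \<in> A"
proof -
  obtain p q where "p \<noteq> q" "p \<in> C" "q \<in> C" "(p, c i) \<in> A" "(q, c i) \<in> A"
    using assms by (auto simp: sinks_in_def)
  then show ?thesis using pred_of_ring[of p i] pred_of_ring[of q i] assms by metis
qed

lemma coords_from:
  assumes "w \<in> C"
  obtains d where "oriented_ring V A f N d" "d ` {..<N} = C" "d 0 = w"
proof -
  obtain j where j: "j < N" "w = c j" using C_cases[OF assms] by metis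
  have "c ((0 + j) mod N) = w" using j by simp
  then show thesis using that[OF rotate[OF j(1)]] by simp
qed

lemma side_exists:
  assumes "(c 1, c 0) \<in> A" "(c (N - 1), c 0) \<in> A"
  obtains L where "0 < L" "L < N" "side A c L"
proof -
  let ?P = "\<lambda>L. L < N \<and> (c L, c (Suc L)) \<in> A"
  have "?P (N - 1)" using assms(2) c_closed N_pos by simp
  then have P: "?P (LEAST L. ?P L)" by (rule LeastI)
  let ?L = "LEAST L. ?P L"
  have "(c (Suc i), c i) \<in> A" if "i < ?L" for i
    using not_less_Least[OF that] P that ring_arc[of i] by auto
  then have "side A c ?L" using P by (simp add: side_def)
  moreover have "?L \<noteq> 0" using P assms(1) arc_asym by (metis One_nat_def)
  ultimately show thesis using that P by blast
qed

lemma sink_sides_exist: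
  assumes "c 0 \<in> sinks" "preds A (c 0) \<subseteq> C"
  obtains L1 L2 where "ring_sink L1 L2"
proof -
  interpret r: oriented_ring V A f N c' by (rule reflect(1))
  have s: "(c 1, c 0) \<in> A" "(c (N - 1), c 0) \<in> A" using assms sink_c0 by auto
  obtain L1 where "0 < L1" "L1 < N" "side A c L1" using side_exists[OF s] by blast
  moreover obtain L2 where "0 < L2" "L2 < N" "side A c' L2"
    using r.side_exists s c_closed N_ge_3 by (auto simp: reflect_fun)
  moreover have "preds A (c 0) = {c 1, c (N - 1)}" using s assms(2) in_C_pred_c0 by blast
  ultimately show thesis using that by (auto simp: ring_sink_def)
qed

lemma ring_sink_in_sinks: "ring_sink L1 L2 \<Longrightarrow> c 0 \<in> sinks"
  unfolding sink_c0 ring_sink_def by blast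

lemma ring_sink_arcs:
  assumes "ring_sink L1 L2"
  shows "i < L1 \<Longrightarrow> (c (Suc i), c i) \<in> A" and "N - L2 \<le> i \<Longrightarrow> i < N \<Longrightarrow> (c i, c (Suc i)) \<in> A"
proof -
  show "i < L1 \<Longrightarrow> (c (Suc i), c i) \<in> A" using assms by (auto simp: ring_sink_def side_def)
  assume i: "N - L2 \<le> i" "i < N"
  have s: "side A c' L2" "L2 < N" using assms by (auto simp: ring_sink_def)
  have "N - Suc i < L2" using i s(2) by linarith
  then have "(c' (Suc (N - Suc i)), c' (N - Suc i)) \<in> A" using s by (simp add: side_def)
  moreover have "N - Suc (N - Suc i) = i" "N - (N - Suc i) = Suc i" using i by auto
  ultimately show "(c i, c (Suc i)) \<in> A" by simp
qed

text \<open>Every ring arc belongs to one of the two sides, and each vertex of a side other than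
  \<open>c 0\<close> sends an arc towards \<open>c 0\<close>. The number of sinks thus tells which
  blind configuration can occur.\<close>

lemma single_sinks:
  assumes "ring_sink L1 L2" "L1 + L2 = N"
  shows "sinks = {c 0}"
proof -
  have "i = 0" if i: "i < N" "c i \<in> sinks" for i
  proof (rule ccontr)
    assume "i \<noteq> 0"
    then have s: "(c (i - 1), c i) \<in> A" "(c (Suc i), c i) \<in> A" using sink_ci i by auto
    show False
      using ring_sink_arcs(1)[OF assms(1), of "i - 1"] ring_sink_arcs(2)[OF assms(1), of i] s i
        \<open>i \<noteq> 0\<close> assms(2) arc_asym
      by (metis Suc_diff_1 add_diff_cancel_right' gr0I le_less_linear less_imp_diff_less not_less_eq_eq Suc_leI Suc_le_eq)
  qed
  note zero = this
  have "w = c 0" if "w \<in> sinks" for w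
  proof -
    have "w \<in> C" using that by (simp add: sinks_in_def)
    then obtain i where "i < N" "w = c i" by (rule C_cases)
    moreover from this that have "i = 0" using zero by metis
    ultimately show ?thesis by simp
  qed
  then show ?thesis using ring_sink_in_sinks[OF assms(1)] by blast
qed

lemma double_sinks:
  assumes "ring_sink L1 L2" "L1 + L2 + 2 = N" "preds A (c (Suc L1)) = {c L1, c' L2}"
  shows "sinks = {c 0, c (Suc L1)}"
proof -
  have "i = 0 \<or> i = Suc L1" if i: "i < N" "c i \<in> sinks" for i
  proof (rule ccontr)
    assume neg: "\<not> (i = 0 \<or> i = Suc L1)"
    then have s: "(c (i - 1), c i) \<in> A" "(c (Suc i), c i) \<in> A" using sink_ci i by auto
    show False
    proof (cases "i \<le> L1")
      case True
      then have "(c i, c (i - 1)) \<in> A" using ring_sink_arcs(1)[OF assms(1), of "i - 1"] neg by simp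
      then show False using s(1) arc_asym by blast
    next
      case False
      then have "N - L2 \<le> i" using neg assms(2) by linarith
      then show False using ring_sink_arcs(2)[OF assms(1), of i] i s(2) arc_asym by blast
    qed
  qed
  moreover have "sinks \<subseteq> C" by (auto simp: sinks_in_def)
  moreover have "c (Suc L1) \<in> sinks"
  proof -
    have "c L1 \<noteq> c' L2" using c_eq_iff[of L1 "N - L2"] assms(1,2) by (auto simp: ring_sink_def)
    moreover have "c L1 \<in> C" "c' L2 \<in> C" "c (Suc L1) \<in> C" using assms(2) by auto
    moreover have "(c L1, c (Suc L1)) \<in> A" "(c' L2, c (Suc L1)) \<in> A" using assms(3) by blast+
    ultimately show ?thesis unfolding sinks_in_def by blast
  qed
  ultimately show ?thesis using ring_sink_in_sinks[OF assms(1)] C_cases by blast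
qed

text \<open>The earliest change of direction would be a sink.\<close>

lemma no_sink_directed:
  assumes "sinks = {}" "(c 0, c 1) \<in> A"
  shows "directed_ring"
proof -
  have "(c i, c (Suc i)) \<in> A" if "i < N" for i
    using that
  proof (induction i)
    case (Suc i)
    show ?case
    proof (rule ccontr)
      assume "(c (Suc i), c (Suc (Suc i))) \<notin> A"
      then have "(c (Suc (Suc i)), c (Suc i)) \<in> A" using ring_arc Suc.prems by blast
      moreover have "(c i, c (Suc i)) \<in> A" using Suc by simp
      moreover have "c i \<noteq> c (Suc (Suc i))"
      proof (cases "Suc (Suc i) = N")
        case True
        then have "c (Suc (Suc i)) = c 0" using c_closed by simp
        then show ?thesis using c_eq_iff[of i 0] True N_ge_3 by auto
      next
        case False
        then show ?thesis using c_eq_iff[of i "Suc (Suc i)"] Suc.prems by auto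
      qed
      moreover have "c i \<in> C" "c (Suc i) \<in> C" "c (Suc (Suc i)) \<in> C" using Suc.prems by auto
      ultimately have "c (Suc i) \<in> sinks" unfolding sinks_in_def by blast
      then show False using assms(1) by simp
    qed
  qed (use assms in simp)
  then show ?thesis by (simp add: directed_ring_def)
qed

lemma directed_coords:
  assumes "sinks = {}" "w \<in> C"
  obtains d where "oriented_ring V A f N d" "d ` {..<N} = C" "d 0 = w" "oriented_ring.directed_ring A N d"
proof -
  obtain d where d: "oriented_ring V A f N d" "d ` {..<N} = C" "d 0 = w" using coords_from[OF assms(2)] by blast
  interpret d: oriented_ring V A f N d by fact
  have C: "d.C = C" using d by (simp add: d.C_def)
  show thesis
  proof (cases "(d 0, d 1) \<in> A")
    case True
    then show ?thesis using that d d.no_sink_directed assms(1) C by simp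
  next
    case False
    interpret r: oriented_ring V A f N d.c' by (rule d.reflect(1))
    have "(d 1, d 0) \<in> A" using False d.ring_arc[of 0] N_pos by simp
    then have "(d (N - 1), d 0) \<notin> A" using d.sink_c0 assms(1) C by simp
    then have "(d.c' 0, d.c' 1) \<in> A"
      using d.ring_arc[of "N - 1"] d.c_closed N_pos by simp
    then have "r.directed_ring"
      using r.no_sink_directed assms(1) d.reflect_structure(1) C by simp
    then show ?thesis using that[OF d.reflect(1)] d.reflect(2) C d.c_closed d(3) by simp
  qed
qed

lemma directed_no_sinks:
  assumes "directed_ring"
  shows "sinks = {}"
proof (rule ccontr)
  assume "sinks \<noteq> {}"
  then obtain w where w: "w \<in> sinks" by blast
  then have "w \<in> C" by (simp add: sinks_in_def)
  then obtain i where i: "i < N" "c i \<in> sinks" using C_cases w by metis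
  have fwd: "(c i, c (Suc i)) \<in> A" using assms i by (simp add: directed_ring_def)
  show False
  proof (cases "i = 0")
    case True
    then show False using sink_c0 i fwd arc_asym by auto
  next
    case False
    then show False using sink_ci[of i] i fwd arc_asym by auto
  qed
qed

end

section \<open>Reachability, and directed rings without coordinates\<close>

context oriented_ring
begin

definition coords :: "(nat \<Rightarrow> 'a) \<Rightarrow> bool" where
  "coords d \<longleftrightarrow> oriented_ring V A f N d \<and> d ` {..<N} = C"

lemma coords_C: "coords d \<Longrightarrow> oriented_ring.C N d = C"
  by (metis coords_def oriented_ring.C_def)

lemma coords_self: "coords c"
  using oriented_ring_axioms by (simp add: coords_def C_def)

text \<open>Climbing against the arcs stays within ever smaller subtrees and so ends at a
  source.\<close>

lemma source_above:
  assumes "\<And>v. v \<in> V \<Longrightarrow> preds A v = {} \<Longrightarrow> v \<in> S"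
  shows "b \<in> V \<Longrightarrow> b \<notin> C \<Longrightarrow> (b, f b) \<in> A \<Longrightarrow> \<exists>x\<in>S. (x, b) \<in> A\<^sup>*"
proof (induction "card (down b)" arbitrary: b rule: less_induct)
  case less
  show ?case
  proof (cases "preds A b = {}")
    case True
    then show ?thesis using assms less.prems(1) by blast
  next
    case False
    then obtain p where p: "(p, b) \<in> A" by blast
    then have "p \<noteq> f b" using less.prems(3) arc_asym by blast
    then have p': "p \<in> V" "p \<notin> C" "f p = b" using pred_of_off[OF p less.prems(2)] by auto
    have "down p \<subset> down b"
    proof
      show "down p \<subseteq> down b" using anc_off[OF p'(1,2)] p' anc_trans[of _ p b] by (auto simp: down_def)
      show "down p \<noteq> down b" using parent_not_down[OF p'(1,2)] down_refl[OF less.prems(1)] p'(3) by auto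
    qed
    then have "card (down p) < card (down b)"
      using finite_subset[OF down_V finite_V] by (intro psubset_card_mono)
    then obtain x where "x \<in> S" "(x, p) \<in> A\<^sup>*" using less.hyps[of p] p p' by auto
    then show ?thesis using p by (meson rtrancl.rtrancl_into_rtrancl)
  qed
qed

text \<open>The set \<open>U\<close> of unreached vertices is closed under predecessors, and a
  vertex with an upward arc is never in it. So the root of an unreached vertex is unreached, and
  going back from it along ring predecessors sweeps the whole ring.\<close>

lemma reach_dichotomy:
  assumes src: "\<And>v. v \<in> V \<Longrightarrow> preds A v = {} \<Longrightarrow> v \<in> S"
  shows "(\<forall>v\<in>V. \<exists>x\<in>S. (x, v) \<in> A\<^sup>*) \<or> (sinks = {} \<and> S \<inter> C = {} \<and> entries A C = {})"
proof (rule disjCI)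
  assume neg: "\<not> (sinks = {} \<and> S \<inter> C = {} \<and> entries A C = {})"
  define U where "U = {v\<in>V. \<not> (\<exists>x\<in>S. (x, v) \<in> A\<^sup>*)}"
  have U_pred: "u \<in> U" if "(u, v) \<in> A" "v \<in> U" for u v
    using that arc_V(1)[OF that(1)] unfolding U_def by (auto intro: rtrancl_into_rtrancl)
  have U_tree: "\<not> (b \<notin> C \<and> (b, f b) \<in> A \<and> b \<in> U)" for b
    using source_above[OF src, of b] unfolding U_def by blast
  have U_S: "v \<notin> S" if "v \<in> U" for v using that by (auto simp: U_def)
  have U_ex: "preds A v \<noteq> {}" if "v \<in> U" for v using that src[of v] U_S[OF that] by (auto simp: U_def)
  have U_ring: "\<exists>p\<in>C \<inter> U. (p, v) \<in> A" if v: "v \<in> U" "v \<in> C" for v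
  proof -
    obtain p where p: "(p, v) \<in> A" using U_ex[OF v(1)] by blast
    then have "p \<in> C" using off_ring_pred[OF p v(2)] U_pred[OF p v(1)] U_tree[of p] by blast
    then show ?thesis using p U_pred[OF p v(1)] by blast
  qed
  have "U = {}"
  proof (rule ccontr)
    assume "U \<noteq> {}"
    then obtain v0 where "v0 \<in> U" by blast
    have root_U: "root v \<in> U" if "v \<in> V" "v \<in> U" for v
      using that
    proof (induction v rule: tree_induct)
      case (off v)
      then have "(f v, v) \<in> A" using U_tree[of v] tree_arc' by blast
      then show ?case using off U_pred[of "f v" v] root_off[OF off(1,2)] by simp
    qed simp
    define u where "u = root v0"
    have u: "u \<in> U" "u \<in> C" using \<open>v0 \<in> U\<close> root_U root_C by (auto simp: U_def u_def)
    obtain p where p: "p \<in> C" "p \<in> U" "(p, u) \<in> A" using U_ring[OF u] by blast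
    \<comment> \<open>With the unreached predecessor in last position, going back means going down
      through the positions.\<close>
    obtain d where d: "coords d" "d 0 = u" "d (N - 1) = p"
    proof -
      obtain e where e: "oriented_ring V A f N e" "e ` {..<N} = C" "e 0 = u" using coords_from[OF u(2)] by blast
      interpret e: oriented_ring V A f N e by fact
      have eC: "e.C = C" using e by (simp add: e.C_def)
      have "p = e 1 \<or> p = e (N - 1)" using e.in_C_pred_c0[of p] p e(3) eC by simp
      then show thesis
      proof
        assume "p = e (N - 1)"
        then show thesis using that[of e] e by (simp add: coords_def)
      next
        assume "p = e 1"
        moreover have "e.c' (N - 1) = e 1" "e.c' 0 = u" using N_ge_3 e.c_closed e(3) by (auto simp: e.reflect_fun)
        ultimately show thesis using that[of e.c'] e.reflect eC by (simp add: coords_def)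
      qed
    qed
    interpret d: oriented_ring V A f N d using d(1) by (simp add: coords_def)
    have dC: "d.C = C" using d(1) by (rule coords_C)
    have step: "d (N - Suc k) \<in> U \<and> (d (N - Suc k), d (N - k)) \<in> A" if "k < N" for k
      using that
    proof (induction k)
      case 0
      then show ?case using d p d.c_closed by simp
    next
      case (Suc k)
      define i where "i = N - Suc k"
      have i: "0 < i" "i < N" "N - k = Suc i" "N - Suc (Suc k) = i - 1" using Suc.prems by (auto simp: i_def)
      have IH: "d i \<in> U" "(d i, d (Suc i)) \<in> A" using Suc i unfolding i_def by auto
      have "d i \<in> C" using dC d.c_C[of i] i by simp
      then obtain q where q: "q \<in> C" "q \<in> U" "(q, d i) \<in> A" using U_ring[OF IH(1)] by blast
      then have "q \<noteq> d (Suc i)" using IH(2) arc_asym by blast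
      then have "q = d (i - 1)" using d.pred_of_ring[OF q(3) i(1,2)] q(1) dC by auto
      then show ?case unfolding i(4) i_def[symmetric] using q by simp
    qed
    have fwd: "d i \<in> U \<and> (d i, d (Suc i)) \<in> A" if "i < N" for i
      using step[of "N - Suc i"] that by (simp add: Suc_diff_Suc)
    have CU: "C \<subseteq> U"
    proof
      fix x assume "x \<in> C"
      then obtain i where "i < N" "x = d i" using dC d.C_cases by metis
      then show "x \<in> U" using fwd by simp
    qed
    have "d.directed_ring" using fwd by (simp add: d.directed_ring_def)
    then have "sinks = {}" using d.directed_no_sinks dC by simp
    moreover have "S \<inter> C = {}" using CU U_S by blast
    moreover have "entries A C = {}"
    proof (rule ccontr)
      assume "entries A C \<noteq> {}"
      then obtain b w where b: "b \<notin> C" "w \<in> C" "(b, w) \<in> A" by (auto simp: entries_def)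
      then have "b \<in> U" using U_pred CU by blast
      then show False using U_tree[of b] off_ring_pred[OF b(3,2,1)] b by auto
    qed
    ultimately show False using neg by blast
  qed
  then show "\<forall>v\<in>V. \<exists>x\<in>S. (x, v) \<in> A\<^sup>*" by (auto simp: U_def)
qed

text \<open>\<open>blind_directed\<close> freed from its coordinates.\<close>

definition blind_cycle :: "'a set \<Rightarrow> bool" where
  "blind_cycle S \<longleftrightarrow> sinks = {} \<and> S \<inter> C = {} \<and> (\<exists>a. entries A C = {a} \<and> sole_succs A a - S \<noteq> {})"

lemma blind_directed_blind_cycle:
  assumes "blind_directed S"
  shows "blind_cycle S"
proof -
  have b: "directed_ring" "S \<inter> C = {}" "\<And>i. 0 < i \<Longrightarrow> i < N \<Longrightarrow> preds A (c i) = {c (i - 1)}"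
    using assms by (auto simp: blind_directed_def)
  obtain a where a: "a \<in> V - C" "preds A (c 0) = {a, c (N - 1)}" "sole_succs A a - S \<noteq> {}"
    using assms by (auto simp: blind_directed_def)
  have "b' = a" if b': "b' \<notin> C" "w \<in> C" "(b', w) \<in> A" for b' w
  proof -
    obtain i where i: "i < N" "w = c i" using C_cases[OF b'(2)] by metis
    show ?thesis
    proof (cases "i = 0")
      case True
      then have "b' \<in> {a, c (N - 1)}" using a(2) b' i by blast
      then show ?thesis using b'(1) c_C[of "N - 1"] by auto
    next
      case False
      then have "b' \<in> {c (i - 1)}" using b(3)[of i] b' i by blast
      then show ?thesis using b'(1) c_C[of "i - 1"] i by auto
    qed
  qed
  moreover have "(a, c 0) \<in> A" using a(2) by blast
  ultimately have "entries A C = {a}" using a(1) c_C[of 0] unfolding entries_def by blast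
  then show ?thesis unfolding blind_cycle_def using directed_no_sinks[OF b(1)] b(2) a(3) by blast
qed

lemma blind_cycle_not_resolves:
  assumes "blind_cycle S"
  shows "\<not> resolves V A S"
proof -
  obtain a where a: "sinks = {}" "S \<inter> C = {}" "entries A C = {a}" "sole_succs A a - S \<noteq> {}"
    using assms by (auto simp: blind_cycle_def)
  then obtain w where w: "a \<notin> C" "w \<in> C" "(a, w) \<in> A" unfolding entries_def by blast
  obtain d where d: "oriented_ring V A f N d" "d ` {..<N} = C" "d 0 = w" "oriented_ring.directed_ring A N d"
    using directed_coords[OF a(1) w(2)] by blast
  interpret d: oriented_ring V A f N d by fact
  have dC: "d.C = C" using d by (simp add: d.C_def)
  have a': "a \<in> V" "f a = w" using off_ring_pred[OF w(3,2,1)] by auto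
  have entry: "b = a" if "(b, d i) \<in> A" "b \<notin> C" "i < N" for b i
  proof -
    have "d i \<in> C" using dC d.c_C[of i] that by simp
    then have "b \<in> entries A C" using that unfolding entries_def by blast
    then show ?thesis using a(3) by simp
  qed
  have fwd: "(d i, d (Suc i)) \<in> A" if "i < N" for i using d(4) that by (simp add: d.directed_ring_def)
  have "preds A (d i) = {d (i - 1)}" if i: "0 < i" "i < N" for i
  proof -
    have "(d (i - 1), d i) \<in> A" using fwd[of "i - 1"] i by simp
    moreover have "u = d (i - 1)" if u: "(u, d i) \<in> A" for u
    proof -
      have "u \<noteq> d (Suc i)" using u fwd[of i] i arc_asym by blast
      moreover have False if "u \<in> V \<and> u \<notin> C \<and> f u = d i"
      proof -
        have "d i = d 0" using entry[OF u _ i(2)] that a' d(3) by auto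
        then show False using d.c_eq_iff[of i 0] i by auto
      qed
      ultimately show ?thesis using d.pred_of_ring[OF u i] dC by blast
    qed
    ultimately show ?thesis by blast
  qed
  moreover have "preds A (d 0) = {a, d (N - 1)}"
  proof -
    have "(d (N - 1), d 0) \<in> A" using fwd[of "N - 1"] N_pos d.c_closed by simp
    moreover have "u = a \<or> u = d (N - 1)" if u: "(u, d 0) \<in> A" for u
    proof -
      have "u \<noteq> d 1" using u fwd[of 0] N_pos arc_asym by auto
      then show ?thesis using d.pred_of_c0[OF u] dC entry[OF u] N_pos by blast
    qed
    ultimately show ?thesis using w(3) d(3) by blast
  qed
  ultimately have "d.blind_directed S"
    unfolding d.blind_directed_def using a d(4) a' w dC by blast
  then show ?thesis by (rule d.blind_directed_not_resolves)
qed

end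

lemma (in unresolved) unresolved_coords: "coords d \<Longrightarrow> unresolved V A f N d S"
  by (intro unresolved.intro unresolved_axioms.intro) (use twin_free reaches_all in \<open>auto simp: coords_def\<close>)

text \<open>An ambiguous pair is ordered so that \<open>w\<close> has two predecessors. Then
  \<open>w\<close> is on the ring with a ring predecessor, and a tree predecessor, if any, makes the
  ring a blind cycle.\<close>

lemma (in unresolved) unresolved_cases:
  assumes "\<not> resolves V A S"
  shows "blind_cycle S \<or> (\<exists>v w. ambiguous V A S v w \<and> w \<in> sinks \<and> preds A w \<subseteq> C)"
proof -
  have "\<exists>v\<in>V. \<exists>w\<in>V. confused A S v w"
    using assms S_V reaches_all unfolding resolves_def confused_def by blast
  then obtain v1 w1 where "v1 \<in> V" "w1 \<in> V" "confused A S v1 w1" by blast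
  then obtain v0 w0 where "ambiguous V A S v0 w0" using ambiguous_exists by metis
  then obtain v w p q where amb: "ambiguous V A S v w" and pq: "p \<noteq> q" "p \<in> preds A w" "q \<in> preds A w"
    using ambiguous_two_preds[of v0 w0] ambiguous_sym by metis
  have wV: "w \<in> V" and conf: "confused A S v w" using amb by (auto simp: ambiguous_def)
  note tp = two_preds_on_ring[OF conf wV pq(2,3,1)]
  show ?thesis
  proof (cases "preds A w \<subseteq> C")
    case True
    then have "w \<in> sinks" using tp(1) pq unfolding sinks_in_def by blast
    then show ?thesis using amb True by blast
  next
    case False
    then obtain a where a: "a \<notin> C" "(a, w) \<in> A" by blast
    obtain p where p: "p \<in> C" "(p, w) \<in> A" using tp(2) pq by blast
    obtain e where e: "oriented_ring V A f N e" "e ` {..<N} = C" "e 0 = w" using coords_from[OF tp(1)] by blast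
    interpret e: unresolved V A f N e S by (rule unresolved_coords) (use e in \<open>simp add: coords_def\<close>)
    have eC: "e.C = C" using e by (simp add: e.C_def)
    have "p = e 1 \<or> p = e (N - 1)" using e.in_C_pred_c0[of p] p e(3) eC by simp
    then show ?thesis
    proof
      assume "p = e (N - 1)"
      then have "e.blind_directed S" using e.entry_blind_directed[of v a] amb a p e(3) eC by simp
      then show ?thesis using e.blind_directed_blind_cycle e.blind_cycle_def blind_cycle_def eC by simp
    next
      assume pe: "p = e 1"
      interpret r: unresolved V A f N e.c' S
        by (rule unresolved_coords) (use e.reflect eC in \<open>simp add: coords_def\<close>)
      have rC: "r.C = C" using e.reflect eC by (simp add: r.C_def)
      have "e.c' (N - 1) = e 1" "e.c' 0 = w" using N_ge_3 e.c_closed e(3) by (auto simp: e.reflect_fun)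
      then have "r.blind_directed S" using r.entry_blind_directed[of v a] amb a p pe rC by simp
      then show ?thesis using r.blind_directed_blind_cycle r.blind_cycle_def blind_cycle_def rC by simp
    qed
  qed
qed

section \<open>Sufficient conditions for resolving\<close>

context oriented_ring
begin

lemma unresolvedI:
  assumes "twin_free V A S" "\<forall>v\<in>V. \<exists>x\<in>S. (x, v) \<in> A\<^sup>*"
  shows "unresolved V A f N c S"
  by (intro unresolved.intro unresolved_axioms.intro oriented_ring_axioms) (use assms in auto)

lemma resolves_directed:
  assumes "twin_free V A S" "sinks = {}" "\<not> (S \<inter> C = {} \<and> entries A C = {})" "\<not> blind_cycle S"
  shows "resolves V A S"
proof (rule ccontr)
  assume neg: "\<not> ?thesis"
  have "\<forall>v\<in>V. \<exists>x\<in>S. (x, v) \<in> A\<^sup>*"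
    using reach_dichotomy[of S] assms by (auto simp: twin_free_def)
  then interpret unresolved V A f N c S by (rule unresolvedI[OF assms(1)])
  show False using unresolved_cases[OF neg] assms by blast
qed

text \<open>One choice of coordinates per sink is enough, because an ambiguous pair would make the
  sink blind in all of them. Sinks entered from a tree need no check.\<close>

lemma resolves_sinks:
  assumes tf: "twin_free V A S" and ne: "sinks \<noteq> {}"
    and not_blind: "\<And>w. w \<in> sinks \<Longrightarrow> preds A w \<subseteq> C \<Longrightarrow> \<exists>d L1 L2. coords d \<and> d 0 = w \<and>
      oriented_ring.ring_sink A N d L1 L2 \<and> \<not> oriented_ring.blind_single A N d S L1 L2 \<and>
      \<not> oriented_ring.blind_double A N d S L1 L2"
  shows "resolves V A S"
proof (rule ccontr)
  assume neg: "\<not> ?thesis"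
  have "\<forall>v\<in>V. \<exists>x\<in>S. (x, v) \<in> A\<^sup>*"
    using reach_dichotomy[of S] assms by (auto simp: twin_free_def)
  then interpret unresolved V A f N c S by (rule unresolvedI[OF assms(1)])
  have "\<not> blind_cycle S" using ne by (simp add: blind_cycle_def)
  then obtain v w where w: "ambiguous V A S v w" "w \<in> sinks" "preds A w \<subseteq> C"
    using unresolved_cases[OF neg] by blast
  obtain d L1 L2 where d: "coords d" "d 0 = w" "oriented_ring.ring_sink A N d L1 L2"
    "\<not> oriented_ring.blind_single A N d S L1 L2" "\<not> oriented_ring.blind_double A N d S L1 L2"
    using not_blind[OF w(2,3)] by blast
  interpret d: unresolved V A f N d S by (rule unresolved_coords[OF d(1)])
  interpret d: ambiguous_sink V A f N d S v L1 L2
    by unfold_locales (use w d in simp_all)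
  show False using d.blind d by blast
qed

lemma coords_sides_exist:
  assumes "w \<in> sinks" "preds A w \<subseteq> C"
  obtains d L1 L2 where "coords d" "d 0 = w" "oriented_ring.ring_sink A N d L1 L2"
proof -
  have "w \<in> C" using assms by (simp add: sinks_in_def)
  then obtain d where d: "oriented_ring V A f N d" "d ` {..<N} = C" "d 0 = w" using coords_from by blast
  interpret d: oriented_ring V A f N d by fact
  have dC: "d.C = C" using d by (simp add: d.C_def)
  obtain L1 L2 where "d.ring_sink L1 L2" using d.sink_sides_exist assms d(3) dC by metis
  then show thesis using that d by (simp add: coords_def)
qed

lemma blind_single_sinks:
  "ring_sink L1 L2 \<Longrightarrow> blind_single S L1 L2 \<Longrightarrow> sinks = {c 0}"
  using single_sinks by (auto simp: blind_single_def)

lemma blind_double_sinks: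
  "ring_sink L1 L2 \<Longrightarrow> blind_double S L1 L2 \<Longrightarrow> sinks = {c 0, c (Suc L1)}"
  using double_sinks by (auto simp: blind_double_def)

text \<open>Each blind configuration determines the sinks completely and has at most two of
  them.\<close>

lemma resolves_many_sinks:
  assumes tf: "twin_free V A S" and many: "3 \<le> card sinks"
  shows "resolves V A S"
proof (rule resolves_sinks[OF tf])
  show "sinks \<noteq> {}" using many by auto
next
  fix w assume "w \<in> sinks" "preds A w \<subseteq> C"
  then obtain d L1 L2 where d: "coords d" "d 0 = w" "oriented_ring.ring_sink A N d L1 L2"
    by (rule coords_sides_exist)
  interpret d: oriented_ring V A f N d using d(1) by (simp add: coords_def)
  have dC: "d.C = C" using coords_C[OF d(1)] .
  have "\<not> d.blind_single S L1 L2"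
  proof
    assume "d.blind_single S L1 L2"
    then have "sinks = {d 0}" using d.blind_single_sinks[OF d(3)] dC by simp
    then show False using many by simp
  qed
  moreover have "\<not> d.blind_double S L1 L2"
  proof
    assume "d.blind_double S L1 L2"
    then have "sinks = {d 0, d (Suc L1)}" using d.blind_double_sinks[OF d(3)] dC by simp
    moreover have "card {d 0, d (Suc L1)} \<le> 2" by (simp add: card_insert_if)
    ultimately show False using many by simp
  qed
  ultimately show "\<exists>d L1 L2. coords d \<and> d 0 = w \<and>
      oriented_ring.ring_sink A N d L1 L2 \<and> \<not> oriented_ring.blind_single A N d S L1 L2 \<and>
      \<not> oriented_ring.blind_double A N d S L1 L2" using d by blast
qed

section \<open>Comparing all base sets with one\<close>

lemma sink_notin_base:
  assumes "base_set V A B" "(p, w) \<in> A" "(q, w) \<in> A" "p \<noteq> q"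
  shows "w \<notin> B"
proof
  assume "w \<in> B"
  then have "preds A w = {} \<or> (\<exists>u. preds A w = {u})" using assms(1) by (auto simp: base_set_def sole_succs_def)
  moreover have "p \<in> preds A w" "q \<in> preds A w" using assms by auto
  ultimately show False using assms(4) by (metis empty_iff singletonD)
qed

lemma ring_succ:
  assumes "(c i, v) \<in> A" "v \<in> C" "0 < i" "i < N"
  shows "v = c (i - 1) \<or> v = c (Suc i)"
  using assms(1)
proof (cases rule: arc_cases)
  case (gnir j)
  then have "i = Suc j" using c_eq_iff'[of i "Suc j"] assms by auto
  then show ?thesis using gnir by simp
next
  case (ring j)
  then show ?thesis using c_eq_iff assms by auto
qed (use assms in auto)

lemma base_set_singleton:
  assumes "base_set V A B" "sole_succs A u = {v}"
  shows "v \<notin> B"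
proof -
  have "\<exists>!x. x \<in> sole_succs A u - B" using assms unfolding base_set_def by (metis insert_not_empty)
  then show ?thesis using assms(2) by auto
qed

text \<open>Inside a clean side all choices but the first are forced.\<close>

lemma clean_forced:
  assumes X: "ring_averse A C X" and B: "base_set V A B" and s: "side A c L" "L < N"
    and cl: "clean A X c L" and first: "1 < L \<Longrightarrow> c (L - 1) \<notin> B"
  shows "clean A B c L"
  unfolding clean_def
proof (intro allI impI conjI)
  fix i assume i: "0 < i \<and> i < L"
  then have ci: "c i \<notin> X" "preds A (c i) = {c (Suc i)}" using cl by (auto simp: clean_def)
  then show "preds A (c i) = {c (Suc i)}" by simp
  show "c i \<notin> B"
  proof (cases "Suc i = L")
    case True
    then show ?thesis using first i by auto
  next
    case False
    have ss: "c i \<in> sole_succs A (c (Suc i)) - X" using ci by (simp add: sole_succs_def)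
    moreover have "c i \<in> C" using i s by simp
    \<comment> \<open>\<open>X\<close> avoids leaving out ring vertices, so no candidate lies in a
      tree. Of the ring neighbours of \<open>c (Suc i)\<close>, the one other than
      \<open>c i\<close> is its predecessor.\<close>
    ultimately have sub: "sole_succs A (c (Suc i)) \<subseteq> C" using X unfolding ring_averse_def by blast
    have "v = c i" if v: "v \<in> sole_succs A (c (Suc i))" for v
    proof -
      have a: "(c (Suc i), v) \<in> A" using v unfolding sole_succs_def by blast
      have "(c (Suc (Suc i)), c (Suc i)) \<in> A" using s(1) False i by (simp add: side_def)
      then have "v \<noteq> c (Suc (Suc i))" using a arc_asym by blast
      then show ?thesis using ring_succ[OF a _ _] sub v i s by auto
    qed
    then have "sole_succs A (c (Suc i)) = {c i}" using ss by blast
    then show ?thesis using base_set_singleton[OF B] by blast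
  qed
qed

definition swap :: "'a \<Rightarrow> 'a \<Rightarrow> 'a set \<Rightarrow> 'a set" where
  "swap s t X = (X - {s, t}) \<union> ({s, t} - X)"

lemma base_set_swap:
  assumes X: "base_set V A X" and ss: "sole_succs A z = {s, t}" "s \<noteq> t"
  shows "base_set V A (swap s t X)"
proof -
  have st: "s \<in> sole_succs A z" "t \<in> sole_succs A z" using ss by auto
  have one: "s \<in> X \<longleftrightarrow> t \<notin> X"
  proof -
    have "\<exists>!v. v \<in> {s, t} - X" using X ss unfolding base_set_def by (metis insert_not_empty)
    then show ?thesis using ss(2) by blast
  qed
  have zs: "preds A s = {z}" "preds A t = {z}" using st by (auto simp: sole_succs_def)
  have "(z, s) \<in> A" "(z, t) \<in> A" using zs by blast+
  then have V: "s \<in> V" "t \<in> V" using arc_V by blast+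
  have other: "s \<notin> sole_succs A u \<and> t \<notin> sole_succs A u" if "u \<noteq> z" for u
    using that st sole_succs_inj by metis
  show ?thesis
    unfolding base_set_def
  proof (intro conjI ballI allI impI)
    show "swap s t X \<subseteq> V" using X V by (auto simp: swap_def base_set_def)
  next
    fix v assume "v \<in> V" "preds A v = {}"
    then show "v \<in> swap s t X" using X zs by (auto simp: swap_def base_set_def)
  next
    fix v assume "v \<in> swap s t X"
    then show "preds A v = {} \<or> (\<exists>u. v \<in> sole_succs A u)" using X st unfolding swap_def base_set_def by blast
  next
    fix u assume u: "sole_succs A u \<noteq> {}"
    show "\<exists>!v. v \<in> sole_succs A u - swap s t X"
    proof (cases "u = z")
      case True
      have "sole_succs A u - swap s t X = (if s \<in> X then {s} else {t})"
        using True ss one by (auto simp: swap_def)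
      then show ?thesis by (auto split: if_splits)
    next
      case False
      then have "sole_succs A u - swap s t X = sole_succs A u - X" using other[OF False] by (auto simp: swap_def)
      then show ?thesis using X u by (simp add: base_set_def)
    qed
  qed
qed

lemma ring_averse_swap:
  assumes X: "ring_averse A C X" and ss: "sole_succs A z = {s, t}" "s \<in> C" "t \<in> C"
  shows "ring_averse A C (swap s t X)"
  unfolding ring_averse_def
proof (intro allI impI)
  fix u v assume v: "v \<in> sole_succs A u - swap s t X" "v \<in> C"
  show "sole_succs A u \<subseteq> C"
  proof (cases "u = z")
    case False
    then have "s \<notin> sole_succs A u" "t \<notin> sole_succs A u" using ss sole_succs_inj[of _ A u z] by auto
    then have "v \<in> sole_succs A u - X" using v by (auto simp: swap_def)
    then show ?thesis using X v(2) unfolding ring_averse_def by blast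
  qed (use ss in auto)
qed

text \<open>If \<open>B\<close> leaves out \<open>?s\<close>, the neighbour of the source on the
  clean side, this side is clean for \<open>B\<close> as well. Otherwise \<open>B\<close> leaves out
  \<open>?t\<close>, the other neighbour. The exchanged \<open>X\<close> no longer has the first
  side clean, so its blindness comes from the second one, which \<open>?t\<close> begins and which
  stays clean for \<open>B\<close>.\<close>

lemma blind_single_half_all:
  assumes sink: "ring_sink L1 L2" and L: "L1 + L2 = N" "L2 \<le> L1"
    and X: "base_set V A X" "ring_averse A C X" and B: "base_set V A B"
    and cl: "clean A X c L1" and K: "sole_succs A (c' 1) \<noteq> {}"
    and sw: "{c (L1 - 1), c (Suc L1)} \<subseteq> sole_succs A (c L1) \<Longrightarrow>
      blind_single (swap (c (L1 - 1)) (c (Suc L1)) X) L1 L2"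
  shows "blind_single B L1 L2"
proof -
  let ?s = "c (L1 - 1)" and ?t = "c (Suc L1)"
  have L': "1 < L1" "0 < L2" "L1 < N" "L2 < N" "side A c L1" "side A c' L2" "preds A (c 0) = {c 1, c (N - 1)}"
    using sink L N_ge_3 by (auto simp: ring_sink_def)
  have y: "c 0 \<notin> B" using sink_notin_base[OF B, of "c 1" "c 0" "c (N - 1)"] L'(7) c1_neq by blast
  have s: "?s \<in> sole_succs A (c L1)" "?s \<notin> X"
    using cl L' by (auto simp: clean_def sole_succs_def)
  have sC: "?s \<in> C" "?t \<in> C" using L' by auto
  then have zC: "sole_succs A (c L1) \<subseteq> C" using X(2) s unfolding ring_averse_def by blast
  have succ: "v = ?s \<or> v = ?t" if "v \<in> sole_succs A (c L1)" for v
  proof -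
    have "(c L1, v) \<in> A" using that unfolding sole_succs_def by blast
    then show ?thesis using ring_succ[of L1 v] zC that L' by auto
  qed
  have KB: "sole_succs A (c' 1) - B \<noteq> {}" using K base_set_sole_nonempty[OF B] by simp
  show ?thesis
  proof (cases "?s \<in> B")
    case False
    then have "clean A B c L1" using clean_forced[OF X(2) B L'(5,3) cl] by blast
    then show ?thesis unfolding blind_single_def using L y KB by blast
  next
    case True
    obtain v where "v \<in> sole_succs A (c L1)" "v \<notin> B" using B s(1) unfolding base_set_def by blast
    then have t: "?t \<in> sole_succs A (c L1)" "?t \<notin> B" using succ True by auto
    have ss: "sole_succs A (c L1) = {?s, ?t}" using s t succ by blast
    have st: "?s \<noteq> ?t" using True t by auto
    let ?X = "swap ?s ?t X"
    have X': "base_set V A ?X" "ring_averse A C ?X"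
      using base_set_swap[OF X(1) ss st] ring_averse_swap[OF X(2) ss sC] by auto
    have "?s \<in> ?X" using s(2) by (simp add: swap_def)
    then have "\<not> clean A ?X c L1" using L'(1) by (auto simp: clean_def intro!: exI[of _ "L1 - 1"])
    moreover have "blind_single ?X L1 L2" using sw s t by simp
    ultimately have b: "L1 \<le> L2" "clean A ?X c' L2" "sole_succs A (c 1) - ?X \<noteq> {}"
      by (auto simp: blind_single_def)
    interpret r: oriented_ring V A f N c' by (rule reflect(1))
    have "N - (L2 - 1) = Suc L1" using L L'(2) by linarith
    then have "clean A B c' L2"
      using r.clean_forced[of ?X B L2] X'(2) B L' b(2) t(2) reflect_structure(1) by simp
    moreover have "sole_succs A (c 1) - B \<noteq> {}" using b(3) base_set_sole_nonempty[OF B] by blast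
    ultimately show ?thesis unfolding blind_single_def using L y b(1) by blast
  qed
qed

lemma swap_commute: "swap s t X = swap t s X" by (auto simp: swap_def)

text \<open>This is why a single exchange settles the matter: if \<open>X\<close> and, where it
  exists, its exchanged copy are blind, so is every base set.\<close>

lemma blind_single_all:
  assumes sink: "ring_sink L1 L2" and bl: "blind_single X L1 L2"
    and X: "base_set V A X" "ring_averse A C X" and B: "base_set V A B"
    and sw: "{c (L1 - 1), c (Suc L1)} \<subseteq> sole_succs A (c L1) \<Longrightarrow>
      blind_single (swap (c (L1 - 1)) (c (Suc L1)) X) L1 L2"
  shows "blind_single B L1 L2"
proof -
  have L: "L1 + L2 = N" "0 < L1" "L1 < N" "0 < L2" "L2 < N" using bl sink by (auto simp: blind_single_def ring_sink_def)
  consider "L2 \<le> L1" "clean A X c L1" "sole_succs A (c' 1) \<noteq> {}"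
    | "L1 \<le> L2" "clean A X c' L2" "sole_succs A (c 1) \<noteq> {}"
    using bl unfolding blind_single_def by blast
  then show ?thesis
  proof cases
    case 1
    then show ?thesis using blind_single_half_all[OF sink L(1) _ X B] sw by blast
  next
    case 2
    interpret r: oriented_ring V A f N c' by (rule reflect(1))
    have idx: "N - (L2 - 1) = Suc L1" "N - Suc L2 = L1 - 1" "N - L2 = L1" "r.c' 1 = c 1"
      using L N_ge_3 by (auto simp: reflect_fun)
    have flip: "r.blind_single Y L2 L1 \<longleftrightarrow> blind_single Y L1 L2" for Y
      using clean_reflect2[of L1 Y] L c_closed idx(4)
      unfolding r.blind_single_def blind_single_def by (auto simp: reflect_fun)
    have "r.blind_single B L2 L1"
    proof (rule r.blind_single_half_all[OF ring_sink_reflect[OF sink] _ _ X(1) _ B])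
      show "ring_averse A r.C X" using X(2) reflect_structure(1) by simp
      show "clean A X c' L2" by (rule 2)
      show "sole_succs A (r.c' 1) \<noteq> {}" using 2 idx(4) by simp
      assume "{c' (L2 - 1), c' (Suc L2)} \<subseteq> sole_succs A (c' L2)"
      then show "r.blind_single (swap (c' (L2 - 1)) (c' (Suc L2)) X) L2 L1"
        using sw unfolding flip idx by (simp add: swap_commute)
    qed (use L 2 in auto)
    then show ?thesis using flip by simp
  qed
qed

end

lemma trail_Suc_left: "trail A S t (Suc k) = (\<Union>w\<in>sole_succs A t - S. trail A S w k)"
proof (induction k)
  case (Suc k)
  have "trail A S t (Suc (Suc k)) = (\<Union>w\<in>trail A S t (Suc k). sole_succs A w - S)" by simp
  also have "\<dots> = (\<Union>w\<in>sole_succs A t - S. trail A S w (Suc k))" unfolding Suc by auto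
  finally show ?case .
qed simp

section \<open>Unavoidable trails below a sink\<close>

context oriented_ring
begin

text \<open>Keeps trails inside the trees: from such a vertex every trail descends, so heights can
  be computed from the leaves upwards.\<close>

definition below :: "'a \<Rightarrow> bool" where
  "below u \<longleftrightarrow> u \<in> V \<and> (\<forall>v\<in>sole_succs A u. v \<notin> C \<and> f v = u)"

text \<open>\<open>H\<close> is the length of the longest trail that cannot be avoided; \<open>X\<close> attains it.\<close>

definition heights :: "'a set \<Rightarrow> ('a \<Rightarrow> nat) \<Rightarrow> bool" where
  "heights X H \<longleftrightarrow> (\<forall>u. below u \<longrightarrow> (sole_succs A u = {} \<longrightarrow> H u = 0) \<and>
     (\<forall>v\<in>sole_succs A u. H u \<le> Suc (H v)) \<and> (\<forall>v\<in>sole_succs A u - X. H u = Suc (H v)))"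

lemma below_step:
  assumes "below u" "v \<in> sole_succs A u"
  shows "below v"
proof -
  have v: "v \<notin> C" "f v = u" "preds A v = {u}" using assms by (auto simp: below_def sole_succs_def)
  have a: "(u, v) \<in> A" using v(3) by blast
  have "w \<notin> C \<and> f w = v" if w: "w \<in> sole_succs A v" for w
  proof -
    have vw: "(v, w) \<in> A" using w unfolding sole_succs_def by blast
    then have "w \<noteq> u" using a arc_asym by blast
    moreover have "w \<notin> C" using off_ring_pred[OF vw _ v(1)] v(2) calculation by auto
    ultimately show ?thesis using pred_of_off[OF vw] v a vw arc_asym
      by (cases rule: arc_cases[OF vw]) auto
  qed
  then show ?thesis using arc_V(2)[OF a] by (simp add: below_def)
qed

text \<open>Whatever \<open>v\<close> a base set leaves out, its height is at least
  \<open>H u - 1\<close>, so a trail can always be continued. In \<open>heights_upper\<close> the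
  equality for \<open>X\<close> gives the opposite bound.\<close>

lemma heights_lower:
  assumes "heights X H" "base_set V A B" "below u" "k \<le> H u"
  shows "trail A B u k \<noteq> {}"
  using assms(3,4)
proof (induction k arbitrary: u)
  case (Suc k)
  then have "sole_succs A u \<noteq> {}" using assms(1) by (auto simp: heights_def)
  then obtain v where v: "v \<in> sole_succs A u - B" using base_set_sole_nonempty[OF assms(2)] by blast
  then have "H u \<le> Suc (H v)" using assms(1) Suc.prems by (auto simp: heights_def)
  then have "trail A B v k \<noteq> {}" using Suc below_step[of u v] v by auto
  then show ?case unfolding trail_Suc_left using v by blast
qed simp

lemma heights_upper:
  assumes "heights X H" "below u" "trail A X u k \<noteq> {}"
  shows "k \<le> H u"
  using assms(2,3)
proof (induction k arbitrary: u)
  case (Suc k)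
  then obtain v where v: "v \<in> sole_succs A u - X" "trail A X v k \<noteq> {}"
    unfolding trail_Suc_left by blast
  then have "k \<le> H v" using Suc.IH[of v] below_step[of u v] Suc.prems by blast
  moreover have "H u = Suc (H v)" using assms(1) Suc.prems(1) v(1) unfolding heights_def by blast
  ultimately show ?case by simp
qed simp

text \<open>Both ring neighbours of a sink are its predecessors, so all its successors are
  children.\<close>

lemma below_sink:
  assumes "w \<in> sinks" "preds A w \<subseteq> C"
  shows "below w"
proof -
  have wC: "w \<in> C" using assms by (simp add: sinks_in_def)
  obtain d where d: "oriented_ring V A f N d" "d ` {..<N} = C" "d 0 = w" using coords_from[OF wC] by blast
  interpret d: oriented_ring V A f N d by fact
  have dC: "d.C = C" using d by (simp add: d.C_def)
  have s: "(d 1, d 0) \<in> A" "(d (N - 1), d 0) \<in> A" using assms d.sink_c0 dC d(3) by auto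
  have "v \<notin> C \<and> f v = w" if v: "v \<in> sole_succs A w" for v
  proof -
    have wv: "(d 0, v) \<in> A" using v d(3) unfolding sole_succs_def by blast
    then have "v \<noteq> d 1" "v \<noteq> d (N - 1)" using s arc_asym by blast+
    then have "v \<notin> C \<and> f v = d 0"
    proof (cases rule: d.arc_cases[OF wv])
      case (3 i)
      then have "i = 0" using d.c_eq_iff N_pos by metis
      then show ?thesis using 3 \<open>v \<noteq> d 1\<close> by simp
    next
      case (4 i)
      then have "Suc i = N" using d.c_eq_iff'[of N "Suc i"] d.c_closed N_pos by auto
      then show ?thesis using 4 \<open>v \<noteq> d (N - 1)\<close> by auto
    qed (use dC d.c_C[of 0] in auto)
    then show ?thesis using d(3) by simp
  qed
  then show ?thesis using wC C_V by (auto simp: below_def)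
qed

text \<open>If the far neighbour of the source has another predecessor, it is no sole successor, so
  the choice at the source is forced too. Hence two sources call for no exchange.\<close>

lemma clean_forced_source:
  assumes X: "base_set V A X" "ring_averse A C X" and B: "base_set V A B" and s: "side A c L" "0 < L" "L < N"
    and cl: "clean A X c L" and t: "(q, c (Suc L)) \<in> A" "q \<noteq> c L"
  shows "clean A B c L"
proof (rule clean_forced[OF X(2) B s(1,3) cl])
  assume L: "1 < L"
  have ss: "c (L - 1) \<in> sole_succs A (c L) - X"
    using cl L by (auto simp: clean_def sole_succs_def)
  moreover have "c (L - 1) \<in> C" using s by simp
  ultimately have zC: "sole_succs A (c L) \<subseteq> C" using X(2) unfolding ring_averse_def by blast
  have "v = c (L - 1)" if v: "v \<in> sole_succs A (c L)" for v
  proof -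
    have "(c L, v) \<in> A" using v unfolding sole_succs_def by blast
    moreover have "v \<noteq> c (Suc L)"
    proof
      assume "v = c (Suc L)"
      then have "preds A (c (Suc L)) = {c L}" using v by (simp add: sole_succs_def)
      then show False using t by blast
    qed
    ultimately show ?thesis using ring_succ[of L v] zC v s by auto
  qed
  then have "sole_succs A (c L) = {c (L - 1)}" using ss by blast
  then show "c (L - 1) \<notin> B" using base_set_singleton[OF B] by blast
qed

lemma blind_double_all:
  assumes sink: "ring_sink L1 L2" and bl: "blind_double X L1 L2"
    and X: "base_set V A X" "ring_averse A C X" and B: "base_set V A B" and H: "heights X H"
  shows "blind_double B L1 L2"
proof -
  let ?t = "c (Suc L1)"
  have L: "0 < L1" "L1 < N" "0 < L2" "L2 < N" "side A c L1" "side A c' L2" "preds A (c 0) = {c 1, c (N - 1)}"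
    using sink by (auto simp: ring_sink_def)
  have b: "L1 = L2" "L1 + L2 + 2 = N" "clean A X c L1" "clean A X c' L2"
    "preds A ?t = {c L1, c' L2}" "trail A X ?t (L1 - 1) \<noteq> {}" using bl by (auto simp: blind_double_def)
  have z: "c L1 \<noteq> c' L2" using c_eq_iff[of L1 "N - L2"] b L by auto
  have tp: "(c L1, ?t) \<in> A" "(c' L2, ?t) \<in> A" using b(5) by blast+
  have y: "c 0 \<notin> B" using sink_notin_base[OF B, of "c 1" "c 0" "c (N - 1)"] L(7) c1_neq by blast
  have tB: "?t \<notin> B" using sink_notin_base[OF B tp z] .
  interpret r: oriented_ring V A f N c' by (rule reflect(1))
  have "clean A B c L1" using clean_forced_source[OF X B L(5,1,2) b(3) tp(2)] z by simp
  moreover have "clean A B c' L2"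
  proof (rule r.clean_forced_source[OF X(1) _ B L(6,3,4) b(4)])
    have "N - Suc L2 = Suc L1" using b by linarith
    then show "(c L1, c' (Suc L2)) \<in> A" using tp(1) by simp
  qed (use X(2) z reflect_structure(1) in auto)
  moreover have "below ?t"
  proof (rule below_sink)
    show "?t \<in> sinks" using blind_double_sinks[OF sink bl] by simp
    show "preds A ?t \<subseteq> C" unfolding b(5) using L by simp
  qed
  then have "trail A B ?t (L1 - 1) \<noteq> {}"
    using heights_lower[OF H B] heights_upper[OF H _ b(6)] by blast
  ultimately show ?thesis unfolding blind_double_def using b y tB by blast
qed

section \<open>Metric bases in each configuration\<close>

lemma basis_sink:
  assumes sink: "ring_sink L1 L2" and X: "base_set V A X"
    and all: "(\<forall>B. base_set V A B \<longrightarrow> blind_single B L1 L2) \<or> (\<forall>B. base_set V A B \<longrightarrow> blind_double B L1 L2)"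
  shows "basis V A (insert (c 0) X)"
proof (rule basis_insert[OF finite_V arcs_V X])
  show "\<not> resolves V A B" if "base_set V A B" for B
    using all that blind_single_not_resolves[OF sink] blind_double_not_resolves[OF sink] by blast
  let ?S = "insert (c 0) X"
  have y: "c 0 \<in> sinks" by (rule ring_sink_in_sinks[OF sink])
  show "resolves V A ?S"
  proof (rule resolves_sinks)
    show "twin_free V A ?S" using twin_free_insert[OF base_set_twin_free[OF X]] by simp
    show "sinks \<noteq> {}" using y by blast
  next
    fix w assume w: "w \<in> sinks" "preds A w \<subseteq> C"
    show "\<exists>d L1 L2. coords d \<and> d 0 = w \<and> oriented_ring.ring_sink A N d L1 L2 \<and>
        \<not> oriented_ring.blind_single A N d ?S L1 L2 \<and> \<not> oriented_ring.blind_double A N d ?S L1 L2"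
    proof (cases "w = c 0")
      case True
      then show ?thesis using coords_self sink
        by (intro exI[of _ c] exI[of _ L1] exI[of _ L2]) (auto simp: blind_single_def blind_double_def)
    next
      case False
      obtain d M1 M2 where d: "coords d" "d 0 = w" "oriented_ring.ring_sink A N d M1 M2"
        using coords_sides_exist[OF w] by blast
      interpret d: oriented_ring V A f N d using d(1) by (simp add: coords_def)
      have dC: "d.C = C" using coords_C[OF d(1)] .
      have two: "c 0 \<noteq> d 0" "c 0 \<in> sinks" "d 0 \<in> sinks" using False d y w by auto
      have "\<not> (\<forall>B. base_set V A B \<longrightarrow> blind_single B L1 L2)"
      proof
        assume "\<forall>B. base_set V A B \<longrightarrow> blind_single B L1 L2"
        then have "sinks = {c 0}" using blind_single_sinks[OF sink, of X] X by simp
        then show False using two by auto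
      qed
      then have "blind_double X L1 L2" using all X by blast
      then have s2: "sinks = {c 0, c (Suc L1)}" by (rule blind_double_sinks[OF sink])
      then have "d 0 = c (Suc L1)" using two(1,3) by auto
      then have s: "sinks = {c 0, d 0}" using s2 by simp
      have "\<not> d.blind_single ?S M1 M2"
        using d.blind_single_sinks[OF d(3)] dC two by auto
      moreover have "\<not> d.blind_double ?S M1 M2"
      proof
        assume bd: "d.blind_double ?S M1 M2"
        then have "sinks = {d 0, d (Suc M1)}" using d.blind_double_sinks[OF d(3)] dC by simp
        \<comment> \<open>Blindness of the opposite sink would require \<open>c 0\<close> to be
          outside the set; so inserting one sink cures both.\<close>
        then have "d (Suc M1) = c 0" using s two(1) by (metis doubleton_eq_iff)
        then show False using bd by (auto simp: d.blind_double_def)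
      qed
      ultimately show ?thesis using d by blast
    qed
  qed
qed

lemma basis_single_sink:
  assumes "ring_sink L1 L2" "sinks = {c 0}" "base_set V A X" "\<not> blind_single X L1 L2"
  shows "basis V A X"
proof (rule basis_base_set[OF finite_V arcs_V assms(3)], rule resolves_sinks[OF base_set_twin_free[OF assms(3)]])
  have "\<not> blind_double X L1 L2"
  proof
    assume bd: "blind_double X L1 L2"
    then have "sinks = {c 0, c (Suc L1)}" by (rule blind_double_sinks[OF assms(1)])
    then have "c (Suc L1) = c 0" using assms(2) by auto
    then show False using bd c_eq_iff[of "Suc L1" 0] by (auto simp: blind_double_def)
  qed
  then show "\<exists>d L1 L2. coords d \<and> d 0 = w \<and> oriented_ring.ring_sink A N d L1 L2 \<and>
        \<not> oriented_ring.blind_single A N d X L1 L2 \<and> \<not> oriented_ring.blind_double A N d X L1 L2"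
    if "w \<in> sinks" for w
    using that assms coords_self by (intro exI[of _ c] exI[of _ L1] exI[of _ L2]) auto
qed (use assms in simp)

lemma basis_two_sinks:
  assumes X: "base_set V A X" and yt: "sinks = {y, t}" "y \<noteq> t"
    and ok: "\<And>w. w \<in> {y, t} \<Longrightarrow> preds A w \<subseteq> C \<Longrightarrow> \<exists>d L1 L2. coords d \<and> d 0 = w \<and>
      oriented_ring.ring_sink A N d L1 L2 \<and> \<not> oriented_ring.blind_double A N d X L1 L2"
  shows "basis V A X"
proof (rule basis_base_set[OF finite_V arcs_V X], rule resolves_sinks[OF base_set_twin_free[OF X]])
  fix w assume "w \<in> sinks" "preds A w \<subseteq> C"
  then obtain d L1 L2 where d: "coords d" "d 0 = w" "oriented_ring.ring_sink A N d L1 L2"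
    "\<not> oriented_ring.blind_double A N d X L1 L2" using ok yt by blast
  interpret d: oriented_ring V A f N d using d(1) by (simp add: coords_def)
  have "\<not> d.blind_single X L1 L2"
    using d.blind_single_sinks[OF d(3)] coords_C[OF d(1)] yt by auto
  then show "\<exists>d L1 L2. coords d \<and> d 0 = w \<and> oriented_ring.ring_sink A N d L1 L2 \<and>
        \<not> oriented_ring.blind_single A N d X L1 L2 \<and> \<not> oriented_ring.blind_double A N d X L1 L2"
    using d by blast
qed (use yt in simp)

lemma basis_entered_sink:
  assumes "base_set V A X" "sinks = {y}" "\<not> preds A y \<subseteq> C"
  shows "basis V A X"
  by (rule basis_base_set[OF finite_V arcs_V assms(1)], rule resolves_sinks[OF base_set_twin_free[OF assms(1)]])
    (use assms in auto)

lemma basis_many_sinks: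
  assumes "base_set V A X" "3 \<le> card sinks"
  shows "basis V A X"
  using basis_base_set[OF finite_V arcs_V assms(1)] resolves_many_sinks[OF base_set_twin_free[OF assms(1)] assms(2)] .

text \<open>Joins the unreachable ring to \<open>blind_cycle\<close>. A base set leaves out a sole
  successor of \<open>a\<close> as soon as there is one, so the condition on \<open>a\<close> need
  not mention \<open>X\<close>.\<close>

definition bad_cycle :: "'a set \<Rightarrow> bool" where
  "bad_cycle X \<longleftrightarrow> X \<inter> C = {} \<and> (entries A C = {} \<or> (\<exists>a. entries A C = {a} \<and> sole_succs A a \<noteq> {}))"

lemma basis_cycle:
  assumes "base_set V A X" "sinks = {}" "\<not> bad_cycle X"
  shows "basis V A X"
proof (rule basis_base_set[OF finite_V arcs_V assms(1)], rule resolves_directed[OF base_set_twin_free[OF assms(1)] assms(2)])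
  show "\<not> blind_cycle X" using assms(3) unfolding bad_cycle_def blind_cycle_def by blast
qed (use assms(3) in \<open>auto simp: bad_cycle_def\<close>)

text \<open>If \<open>X\<close> misses the ring, then every base set does: a ring vertex has two
  predecessors, or \<open>X\<close> leaves it out for want of a candidate off the ring, and then it
  is the only candidate. Thus no base set resolves.\<close>

lemma basis_bad_cycle:
  assumes X: "base_set V A X" "ring_averse A C X" and no: "sinks = {}" and bad: "bad_cycle X" and w: "w \<in> C"
  shows "basis V A (insert w X)"
proof (rule basis_insert[OF finite_V arcs_V X(1)])
  show "resolves V A (insert w X)"
    by (rule resolves_directed) (use no w C_V twin_free_insert[OF base_set_twin_free[OF X(1)]] in \<open>auto simp: blind_cycle_def\<close>)
next
  fix B assume B: "base_set V A B"
  have "u \<notin> B" if u: "u \<in> C" for u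
  proof -
    obtain d where d: "oriented_ring V A f N d" "d ` {..<N} = C" "d 0 = u" "oriented_ring.directed_ring A N d"
      using directed_coords[OF no u] by blast
    interpret d: oriented_ring V A f N d by fact
    have dC: "d.C = C" using d by (simp add: d.C_def)
    have fwd: "(d i, d (Suc i)) \<in> A" if "i < N" for i using d(4) that by (simp add: d.directed_ring_def)
    let ?p = "d (N - 1)"
    have pu: "(?p, u) \<in> A" using fwd[of "N - 1"] N_pos d.c_closed d(3) by simp
    show ?thesis
    proof (cases "preds A u = {?p}")
      case False
      then obtain q where "(q, u) \<in> A" "q \<noteq> ?p" using pu by blast
      then show ?thesis using sink_notin_base[OF B pu] by blast
    next
      case True
      then have us: "u \<in> sole_succs A ?p - X" using bad u by (auto simp: bad_cycle_def sole_succs_def)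
      then have sub: "sole_succs A ?p \<subseteq> C" using X(2) u unfolding ring_averse_def by blast
      have "v = u" if v: "v \<in> sole_succs A ?p" for v
      proof -
        have pv: "(?p, v) \<in> A" using v unfolding sole_succs_def by blast
        \<comment> \<open>The neighbours of \<open>?p\<close> on the ring are \<open>u\<close> and
          its own predecessor, so \<open>u\<close> is the only ring vertex that can be its
          successor.\<close>
        have "(d (N - 2), ?p) \<in> A" using fwd[of "N - 2"] N_ge_3 by (simp add: numeral_2_eq_2 Suc_diff_Suc)
        then have "v \<noteq> d (N - 1 - 1)" using pv arc_asym by (auto simp: numeral_2_eq_2)
        then show ?thesis using d.ring_succ[OF pv] sub v dC N_ge_3 d.c_closed d(3) by auto
      qed
      then have "sole_succs A ?p = {u}" using us by blast
      then show ?thesis using base_set_singleton[OF B] by blast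
    qed
  qed
  then have BC: "B \<inter> C = {}" by blast
  show "\<not> resolves V A B"
  proof (cases "entries A C = {}")
    case False
    then obtain a where "entries A C = {a}" "sole_succs A a \<noteq> {}" using bad by (auto simp: bad_cycle_def)
    then have "blind_cycle B" using no BC base_set_sole_nonempty[OF B] by (auto simp: blind_cycle_def)
    then show ?thesis by (rule blind_cycle_not_resolves)
  next
    case True
    show ?thesis
    proof
      assume "resolves V A B"
      then obtain x where x: "x \<in> B" "(x, w) \<in> A\<^sup>*" using w C_V unfolding resolves_def by blast
      have "x \<in> C"
      proof (rule ccontr)
        assume "x \<notin> C"
        have "w \<in> - C"
        proof (rule rtrancl_closed[OF x(2)])
          fix u v assume "(u, v) \<in> A" "u \<in> - C"
          then show "v \<in> - C" using True unfolding entries_def by blast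
        qed (use \<open>x \<notin> C\<close> in simp)
        then show False using w by simp
      qed
      then show False using BC x(1) by blast
    qed
  qed
qed

end

section \<open>Orientations of unicyclic graphs\<close>

lemma pcas_verts: "pcas u p v \<Longrightarrow> pawalk_verts u p = map fst p @ [v]"
  by (induction u p v rule: pcas.induct) auto

lemma pcas_nth: "pcas u p v \<Longrightarrow> i < length p \<Longrightarrow> p ! i = ((map fst p @ [v]) ! i, (map fst p @ [v]) ! Suc i)"
proof (induction u p v arbitrary: i rule: pcas.induct)
  case (2 u e es v)
  show ?case
  proof (cases i)
    case 0
    then show ?thesis using 2 by (cases es) auto
  next
    case (Suc j)
    then show ?thesis using 2 by simp
  qed
qed simp

text \<open>The parent map follows shortest ways to the cycle. Its edges and those of the cycle
  connect the graph, and any further edge would close a second cycle.\<close>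

lemma unicyclic_orientation_ring:
  assumes uni: "unicyclic U" and ori: "orientation U D"
  shows "pair_wf_digraph D" and "\<exists>f N c. oriented_ring (pverts D) (parcs D) f N c"
proof -
  let ?V = "pverts U" and ?E = "parcs U"
  interpret U: pair_graph U using uni by (simp add: unicyclic_def)
  have VD: "pverts D = ?V" and DE: "parcs D \<subseteq> ?E"
    and one: "\<And>u v. (u, v) \<in> ?E \<Longrightarrow> (u, v) \<in> parcs D \<longleftrightarrow> (v, u) \<notin> parcs D"
    using ori by (auto simp: orientation_def)
  show wfD: "pair_wf_digraph D"
    by unfold_locales (use VD DE U.arc_fst_in_verts U.arc_snd_in_verts in blast)+
  have sym: "(v, u) \<in> ?E" if "(u, v) \<in> ?E" for u v
    using U.sym_arcs that by (auto simp: symmetric_def sym_def)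
  \<comment> \<open>Connectedness is defined through the symmetric closure, which leaves
    \<open>U\<close> as it is.\<close>
  have mks: "mk_symmetric (with_proj U) = U"
    using sym by (cases U) (auto simp: mk_symmetric_def)
  have conn: "(u, v) \<in> ?E\<^sup>*" if "u \<in> ?V" "v \<in> ?V" for u v
  proof -
    have "strongly_connected (with_proj U)"
      using uni mks by (simp add: unicyclic_def connected_def)
    then have "u \<rightarrow>\<^sup>*\<^bsub>with_proj U\<^esub> v" using that by (simp add: strongly_connected_def)
    then show ?thesis using reachable_iff_rtrancl[OF U.pair_wf_digraph that(1)] by simp
  qed
  obtain p where p: "U.cycle p" "3 \<le> length p"
    using uni by (auto simp: unicyclic_def cycle_edge_sets_def)
  have cycle_unique: "(\<lambda>(u, v). {u, v}) ` set q = (\<lambda>(u, v). {u, v}) ` set p" if "U.cycle q" "3 \<le> length q" for q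
  proof -
    have "(\<lambda>(u, v). {u, v}) ` set q \<in> cycle_edge_sets U" "(\<lambda>(u, v). {u, v}) ` set p \<in> cycle_edge_sets U"
      using that p by (auto simp: cycle_edge_sets_def)
    moreover have "\<exists>!C. C \<in> cycle_edge_sets U" using uni by (simp add: unicyclic_def)
    ultimately show ?thesis by metis
  qed
  define N where "N = length p"
  obtain u0 where u0: "U.awalk u0 p u0" "distinct (tl (pawalk_verts u0 p))" "p \<noteq> []"
    using p(1) by (auto simp: U.cycle_def)
  then have cas: "pcas u0 p u0" "set p \<subseteq> ?E" by (auto simp: U.awalk_def)
  define c where "c i = (map fst p @ [u0]) ! i" for i
  have pn: "p ! i = (c i, c (Suc i))" if "i < N" for i
    using pcas_nth[OF cas(1)] that by (simp add: c_def N_def)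
  have cE: "(c i, c (Suc i)) \<in> ?E" if "i < N" for i
    using pn[OF that] cas(2) that nth_mem[of i p] by (auto simp: N_def)
  have hd: "fst (hd p) = u0" using cas(1) u0(3) by (cases p) auto
  have cN: "c N = c 0" using hd u0(3) by (cases p) (auto simp: c_def N_def nth_append)
  have inj: "inj_on c {..<N}"
  proof -
    have "distinct (tl (map fst p) @ [u0])"
      using u0(2,3) pcas_verts[OF cas(1)] by (simp add: tl_append2)
    then have "distinct (map fst p)" using hd u0(3) by (cases p) auto
    then show ?thesis unfolding inj_on_def by (auto simp: c_def N_def nth_append distinct_conv_nth)
  qed
  have N3: "3 \<le> N" using p(2) by (simp add: N_def)
  define C where "C = c ` {..<N}"
  have CV: "C \<subseteq> ?V" using cE U.in_arcsD1 by (auto simp: C_def)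
  \<comment> \<open>The distance to the cycle; \<open>f\<close> decreases it, so iterating
    \<open>f\<close> ends on the ring.\<close>
  define r where "r v = (LEAST k. \<exists>w\<in>C. (v, w) \<in> ?E ^^ k)" for v
  have "c 0 \<in> C" using N3 by (auto simp: C_def)
  have r: "\<exists>w\<in>C. (v, w) \<in> ?E ^^ r v" if "v \<in> ?V" for v
  proof -
    have "(v, c 0) \<in> ?E\<^sup>*" using conn that \<open>c 0 \<in> C\<close> CV by blast
    then obtain k where "(v, c 0) \<in> ?E ^^ k" by (metis rtrancl_imp_relpow)
    then have "\<exists>w\<in>C. (v, w) \<in> ?E ^^ k" using \<open>c 0 \<in> C\<close> by blast
    then show ?thesis unfolding r_def by (rule LeastI)
  qed
  have nearer: "\<exists>w. (v, w) \<in> ?E \<and> r w < r v" if v: "v \<in> ?V - C" for v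
  proof -
    obtain w where w: "w \<in> C" "(v, w) \<in> ?E ^^ r v" using r v by blast
    then have "r v \<noteq> 0" using v by (metis DiffD2 relpow_0_E)
    then obtain k where k: "r v = Suc k" by (cases "r v") auto
    then obtain x where x: "(v, x) \<in> ?E" "(x, w) \<in> ?E ^^ k" using w(2) by (metis relpow_Suc_E2)
    have "r x \<le> k" unfolding r_def by (rule Least_le) (use w x in blast)
    then show ?thesis using x(1) k by auto
  qed
  define f where "f v = (SOME w. (v, w) \<in> ?E \<and> r w < r v)" for v
  have f: "(v, f v) \<in> ?E \<and> r (f v) < r v" if "v \<in> ?V - C" for v
    unfolding f_def by (rule someI_ex[OF nearer[OF that]])
  have root: "\<exists>k. (f ^^ k) v \<in> C" if "v \<in> ?V" for v
    using that
  proof (induction "r v" arbitrary: v rule: less_induct)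
    case less
    show ?case
    proof (cases "v \<in> C")
      case True
      then show ?thesis by (intro exI[of _ 0]) simp
    next
      case False
      then have fv: "(v, f v) \<in> ?E" "r (f v) < r v" using f less.prems by auto
      then obtain k where "(f ^^ k) (f v) \<in> C" using less.hyps U.in_arcsD2 by blast
      then show ?thesis by (intro exI[of _ "Suc k"]) (simp add: funpow_swap1)
    qed
  qed
  define R where "R = (\<lambda>i. (c i, c (Suc i))) ` {..<N}"
  define T where "T = (\<lambda>v. (v, f v)) ` (?V - C)"
  define H where "H = R \<union> R\<inverse> \<union> T \<union> T\<inverse>"
  have HE: "H \<subseteq> ?E" using cE f sym by (auto simp: H_def R_def T_def)
  have Hsym: "H\<inverse> = H" by (auto simp: H_def)
  have Hroot: "(v, c 0) \<in> H\<^sup>*" if "v \<in> ?V" for v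
    using that
  proof (induction "r v" arbitrary: v rule: less_induct)
    case less
    show ?case
    proof (cases "v \<in> C")
      case True
      have "(c i, c 0) \<in> H\<^sup>*" if "i < N" for i
        using that
      proof (induction i)
        case (Suc i)
        then have "(c (Suc i), c i) \<in> H" by (auto simp: H_def R_def)
        then show ?case using Suc by (meson Suc_lessD converse_rtrancl_into_rtrancl)
      qed simp
      then show ?thesis using True by (auto simp: C_def)
    next
      case False
      then have fv: "(v, f v) \<in> ?E" "r (f v) < r v" using f less.prems by auto
      moreover have "(v, f v) \<in> H" using False less.prems by (auto simp: H_def T_def)
      ultimately show ?thesis using less.hyps U.in_arcsD2 by (meson converse_rtrancl_into_rtrancl)
    qed
  qed
  have Hconn: "(a, b) \<in> H\<^sup>*" if "a \<in> ?V" "b \<in> ?V" for a b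
  proof -
    have "(c 0, b) \<in> (H\<inverse>)\<^sup>*" using Hroot[OF that(2)] by (simp add: rtrancl_converse)
    then show ?thesis using Hroot[OF that(1)] Hsym by (metis rtrancl_trans)
  qed
  have all: "(a, b) \<in> H" if ab: "(a, b) \<in> ?E" for a b
  proof (rule ccontr)
    assume nH: "(a, b) \<notin> H"
    have abV: "a \<in> ?V" "b \<in> ?V" using ab U.in_arcsD1 U.in_arcsD2 by blast+
    let ?H = "\<lparr>pverts = ?V, parcs = H\<rparr>"
    have "fst e \<in> ?V" "snd e \<in> ?V" if "e \<in> H" for e
      using that HE U.arc_fst_in_verts U.arc_snd_in_verts by blast+
    then interpret H: pair_wf_digraph ?H
      by unfold_locales simp_all
    have "a \<rightarrow>\<^sup>*\<^bsub>with_proj ?H\<^esub> b"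
      using reachable_iff_rtrancl[OF H.pair_wf_digraph_axioms, of a b] Hconn[OF abV] abV by simp
    then obtain q where q: "H.apath a q b" using H.reachable_apath by blast
    then have qH: "set q \<subseteq> H" "pcas a q b" "distinct (pawalk_verts a q)"
      by (auto simp: H.apath_def H.awalk_def)
    have "a \<noteq> b" using ab U.no_loops' by blast
    then have "q \<noteq> []" using qH(2) by (cases q) auto
    moreover have "length q \<noteq> 1"
    proof
      assume "length q = 1"
      then obtain e where "q = [e]" by (metis One_nat_def length_0_conv length_Suc_conv)
      then have "e = (a, b)" using qH(2) by (cases e) auto
      then show False using nH qH(1) \<open>q = [e]\<close> by simp
    qed
    \<comment> \<open>The path \<open>q\<close> inside \<open>H\<close> has at least two arcs
      because \<open>(a, b)\<close> is not in \<open>H\<close>. The closed walk is therefore long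
      enough to count as a cycle.\<close>
    ultimately have len: "3 \<le> length ((b, a) # q)" by (cases q) (auto simp: Suc_le_eq)
    have "U.cycle ((b, a) # q)"
      unfolding U.cycle_def using qH HE abV sym[OF ab]
      by (intro exI[of _ b]) (auto simp: U.awalk_def)
    then have "(\<lambda>(u, v). {u, v}) ` set ((b, a) # q) = (\<lambda>(u, v). {u, v}) ` set p"
      using cycle_unique len by blast
    then have "{b, a} \<in> (\<lambda>(u, v). {u, v}) ` set p" by auto
    then obtain x y where xy: "(x, y) \<in> set p" "{b, a} = {x, y}" by auto
    then obtain i where "i < N" "(x, y) = (c i, c (Suc i))" using pn by (metis N_def in_set_conv_nth)
    then have "(x, y) \<in> R" by (auto simp: R_def)
    then have "(a, b) \<in> H" using xy(2) by (auto simp: H_def doubleton_eq_iff)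
    then show False using nH by blast
  qed
  have "oriented_ring (pverts D) (parcs D) f N c"
  proof
    show "finite (pverts D)" using VD by simp
    show "parcs D \<subseteq> pverts D \<times> pverts D"
      using wfD unfolding pair_wf_digraph_def by (auto simp: mem_Times_iff)
    show "3 \<le> N" "inj_on c {..<N}" "c N = c 0" by fact+
    show "c ` {..<N} \<subseteq> pverts D" using CV VD by (simp add: C_def)
    show "((c i, c (Suc i)) \<in> parcs D) \<longleftrightarrow> (c (Suc i), c i) \<notin> parcs D" if "i < N" for i
      using one cE[OF that] .
    show "f v \<in> pverts D" if "v \<in> pverts D - c ` {..<N}" for v
      using f[of v] that VD U.in_arcsD2[of v "f v"] by (auto simp: C_def)
    show "((v, f v) \<in> parcs D) \<longleftrightarrow> (f v, v) \<notin> parcs D" if "v \<in> pverts D - c ` {..<N}" for v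
      using one[of v "f v"] f[of v] that VD by (auto simp: C_def)
    show "\<exists>k. (f ^^ k) v \<in> c ` {..<N}" if "v \<in> pverts D" for v
      using root[of v] that VD by (simp add: C_def)
    fix u v assume "(u, v) \<in> parcs D"
    then have "(u, v) \<in> H" using all DE by blast
    then show "(u \<notin> c ` {..<N} \<and> v = f u) \<or> (v \<notin> c ` {..<N} \<and> u = f v) \<or>
      (\<exists>i<N. u = c i \<and> v = c (Suc i) \<or> u = c (Suc i) \<and> v = c i)"
      unfolding H_def R_def T_def C_def by auto
  qed
  then show "\<exists>f N c. oriented_ring (pverts D) (parcs D) f N c" by blast
qed

section \<open>Reasoning about programs\<close>

abbreviation mem :: "(string \<Rightarrow> nat) \<Rightarrow> (string \<Rightarrow> nat \<Rightarrow> nat) \<Rightarrow> memory" where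
  "mem r a \<equiv> \<lparr>reg = r, arr = a\<rparr>"

definition runs :: "nat \<Rightarrow> com \<Rightarrow> (string \<Rightarrow> nat) \<Rightarrow> (string \<Rightarrow> nat \<Rightarrow> nat) \<Rightarrow> nat \<Rightarrow>
    ((string \<Rightarrow> nat) \<Rightarrow> (string \<Rightarrow> nat \<Rightarrow> nat) \<Rightarrow> bool) \<Rightarrow> bool" where
  "runs W c r a T Q \<longleftrightarrow> (\<exists>t r' a'. exec W c (mem r a) t (mem r' a') \<and> t \<le> T \<and> Q r' a')"

text \<open>Weakest preconditions and time bounds of programs without loops.\<close>

primrec wp :: "nat \<Rightarrow> com \<Rightarrow> ((string \<Rightarrow> nat) \<Rightarrow> (string \<Rightarrow> nat \<Rightarrow> nat) \<Rightarrow> bool) \<Rightarrow>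
    (string \<Rightarrow> nat) \<Rightarrow> (string \<Rightarrow> nat \<Rightarrow> nat) \<Rightarrow> bool" where
  "wp W Skip Q r a \<longleftrightarrow> Q r a"
| "wp W (Assign x e) Q r a \<longleftrightarrow> fits W (mem r a) e \<and> Q (r(x := val (mem r a) e)) a"
| "wp W (Write b i e) Q r a \<longleftrightarrow> fits W (mem r a) i \<and> fits W (mem r a) e \<and>
     Q r (a(b := (a b)(val (mem r a) i := val (mem r a) e)))"
| "wp W (Seq c d) Q r a \<longleftrightarrow> wp W c (wp W d Q) r a"
| "wp W (Branch b c d) Q r a \<longleftrightarrow> cond_fits W (mem r a) b \<and>
     (holds (mem r a) b \<longrightarrow> wp W c Q r a) \<and> (\<not> holds (mem r a) b \<longrightarrow> wp W d Q r a)"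
| "wp W (While b c) Q r a \<longleftrightarrow> False"

primrec tm :: "com \<Rightarrow> nat" where
  "tm Skip = 1"
| "tm (Assign x e) = 1 + cost e"
| "tm (Write b i e) = 1 + cost i + cost e"
| "tm (Seq c d) = tm c + tm d"
| "tm (Branch b c d) = 1 + cond_cost b + tm c + tm d"
| "tm (While b c) = 0"

lemma runsI: "exec W c (mem r a) t (mem r' a') \<Longrightarrow> t \<le> T \<Longrightarrow> Q r' a' \<Longrightarrow> runs W c r a T Q"
  unfolding runs_def by blast

lemma runs_mono:
  "runs W c r a T Q \<Longrightarrow> T \<le> T' \<Longrightarrow> (\<And>r' a'. Q r' a' \<Longrightarrow> Q' r' a') \<Longrightarrow> runs W c r a T' Q'"
  unfolding runs_def by (meson order_trans)

lemma runs_Seq: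
  assumes "runs W c r a T R" "\<And>r' a'. R r' a' \<Longrightarrow> runs W d r' a' T' Q"
  shows "runs W (Seq c d) r a (T + T') Q"
proof -
  obtain t r' a' where c: "exec W c (mem r a) t (mem r' a')" "t \<le> T" "R r' a'"
    using assms(1) by (auto simp: runs_def)
  obtain t' r'' a'' where d: "exec W d (mem r' a') t' (mem r'' a'')" "t' \<le> T'" "Q r'' a''"
    using assms(2)[OF c(3)] by (auto simp: runs_def)
  show ?thesis by (rule runsI[where Q = Q, OF exec.Seq[OF c(1) d(1)] add_mono[OF c(2) d(2)] d(3)])
qed

lemma runs_Branch:
  assumes "cond_fits W (mem r a) b"
    "holds (mem r a) b \<Longrightarrow> runs W c r a T Q" "\<not> holds (mem r a) b \<Longrightarrow> runs W d r a T' Q"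
  shows "runs W (Branch b c d) r a (1 + cond_cost b + T + T') Q"
proof (cases "holds (mem r a) b")
  case True
  then obtain t r' a' where c: "exec W c (mem r a) t (mem r' a')" "t \<le> T" "Q r' a'"
    using assms(2) by (auto simp: runs_def)
  show ?thesis
    by (rule runsI[where Q = Q, OF exec.BranchTrue[OF assms(1) True c(1)] _ c(3)]) (use c in simp)
next
  case False
  then obtain t r' a' where c: "exec W d (mem r a) t (mem r' a')" "t \<le> T'" "Q r' a'"
    using assms(3) by (auto simp: runs_def)
  show ?thesis
    by (rule runsI[where Q = Q, OF exec.BranchFalse[OF assms(1) False c(1)] _ c(3)]) (use c in simp)
qed

lemma exec_Assign_mem:
  "fits W (mem r a) e \<Longrightarrow> exec W (Assign x e) (mem r a) (1 + cost e) (mem (r(x := val (mem r a) e)) a)"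
  using exec.Assign[of W "mem r a" e x] by simp

lemma exec_Write_mem:
  "fits W (mem r a) i \<Longrightarrow> fits W (mem r a) e \<Longrightarrow> exec W (Write b i e) (mem r a) (1 + cost i + cost e)
     (mem r (a(b := (a b)(val (mem r a) i := val (mem r a) e))))"
  using exec.Write[of W "mem r a" i e b] by simp

text \<open>\<open>tm\<close> charges both branches of a \<open>Branch\<close>, so the bound depends
  on the program alone.\<close>

lemma wp_runs: "wp W c Q r a \<Longrightarrow> runs W c r a (tm c) Q"
proof (induction c arbitrary: r a Q)
  case (Seq c d)
  then have "runs W c r a (tm c) (wp W d Q)" by simp
  then show ?case using runs_Seq Seq.IH(2) by fastforce
next
  case (Branch b c d)
  then show ?case using runs_Branch[of W r a b c "tm c" Q d "tm d"] by simp
next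
  case Skip
  then show ?case by (intro runsI[where Q = Q, OF exec.Skip]) simp_all
next
  case (Assign x e)
  then show ?case by (intro runsI[where Q = Q, OF exec_Assign_mem]) simp_all
next
  case (Write b i e)
  then show ?case by (intro runsI[where Q = Q, OF exec_Write_mem]) simp_all
qed simp

lemma wp_mono: "wp W c Q r a \<Longrightarrow> (\<And>r' a'. Q r' a' \<Longrightarrow> Q' r' a') \<Longrightarrow> wp W c Q' r a"
proof (induction c arbitrary: Q Q' r a)
  case (Seq c d)
  have "wp W c (wp W d Q) r a" using Seq.prems(1) by simp
  then have "wp W c (wp W d Q') r a" by (rule Seq.IH(1)) (rule Seq.IH(2), assumption, rule Seq.prems(2))
  then show ?case by simp
next
  case (Branch b c d)
  then show ?case unfolding wp.simps by blast
qed simp_all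

text \<open>\<open>wp\<close> fails on loops, so the body is loop-free and a pass costs at most
  \<open>tm c\<close>. The measure bounds the number of passes, and \<open>Suc\<close> pays for the
  failing test.\<close>

lemma runs_While:
  assumes inv: "I r a"
    and fit: "\<And>r a. I r a \<Longrightarrow> cond_fits W (mem r a) b"
    and body: "\<And>r a. I r a \<Longrightarrow> holds (mem r a) b \<Longrightarrow> wp W c (\<lambda>r' a'. I r' a' \<and> \<mu> r' a' < \<mu> r a) r a"
  shows "runs W (While b c) r a ((tm c + cond_cost b + 1) * Suc (\<mu> r a)) (\<lambda>r' a'. I r' a' \<and> \<not> holds (mem r' a') b)"
  using inv
proof (induction "\<mu> r a" arbitrary: r a rule: less_induct)
  case less
  note f = fit[OF less.prems]
  show ?case
  proof (cases "holds (mem r a) b")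
    case True
    obtain t r' a' where c: "exec W c (mem r a) t (mem r' a')" "t \<le> tm c" "I r' a'" "\<mu> r' a' < \<mu> r a"
      using wp_runs[OF body[OF less.prems True]] by (auto simp: runs_def)
    obtain t' r'' a'' where w: "exec W (While b c) (mem r' a') t' (mem r'' a'')"
      "t' \<le> (tm c + cond_cost b + 1) * Suc (\<mu> r' a')" "I r'' a'' \<and> \<not> holds (mem r'' a'') b"
      using less.hyps[OF c(4,3)] by (auto simp: runs_def)
    have "1 + cond_cost b + t + t' \<le> (tm c + cond_cost b + 1) * 1 + (tm c + cond_cost b + 1) * Suc (\<mu> r' a')"
      using c(2) w(2) by simp
    also have "\<dots> = (tm c + cond_cost b + 1) * (1 + Suc (\<mu> r' a'))" by (simp only: distrib_left)
    also have "\<dots> \<le> (tm c + cond_cost b + 1) * Suc (\<mu> r a)" using c(4) by (intro mult_le_mono2) simp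
    finally show ?thesis
      using runsI[OF exec.WhileTrue[OF f True c(1) w(1)], where Q = "\<lambda>r' a'. I r' a' \<and> \<not> holds (mem r' a') b"] w(3)
      by blast
  next
    case False
    show ?thesis
      using runsI[OF exec.WhileFalse[OF f False], where Q = "\<lambda>r' a'. I r' a' \<and> \<not> holds (mem r' a') b"] less.prems False
      by simp
  qed
qed

definition For :: "string \<Rightarrow> string \<Rightarrow> com \<Rightarrow> com" where
  "For x y c = Seq (Assign x (Num 0))
     (While (Less (Reg x) (Reg y)) (Seq c (Assign x (Plus (Reg x) (Num 1)))))"

text \<open>The \<open>10\<close> consists of \<open>4\<close> for the increment, \<open>3\<close>
  for the comparison, \<open>1\<close> for the loop itself and \<open>2\<close> for the
  initialization.\<close>

lemma runs_For:
  assumes K: "r y = K" "x \<noteq> y" "K < W"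
    and init: "I 0 (r(x := 0)) a"
    and body: "\<And>k r a. k < K \<Longrightarrow> r x = k \<Longrightarrow> r y = K \<Longrightarrow> I k r a \<Longrightarrow>
      wp W c (\<lambda>r' a'. r' x = k \<and> r' y = K \<and> I (Suc k) (r'(x := Suc k)) a') r a"
  shows "runs W (For x y c) r a ((tm c + 10) * Suc K) (\<lambda>r' a'. I K r' a' \<and> r' x = K)"
proof -
  let ?c = "Seq c (Assign x (Plus (Reg x) (Num 1)))"
  let ?b = "Less (Reg x) (Reg y)"
  let ?I = "\<lambda>r a. r y = K \<and> r x \<le> K \<and> I (r x) r a"
  have "runs W (While ?b ?c) (r(x := 0)) a ((tm ?c + cond_cost ?b + 1) * Suc (K - (r(x := 0)) x))
      (\<lambda>r' a'. ?I r' a' \<and> \<not> holds (mem r' a') ?b)"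
  proof (rule runs_While[where \<mu> = "\<lambda>r a. K - r x" and I = ?I])
    show "?I (r(x := 0)) a" using K init by simp
  next
    fix r a assume "?I r a"
    then show "cond_fits W (mem r a) ?b" using K by auto
  next
    fix r a assume I: "?I r a" and h: "holds (mem r a) ?b"
    then have "wp W c (\<lambda>r' a'. r' x = r x \<and> r' y = K \<and> I (Suc (r x)) (r'(x := Suc (r x))) a') r a"
      using body[of "r x" r a] by simp
    then show "wp W ?c (\<lambda>r' a'. ?I r' a' \<and> K - r' x < K - r x) r a"
      unfolding wp.simps by (rule wp_mono) (use I h K in auto)
  qed
  then have loop: "runs W (While ?b ?c) (r(x := 0)) a ((tm ?c + cond_cost ?b + 1) * Suc K)
      (\<lambda>r' a'. ?I r' a' \<and> \<not> holds (mem r' a') ?b)"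
    by (simp only: fun_upd_same minus_nat.diff_0)
  have "exec W (Assign x (Num 0)) (mem r a) 2 (mem (r(x := 0)) a)"
    using exec_Assign_mem[of W r a "Num 0" x] by (simp add: numeral_2_eq_2)
  then have "runs W (Assign x (Num 0)) r a 2 (\<lambda>r' a'. r' = r(x := 0) \<and> a' = a)"
    by (rule runsI) simp_all
  then have "runs W (For x y c) r a (2 + (tm ?c + cond_cost ?b + 1) * Suc K)
      (\<lambda>r' a'. ?I r' a' \<and> \<not> holds (mem r' a') ?b)"
    unfolding For_def by (rule runs_Seq) (elim conjE, hypsubst, rule loop)
  then show ?thesis
    by (rule runs_mono) (auto simp: algebra_simps)
qed

definition Eq :: "expr \<Rightarrow> expr \<Rightarrow> cond" where
  "Eq e e' = Conj (Neg (Less e e')) (Neg (Less e' e))"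

lemma Eq_simps [simp]:
  "holds s (Eq e e') \<longleftrightarrow> val s e = val s e'"
  "cond_fits W s (Eq e e') \<longleftrightarrow> fits W s e \<and> fits W s e'"
  by (auto simp: Eq_def)

text \<open>Frame conditions: which registers or arrays a program may change.\<close>

definition eq_off :: "'x set \<Rightarrow> ('x \<Rightarrow> 'y) \<Rightarrow> ('x \<Rightarrow> 'y) \<Rightarrow> bool" where
  "eq_off X g h \<longleftrightarrow> (\<forall>x. x \<notin> X \<longrightarrow> h x = g x)"

lemma eq_off_refl [simp]: "eq_off X g g" by (simp add: eq_off_def)

lemma eq_off_upd [simp]: "x \<in> X \<Longrightarrow> eq_off X g (h(x := v)) \<longleftrightarrow> eq_off X g h"
  by (auto simp: eq_off_def)

lemma eq_offD: "eq_off X g h \<Longrightarrow> x \<notin> X \<Longrightarrow> h x = g x" by (simp add: eq_off_def)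

fun block :: "com list \<Rightarrow> com" where
  "block [] = Skip"
| "block (c # cs) = Seq c (block cs)"

abbreviation cell :: "string \<Rightarrow> string \<Rightarrow> expr" where "cell b x \<equiv> Read b (Reg x)"

abbreviation one :: expr where "one \<equiv> Num (Suc 0)"

section \<open>Finding the ring\<close>

definition nbrs :: "('a \<times> 'a) set \<Rightarrow> 'a \<Rightarrow> 'a set" where
  "nbrs B v = {u. (u, v) \<in> B \<or> (v, u) \<in> B}"

text \<open>One conditional subtraction reduces modulo \<open>n\<close>, the argument always being
  below \<open>2 * n\<close>.\<close>

definition reduce :: com where
  "reduce = Branch (Less (Reg ''x'') (Reg ''n'')) Skip (Assign ''x'' (Minus (Reg ''x'') (Reg ''n'')))"

text \<open>\<open>D\<close> counts the neighbours and \<open>M\<close> holds their sum modulo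
  \<open>n\<close>, which keeps it within a word; \<open>G\<close> counts the predecessors and
  \<open>P\<close> remembers the last one, which is all that matters when there is just one.\<close>

definition scan_arc :: com where
  "scan_arc = block [
     Assign ''u'' (cell ''tail'' ''i''), Assign ''v'' (cell ''head'' ''i''),
     Write ''D'' (Reg ''u'') (Plus (cell ''D'' ''u'') one),
     Write ''D'' (Reg ''v'') (Plus (cell ''D'' ''v'') one),
     Assign ''x'' (Plus (cell ''M'' ''u'') (Reg ''v'')), reduce, Write ''M'' (Reg ''u'') (Reg ''x''),
     Assign ''x'' (Plus (cell ''M'' ''v'') (Reg ''u'')), reduce, Write ''M'' (Reg ''v'') (Reg ''x''),
     Write ''G'' (Reg ''v'') (Plus (cell ''G'' ''v'') one),
     Write ''P'' (Reg ''v'') (Reg ''u'')]"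

text \<open>Here and below the vertices of degree one are stored in the array \<open>O\<close>, a queue of length \<open>r\<close>.\<close>

definition init_queue :: com where
  "init_queue = Branch (Eq (cell ''D'' ''v'') one)
     (block [Write ''O'' (Reg ''r'') (Reg ''v''), Assign ''r'' (Plus (Reg ''r'') one)]) Skip"

text \<open>A leaf \<open>v\<close> has just one neighbour left, which the sum modulo \<open>n\<close> of these neighbours reveals.\<close>

definition peel :: com where
  "peel = block [
     Assign ''v'' (cell ''O'' ''i''), Assign ''p'' (cell ''M'' ''v''),
     Write ''D'' (Reg ''v'') (Num 0),
     Write ''D'' (Reg ''p'') (Minus (cell ''D'' ''p'') one),
     Assign ''x'' (Minus (Plus (cell ''M'' ''p'') (Reg ''n'')) (Reg ''v'')), reduce,
     Write ''M'' (Reg ''p'') (Reg ''x''),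
     Branch (Eq (cell ''D'' ''p'') one)
       (block [Write ''O'' (Reg ''r'') (Reg ''p''), Assign ''r'' (Plus (Reg ''r'') one)]) Skip,
     Assign ''i'' (Plus (Reg ''i'') one)]"

definition find_ring :: com where
  "find_ring = block [For ''i'' ''m'' scan_arc, For ''v'' ''n'' init_queue,
     Assign ''i'' (Num 0), While (Less (Reg ''i'') (Reg ''r'')) peel]"

lemma wp_reduce [simp]:
  assumes "r ''x'' < 2 * r ''n''" "2 * r ''n'' \<le> W"
  shows "wp W reduce Q r a \<longleftrightarrow> Q (r(''x'' := r ''x'' mod r ''n'')) a"
proof (cases "r ''x'' < r ''n''")
  case True
  then have "r(''x'' := r ''x'' mod r ''n'') = r" by auto
  then show ?thesis using True assms by (simp add: reduce_def)
next
  case False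
  then have "r ''x'' mod r ''n'' = r ''x'' - r ''n''" using assms(1) by (simp add: le_mod_geq)
  then show ?thesis using False assms by (simp add: reduce_def)
qed

lemma nbrs_insert:
  "u \<noteq> v \<Longrightarrow> nbrs (insert (u, v) B) w =
     (if w = u then insert v (nbrs B w) else if w = v then insert u (nbrs B w) else nbrs B w)"
  by (auto simp: nbrs_def)

lemma preds_insert: "preds (insert (u, v) B) w = (if w = v then insert u (preds B w) else preds B w)"
  by auto

text \<open>The word size leaves generous room for vertices, counters of arcs and sums such as
  \<open>M p + n\<close>; mostly it is used through \<open>le_W\<close>.\<close>

locale ring_input = oriented_ring V A f N c
  for V :: "nat set" and A :: "(nat \<times> nat) set" and f :: "nat \<Rightarrow> nat" and N :: nat and c :: "nat \<Rightarrow> nat" +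
  fixes n W :: nat and as :: "(nat \<times> nat) list"
  assumes V: "V = {..<n}" and distinct_as: "distinct as" and set_as: "set as = A"
    and W: "10 * (n + length as) \<le> W"
begin

lemma n_ge_3: "3 \<le> n"
proof -
  have "card (c ` {..<N}) \<le> card V" using c_V finite_V by (rule card_mono[rotated])
  then show ?thesis using N_ge_3 card_image[OF c_inj] V by simp
qed

lemma n_less_W: "n < W" and m_less_W: "length as < W" and le_W: "k \<le> 2 * n + 3 \<Longrightarrow> k \<le> W"
  using W n_ge_3 unfolding distrib_left by simp_all

lemma arc_less: "(u, v) \<in> A \<Longrightarrow> u < n" "(u, v) \<in> A \<Longrightarrow> v < n"
  using arcs_V V by auto

definition inp :: "(string \<Rightarrow> nat) \<Rightarrow> (string \<Rightarrow> nat \<Rightarrow> nat) \<Rightarrow> bool" where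
  "inp r a \<longleftrightarrow> r ''n'' = n \<and> r ''m'' = length as \<and>
     (\<forall>i<length as. a ''tail'' i = fst (as ! i)) \<and> (\<forall>i<length as. a ''head'' i = snd (as ! i))"

lemma inp_reg [simp]: "x \<noteq> ''n'' \<Longrightarrow> x \<noteq> ''m'' \<Longrightarrow> inp (r(x := k)) a = inp r a"
  by (simp add: inp_def)

lemma inp_arr [simp]: "b \<noteq> ''tail'' \<Longrightarrow> b \<noteq> ''head'' \<Longrightarrow> inp r (a(b := h)) = inp r a"
  by (simp add: inp_def)

definition scanned :: "(nat \<times> nat) set \<Rightarrow> (string \<Rightarrow> nat \<Rightarrow> nat) \<Rightarrow> bool" where
  "scanned B a \<longleftrightarrow> (\<forall>v<n. a ''D'' v = card (nbrs B v) \<and> a ''M'' v = \<Sum>(nbrs B v) mod n \<and>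
     a ''G'' v = card (preds B v) \<and> (preds B v \<noteq> {} \<longrightarrow> a ''P'' v \<in> preds B v))"

lemma nbrs_bound: assumes "B \<subseteq> A" shows "nbrs B v \<subseteq> {..<n}" "card (nbrs B v) \<le> n" "finite (nbrs B v)"
proof -
  show 1: "nbrs B v \<subseteq> {..<n}" using assms arc_less by (auto simp: nbrs_def)
  then show "finite (nbrs B v)" by (rule finite_subset) simp
  show "card (nbrs B v) \<le> n" using card_mono[OF _ 1] by simp
qed

lemma preds_bound: assumes "B \<subseteq> A" shows "preds B v \<subseteq> {..<n}" "card (preds B v) \<le> n" "finite (preds B v)"
proof -
  show 1: "preds B v \<subseteq> {..<n}" using assms arc_less by auto
  then show "finite (preds B v)" by (rule finite_subset) simp
  show "card (preds B v) \<le> n" using card_mono[OF _ 1] by simp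
qed

lemma scanned_insert:
  assumes s: "scanned B a" and B: "B \<subseteq> A" "(u, v) \<in> A - B"
    and a': "a' ''D'' = (a ''D'')(u := Suc (a ''D'' u), v := Suc (a ''D'' v))"
      "a' ''M'' = (a ''M'')(u := (a ''M'' u + v) mod n, v := (a ''M'' v + u) mod n)"
      "a' ''G'' = (a ''G'')(v := Suc (a ''G'' v))" "a' ''P'' = (a ''P'')(v := u)"
  shows "scanned (insert (u, v) B) a'"
proof -
  have uv: "u < n" "v < n" "u \<noteq> v" "(v, u) \<notin> B" "(u, v) \<notin> B"
    using B arc_less arc_irrefl arc_asym by auto
  \<comment> \<open>An orientation has no opposite arcs, so each scanned arc contributes a new
    neighbour on both ends.\<close>
  then have nb: "u \<notin> nbrs B v" "v \<notin> nbrs B u" by (auto simp: nbrs_def)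
  show ?thesis
    unfolding scanned_def
  proof (intro allI impI)
    fix w assume w: "w < n"
    note sw = s[unfolded scanned_def, rule_format, OF w]
    have "a' ''D'' w = card (nbrs (insert (u, v) B) w)"
      using sw nb uv nbrs_bound(3)[OF B(1)] by (auto simp: a'(1) nbrs_insert)
    moreover have "a' ''M'' w = \<Sum>(nbrs (insert (u, v) B) w) mod n"
      using sw nb uv nbrs_bound(3)[OF B(1)] by (auto simp: a'(2) nbrs_insert mod_simps add.commute)
    moreover have "a' ''G'' w = card (preds (insert (u, v) B) w)"
      unfolding preds_insert using sw uv preds_bound(3)[OF B(1), of v] by (auto simp: a'(3))
    moreover have "preds (insert (u, v) B) w \<noteq> {} \<longrightarrow> a' ''P'' w \<in> preds (insert (u, v) B) w"
      unfolding preds_insert using sw by (simp add: a'(4))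
    ultimately show "a' ''D'' w = card (nbrs (insert (u, v) B) w) \<and> a' ''M'' w = \<Sum>(nbrs (insert (u, v) B) w) mod n \<and>
      a' ''G'' w = card (preds (insert (u, v) B) w) \<and>
      (preds (insert (u, v) B) w \<noteq> {} \<longrightarrow> a' ''P'' w \<in> preds (insert (u, v) B) w)" by blast
  qed
qed

lemma runs_scan:
  assumes inp: "inp r0 a0" and zero: "\<And>v. a0 ''D'' v = 0" "\<And>v. a0 ''M'' v = 0" "\<And>v. a0 ''G'' v = 0"
  shows "runs W (For ''i'' ''m'' scan_arc) r0 a0 ((tm scan_arc + 10) * Suc (length as))
    (\<lambda>r a. inp r a \<and> scanned A a \<and> eq_off {''D'', ''M'', ''G'', ''P''} a0 a \<and> eq_off {''i'', ''u'', ''v'', ''x''} r0 r)"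
proof -
  let ?J = "\<lambda>r a. inp r a \<and> eq_off {''D'', ''M'', ''G'', ''P''} a0 a \<and> eq_off {''i'', ''u'', ''v'', ''x''} r0 r"
  let ?I = "\<lambda>k r a. ?J r a \<and> scanned (set (take k as)) a"
  have "runs W (For ''i'' ''m'' scan_arc) r0 a0 ((tm scan_arc + 10) * Suc (length as))
    (\<lambda>r a. ?I (length as) r a \<and> r ''i'' = length as)"
  proof (rule runs_For[where I = ?I])
    show "r0 ''m'' = length as" using inp by (simp add: inp_def)
    show "length as < W" by (rule m_less_W)
    show "?I 0 (r0(''i'' := 0)) a0" using inp zero by (simp add: scanned_def nbrs_def)
  next
    fix k r a assume k: "k < length as" and i: "r ''i'' = k" and m: "r ''m'' = length as" and I: "?I k r a"
    obtain u v where uv: "as ! k = (u, v)" by (cases "as ! k")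
    let ?B = "set (take k as)"
    have B: "?B \<subseteq> A" using set_as set_take_subset by metis
    have "(u, v) \<in> A" using set_as k uv by (metis nth_mem)
    moreover have "(u, v) \<notin> ?B"
    proof
      assume "(u, v) \<in> ?B"
      then obtain j where "j < k" "as ! j = as ! k" using k uv by (auto simp: in_set_conv_nth)
      then show False using distinct_as k by (simp add: nth_eq_iff_index_eq)
    qed
    ultimately have uvA: "(u, v) \<in> A - ?B" by simp
    have lt: "u < n" "v < n" "u \<noteq> v" using uvA arc_less arc_irrefl by auto
    have rd: "a ''tail'' k = u" "a ''head'' k = v" using I k uv by (auto simp: inp_def)
    have n: "r ''n'' = n" using I by (simp add: inp_def)
    have sc: "scanned ?B a" using I by simp
    have bounds: "a ''D'' w \<le> n" "a ''M'' w < n" "a ''G'' w \<le> n" if "w < n" for w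
      using sc that nbrs_bound(2)[OF B, of w] preds_bound(2)[OF B, of w] n_ge_3 by (auto simp: scanned_def)
    have ins: "set (take (Suc k) as) = insert (u, v) ?B" using k uv by (simp add: take_Suc_conv_app_nth)
    have Wb: "x \<le> W" if "x \<le> 2 * n + 3" for x using that by (rule le_W)
    have b2: "a ''D'' u \<le> n" "a ''D'' v \<le> n" "a ''M'' u < n" "a ''M'' v < n" "a ''G'' v \<le> n" using bounds lt by auto
    have kW: "k \<le> W" using k m_less_W by linarith
    have mW: "x mod n \<le> W" for x using n_less_W n_ge_3 mod_less_divisor[of n x] by linarith
    show "wp W scan_arc (\<lambda>r' a'. r' ''i'' = k \<and> r' ''m'' = length as \<and> ?I (Suc k) (r'(''i'' := Suc k)) a') r a"
      unfolding scan_arc_def ins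
      using i m n rd lt b2 I Wb n_ge_3 kW mW
      by (simp, intro conjI scanned_insert[OF sc B uvA]) (auto simp: fun_eq_iff)
  qed simp
  then show ?thesis by (rule runs_mono) (simp_all add: set_as)
qed

lemma runs_init_queue:
  assumes inp: "inp r0 a0" and D: "\<And>v. v < n \<Longrightarrow> a0 ''D'' v \<le> n" and r: "r0 ''r'' = 0"
  shows "runs W (For ''v'' ''n'' init_queue) r0 a0 ((tm init_queue + 10) * Suc n)
    (\<lambda>r a. inp r a \<and> eq_off {''O''} a0 a \<and> eq_off {''v'', ''r''} r0 r \<and>
      r ''r'' = length (filter (\<lambda>v. a0 ''D'' v = 1) [0..<n]) \<and>
      (\<forall>j<r ''r''. a ''O'' j = filter (\<lambda>v. a0 ''D'' v = 1) [0..<n] ! j))"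
proof -
  let ?q = "\<lambda>k. filter (\<lambda>v. a0 ''D'' v = 1) [0..<k]"
  let ?I = "\<lambda>k r a. inp r a \<and> eq_off {''O''} a0 a \<and> eq_off {''v'', ''r''} r0 r \<and>
      r ''r'' = length (?q k) \<and> (\<forall>j<length (?q k). a ''O'' j = ?q k ! j)"
  have "runs W (For ''v'' ''n'' init_queue) r0 a0 ((tm init_queue + 10) * Suc n)
    (\<lambda>r a. ?I n r a \<and> r ''v'' = n)"
  proof (rule runs_For[where I = ?I])
    show "r0 ''n'' = n" using inp by (simp add: inp_def)
    show "n < W" by (rule n_less_W)
    show "?I 0 (r0(''v'' := 0)) a0" using inp r by simp
  next
    fix k r a assume k: "k < n" and v: "r ''v'' = k" and n: "r ''n'' = n" and I: "?I k r a"
    have Dk: "a ''D'' k = a0 ''D'' k" "a0 ''D'' k \<le> n" using I D k by (auto simp: eq_off_def)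
    have len: "length (?q k) \<le> k" using length_filter_le[of _ "[0..<k]"] by simp
    have Wb: "x \<le> W" if "x \<le> 2 * n + 3" for x using that by (rule le_W)
    show "wp W init_queue (\<lambda>r' a'. r' ''v'' = k \<and> r' ''n'' = n \<and> ?I (Suc k) (r'(''v'' := Suc k)) a') r a"
      unfolding init_queue_def
      using k v n I Dk len Wb n_ge_3 by (auto simp: nth_append less_Suc_eq)
  qed simp
  then show ?thesis by (rule runs_mono) simp_all
qed

text \<open>\<open>q\<close> is the queue, and its prefix of length \<open>i\<close> has been peeled
  off: degrees and sums refer to the remaining graph, and \<open>M\<close> freezes at the parent
  when a vertex goes. The last conjunct, children before parents, is what the computation of heights
  relies on later.\<close>

definition peeled :: "nat list \<Rightarrow> nat \<Rightarrow> (string \<Rightarrow> nat \<Rightarrow> nat) \<Rightarrow> bool" where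
  "peeled q i a \<longleftrightarrow> distinct q \<and> set q \<subseteq> V - C \<and> i \<le> length q \<and> (\<forall>j<length q. a ''O'' j = q ! j) \<and>
     (\<forall>v<n. v \<notin> set (take i q) \<longrightarrow> a ''D'' v = card (nbrs A v - set (take i q)) \<and>
        a ''M'' v = \<Sum>(nbrs A v - set (take i q)) mod n \<and> (v \<in> set q \<longleftrightarrow> a ''D'' v = 1)) \<and>
     (\<forall>v\<in>set (take i q). a ''D'' v = 0 \<and> a ''M'' v = f v) \<and>
     (\<forall>j<length q. \<forall>b. b \<in> V - C \<longrightarrow> f b = q ! j \<longrightarrow> b \<in> set (take j q))"

lemma parent_nbr: "v \<in> V - C \<Longrightarrow> f v \<in> nbrs A v"
  using tree_arc'[of v] by (auto simp: nbrs_def)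

lemma nbrs_off: "v \<in> V - C \<Longrightarrow> u \<in> nbrs A v \<Longrightarrow> u \<noteq> f v \<Longrightarrow> u \<in> V - C \<and> f u = v"
proof -
  assume v: "v \<in> V - C" "u \<in> nbrs A v" "u \<noteq> f v"
  then consider "(u, v) \<in> A" | "(v, u) \<in> A" by (auto simp: nbrs_def)
  then show ?thesis
  proof cases
    case 1
    then show ?thesis using pred_of_off[of u v] v by auto
  next
    case 2
    then show ?thesis
      by (cases rule: arc_cases) (use v arc_V[OF 2] in auto)
  qed
qed

text \<open>Ring vertices always keep two neighbours, so they never become leaves.\<close>

lemma ring_nbrs:
  assumes "v \<in> C"
  shows "\<exists>x\<in>C. \<exists>y\<in>C. x \<noteq> y \<and> x \<in> nbrs A v \<and> y \<in> nbrs A v"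
proof -
  obtain d where d: "oriented_ring V A f N d" "d ` {..<N} = C" "d 0 = v" using coords_from[OF assms] by blast
  interpret d: oriented_ring V A f N d by fact
  have "d.C = C" using d by (simp add: d.C_def)
  moreover have "d 1 \<in> nbrs A v" using d.ring_arc[of 0] N_pos d(3) by (auto simp: nbrs_def)
  moreover have "d (N - 1) \<in> nbrs A v"
    using d.ring_arc[of "N - 1"] N_pos d(3) d.c_closed by (auto simp: nbrs_def)
  ultimately show ?thesis using d.c1_neq d.c_C[of 1] d.c_C[of "N - 1"] N_ge_3 by force
qed

lemma card_ge_2: "finite X \<Longrightarrow> x \<in> X \<Longrightarrow> y \<in> X \<Longrightarrow> x \<noteq> y \<Longrightarrow> 2 \<le> card X"
  using card_mono[of X "{x, y}"] by simp

lemma peel_facts: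
  assumes p: "peeled q i a" and i: "i < length q" and v: "v = q ! i"
  shows "v \<in> V - C" "v < n" "v \<notin> set (take i q)" "nbrs A v - set (take i q) = {f v}" "a ''M'' v = f v"
    "f v < n" "f v \<noteq> v" "f v \<notin> set (take i q)" "2 \<le> a ''D'' (f v)" "a ''D'' (f v) \<le> n"
proof -
  let ?R = "set (take i q)"
  have q: "distinct q" "set q \<subseteq> V - C" using p by (auto simp: peeled_def)
  have vq: "v \<in> set q" using i v by simp
  show vV: "v \<in> V - C" using q vq by blast
  then show vn: "v < n" using V by simp
  show vR: "v \<notin> ?R"
  proof
    assume "v \<in> ?R"
    then obtain j where "j < i" "q ! j = q ! i" using v i by (auto simp: in_set_conv_nth)
    then show False using q(1) i by (simp add: nth_eq_iff_index_eq)
  qed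
  have RV: "?R \<subseteq> V - C" using q(2) set_take_subset by fast
  \<comment> \<open>A vertex comes after all its children in the queue, so it cannot be peeled off
    before any of them.\<close>
  have up: "f b \<notin> ?R" if b: "b \<in> V - C" "b \<notin> ?R" for b
  proof
    assume "f b \<in> ?R"
    then obtain j where "j < i" "f b = q ! j" using i by (auto simp: in_set_conv_nth)
    moreover from this have "b \<in> set (take j q)" using p b i by (auto simp: peeled_def)
    ultimately show False using b(2) set_take_subset_set_take[of j i q] by auto
  qed
  show fR: "f v \<notin> ?R" by (rule up[OF vV vR])
  have "a ''D'' v = 1" using p vn vR vq by (auto simp: peeled_def)
  then have "card (nbrs A v - ?R) = 1" using p vn vR by (auto simp: peeled_def)
  moreover have "f v \<in> nbrs A v - ?R" using parent_nbr[OF vV] fR by simp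
  ultimately show nb: "nbrs A v - ?R = {f v}" by (metis card_1_singletonE singletonD)
  show fn: "f v < n" using f_V[of v] vV V by auto
  have "a ''M'' v = \<Sum>(nbrs A v - ?R) mod n" using p vn vR by (auto simp: peeled_def)
  then show "a ''M'' v = f v" using nb fn by simp
  have depth: "depth v = Suc (depth (f v))" using depth_off vV by simp
  then show "f v \<noteq> v" by auto
  have Df: "a ''D'' (f v) = card (nbrs A (f v) - ?R)" using p fn fR by (auto simp: peeled_def)
  have fin: "finite (nbrs A (f v) - ?R)" using nbrs_bound(3)[of A] by simp
  have vf: "v \<in> nbrs A (f v) - ?R" using nb vR by (auto simp: nbrs_def)
  have "\<exists>y. y \<in> nbrs A (f v) - ?R \<and> y \<noteq> v"
  proof (cases "f v \<in> C")
    case True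
    then show ?thesis using ring_nbrs[OF True] RV vV by blast
  next
    case False
    then have fv: "f v \<in> V - C" using fn V by simp
    have "f (f v) \<noteq> v" using depth depth_off[of "f v"] fv by auto
    then show ?thesis using parent_nbr[OF fv] up[OF fv fR] by blast
  qed
  then show "2 \<le> a ''D'' (f v)" using card_ge_2[OF fin vf] Df by auto
  have "card (nbrs A (f v) - ?R) \<le> card (nbrs A (f v))" using nbrs_bound(3)[of A] by (intro card_mono) auto
  then show "a ''D'' (f v) \<le> n" using Df nbrs_bound(2)[of A "f v"] by simp
qed

text \<open>\<open>n\<close> is added before the subtraction because subtraction truncates at
  \<open>0\<close>.\<close>

lemma sum_minus_mod:
  assumes "v < n" "v \<le> (S :: nat)"
  shows "(S mod n + n - v) mod n = (S - v) mod n"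
proof -
  have "(S mod n + n - v) mod n = (S mod n + (n - v)) mod n" using assms by simp
  also have "\<dots> = (S + (n - v)) mod n" by (simp add: mod_simps)
  also have "S + (n - v) = (S - v) + n" using assms by simp
  finally show ?thesis by simp
qed

lemma peel_step:
  assumes p: "peeled q i a" and i: "i < length q" and v: "v = q ! i"
    and q': "q' = q @ (if a ''D'' (f v) = 2 then [f v] else [])"
    and a': "a' ''D'' = (a ''D'')(v := 0, f v := a ''D'' (f v) - 1)"
      "a' ''M'' = (a ''M'')(f v := (a ''M'' (f v) + n - v) mod n)"
      "\<And>j. j < length q' \<Longrightarrow> a' ''O'' j = q' ! j"
  shows "peeled q' (Suc i) a'"
proof -
  note facts = peel_facts[OF p i v]
  let ?R = "set (take i q)" and ?w = "f v"
  let ?R' = "insert v ?R"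
  have q: "distinct q" "set q \<subseteq> V - C" using p by (auto simp: peeled_def)
  have R': "set (take (Suc i) q') = ?R'" using i v q' by (simp add: take_Suc_conv_app_nth)
  have R'q: "?R' \<subseteq> set q" using i v set_take_subset[of i q] by auto
  have wR': "?w \<notin> ?R'" using facts by simp
  have nb: "nbrs A u - ?R' = (if u = ?w then nbrs A u - ?R - {v} else nbrs A u - ?R)" if "u \<notin> ?R'" for u
  proof -
    have "v \<notin> nbrs A u" if "u \<noteq> ?w"
    proof
      assume "v \<in> nbrs A u"
      then have "u \<in> nbrs A v - ?R" using \<open>u \<notin> ?R'\<close> by (auto simp: nbrs_def)
      then show False using facts(4) that by simp
    qed
    then show ?thesis by auto
  qed
  have fin: "finite (nbrs A u - ?R)" for u using nbrs_bound(3)[of A] by simp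
  have vw: "v \<in> nbrs A ?w - ?R" using facts by (auto simp: nbrs_def)
  have old: "a ''D'' u = card (nbrs A u - ?R)" "a ''M'' u = \<Sum>(nbrs A u - ?R) mod n"
    "u \<in> set q \<longleftrightarrow> a ''D'' u = 1" if "u < n" "u \<notin> ?R" for u
    using p that by (auto simp: peeled_def)
  have w_q: "?w \<notin> set q" using old(3)[of ?w] facts by simp
  \<comment> \<open>Removing \<open>v\<close> leaves \<open>?w\<close> with a single neighbour. So
    \<open>?w\<close> is off the ring, its last neighbour is its parent, and all its children are
    already in the queue.\<close>
  have push: "?w \<in> V - C \<and> (\<forall>b. b \<in> V - C \<longrightarrow> f b = ?w \<longrightarrow> b \<in> set q)" if D: "a ''D'' ?w = 2"
  proof -
    have "card (nbrs A ?w - ?R - {v}) = 1" using old(1)[of ?w] facts vw D fin by simp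
    then have one: "card (nbrs A ?w - ?R') = 1" using nb[OF wR'] by simp
    have "?w \<notin> C"
    proof
      assume "?w \<in> C"
      then obtain x y where "x \<in> C" "y \<in> C" "x \<noteq> y" "x \<in> nbrs A ?w" "y \<in> nbrs A ?w"
        using ring_nbrs by blast
      then have "x \<in> nbrs A ?w - ?R'" "y \<in> nbrs A ?w - ?R'" using R'q q(2) by auto
      then have "2 \<le> card (nbrs A ?w - ?R')"
        using card_ge_2[of "nbrs A ?w - ?R'" x y] \<open>x \<noteq> y\<close> nbrs_bound(3)[of A] by simp
      then show False using one by simp
    qed
    then have wV: "?w \<in> V - C" using facts V by simp
    have dw: "depth ?w = Suc (depth (f ?w))" using depth_off wV by simp
    have fw: "f ?w \<notin> ?R'"
    proof
      assume fR: "f ?w \<in> ?R'"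
      have dv: "depth v = Suc (depth ?w)" using depth_off[of v] facts(1) by simp
      have "f ?w \<noteq> v"
      proof
        assume "f ?w = v"
        then have "depth ?w = Suc (depth v)" using dw by simp
        then show False using dv by simp
      qed
      then have "f ?w \<in> ?R" using fR by simp
      then obtain j where "j < i" "f ?w = q ! j" using i by (auto simp: in_set_conv_nth)
      then have "?w \<in> set (take j q)" using p wV i by (auto simp: peeled_def)
      then show False using w_q set_take_subset[of j q] by auto
    qed
    then have single: "nbrs A ?w - ?R' = {f ?w}"
      using one parent_nbr[OF wV] by (metis DiffI card_1_singletonE singletonD)
    have "b \<in> set q" if b: "b \<in> V - C" "f b = ?w" for b
    proof -
      have "b \<in> nbrs A ?w" using parent_nbr[OF b(1)] b(2) by (auto simp: nbrs_def)
      moreover have "b \<noteq> f ?w" using dw depth_off[of b] b by auto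
      ultimately have "b \<in> ?R'" using single by blast
      then show ?thesis using R'q by blast
    qed
    then show ?thesis using wV by blast
  qed
  show ?thesis
    unfolding peeled_def R'
  proof (intro conjI)
    show "distinct q'" using q q' w_q by simp
    show "set q' \<subseteq> V - C" using q q' push by (auto split: if_splits)
    show "Suc i \<le> length q'" using i q' by simp
    show "\<forall>j<length q'. a' ''O'' j = q' ! j" using a'(3) by blast
    show "\<forall>u<n. u \<notin> ?R' \<longrightarrow> a' ''D'' u = card (nbrs A u - ?R') \<and>
        a' ''M'' u = \<Sum>(nbrs A u - ?R') mod n \<and> (u \<in> set q' \<longleftrightarrow> a' ''D'' u = 1)"
    proof (intro allI impI)
      fix u assume u: "u < n" "u \<notin> ?R'"
      show "a' ''D'' u = card (nbrs A u - ?R') \<and> a' ''M'' u = \<Sum>(nbrs A u - ?R') mod n \<and> (u \<in> set q' \<longleftrightarrow> a' ''D'' u = 1)"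
      proof (cases "u = ?w")
        case False
        then show ?thesis using u old[of u] q' by (simp add: nb[OF u(2)] a'(1,2))
      next
        case True
        have "\<Sum>(nbrs A ?w - ?R) = v + \<Sum>(nbrs A ?w - ?R - {v})" using fin vw by (rule sum.remove)
        then have "(\<Sum>(nbrs A ?w - ?R) mod n + n - v) mod n = \<Sum>(nbrs A ?w - ?R - {v}) mod n"
          using sum_minus_mod[OF facts(2), of "\<Sum>(nbrs A ?w - ?R)"] by simp
        moreover have "card (nbrs A ?w - ?R - {v}) = card (nbrs A ?w - ?R) - 1" using fin vw by simp
        moreover have "?w \<in> set q' \<longleftrightarrow> a ''D'' ?w = 2" using q' w_q by simp
        ultimately show ?thesis
          unfolding True nb[OF wR'] using old(1,2)[of ?w] facts(6,8,9) by (auto simp: a'(1,2))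
      qed
    qed
    show "\<forall>u\<in>?R'. a' ''D'' u = 0 \<and> a' ''M'' u = f u"
    proof
      fix u assume u: "u \<in> ?R'"
      then have "u \<noteq> ?w" using wR' by blast
      then show "a' ''D'' u = 0 \<and> a' ''M'' u = f u"
        using u p facts(5) by (auto simp: a'(1,2) peeled_def)
    qed
    show "\<forall>j<length q'. \<forall>b. b \<in> V - C \<longrightarrow> f b = q' ! j \<longrightarrow> b \<in> set (take j q')"
    proof (intro allI impI)
      fix j b assume j: "j < length q'" and b: "b \<in> V - C" "f b = q' ! j"
      show "b \<in> set (take j q')"
      proof (cases "j < length q")
        case True
        then show ?thesis using p b q' by (auto simp: peeled_def nth_append)
      next
        case False
        then have "a ''D'' ?w = 2" "j = length q" "q' ! j = ?w"
            using j q' by (auto simp: nth_append less_Suc_eq split: if_splits)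
        then show ?thesis using push b q' by simp
      qed
    qed
  qed
qed

text \<open>A deepest vertex missing from the queue has all its children peeled off but not its
  parent, so its remaining degree is \<open>1\<close> and it would be in the queue.\<close>

lemma peeled_all:
  assumes p: "peeled q (length q) a"
  shows "set q = V - C"
proof (rule ccontr)
  assume ne: "set q \<noteq> V - C"
  let ?X = "V - C - set q"
  have "?X \<noteq> {}" "finite ?X" using ne p finite_V by (auto simp: peeled_def)
  then have "Max (depth ` ?X) \<in> depth ` ?X" by (intro Max_in) auto
  then obtain w where w: "w \<in> ?X" "depth w = Max (depth ` ?X)" by force
  have wV: "w \<in> V - C" "w < n" "w \<notin> set (take (length q) q)" using w V by auto
  have deep: "b \<in> set q" if b: "b \<in> V - C" "f b = w" for b
  proof (rule ccontr)
    assume "b \<notin> set q"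
    then have "depth b \<le> depth w" unfolding w(2) using b \<open>finite ?X\<close> by (intro Max_ge) auto
    then show False using depth_off[of b] b by simp
  qed
  have "f w \<notin> set q"
  proof
    assume "f w \<in> set q"
    then obtain j where "j < length q" "f w = q ! j" by (auto simp: in_set_conv_nth)
    then have "w \<in> set (take j q)" using p wV by (auto simp: peeled_def)
    then show False using w set_take_subset[of j q] by auto
  qed
  then have "nbrs A w - set q = {f w}" using parent_nbr[OF wV(1)] nbrs_off[OF wV(1)] deep by blast
  then have "a ''D'' w = 1" using p wV by (simp add: peeled_def)
  moreover have "w \<in> set q \<longleftrightarrow> a ''D'' w = 1" using p wV(2,3) unfolding peeled_def by blast
  ultimately show False using w by simp
qed

text \<open>From here on \<open>D\<close> serves to recognize ring vertices and \<open>M\<close> as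
  the parent map.\<close>

definition ring_found :: "nat list \<Rightarrow> (string \<Rightarrow> nat) \<Rightarrow> (string \<Rightarrow> nat \<Rightarrow> nat) \<Rightarrow> bool" where
  "ring_found q r a \<longleftrightarrow> r ''r'' = length q \<and> distinct q \<and> set q = V - C \<and> (\<forall>j<length q. a ''O'' j = q ! j) \<and>
     (\<forall>v\<in>V - C. a ''D'' v = 0 \<and> a ''M'' v = f v) \<and> (\<forall>v\<in>C. 0 < a ''D'' v \<and> a ''D'' v \<le> n) \<and>
     (\<forall>j<length q. \<forall>b. b \<in> V - C \<longrightarrow> f b = q ! j \<longrightarrow> b \<in> set (take j q))"

definition in_arcs :: "(string \<Rightarrow> nat \<Rightarrow> nat) \<Rightarrow> bool" where
  "in_arcs a \<longleftrightarrow> (\<forall>v<n. a ''G'' v = card (preds A v) \<and> (preds A v \<noteq> {} \<longrightarrow> a ''P'' v \<in> preds A v))"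

lemma runs_peel:
  assumes inp: "inp r0 a0" and p0: "peeled q0 0 a0" and r0: "r0 ''r'' = length q0" "r0 ''i'' = 0"
  shows "runs W (While (Less (Reg ''i'') (Reg ''r'')) peel) r0 a0
    ((tm peel + cond_cost (Less (Reg ''i'') (Reg ''r'')) + 1) * Suc n)
    (\<lambda>r a. inp r a \<and> eq_off {''D'', ''M'', ''O''} a0 a \<and> eq_off {''i'', ''r'', ''v'', ''p'', ''x''} r0 r \<and>
      (\<exists>q. peeled q (length q) a \<and> r ''r'' = length q))"
proof -
  let ?I = "\<lambda>r a. inp r a \<and> eq_off {''D'', ''M'', ''O''} a0 a \<and> eq_off {''i'', ''r'', ''v'', ''p'', ''x''} r0 r \<and>
      (\<exists>q. peeled q (r ''i'') a \<and> r ''r'' = length q)"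
  have "runs W (While (Less (Reg ''i'') (Reg ''r'')) peel) r0 a0
    ((tm peel + cond_cost (Less (Reg ''i'') (Reg ''r'')) + 1) * Suc (n - r0 ''i''))
    (\<lambda>r a. ?I r a \<and> \<not> holds (mem r a) (Less (Reg ''i'') (Reg ''r'')))"
  proof (rule runs_While[where I = ?I and \<mu> = "\<lambda>r a. n - r ''i''"])
    show "?I r0 a0" using inp p0 r0 by auto
  next
    fix r a assume "?I r a"
    then obtain q where q: "peeled q (r ''i'') a" "r ''r'' = length q" by blast
    have "length q \<le> n"
    proof -
      have "length q = card (set q)" using q(1) by (simp add: peeled_def distinct_card)
      also have "\<dots> \<le> card V" using q(1) finite_V by (intro card_mono) (auto simp: peeled_def)
      finally show ?thesis using V by simp
    qed
    moreover have "r ''i'' \<le> length q" using q(1) by (simp add: peeled_def)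
    ultimately show "cond_fits W (mem r a) (Less (Reg ''i'') (Reg ''r''))" using q(2) n_less_W by simp
  next
    fix r a assume I: "?I r a" and h: "holds (mem r a) (Less (Reg ''i'') (Reg ''r''))"
    then obtain q where q: "peeled q (r ''i'') a" "r ''r'' = length q" by blast
    let ?i = "r ''i''"
    have i: "?i < length q" using h q by simp
    let ?v = "q ! ?i"
    note facts = peel_facts[OF q(1) i refl]
    have O: "a ''O'' ?i = ?v" "\<forall>j<length q. a ''O'' j = q ! j" using q(1) i by (auto simp: peeled_def)
    have len: "length q \<le> n"
    proof -
      have "length q = card (set q)" using q(1) by (simp add: peeled_def distinct_card)
      also have "\<dots> \<le> card V" using q(1) finite_V by (intro card_mono) (auto simp: peeled_def)
      finally show ?thesis using V by simp
    qed
    have Mw: "a ''M'' (f ?v) < n"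
      using q(1) facts(6,8) n_ge_3 by (auto simp: peeled_def)
    have n: "r ''n'' = n" using I by (simp add: inp_def)
    have Wb: "x \<le> W" if "x \<le> 2 * n + 3" for x using that by (rule le_W)
    have mW: "x mod n \<le> W" for x using n_less_W n_ge_3 mod_less_divisor[of n x] by linarith
    have iW: "?i \<le> W" "length q \<le> W" "?v \<le> W" "f ?v \<le> W" "Suc ?i \<le> W" "Suc (length q) \<le> W"
      "a ''M'' (f ?v) + n \<le> W" "a ''D'' (f ?v) \<le> W" "a ''M'' (f ?v) \<le> W" "1 \<le> W" "n \<le> W" "Suc 0 \<le> W" "2 * n \<le> W"
      "a ''D'' (f ?v) - Suc 0 \<le> W" "n - Suc ?i < n - ?i"
      using i len facts Mw n_ge_3 by (auto intro!: Wb)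
    have x: "a ''M'' (f ?v) + n - ?v < 2 * n" using Mw by simp
    define a1 where "a1 = a(''D'' := (a ''D'')(?v := 0, f ?v := a ''D'' (f ?v) - 1),
      ''M'' := (a ''M'')(f ?v := (a ''M'' (f ?v) + n - ?v) mod n))"
    define a2 where "a2 = a1(''O'' := (a ''O'')(length q := f ?v))"
    have step1: "peeled q (Suc ?i) a1" if "a ''D'' (f ?v) \<noteq> 2"
      by (rule peel_step[OF q(1) i refl]) (use that O in \<open>auto simp: a1_def\<close>)
    have step2: "peeled (q @ [f ?v]) (Suc ?i) a2" if "a ''D'' (f ?v) = 2"
      by (rule peel_step[OF q(1) i refl]) (use that O in \<open>auto simp: a1_def a2_def nth_append less_Suc_eq\<close>)
    have D1: "a ''D'' (f ?v) - Suc 0 = Suc 0 \<longleftrightarrow> a ''D'' (f ?v) = 2" using facts(9) by auto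
    have inp: "inp r a" using I by blast
    have inp1: "inp r a1" "inp r a2" using inp by (simp_all add: a1_def a2_def)
    have upd: "a(''D'' := (a ''D'')(?v := 0), ''D'' := ((a ''D'')(?v := 0))(f ?v := a ''D'' (f ?v) - Suc 0),
       ''M'' := (a ''M'')(f ?v := (a ''M'' (f ?v) + n - ?v) mod n)) = a1"
      by (simp add: a1_def)
    show "wp W peel (\<lambda>r' a'. ?I r' a' \<and> n - r' ''i'' < n - r ''i'') r a"
    proof (cases "a ''D'' (f ?v) = 2")
      case False
      then have D1': "a ''D'' (f ?v) - Suc 0 \<noteq> Suc 0" using D1 by blast
      have e: "eq_off {''D'', ''M'', ''O''} a0 a1" using I by (simp add: a1_def)
      show ?thesis
        unfolding peel_def
        using I O n q(2) i facts(5,7) iW mW x D1' step1[OF False] inp1(1) e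
        by (simp add: a1_def) (intro exI[of _ q] conjI refl, assumption)
    next
      case True
      have e: "eq_off {''D'', ''M'', ''O''} a0 a2" using I by (simp add: a1_def a2_def)
      show ?thesis
        unfolding peel_def
        using I O n q(2) i facts(5,7) iW mW x True step2[OF True] inp1(2) e
        by (simp add: a1_def a2_def) (auto intro!: exI[of _ "q @ [f ?v]"])
    qed
  qed
  then show ?thesis by (rule runs_mono) (use r0 in \<open>auto simp: peeled_def\<close>)
qed

end

section \<open>Choosing a base set\<close>

text \<open>
  The array \<open>L\<close> holds one plus the vertex that the base set leaves out among those with the given
  sole predecessor, and \<open>0\<close> if there is none; \<open>H\<close> holds the heights.
\<close>

definition choose_low :: com where
  "choose_low = block [Assign ''v'' (cell ''O'' ''i''), Assign ''q'' (cell ''M'' ''v''),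
     Branch (Eq (cell ''G'' ''v'') one) (Branch (Eq (cell ''P'' ''v'') (Reg ''q''))
       (Branch (Conj (Less (Num 0) (cell ''L'' ''q'')) (Neg (Less (Plus (cell ''H'' ''v'') one) (cell ''H'' ''q''))))
         Skip
         (block [Write ''L'' (Reg ''q'') (Plus (Reg ''v'') one),
            Write ''H'' (Reg ''q'') (Plus (cell ''H'' ''v'') one)]))
       Skip) Skip]"

definition choose_any :: "cond \<Rightarrow> com" where
  "choose_any b = Branch (Conj b (Eq (cell ''G'' ''v'') one))
     (block [Assign ''u'' (cell ''P'' ''v''),
        Branch (Less (Num 0) (cell ''L'' ''u'')) Skip (Write ''L'' (Reg ''u'') (Plus (Reg ''v'') one))])
     Skip"

definition fill_base :: com where
  "fill_base = Branch (Less (Num 0) (cell ''G'' ''v''))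
     (Branch (Eq (cell ''G'' ''v'') one)
       (block [Assign ''u'' (cell ''P'' ''v''),
          Branch (Eq (cell ''L'' ''u'') (Plus (Reg ''v'') one)) Skip (Write ''X'' (Reg ''v'') one)])
       Skip)
     (Write ''X'' (Reg ''v'') one)"

definition off_ring :: cond where "off_ring = Less (cell ''D'' ''v'') one"

definition anywhere :: cond where "anywhere = Less (Num 0) one"

text \<open>Children of least height come first, other vertices off the ring second, ring vertices
  last. Earlier entries are never overwritten by the later passes, which makes the base set ring
  averse and keeps its trails short.\<close>

definition choose_base :: com where
  "choose_base = block [For ''i'' ''r'' choose_low, For ''v'' ''n'' (choose_any off_ring),
     For ''v'' ''n'' (choose_any anywhere), For ''v'' ''n'' fill_base]"

section \<open>Correctness of the peeling and of the chosen base set\<close>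

context ring_input
begin

text \<open>Costs are counted in multiples of \<open>Suc (n + length as)\<close>. The successor lets
  constant costs be absorbed, and the factors of consecutive programs add up.\<close>

abbreviation lin :: "com \<Rightarrow> (string \<Rightarrow> nat) \<Rightarrow> (string \<Rightarrow> nat \<Rightarrow> nat) \<Rightarrow> nat \<Rightarrow>
    ((string \<Rightarrow> nat) \<Rightarrow> (string \<Rightarrow> nat \<Rightarrow> nat) \<Rightarrow> bool) \<Rightarrow> bool" where
  "lin p r a k Q \<equiv> runs W p r a (k * Suc (n + length as)) Q"

lemma lin_Seq: "lin p r a k R \<Longrightarrow> (\<And>r' a'. R r' a' \<Longrightarrow> lin d r' a' k' Q) \<Longrightarrow> lin (Seq p d) r a (k + k') Q"
  unfolding add_mult_distrib by (rule runs_Seq)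

lemma lin_wp: "wp W p Q r a \<Longrightarrow> lin p r a (tm p) Q"
  by (rule runs_mono[OF wp_runs]) simp_all

lemma lin_mono: "lin p r a k Q \<Longrightarrow> k \<le> k' \<Longrightarrow> (\<And>r' a'. Q r' a' \<Longrightarrow> Q' r' a') \<Longrightarrow> lin p r a k' Q'"
  by (rule runs_mono, assumption, erule mult_le_mono1, blast)

lemma lin_Branch:
  assumes "cond_fits W (mem r a) b"
    "holds (mem r a) b \<Longrightarrow> lin p r a k Q" "\<not> holds (mem r a) b \<Longrightarrow> lin d r a k' Q"
  shows "lin (Branch b p d) r a (1 + cond_cost b + k + k') Q"
proof -
  let ?s = "Suc (n + length as)"
  have "(1 + cond_cost b) * 1 \<le> (1 + cond_cost b) * ?s" by (rule mult_le_mono2) simp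
  then have "1 + cond_cost b + k * ?s + k' * ?s \<le> (1 + cond_cost b + k + k') * ?s"
    unfolding add_mult_distrib by simp
  then show ?thesis using runs_mono[OF runs_Branch[OF assms]] by blast
qed

lemma lin_of_runs: "runs W p r a (k * Suc l) Q \<Longrightarrow> l \<le> n + length as \<Longrightarrow> lin p r a k Q"
  by (erule runs_mono) (simp_all del: mult_Suc_right)

lemma lin_Skip: "Q r a \<Longrightarrow> lin Skip r a 1 Q"
  using lin_wp[of Skip Q r a] by simp

text \<open>The only neighbour of a vertex of degree one is its parent, so the initial queue
  contains no vertex with children and its order is immaterial.\<close>

lemma peeled_init:
  assumes s: "scanned A a" and O: "\<forall>j<length q. a' ''O'' j = q ! j"
    and a': "a' ''D'' = a ''D''" "a' ''M'' = a ''M''" and q: "q = filter (\<lambda>v. a ''D'' v = 1) [0..<n]"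
  shows "peeled q 0 a'"
proof -
  have q_iff: "v \<in> set q \<longleftrightarrow> v < n \<and> card (nbrs A v) = 1" for v
    using s by (auto simp: q scanned_def)
  have qV: "v \<in> V - C" if "v \<in> set q" for v
  proof -
    have "v \<notin> C"
    proof
      assume "v \<in> C"
      then obtain x y where "x \<in> nbrs A v" "y \<in> nbrs A v" "x \<noteq> y" using ring_nbrs by blast
      then have "2 \<le> card (nbrs A v)" using card_ge_2[of "nbrs A v" x y] nbrs_bound(3)[of A v] by simp
      then show False using q_iff that by simp
    qed
    then show ?thesis using q_iff that V by simp
  qed
  have "b \<in> set (take j q)" if "j < length q" "b \<in> V - C" "f b = q ! j" for j b
  proof -
    have jq: "q ! j \<in> set q" using that by simp
    then have jV: "q ! j \<in> V - C" using qV by blast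
    have "card (nbrs A (q ! j)) = 1" using jq q_iff by blast
    then have "nbrs A (q ! j) = {f (q ! j)}" using parent_nbr[OF jV] by (metis card_1_singletonE singletonD)
    moreover have "b \<in> nbrs A (q ! j)" using parent_nbr[OF that(2)] that(3) by (auto simp: nbrs_def)
    ultimately have "b = f (q ! j)" by simp
    then have "depth b = Suc (depth (q ! j))" "depth (q ! j) = Suc (depth b)"
      using depth_off[of b] depth_off[of "q ! j"] that jV by auto
    then show ?thesis by simp
  qed
  then show ?thesis
    unfolding peeled_def using s O a' q_iff qV by (auto simp: scanned_def q)
qed

lemma ring_found_if_peeled:
  assumes p: "peeled q (length q) a" and r: "r ''r'' = length q"
  shows "ring_found q r a"
proof -
  have sq: "set q = V - C" by (rule peeled_all[OF p])
  have "0 < a ''D'' v \<and> a ''D'' v \<le> n" if v: "v \<in> C" for v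
  proof -
    have vn: "v < n" "v \<notin> set q" using v sq C_V V by auto
    then have D: "a ''D'' v = card (nbrs A v - set q)" using p by (simp add: peeled_def)
    obtain x where "x \<in> nbrs A v - set q" using ring_nbrs[OF v] sq by blast
    moreover have fin: "finite (nbrs A v - set q)" using nbrs_bound(3)[of A] by simp
    ultimately have "0 < card (nbrs A v - set q)" using card_gt_0_iff by blast
    moreover have "card (nbrs A v - set q) \<le> card (nbrs A v)" using nbrs_bound(3)[of A] by (intro card_mono) auto
    ultimately show ?thesis using D nbrs_bound(2)[of A v] by simp
  qed
  then show ?thesis using p r sq by (auto simp: ring_found_def peeled_def)
qed

definition k_find :: nat where
  "k_find = (tm scan_arc + 10) + ((tm init_queue + 10) + (tm (Assign ''i'' (Num 0)) +
     ((tm peel + cond_cost (Less (Reg ''i'') (Reg ''r'')) + 1) + 1)))"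

lemma runs_find_ring:
  assumes inp: "inp r0 a0" and zero: "\<And>v. a0 ''D'' v = 0" "\<And>v. a0 ''M'' v = 0" "\<And>v. a0 ''G'' v = 0"
    and r: "r0 ''r'' = 0"
  shows "lin find_ring r0 a0 k_find
    (\<lambda>r a. inp r a \<and> (\<exists>q. ring_found q r a) \<and> in_arcs a \<and>
      eq_off {''D'', ''M'', ''G'', ''P'', ''O''} a0 a \<and> eq_off {''i'', ''u'', ''v'', ''x'', ''r'', ''p''} r0 r)"
proof -
  let ?Q1 = "\<lambda>r a. inp r a \<and> scanned A a \<and> eq_off {''D'', ''M'', ''G'', ''P'', ''O''} a0 a \<and>
    eq_off {''i'', ''u'', ''v'', ''x'', ''r'', ''p''} r0 r \<and> r ''r'' = 0"
  let ?R = "\<lambda>r a. inp r a \<and> in_arcs a \<and> eq_off {''D'', ''M'', ''G'', ''P'', ''O''} a0 a \<and>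
    eq_off {''i'', ''u'', ''v'', ''x'', ''r'', ''p''} r0 r"
  let ?Q2 = "\<lambda>r a. ?R r a \<and> (\<exists>q. peeled q 0 a \<and> r ''r'' = length q)"
  let ?Q3 = "\<lambda>r a. ?Q2 r a \<and> r ''i'' = 0"
  let ?Q4 = "\<lambda>r a. ?R r a \<and> (\<exists>q. ring_found q r a)"
  have 1: "lin (For ''i'' ''m'' scan_arc) r0 a0 (tm scan_arc + 10) ?Q1"
    by (rule runs_mono[OF runs_scan[OF inp zero]]) (use r in \<open>auto simp: eq_off_def simp del: mult_Suc_right\<close>)
  have 2: "lin (For ''v'' ''n'' init_queue) r1 a1 (tm init_queue + 10) ?Q2" if I: "?Q1 r1 a1" for r1 a1
  proof -
    have D: "a1 ''D'' v \<le> n" if "v < n" for v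
      using I that nbrs_bound(2)[of A v] by (simp add: scanned_def)
    show ?thesis
    proof (rule runs_mono[OF runs_init_queue[of r1 a1]])
      fix r a
      assume "inp r a \<and> eq_off {''O''} a1 a \<and> eq_off {''v'', ''r''} r1 r \<and>
        r ''r'' = length (filter (\<lambda>v. a1 ''D'' v = 1) [0..<n]) \<and>
        (\<forall>j<r ''r''. a ''O'' j = filter (\<lambda>v. a1 ''D'' v = 1) [0..<n] ! j)"
      then have post: "inp r a" "eq_off {''O''} a1 a" "eq_off {''v'', ''r''} r1 r"
        "r ''r'' = length (filter (\<lambda>v. a1 ''D'' v = 1) [0..<n])"
        "\<forall>j<length (filter (\<lambda>v. a1 ''D'' v = 1) [0..<n]). a ''O'' j = filter (\<lambda>v. a1 ''D'' v = 1) [0..<n] ! j" by auto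
      have same: "a ''D'' = a1 ''D''" "a ''M'' = a1 ''M''" "a ''G'' = a1 ''G''" "a ''P'' = a1 ''P''"
        using post(2) by (auto simp: eq_off_def)
      have "peeled (filter (\<lambda>v. a1 ''D'' v = 1) [0..<n]) 0 a"
        using I by (intro peeled_init[OF _ post(5) same(1,2) refl]) simp
      moreover have "in_arcs a" using I same by (simp add: scanned_def in_arcs_def)
      moreover have "eq_off {''D'', ''M'', ''G'', ''P'', ''O''} a0 a" using I post(2) by (simp add: eq_off_def)
      moreover have "eq_off {''i'', ''u'', ''v'', ''x'', ''r'', ''p''} r0 r" using I post(3) by (simp add: eq_off_def)
      ultimately show "?Q2 r a" using post by blast
    qed (use I D in \<open>simp_all del: mult_Suc_right\<close>)
  qed
  have 3: "lin (Assign ''i'' (Num 0)) r1 a1 (tm (Assign ''i'' (Num 0))) ?Q3" if "?Q2 r1 a1" for r1 a1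
    by (rule lin_wp) (use that in simp)
  have 4: "lin (While (Less (Reg ''i'') (Reg ''r'')) peel) r1 a1
      (tm peel + cond_cost (Less (Reg ''i'') (Reg ''r'')) + 1) ?Q4" if I: "?Q3 r1 a1" for r1 a1
  proof -
    obtain q where q: "peeled q 0 a1" "r1 ''r'' = length q" using I by blast
    show ?thesis
    proof (rule lin_mono[OF lin_of_runs[OF runs_peel[of r1 a1 q]] order_refl])
      fix r a
      assume "inp r a \<and> eq_off {''D'', ''M'', ''O''} a1 a \<and> eq_off {''i'', ''r'', ''v'', ''p'', ''x''} r1 r \<and>
        (\<exists>q. peeled q (length q) a \<and> r ''r'' = length q)"
      then obtain q' where post: "inp r a" "eq_off {''D'', ''M'', ''O''} a1 a" "eq_off {''i'', ''r'', ''v'', ''p'', ''x''} r1 r"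
        "peeled q' (length q') a" "r ''r'' = length q'" by blast
      have "a ''G'' = a1 ''G''" "a ''P'' = a1 ''P''" using post(2) by (auto simp: eq_off_def)
      then have "in_arcs a" using I by (simp add: in_arcs_def)
      moreover have "eq_off {''D'', ''M'', ''G'', ''P'', ''O''} a0 a" using I post(2) by (simp add: eq_off_def)
      moreover have "eq_off {''i'', ''u'', ''v'', ''x'', ''r'', ''p''} r0 r" using I post(3) by (simp add: eq_off_def)
      ultimately show "?Q4 r a" using post(1) ring_found_if_peeled[of q' a r] post(4,5) by blast
    qed (use I q in simp_all)
  qed
  have "lin find_ring r0 a0 k_find ?Q4"
    unfolding find_ring_def block.simps k_find_def
    by (rule lin_Seq[OF 1], rule lin_Seq[OF 2], assumption, rule lin_Seq[OF 3], assumption, rule lin_Seq[OF 4], assumption, erule lin_Skip)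
  then show ?thesis by (rule lin_mono) auto
qed

section \<open>Heights and the choice of left out vertices\<close>

definition low :: "nat list \<Rightarrow> nat \<Rightarrow> nat set" where
  "low ps u = {v \<in> set ps. f v = u \<and> v \<in> sole_succs A u}"

definition lowest :: "nat list \<Rightarrow> (nat \<Rightarrow> nat) \<Rightarrow> (nat \<Rightarrow> nat) \<Rightarrow> bool" where
  "lowest ps L H \<longleftrightarrow> (\<forall>u<n. H u \<le> length ps \<and> (low ps u = {} \<longrightarrow> L u = 0 \<and> H u = 0) \<and>
     (low ps u \<noteq> {} \<longrightarrow> (\<exists>l\<in>low ps u. L u = Suc l \<and> H u = Suc (H l))) \<and> (\<forall>v\<in>low ps u. H u \<le> Suc (H v)))"

lemma in_arcs_sole:
  assumes "in_arcs a" "v < n"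
  shows "v \<in> sole_succs A u \<longleftrightarrow> a ''G'' v = 1 \<and> a ''P'' v = u"
proof
  assume v: "v \<in> sole_succs A u"
  then have "preds A v = {u}" by (simp add: sole_succs_def)
  moreover from this have "a ''G'' v = 1" "a ''P'' v \<in> preds A v"
    using assms unfolding in_arcs_def by (metis One_nat_def is_singletonI is_singleton_altdef, metis insert_not_empty)
  ultimately show "a ''G'' v = 1 \<and> a ''P'' v = u" by simp
next
  assume v: "a ''G'' v = 1 \<and> a ''P'' v = u"
  then have c1: "card (preds A v) = 1" using assms by (simp add: in_arcs_def)
  then obtain w where w: "preds A v = {w}" using card_1_singletonE by blast
  then have "a ''P'' v \<in> preds A v" using assms unfolding in_arcs_def by blast
  then show "v \<in> sole_succs A u" using v w by (simp add: sole_succs_def)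
qed

text \<open>Children precede parents in the queue. So \<open>H v\<close> is final when
  \<open>v\<close> is processed, and the entry of \<open>f v\<close>, which may still change, is not
  yet compared with any other.\<close>

lemma lowest_step:
  assumes l: "lowest (take i q) L H" and q: "distinct q" "set q = V - C" and i: "i < length q" "v = q ! i"
    and order: "\<forall>j<length q. \<forall>b. b \<in> V - C \<longrightarrow> f b = q ! j \<longrightarrow> b \<in> set (take j q)"
  shows "v \<notin> sole_succs A (f v) \<Longrightarrow> lowest (take (Suc i) q) L H"
    and "v \<in> sole_succs A (f v) \<Longrightarrow> 0 < L (f v) \<Longrightarrow> H (f v) \<le> Suc (H v) \<Longrightarrow> lowest (take (Suc i) q) L H"
    and "v \<in> sole_succs A (f v) \<Longrightarrow> L (f v) = 0 \<or> Suc (H v) < H (f v) \<Longrightarrow>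
      lowest (take (Suc i) q) (L(f v := Suc v)) (H(f v := Suc (H v)))"
proof -
  let ?ps = "take i q"
  have ps': "take (Suc i) q = ?ps @ [v]" using i by (simp add: take_Suc_conv_app_nth)
  have "v \<in> set q" using i by simp
  then have vV: "v \<in> V - C" using q(2) by simp
  have fn: "f v < n" "v < n" using f_V[of v] vV V by auto
  have low': "low (?ps @ [v]) u = (if u = f v \<and> v \<in> sole_succs A u then insert v (low ?ps u) else low ?ps u)" for u
    by (auto simp: low_def)
  have fv_notin: "f v \<notin> set (?ps @ [v])"
  proof
    assume "f v \<in> set (?ps @ [v])"
    moreover have "f v \<noteq> v" using depth_off[of v] vV by auto
    ultimately obtain j where "j < i" "f v = q ! j" using i by (auto simp: in_set_conv_nth)
    then have "v \<in> set (take j q)" using order vV i by auto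
    then obtain k where "k < j" "q ! k = q ! i" using i \<open>j < i\<close> by (auto simp: in_set_conv_nth)
    then show False using q(1) i \<open>j < i\<close> by (simp add: nth_eq_iff_index_eq)
  qed
  have len: "length (?ps @ [v]) = Suc (length ?ps)" by simp
  {
    assume "v \<notin> sole_succs A (f v)"
    then have "low (?ps @ [v]) u = low ?ps u" for u by (auto simp: low')
    then show "lowest (take (Suc i) q) L H" using l unfolding lowest_def ps' len by (simp add: le_SucI)
  next
    assume v: "v \<in> sole_succs A (f v)" "0 < L (f v)" "H (f v) \<le> Suc (H v)"
    then have "low ?ps (f v) \<noteq> {}" using l fn by (auto simp: lowest_def)
    then show "lowest (take (Suc i) q) L H"
      using l v unfolding lowest_def ps' len low' by (auto simp: le_SucI)
  next
    assume v: "v \<in> sole_succs A (f v)" "L (f v) = 0 \<or> Suc (H v) < H (f v)"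
    let ?L = "L(f v := Suc v)" and ?H = "H(f v := Suc (H v))"
    have stay: "?H w = H w" if "w \<in> low (?ps @ [v]) u" for w u
      using that fv_notin by (auto simp: low_def)
    show "lowest (take (Suc i) q) ?L ?H"
      unfolding lowest_def ps'
    proof (intro allI impI)
      fix u assume u: "u < n"
      show "?H u \<le> length (?ps @ [v]) \<and> (low (?ps @ [v]) u = {} \<longrightarrow> ?L u = 0 \<and> ?H u = 0) \<and>
        (low (?ps @ [v]) u \<noteq> {} \<longrightarrow> (\<exists>l\<in>low (?ps @ [v]) u. ?L u = Suc l \<and> ?H u = Suc (?H l))) \<and>
        (\<forall>w\<in>low (?ps @ [v]) u. ?H u \<le> Suc (?H w))"
      proof (cases "u = f v")
        case False
        then have "low (?ps @ [v]) u = low ?ps u" by (simp add: low')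
        moreover have "?H w = H w" if "w \<in> low ?ps u" for w using stay[of w u] that calculation by simp
        ultimately show ?thesis using l u False unfolding lowest_def by (auto simp: le_SucI)
      next
        case True
        have lw: "low (?ps @ [v]) u = insert v (low ?ps u)" using True v(1) by (simp add: low')
        have "\<forall>w\<in>low ?ps u. H v \<le> H w"
        proof
          fix w assume w: "w \<in> low ?ps u"
          then have "L (f v) \<noteq> 0" using l fn True unfolding lowest_def by (metis Zero_not_Suc empty_iff)
          moreover have "H (f v) \<le> Suc (H w)" using l fn True w by (auto simp: lowest_def)
          ultimately show "H v \<le> H w" using v(2) by simp
        qed
        moreover have "?H w = H w" if "w \<in> insert v (low ?ps u)" for w using stay[of w u] that lw by simp
        moreover have "H v \<le> length ?ps" using l fn(2) by (auto simp: lowest_def)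
        ultimately show ?thesis unfolding lw using True by auto
      qed
    qed
  }
qed

lemma runs_choose_low:
  assumes inp: "inp r0 a0" and q: "ring_found q r0 a0" and g: "in_arcs a0"
    and zero: "\<And>v. a0 ''L'' v = 0" "\<And>v. a0 ''H'' v = 0"
  shows "lin (For ''i'' ''r'' choose_low) r0 a0 (tm choose_low + 10)
    (\<lambda>r a. inp r a \<and> ring_found q r a \<and> in_arcs a \<and> lowest q (a ''L'') (a ''H'') \<and>
      eq_off {''L'', ''H''} a0 a \<and> eq_off {''i'', ''v'', ''q''} r0 r)"
proof -
  let ?I = "\<lambda>k r a. inp r a \<and> ring_found q r a \<and> in_arcs a \<and> lowest (take k q) (a ''L'') (a ''H'') \<and>
      eq_off {''L'', ''H''} a0 a \<and> eq_off {''i'', ''v'', ''q''} r0 r"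
  have lenq: "length q \<le> n"
  proof -
    have "length q = card (set q)" using q unfolding ring_found_def by (metis distinct_card)
    also have "\<dots> \<le> card V" using q finite_V by (intro card_mono) (auto simp: ring_found_def)
    finally show ?thesis using V by simp
  qed
  have "runs W (For ''i'' ''r'' choose_low) r0 a0 ((tm choose_low + 10) * Suc (length q))
     (\<lambda>r a. ?I (length q) r a \<and> r ''i'' = length q)"
  proof (rule runs_For[where I = ?I])
    show "r0 ''r'' = length q" using q by (simp add: ring_found_def)
    show "length q < W" using lenq n_less_W by simp
    show "?I 0 (r0(''i'' := 0)) a0"
      using inp q g zero by (auto simp: ring_found_def lowest_def low_def)
  next
    fix k r a assume k: "k < length q" "r ''i'' = k" "r ''r'' = length q" and I: "?I k r a"
    let ?v = "q ! k"
    have rf: "distinct q" "set q = V - C" "a ''O'' k = ?v" "a ''M'' ?v = f ?v"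
      "\<forall>j<length q. \<forall>b. b \<in> V - C \<longrightarrow> f b = q ! j \<longrightarrow> b \<in> set (take j q)"
      using I k by (auto simp: ring_found_def)
    have vV: "?v \<in> V - C" using rf k by auto
    then have vn: "?v < n" "f ?v < n" using f_V[of ?v] V by auto
    note step = lowest_step[OF _ rf(1,2) k(1) refl rf(5), of "a ''L''" "a ''H''"]
    have low: "lowest (take k q) (a ''L'') (a ''H'')" using I by blast
    have sole: "?v \<in> sole_succs A (f ?v) \<longleftrightarrow> a ''G'' ?v = Suc 0 \<and> a ''P'' ?v = f ?v"
      using in_arcs_sole[of a ?v "f ?v"] I vn by simp
    have Hb: "a ''H'' u \<le> n" if "u < n" for u
    proof -
      have "a ''H'' u \<le> length (take k q)" using low that unfolding lowest_def by blast
      then show ?thesis using k lenq by simp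
    qed
    have Lb: "a ''L'' u \<le> n" if "u < n" for u
    proof -
      have "\<forall>l\<in>low (take k q) u. l < n" using rf(2) V set_take_subset[of k q] by (auto simp: low_def)
      then show ?thesis using low that unfolding lowest_def by (metis Suc_leI le0 order.refl)
    qed
    have Gb: "a ''G'' ?v \<le> n" using I vn preds_bound(2)[of A ?v] by (simp add: in_arcs_def)
    have Pb: "a ''P'' ?v \<le> W" if "a ''G'' ?v = Suc 0"
    proof -
      have "preds A ?v \<noteq> {}" using I vn that by (auto simp: in_arcs_def)
      then have "a ''P'' ?v < n" using I vn preds_bound(1)[of A ?v] by (auto simp: in_arcs_def)
      then show ?thesis using n_less_W by simp
    qed
    have Wb: "k \<le> W" "?v \<le> W" "f ?v \<le> W" "Suc ?v \<le> W" "a ''H'' ?v \<le> W" "Suc (a ''H'' ?v) \<le> W" "a ''H'' (f ?v) \<le> W"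
      "a ''L'' (f ?v) \<le> W" "a ''G'' ?v \<le> W" "Suc 0 \<le> W"
      using k lenq vn Hb[of ?v] Hb[of "f ?v"] Lb[of "f ?v"] Gb n_ge_3 by (auto intro!: le_W)
    show "wp W choose_low (\<lambda>r' a'. r' ''i'' = k \<and> r' ''r'' = length q \<and> ?I (Suc k) (r'(''i'' := Suc k)) a') r a"
      unfolding choose_low_def
      using I k rf(3,4) step[OF low] sole Wb Pb
      by (auto simp: ring_found_def in_arcs_def not_less)
  qed simp
  then have "lin (For ''i'' ''r'' choose_low) r0 a0 (tm choose_low + 10) (\<lambda>r a. ?I (length q) r a \<and> r ''i'' = length q)"
    by (rule lin_of_runs) (use lenq in simp)
  then show ?thesis by (rule lin_mono) auto
qed

text \<open>Used with \<open>P\<close> the complement of the ring and again with \<open>P\<close>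
  everything. The test must not depend on \<open>L\<close>, the only array that changes.\<close>

lemma runs_choose_any:
  assumes inp: "inp r0 a0" and g: "in_arcs a0" and L0: "\<And>u. u < n \<Longrightarrow> a0 ''L'' u \<le> n"
    and b: "\<And>r a. inp r a \<Longrightarrow> eq_off {''L''} a0 a \<Longrightarrow> r ''v'' < n \<Longrightarrow>
      cond_fits W (mem r a) b \<and> (holds (mem r a) b \<longleftrightarrow> r ''v'' \<in> P)"
  shows "lin (For ''v'' ''n'' (choose_any b)) r0 a0 (tm (choose_any b) + 10)
    (\<lambda>r a. inp r a \<and> eq_off {''L''} a0 a \<and> eq_off {''v'', ''u''} r0 r \<and>
      (\<forall>u<n. a ''L'' u \<le> n \<and> (a0 ''L'' u \<noteq> 0 \<longrightarrow> a ''L'' u = a0 ''L'' u) \<and>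
        (a0 ''L'' u = 0 \<longrightarrow> a ''L'' u = 0 \<and> sole_succs A u \<inter> P = {} \<or>
          (\<exists>l. a ''L'' u = Suc l \<and> l \<in> sole_succs A u \<inter> P))))"
proof -
  let ?ok = "\<lambda>k a u. a ''L'' u \<le> n \<and> (a0 ''L'' u \<noteq> 0 \<longrightarrow> a ''L'' u = a0 ''L'' u) \<and>
        (a0 ''L'' u = 0 \<longrightarrow> a ''L'' u = 0 \<and> sole_succs A u \<inter> P \<inter> {..<k} = {} \<or>
          (\<exists>l. a ''L'' u = Suc l \<and> l \<in> sole_succs A u \<inter> P))"
  let ?J = "\<lambda>r a. inp r a \<and> eq_off {''L''} a0 a \<and> eq_off {''v'', ''u''} r0 r"
  let ?I = "\<lambda>k r a. ?J r a \<and> (\<forall>u<n. ?ok k a u)"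
  have "runs W (For ''v'' ''n'' (choose_any b)) r0 a0 ((tm (choose_any b) + 10) * Suc n) (\<lambda>r a. ?I n r a \<and> r ''v'' = n)"
  proof (rule runs_For[where I = ?I])
    show "r0 ''n'' = n" using inp by (simp add: inp_def)
    show "n < W" by (rule n_less_W)
    show "?I 0 (r0(''v'' := 0)) a0" using inp L0 by simp
  next
    fix k r a assume k: "k < n" "r ''v'' = k" "r ''n'' = n" and I: "?I k r a"
    have bk: "cond_fits W (mem r a) b" "holds (mem r a) b \<longleftrightarrow> k \<in> P" using b[of r a] I k by auto
    have same: "a ''G'' = a0 ''G''" "a ''P'' = a0 ''P''" using I by (auto simp: eq_off_def)
    have g': "in_arcs a" using g same by (simp add: in_arcs_def)
    have Gb: "a ''G'' k \<le> W" using g' k preds_bound(2)[of A k] n_less_W by (simp add: in_arcs_def)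
    have sole: "k \<in> sole_succs A u \<longleftrightarrow> a ''G'' k = Suc 0 \<and> a ''P'' k = u" for u
      using in_arcs_sole[OF g' k(1)] by simp
    show "wp W (choose_any b) (\<lambda>r' a'. r' ''v'' = k \<and> r' ''n'' = n \<and> ?I (Suc k) (r'(''v'' := Suc k)) a') r a"
    proof (cases "k \<in> P \<and> a ''G'' k = Suc 0")
      case False
      have "\<forall>u<n. ?ok (Suc k) a u"
      proof (intro allI impI)
        fix u assume "u < n"
        moreover have "sole_succs A u \<inter> P \<inter> {..<Suc k} = sole_succs A u \<inter> P \<inter> {..<k}"
          using False sole by (auto simp: less_Suc_eq)
        ultimately show "?ok (Suc k) a u" using I by simp
      qed
      moreover have "Suc 0 \<le> W" "k \<le> W" using n_less_W n_ge_3 k by auto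
      ultimately show ?thesis
        unfolding choose_any_def using I k bk Gb False by auto
    next
      case True
      let ?u = "a ''P'' k"
      have "preds A k \<noteq> {}" using g' k True by (auto simp: in_arcs_def)
      then have u: "?u < n" using g' k preds_bound(1)[of A k] by (auto simp: in_arcs_def)
      have ks: "k \<in> sole_succs A ?u" using sole True by blast
      have other: "k \<notin> sole_succs A u" if "u \<noteq> ?u" for u using sole[of u] that by simp
      have Wb: "Suc 0 \<le> W" "k \<le> W" "?u \<le> W" "a ''L'' ?u \<le> W" "Suc k \<le> W"
        using n_less_W n_ge_3 k u I by auto
      show ?thesis
      proof (cases "a ''L'' ?u = 0")
        case False
        have "\<forall>u<n. ?ok (Suc k) a u"
        proof (intro allI impI)
          fix u assume un: "u < n"
          show "?ok (Suc k) a u"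
          proof (cases "u = ?u")
            case True
            then show ?thesis using I un False by auto
          next
            case False
            have "sole_succs A u \<inter> P \<inter> {..<Suc k} = sole_succs A u \<inter> P \<inter> {..<k}"
              using other[OF False] by (auto simp: less_Suc_eq)
            then show ?thesis using I un by simp
          qed
        qed
        then show ?thesis
          unfolding choose_any_def using I k bk Gb True Wb False by auto
      next
        case L: True
        let ?a = "a(''L'' := (a ''L'')(?u := Suc k))"
        have "\<forall>u<n. ?ok (Suc k) ?a u"
        proof (intro allI impI)
          fix u assume un: "u < n"
          show "?ok (Suc k) ?a u"
          proof (cases "u = ?u")
            case eq: True
            have "a0 ''L'' ?u = 0" using I u L by force
            then show ?thesis using eq ks True k by simp
          next
            case False
            have "sole_succs A u \<inter> P \<inter> {..<Suc k} = sole_succs A u \<inter> P \<inter> {..<k}"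
              using other[OF False] by (auto simp: less_Suc_eq)
            then show ?thesis using I un False by simp
          qed
        qed
        then show ?thesis
          unfolding choose_any_def using I k bk Gb True Wb L by simp
      qed
    qed
  qed simp
  then have "lin (For ''v'' ''n'' (choose_any b)) r0 a0 (tm (choose_any b) + 10) (\<lambda>r a. ?I n r a \<and> r ''v'' = n)"
    by (rule lin_of_runs) simp
  moreover have "sole_succs A u \<inter> P \<inter> {..<n} = sole_succs A u \<inter> P" for u
    using arc_less unfolding sole_succs_def by blast
  ultimately show ?thesis by (elim lin_mono) auto
qed

definition chosen :: "(nat \<Rightarrow> nat) \<Rightarrow> (nat \<Rightarrow> nat) \<Rightarrow> bool" where
  "chosen L H \<longleftrightarrow> (\<forall>u<n. (L u = 0 \<longleftrightarrow> sole_succs A u = {}) \<and>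
     (\<forall>l. L u = Suc l \<longrightarrow> l \<in> sole_succs A u \<and> (l \<in> C \<longrightarrow> sole_succs A u \<subseteq> C)) \<and>
     (below u \<longrightarrow> (sole_succs A u = {} \<longrightarrow> H u = 0) \<and> (\<forall>v\<in>sole_succs A u. H u \<le> Suc (H v)) \<and>
       (\<forall>l. L u = Suc l \<longrightarrow> H u = Suc (H l))))"

text \<open>Where \<open>below u\<close> holds, all sole successors of \<open>u\<close> are
  children, so the pass by heights has settled the entry of \<open>u\<close> for good.\<close>

lemma chosenI:
  assumes q: "set q = V - C" and low: "lowest q L0 H"
    and L1: "\<And>u. u < n \<Longrightarrow> (L0 u \<noteq> 0 \<longrightarrow> L1 u = L0 u) \<and>
        (L0 u = 0 \<longrightarrow> L1 u = 0 \<and> sole_succs A u \<inter> - C = {} \<or> (\<exists>l. L1 u = Suc l \<and> l \<in> sole_succs A u \<inter> - C))"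
    and L2: "\<And>u. u < n \<Longrightarrow> (L1 u \<noteq> 0 \<longrightarrow> L2 u = L1 u) \<and>
        (L1 u = 0 \<longrightarrow> L2 u = 0 \<and> sole_succs A u \<inter> UNIV = {} \<or> (\<exists>l. L2 u = Suc l \<and> l \<in> sole_succs A u \<inter> UNIV))"
  shows "chosen L2 H"
  unfolding chosen_def
proof (intro allI impI)
  fix u assume u: "u < n"
  have sV: "sole_succs A u \<subseteq> V" using arc_V unfolding sole_succs_def by blast
  have lu: "low q u = {v \<in> sole_succs A u. v \<notin> C \<and> f v = u}" using q sV by (auto simp: low_def)
  have l0: "(low q u = {} \<longrightarrow> L0 u = 0 \<and> H u = 0) \<and>
     (low q u \<noteq> {} \<longrightarrow> (\<exists>l\<in>low q u. L0 u = Suc l \<and> H u = Suc (H l))) \<and> (\<forall>v\<in>low q u. H u \<le> Suc (H v))"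
    using low u unfolding lowest_def by blast
  have L0: "\<exists>l\<in>low q u. L0 u = Suc l" if "L0 u \<noteq> 0" using l0 that by metis
  have 1: "L2 u = 0 \<longleftrightarrow> sole_succs A u = {}"
  proof
    assume "L2 u = 0"
    then show "sole_succs A u = {}" using L1[OF u] L2[OF u] by auto
  next
    assume e: "sole_succs A u = {}"
    then have "L0 u = 0" using L0 lu by auto
    then have "L1 u = 0" using L1[OF u] e by auto
    then show "L2 u = 0" using L2[OF u] e by auto
  qed
  have L1': "\<exists>l. L1 u = Suc l \<and> l \<in> sole_succs A u \<and> l \<notin> C" if "L1 u \<noteq> 0"
  proof (cases "L0 u = 0")
    case True
    then show ?thesis using L1[OF u] that by auto
  next
    case False
    then show ?thesis using L0 L1[OF u] lu by auto
  qed
  have 2: "l \<in> sole_succs A u \<and> (l \<in> C \<longrightarrow> sole_succs A u \<subseteq> C)" if l: "L2 u = Suc l" for l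
  proof (cases "L1 u = 0")
    case True
    then have "sole_succs A u \<inter> - C = {}" using L1[OF u] by auto
    then show ?thesis using L2[OF u] True l by auto
  next
    case False
    then show ?thesis using L1' L2[OF u] l by auto
  qed
  have 3: "(sole_succs A u = {} \<longrightarrow> H u = 0) \<and> (\<forall>v\<in>sole_succs A u. H u \<le> Suc (H v)) \<and>
       (\<forall>l. L2 u = Suc l \<longrightarrow> H u = Suc (H l))" if "below u"
  proof -
    have lows: "low q u = sole_succs A u" using that lu by (auto simp: below_def)
    have "H u = Suc (H l)" if l: "L2 u = Suc l" for l
    proof -
      have "low q u \<noteq> {}" using 1 l lows by simp
      then obtain l' where "l' \<in> low q u" "L0 u = Suc l'" "H u = Suc (H l')" using l0 by blast
      then show ?thesis using L1[OF u] L2[OF u] l by auto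
    qed
    then show ?thesis using l0 lows by auto
  qed
  show "(L2 u = 0 \<longleftrightarrow> sole_succs A u = {}) \<and>
     (\<forall>l. L2 u = Suc l \<longrightarrow> l \<in> sole_succs A u \<and> (l \<in> C \<longrightarrow> sole_succs A u \<subseteq> C)) \<and>
     (below u \<longrightarrow> (sole_succs A u = {} \<longrightarrow> H u = 0) \<and> (\<forall>v\<in>sole_succs A u. H u \<le> Suc (H v)) \<and>
       (\<forall>l. L2 u = Suc l \<longrightarrow> H u = Suc (H l)))"
    using 1 2 3 by blast
qed

definition base_of :: "(nat \<Rightarrow> nat) \<Rightarrow> nat set" where
  "base_of L = {v \<in> V. preds A v = {} \<or> (\<exists>u. v \<in> sole_succs A u \<and> L u \<noteq> Suc v)}"

lemma base_of_chosen:
  assumes ch: "chosen L H"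
  shows "base_set V A (base_of L)" "ring_averse A C (base_of L)" "heights (base_of L) H"
proof -
  have sole_V: "v \<in> V \<and> u < n" if "v \<in> sole_succs A u" for u v
  proof -
    have "(u, v) \<in> A" using that unfolding sole_succs_def by blast
    then show ?thesis using arc_V arc_less by blast
  qed
  have mem: "v \<in> base_of L \<longleftrightarrow> L u \<noteq> Suc v" if "v \<in> sole_succs A u" for u v
  proof -
    have "preds A v \<noteq> {}" using that by (simp add: sole_succs_def)
    moreover have "u' = u" if "v \<in> sole_succs A u'" for u' using sole_succs_inj[OF that \<open>v \<in> sole_succs A u\<close>] .
    ultimately show ?thesis using that sole_V[OF that] unfolding base_of_def by blast
  qed
  show "base_set V A (base_of L)"
    unfolding base_set_def
  proof (intro conjI ballI allI impI)
    fix u assume u: "sole_succs A u \<noteq> {}"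
    then obtain v where "v \<in> sole_succs A u" by blast
    then have un: "u < n" using sole_V by blast
    then obtain l where l: "L u = Suc l" using ch u unfolding chosen_def by (metis not0_implies_Suc)
    then have ls: "l \<in> sole_succs A u" using ch un by (auto simp: chosen_def)
    show "\<exists>!v. v \<in> sole_succs A u - base_of L"
      by (rule ex1I[of _ l]) (use mem[of _ u] l ls in auto)
  qed (auto simp: base_of_def)
  have out: "u < n \<and> L u = Suc v" if "v \<in> sole_succs A u - base_of L" for u v
    using that mem sole_V by blast
  show "ring_averse A C (base_of L)"
    unfolding ring_averse_def using out ch unfolding chosen_def by blast
  show "heights (base_of L) H"
    unfolding heights_def
  proof (intro allI impI)
    fix u assume b: "below u"
    then have "u \<in> V" by (simp add: below_def)
    then have "u < n" using V by simp
    then show "(sole_succs A u = {} \<longrightarrow> H u = 0) \<and> (\<forall>v\<in>sole_succs A u. H u \<le> Suc (H v)) \<and>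
      (\<forall>v\<in>sole_succs A u - base_of L. H u = Suc (H v))"
      using ch b out unfolding chosen_def by blast
  qed
qed

lemma runs_fill_base:
  assumes inp: "inp r0 a0" and g: "in_arcs a0" and L: "\<And>u. u < n \<Longrightarrow> a0 ''L'' u \<le> n" and X: "\<And>v. a0 ''X'' v = 0"
  shows "lin (For ''v'' ''n'' fill_base) r0 a0 (tm fill_base + 10)
    (\<lambda>r a. inp r a \<and> eq_off {''X''} a0 a \<and> eq_off {''v'', ''u''} r0 r \<and>
      (\<forall>v<n. a ''X'' v = (if v \<in> base_of (a0 ''L'') then 1 else 0)))"
proof -
  let ?B = "base_of (a0 ''L'')"
  let ?I = "\<lambda>k r a. inp r a \<and> eq_off {''X''} a0 a \<and> eq_off {''v'', ''u''} r0 r \<and>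
      (\<forall>v<n. a ''X'' v = (if v \<in> ?B \<and> v < k then 1 else 0))"
  have "runs W (For ''v'' ''n'' fill_base) r0 a0 ((tm fill_base + 10) * Suc n) (\<lambda>r a. ?I n r a \<and> r ''v'' = n)"
  proof (rule runs_For[where I = ?I])
    show "r0 ''n'' = n" using inp by (simp add: inp_def)
    show "n < W" by (rule n_less_W)
    show "?I 0 (r0(''v'' := 0)) a0" using inp X by simp
  next
    fix k r a assume k: "k < n" "r ''v'' = k" "r ''n'' = n" and I: "?I k r a"
    have same: "a ''G'' = a0 ''G''" "a ''P'' = a0 ''P''" "a ''L'' = a0 ''L''" using I by (auto simp: eq_off_def)
    have g': "in_arcs a" using g same by (simp add: in_arcs_def)
    have G: "a ''G'' k = card (preds A k)" using g' k by (simp add: in_arcs_def)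
    have Gb: "a ''G'' k \<le> W" using G preds_bound(2)[of A k] n_less_W by simp
    have sole: "k \<in> sole_succs A u \<longleftrightarrow> a ''G'' k = Suc 0 \<and> a ''P'' k = u" for u
      using in_arcs_sole[OF g' k(1)] by simp
    have Pb: "a ''P'' k < n" if "0 < a ''G'' k"
    proof -
      have "preds A k \<noteq> {}" using G that by (metis card.empty less_numeral_extra(3))
      then show ?thesis using g' k preds_bound(1)[of A k] by (auto simp: in_arcs_def)
    qed
    have emp: "a ''G'' k = 0 \<longleftrightarrow> preds A k = {}" using G preds_bound(3)[of A k] by simp
    have kV: "k \<in> V" using k V by simp
    have B: "k \<in> ?B \<longleftrightarrow> a ''G'' k = 0 \<or> a ''G'' k = Suc 0 \<and> a ''L'' (a ''P'' k) \<noteq> Suc k"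
      unfolding base_of_def using sole emp kV same(3) by auto
    have Wb: "Suc 0 \<le> W" "k \<le> W" "Suc k \<le> W" using n_less_W n_ge_3 k by auto
    have Wb2: "a ''P'' k \<le> W" "a ''L'' (a ''P'' k) \<le> W" if "a ''G'' k = Suc 0"
      using Pb that n_less_W L[of "a ''P'' k"] same(3) by auto
    show "wp W fill_base (\<lambda>r' a'. r' ''v'' = k \<and> r' ''n'' = n \<and> ?I (Suc k) (r'(''v'' := Suc k)) a') r a"
      unfolding fill_base_def
      using I k B Gb Wb Wb2 by (auto simp: less_Suc_eq)
  qed simp
  then have "lin (For ''v'' ''n'' fill_base) r0 a0 (tm fill_base + 10) (\<lambda>r a. ?I n r a \<and> r ''v'' = n)"
    by (rule lin_of_runs) simp
  then show ?thesis by (elim lin_mono) auto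
qed

definition tables :: "nat set \<Rightarrow> (string \<Rightarrow> nat \<Rightarrow> nat) \<Rightarrow> bool" where
  "tables B a \<longleftrightarrow> heights B (a ''H'') \<and> (\<forall>v<n. (0 < a ''D'' v \<longleftrightarrow> v \<in> C) \<and> a ''D'' v \<le> n \<and>
     a ''G'' v = card (preds A v) \<and> (a ''L'' v = 0 \<longleftrightarrow> sole_succs A v = {}) \<and> a ''L'' v \<le> n \<and> a ''H'' v \<le> n)"

definition marked :: "nat set \<Rightarrow> (string \<Rightarrow> nat \<Rightarrow> nat) \<Rightarrow> bool" where
  "marked B a \<longleftrightarrow> B \<subseteq> V \<and> (\<forall>v<n. a ''X'' v = (if v \<in> B then 1 else 0))"

definition k_base :: nat where
  "k_base = (tm choose_low + 10) + ((tm (choose_any off_ring) + 10) + ((tm (choose_any anywhere) + 10) +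
     ((tm fill_base + 10) + 1)))"

lemma runs_choose_base:
  assumes inp: "inp r0 a0" and q: "ring_found q r0 a0" and g: "in_arcs a0"
    and zero: "\<And>v. a0 ''L'' v = 0" "\<And>v. a0 ''H'' v = 0" "\<And>v. a0 ''X'' v = 0"
  shows "lin choose_base r0 a0 k_base
    (\<lambda>r a. inp r a \<and> eq_off {''L'', ''H'', ''X''} a0 a \<and> eq_off {''i'', ''v'', ''u'', ''q''} r0 r \<and>
      (\<exists>B. base_set V A B \<and> ring_averse A C B \<and> marked B a \<and> tables B a))"
proof -
  let ?F = "\<lambda>r a. inp r a \<and> eq_off {''L'', ''H'', ''X''} a0 a \<and> eq_off {''i'', ''v'', ''u'', ''q''} r0 r"
  let ?Q1 = "\<lambda>r a. ?F r a \<and> lowest q (a ''L'') (a ''H'') \<and> a ''X'' = a0 ''X''"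
  let ?Q2 = "\<lambda>r a. ?F r a \<and> (\<exists>L0. lowest q L0 (a ''H'') \<and> (\<forall>u<n. a ''L'' u \<le> n \<and> (L0 u \<noteq> 0 \<longrightarrow> a ''L'' u = L0 u) \<and>
        (L0 u = 0 \<longrightarrow> a ''L'' u = 0 \<and> sole_succs A u \<inter> - C = {} \<or> (\<exists>l. a ''L'' u = Suc l \<and> l \<in> sole_succs A u \<inter> - C)))) \<and>
        a ''X'' = a0 ''X''"
  let ?Q3 = "\<lambda>r a. ?F r a \<and> chosen (a ''L'') (a ''H'') \<and> (\<forall>u<n. a ''L'' u \<le> n) \<and> (\<forall>u<n. a ''H'' u \<le> n) \<and> a ''X'' = a0 ''X''"
  let ?Q4 = "\<lambda>r a. ?F r a \<and> (\<exists>B. base_set V A B \<and> ring_averse A C B \<and> marked B a \<and> tables B a)"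
  have sq: "set q = V - C" and lenq: "length q \<le> n"
  proof -
    show sq: "set q = V - C" using q by (simp add: ring_found_def)
    have "length q = card (set q)" using q unfolding ring_found_def by (metis distinct_card)
    also have "\<dots> \<le> card V" unfolding sq using finite_V by (intro card_mono) auto
    finally show "length q \<le> n" using V by simp
  qed
  have D: "(0 < a0 ''D'' v \<longleftrightarrow> v \<in> C) \<and> a0 ''D'' v \<le> n" if "v < n" for v
    using q that V unfolding ring_found_def by (cases "v \<in> C") auto
  have arcs: "in_arcs a" if "?F r a" for r a
  proof -
    have "a ''G'' = a0 ''G''" "a ''P'' = a0 ''P''" using that by (auto simp: eq_off_def)
    then show ?thesis using g by (simp add: in_arcs_def)
  qed
  have Dsame: "a ''D'' = a0 ''D''" if "?F r a" for r a using that by (auto simp: eq_off_def)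
  have 1: "lin (For ''i'' ''r'' choose_low) r0 a0 (tm choose_low + 10) ?Q1"
    by (rule lin_mono[OF runs_choose_low[OF inp q g zero(1,2)] order_refl]) (auto simp: eq_off_def)
  have 2: "lin (For ''v'' ''n'' (choose_any off_ring)) r1 a1 (tm (choose_any off_ring) + 10) ?Q2" if I: "?Q1 r1 a1" for r1 a1
  proof (rule lin_mono[OF runs_choose_any[where P = "- C"] order_refl])
    show "inp r1 a1" "in_arcs a1" using I arcs by blast+
    show "a1 ''L'' u \<le> n" if "u < n" for u
    proof -
      have "\<forall>l\<in>low q u. l < n" using sq V by (auto simp: low_def)
      then show ?thesis using I that unfolding lowest_def by (metis Suc_leI le0)
    qed
    show "cond_fits W (mem r a) off_ring \<and> (holds (mem r a) off_ring \<longleftrightarrow> r ''v'' \<in> - C)"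
      if "inp r a" "eq_off {''L''} a1 a" "r ''v'' < n" for r a
    proof -
      have "a ''D'' = a0 ''D''" using that Dsame[of r1 a1] I by (auto simp: eq_off_def)
      then show ?thesis using D[OF that(3)] n_less_W that n_ge_3 by (auto simp: off_ring_def)
    qed
  next
    fix r a
    assume post: "inp r a \<and> eq_off {''L''} a1 a \<and> eq_off {''v'', ''u''} r1 r \<and>
      (\<forall>u<n. a ''L'' u \<le> n \<and> (a1 ''L'' u \<noteq> 0 \<longrightarrow> a ''L'' u = a1 ''L'' u) \<and>
        (a1 ''L'' u = 0 \<longrightarrow> a ''L'' u = 0 \<and> sole_succs A u \<inter> - C = {} \<or>
          (\<exists>l. a ''L'' u = Suc l \<and> l \<in> sole_succs A u \<inter> - C)))"
    then have "a ''H'' = a1 ''H''" "a ''X'' = a1 ''X''" "?F r a" using I by (auto simp: eq_off_def)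
    then show "?Q2 r a" using post I by (intro conjI exI[of _ "a1 ''L''"]) simp_all
  qed
  have 3: "lin (For ''v'' ''n'' (choose_any anywhere)) r1 a1 (tm (choose_any anywhere) + 10) ?Q3" if I: "?Q2 r1 a1" for r1 a1
  proof (rule lin_mono[OF runs_choose_any[where P = "UNIV"] order_refl])
    show "inp r1 a1" "in_arcs a1" using I arcs by blast+
    show "a1 ''L'' u \<le> n" if "u < n" for u using I that by auto
    show "cond_fits W (mem r a) anywhere \<and> (holds (mem r a) anywhere \<longleftrightarrow> r ''v'' \<in> UNIV)" for r a
      using n_less_W n_ge_3 by (simp add: anywhere_def)
  next
    fix r a
    assume post: "inp r a \<and> eq_off {''L''} a1 a \<and> eq_off {''v'', ''u''} r1 r \<and>
      (\<forall>u<n. a ''L'' u \<le> n \<and> (a1 ''L'' u \<noteq> 0 \<longrightarrow> a ''L'' u = a1 ''L'' u) \<and>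
        (a1 ''L'' u = 0 \<longrightarrow> a ''L'' u = 0 \<and> sole_succs A u \<inter> UNIV = {} \<or>
          (\<exists>l. a ''L'' u = Suc l \<and> l \<in> sole_succs A u \<inter> UNIV)))"
    then have F: "a ''H'' = a1 ''H''" "a ''X'' = a1 ''X''" "?F r a" using I by (auto simp: eq_off_def)
    obtain L0 where L0: "lowest q L0 (a1 ''H'')" "\<And>u. u < n \<Longrightarrow> (L0 u \<noteq> 0 \<longrightarrow> a1 ''L'' u = L0 u) \<and>
        (L0 u = 0 \<longrightarrow> a1 ''L'' u = 0 \<and> sole_succs A u \<inter> - C = {} \<or> (\<exists>l. a1 ''L'' u = Suc l \<and> l \<in> sole_succs A u \<inter> - C))"
      using I by blast
    have "chosen (a ''L'') (a1 ''H'')" by (rule chosenI[OF sq L0]) (use post in blast)+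
    moreover have "\<forall>u<n. a1 ''H'' u \<le> n" using L0(1) lenq unfolding lowest_def by (meson order_trans)
    ultimately show "?Q3 r a" using post I F by simp
  qed
  have 4: "lin (For ''v'' ''n'' fill_base) r1 a1 (tm fill_base + 10) ?Q4" if I: "?Q3 r1 a1" for r1 a1
  proof (rule lin_mono[OF runs_fill_base order_refl])
    show "inp r1 a1" "in_arcs a1" using I arcs by blast+
    show "a1 ''L'' u \<le> n" if "u < n" for u using I that by auto
    show "a1 ''X'' v = 0" for v using I zero by simp
  next
    fix r a
    assume post: "inp r a \<and> eq_off {''X''} a1 a \<and> eq_off {''v'', ''u''} r1 r \<and>
      (\<forall>v<n. a ''X'' v = (if v \<in> base_of (a1 ''L'') then 1 else 0))"
    let ?B = "base_of (a1 ''L'')"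
    have F: "?F r a" "a ''L'' = a1 ''L''" "a ''H'' = a1 ''H''" using I post by (auto simp: eq_off_def)
    have B: "base_set V A ?B" "ring_averse A C ?B" "heights ?B (a1 ''H'')" using base_of_chosen I by blast+
    have "marked ?B a" using post by (auto simp: marked_def base_of_def)
    moreover have "tables ?B a"
      unfolding tables_def using B(3) F I D Dsame[OF F(1)] arcs[OF F(1)]
      by (auto simp: chosen_def in_arcs_def)
    ultimately show "?Q4 r a" using F(1) B by blast
  qed
  have c4: "lin (Seq (For ''v'' ''n'' fill_base) Skip) r1 a1 (tm fill_base + 10 + 1) ?Q4" if "?Q3 r1 a1" for r1 a1
    by (rule lin_Seq[OF 4[OF that]], rule lin_Skip)
  have c3: "lin (Seq (For ''v'' ''n'' (choose_any anywhere)) (Seq (For ''v'' ''n'' fill_base) Skip)) r1 a1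
      (tm (choose_any anywhere) + 10 + (tm fill_base + 10 + 1)) ?Q4" if "?Q2 r1 a1" for r1 a1
    by (rule lin_Seq[OF 3[OF that]], rule c4)
  have c2: "lin (Seq (For ''v'' ''n'' (choose_any off_ring)) (Seq (For ''v'' ''n'' (choose_any anywhere))
      (Seq (For ''v'' ''n'' fill_base) Skip))) r1 a1
      (tm (choose_any off_ring) + 10 + (tm (choose_any anywhere) + 10 + (tm fill_base + 10 + 1))) ?Q4"
    if "?Q1 r1 a1" for r1 a1
    by (rule lin_Seq[OF 2[OF that]], rule c3)
  have "lin choose_base r0 a0 k_base ?Q4"
    unfolding choose_base_def block.simps k_base_def
    by (rule lin_Seq[OF 1], rule c2)
  then show ?thesis by (rule lin_mono) auto
qed

end

section \<open>Surveying the ring\<close>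

text \<open>
  The arrays \<open>A\<close> and \<open>B\<close> receive the ring predecessors of a ring vertex, \<open>R\<close> counts them; the
  registers \<open>e\<close> and \<open>a\<close> count the arcs entering the ring and keep the tail of the last one.
\<close>

definition scan_ring :: com where
  "scan_ring = block [Assign ''u'' (cell ''tail'' ''i''), Assign ''v'' (cell ''head'' ''i''),
     Branch (Less (Num 0) (cell ''D'' ''v''))
       (Branch (Less (Num 0) (cell ''D'' ''u''))
         (block [Write ''B'' (Reg ''v'') (cell ''A'' ''v''), Write ''A'' (Reg ''v'') (Reg ''u''),
            Write ''R'' (Reg ''v'') (Plus (cell ''R'' ''v'') one)])
         (block [Assign ''e'' (Plus (Reg ''e'') one), Assign ''a'' (Reg ''u'')]))
       Skip]"

text \<open>
  The register \<open>c\<close> counts the sinks of the ring, \<open>w\<close> and \<open>y\<close> are the last two of them; \<open>z\<close> is some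
  ring vertex, and \<open>h\<close> tells whether the base set hits the ring.
\<close>

definition scan_sinks :: com where
  "scan_sinks = Branch (Less (Num 0) (cell ''D'' ''v''))
     (block [Assign ''z'' (Reg ''v''),
        Branch (Eq (cell ''X'' ''v'') one) (Assign ''h'' one) Skip,
        Branch (Eq (cell ''R'' ''v'') (Num 2))
          (block [Assign ''y'' (Reg ''w''), Assign ''w'' (Reg ''v''), Assign ''c'' (Plus (Reg ''c'') one)]) Skip])
     Skip"

definition survey_ring :: com where
  "survey_ring = block [For ''i'' ''m'' scan_ring, For ''v'' ''n'' scan_sinks]"

section \<open>Correctness of the survey\<close>

context ring_input
begin

lemma card_ring_preds: "v \<in> C \<Longrightarrow> card (preds A v \<inter> C) \<le> 2"
proof -
  assume "v \<in> C"
  then obtain d where d: "oriented_ring V A f N d" "d ` {..<N} = C" "d 0 = v" using coords_from by blast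
  interpret d: oriented_ring V A f N d by fact
  have "d.C = C" using d by (simp add: d.C_def)
  then have "preds A v \<inter> C \<subseteq> {d 1, d (N - 1)}" using d.in_C_pred_c0 d(3) by auto
  then have "card (preds A v \<inter> C) \<le> card {d 1, d (N - 1)}" by (intro card_mono) auto
  also have "\<dots> \<le> 2" by (simp add: card_insert_if)
  finally show ?thesis .
qed

lemma sinks_iff: assumes "v \<in> C" shows "v \<in> sinks \<longleftrightarrow> card (preds A v \<inter> C) = 2"
proof
  assume "v \<in> sinks"
  then obtain p q where "p \<noteq> q" "p \<in> preds A v \<inter> C" "q \<in> preds A v \<inter> C" by (auto simp: sinks_in_def)
  moreover have "finite (preds A v \<inter> C)" using preds_bound(3)[of A v] by simp
  ultimately have "2 \<le> card (preds A v \<inter> C)" using card_ge_2 by metis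
  then show "card (preds A v \<inter> C) = 2" using card_ring_preds[OF assms] by simp
next
  assume "card (preds A v \<inter> C) = 2"
  then obtain p q where "preds A v \<inter> C = {p, q}" "p \<noteq> q" by (auto simp: card_2_iff)
  then have "p \<in> preds A v \<inter> C" "q \<in> preds A v \<inter> C" "p \<noteq> q" by auto
  then show "v \<in> sinks" using assms unfolding sinks_in_def by blast
qed

definition entering :: "(nat \<times> nat) set \<Rightarrow> (nat \<times> nat) set" where
  "entering B = {(u, v) \<in> B. u \<notin> C \<and> v \<in> C}"

text \<open>A vertex off the ring has at most one arc onto the ring, namely to its parent, so
  counting arcs counts entries.\<close>

lemma card_entering: "card (entering A) = card (entries A C)"
proof -
  have "fst ` entering A = entries A C" by (force simp: entering_def entries_def)
  moreover have "inj_on fst (entering A)"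
  proof (rule inj_onI)
    fix x y assume "x \<in> entering A" "y \<in> entering A" "fst x = fst y"
    moreover have "v = f u" if "(u, v) \<in> entering A" for u v
      using that off_ring_pred[of u v] by (auto simp: entering_def)
    ultimately show "x = y" by (metis prod.collapse)
  qed
  ultimately show ?thesis using card_image by metis
qed

lemma finite_entries: "finite (entries A C)"
  by (rule finite_subset[OF _ finite_V]) (use arc_V in \<open>auto simp: entries_def\<close>)

definition ring_scanned :: "(nat \<times> nat) set \<Rightarrow> (string \<Rightarrow> nat) \<Rightarrow> (string \<Rightarrow> nat \<Rightarrow> nat) \<Rightarrow> bool" where
  "ring_scanned B r a \<longleftrightarrow> (\<forall>v<n. a ''A'' v \<le> n \<and> a ''B'' v \<le> n \<and> (v \<notin> C \<longrightarrow> a ''R'' v = 0)) \<and>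
     (\<forall>v\<in>C. a ''R'' v = card (preds B v \<inter> C) \<and> (1 \<le> a ''R'' v \<longrightarrow> a ''A'' v \<in> preds B v \<inter> C) \<and>
        (2 \<le> a ''R'' v \<longrightarrow> a ''B'' v \<in> preds B v \<inter> C \<and> a ''A'' v \<noteq> a ''B'' v)) \<and>
     r ''e'' = card (entering B) \<and> (0 < r ''e'' \<longrightarrow> r ''a'' \<in> entries A C) \<and> r ''a'' \<le> n"

lemma runs_scan_ring:
  assumes inp: "inp r0 a0" and D: "\<And>v. v < n \<Longrightarrow> (0 < a0 ''D'' v \<longleftrightarrow> v \<in> C) \<and> a0 ''D'' v \<le> n"
    and zero: "\<And>v. a0 ''A'' v = 0" "\<And>v. a0 ''B'' v = 0" "\<And>v. a0 ''R'' v = 0" "r0 ''e'' = 0" "r0 ''a'' = 0"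
  shows "lin (For ''i'' ''m'' scan_ring) r0 a0 (tm scan_ring + 10)
    (\<lambda>r a. inp r a \<and> ring_scanned A r a \<and> eq_off {''A'', ''B'', ''R''} a0 a \<and> eq_off {''i'', ''u'', ''v'', ''e'', ''a''} r0 r)"
proof -
  let ?J = "\<lambda>r a. inp r a \<and> eq_off {''A'', ''B'', ''R''} a0 a \<and> eq_off {''i'', ''u'', ''v'', ''e'', ''a''} r0 r"
  let ?I = "\<lambda>k r a. ?J r a \<and> ring_scanned (set (take k as)) r a"
  have "runs W (For ''i'' ''m'' scan_ring) r0 a0 ((tm scan_ring + 10) * Suc (length as))
    (\<lambda>r a. ?I (length as) r a \<and> r ''i'' = length as)"
  proof (rule runs_For[where I = ?I])
    show "r0 ''m'' = length as" using inp by (simp add: inp_def)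
    show "length as < W" by (rule m_less_W)
    show "?I 0 (r0(''i'' := 0)) a0" using inp zero by (simp add: ring_scanned_def entering_def)
  next
    fix k r a assume k: "k < length as" and i: "r ''i'' = k" and m: "r ''m'' = length as" and I: "?I k r a"
    obtain u v where uv: "as ! k = (u, v)" by (cases "as ! k")
    let ?B = "set (take k as)"
    have B: "?B \<subseteq> A" using set_as set_take_subset by metis
    have "(u, v) \<in> A" using set_as k uv by (metis nth_mem)
    moreover have new: "(u, v) \<notin> ?B"
    proof
      assume "(u, v) \<in> ?B"
      then obtain j where "j < k" "as ! j = as ! k" using k uv by (auto simp: in_set_conv_nth)
      then show False using distinct_as k by (simp add: nth_eq_iff_index_eq)
    qed
    ultimately have uvA: "(u, v) \<in> A" by simp
    have lt: "u < n" "v < n" using uvA arc_less by auto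
    have rd: "a ''tail'' k = u" "a ''head'' k = v" using I k uv by (auto simp: inp_def)
    have sc: "ring_scanned ?B r a" using I by simp
    have ins: "set (take (Suc k) as) = insert (u, v) ?B" using k uv by (simp add: take_Suc_conv_app_nth)
    have "a ''D'' = a0 ''D''" using I by (auto simp: eq_off_def)
    then have Du: "0 < a ''D'' u \<longleftrightarrow> u \<in> C" "0 < a ''D'' v \<longleftrightarrow> v \<in> C" "a ''D'' u \<le> W" "a ''D'' v \<le> W"
      using D[OF lt(1)] D[OF lt(2)] n_less_W by auto
    have finB: "finite ?B" by simp
    have eB: "card (entering ?B) \<le> length as"
    proof -
      have "card (entering ?B) \<le> card ?B" by (intro card_mono) (auto simp: entering_def)
      then show ?thesis using card_length[of "take k as"] k by simp
    qed
    have finp: "finite (preds ?B v \<inter> C)" using preds_bound(3)[OF B, of v] by simp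
    have Rb: "a ''R'' v \<le> n"
    proof (cases "v \<in> C")
      case True
      have "card (preds ?B v \<inter> C) \<le> card (preds ?B v)" using preds_bound(3)[OF B, of v] by (intro card_mono) auto
      then show ?thesis using sc True preds_bound(2)[OF B, of v] by (simp add: ring_scanned_def)
    next
      case False
      then show ?thesis using sc lt by (simp add: ring_scanned_def)
    qed
    have Wb: "k \<le> W" "u \<le> W" "v \<le> W" "a ''A'' v \<le> W" "Suc (a ''R'' v) \<le> W" "a ''R'' v \<le> W" "Suc (r ''e'') \<le> W" "r ''e'' \<le> W" "Suc 0 \<le> W"
      using k m_less_W lt n_less_W sc Rb eB n_ge_3 by (auto simp: ring_scanned_def)
    let ?r = "r(''u'' := u, ''v'' := v)"
    have case1: "ring_scanned (insert (u, v) ?B) r' a'"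
      if "v \<in> C" "u \<in> C" "a' ''B'' = (a ''B'')(v := a ''A'' v)" "a' ''A'' = (a ''A'')(v := u)"
        "a' ''R'' = (a ''R'')(v := Suc (a ''R'' v))" "r' ''e'' = r ''e''" "r' ''a'' = r ''a''" for r' a'
    proof -
      have e: "entering (insert (u, v) ?B) = entering ?B" using that by (auto simp: entering_def)
      have p: "preds (insert (u, v) ?B) w \<inter> C = (if w = v then insert u (preds ?B w \<inter> C) else preds ?B w \<inter> C)" for w
        using that(2) by auto
      have "u \<notin> preds ?B v \<inter> C" using new by simp
      then show ?thesis
        using sc that lt finp new unfolding ring_scanned_def e p by (auto simp: numeral_2_eq_2)
    qed
    have case2: "ring_scanned (insert (u, v) ?B) r' a'"
      if "v \<in> C" "u \<notin> C" "a' ''A'' = a ''A''" "a' ''B'' = a ''B''" "a' ''R'' = a ''R''"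
        "r' ''e'' = Suc (r ''e'')" "r' ''a'' = u" for r' a'
    proof -
      have "entering (insert (u, v) ?B) = insert (u, v) (entering ?B)" using that by (auto simp: entering_def)
      moreover have "(u, v) \<notin> entering ?B" using new by (auto simp: entering_def)
      moreover have "finite (entering ?B)" using finB by (rule finite_subset[rotated]) (auto simp: entering_def)
      ultimately have e: "card (entering (insert (u, v) ?B)) = Suc (card (entering ?B))" by simp
      have p: "preds (insert (u, v) ?B) w \<inter> C = preds ?B w \<inter> C" for w using that(2) by auto
      have "u \<in> entries A C" using uvA that unfolding entries_def by blast
      then show ?thesis using sc that lt unfolding ring_scanned_def e p by auto
    qed
    have case3: "ring_scanned (insert (u, v) ?B) r' a'"
      if "v \<notin> C" "a' ''A'' = a ''A''" "a' ''B'' = a ''B''" "a' ''R'' = a ''R''" "r' ''e'' = r ''e''" "r' ''a'' = r ''a''" for r' a'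
    proof -
      have e: "entering (insert (u, v) ?B) = entering ?B" using that by (auto simp: entering_def)
      have p: "w \<in> C \<Longrightarrow> preds (insert (u, v) ?B) w = preds ?B w" for w using that(1) by auto
      show ?thesis using sc that unfolding ring_scanned_def e by (simp add: p del: insert_iff Collect_mem_eq)
    qed
    consider "v \<in> C" "u \<in> C" | "v \<in> C" "u \<notin> C" | "v \<notin> C" by blast
    then show "wp W scan_ring (\<lambda>r' a'. r' ''i'' = k \<and> r' ''m'' = length as \<and> ?I (Suc k) (r'(''i'' := Suc k)) a') r a"
    proof cases
      case 1
      then show ?thesis
        unfolding scan_ring_def ins using i m rd I Du Wb
        by simp (intro case1; simp)
    next
      case 2
      then show ?thesis
        unfolding scan_ring_def ins using i m rd I Du Wb
        by simp (intro case2; simp)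
    next
      case 3
      then show ?thesis
        unfolding scan_ring_def ins using i m rd I Du Wb
        by simp (intro case3; simp)
    qed
  qed simp
  then have "lin (For ''i'' ''m'' scan_ring) r0 a0 (tm scan_ring + 10) (\<lambda>r a. ?I (length as) r a \<and> r ''i'' = length as)"
    by (rule lin_of_runs) simp
  then show ?thesis by (elim lin_mono) (simp_all add: set_as)
qed

definition sinks_found :: "nat set \<Rightarrow> nat \<Rightarrow> (string \<Rightarrow> nat) \<Rightarrow> bool" where
  "sinks_found B k r \<longleftrightarrow> r ''h'' = (if B \<inter> C \<inter> {..<k} = {} then 0 else 1) \<and> r ''c'' = card (sinks \<inter> {..<k}) \<and>
     (1 \<le> r ''c'' \<longrightarrow> r ''w'' \<in> sinks \<inter> {..<k}) \<and> (2 \<le> r ''c'' \<longrightarrow> r ''y'' \<in> sinks \<inter> {..<k} \<and> r ''y'' \<noteq> r ''w'') \<and>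
     (C \<inter> {..<k} \<noteq> {} \<longrightarrow> r ''z'' \<in> C) \<and> r ''w'' \<le> n \<and> r ''y'' \<le> n"

lemma runs_scan_sinks:
  assumes inp: "inp r0 a0" and D: "\<And>v. v < n \<Longrightarrow> (0 < a0 ''D'' v \<longleftrightarrow> v \<in> C) \<and> a0 ''D'' v \<le> n"
    and X: "marked B a0" and R: "ring_scanned A r0 a0"
    and zero: "r0 ''h'' = 0" "r0 ''c'' = 0" "r0 ''w'' = 0" "r0 ''y'' = 0"
  shows "lin (For ''v'' ''n'' scan_sinks) r0 a0 (tm scan_sinks + 10)
    (\<lambda>r a. inp r a \<and> a = a0 \<and> sinks_found B n r \<and> eq_off {''v'', ''z'', ''h'', ''y'', ''w'', ''c''} r0 r)"
proof -
  let ?I = "\<lambda>k r a. inp r a \<and> a = a0 \<and> sinks_found B k r \<and> eq_off {''v'', ''z'', ''h'', ''y'', ''w'', ''c''} r0 r"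
  have "runs W (For ''v'' ''n'' scan_sinks) r0 a0 ((tm scan_sinks + 10) * Suc n) (\<lambda>r a. ?I n r a \<and> r ''v'' = n)"
  proof (rule runs_For[where I = ?I])
    show "r0 ''n'' = n" using inp by (simp add: inp_def)
    show "n < W" by (rule n_less_W)
    show "?I 0 (r0(''v'' := 0)) a0" using inp zero by (simp add: sinks_found_def)
  next
    fix k r a assume k: "k < n" "r ''v'' = k" "r ''n'' = n" and I: "?I k r a"
    have a: "a = a0" using I by blast
    have sf: "sinks_found B k r" using I by blast
    have Xk: "a0 ''X'' k = Suc 0 \<longleftrightarrow> k \<in> B" "a0 ''X'' k \<le> W"
      using X k n_less_W by (auto simp: marked_def)
    have Rk: "k \<in> C \<Longrightarrow> a0 ''R'' k = 2 \<longleftrightarrow> k \<in> sinks" "k \<in> C \<Longrightarrow> a0 ''R'' k \<le> 2"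
      using R sinks_iff card_ring_preds by (auto simp: ring_scanned_def)
    have "card (sinks \<inter> {..<k}) \<le> card {..<k}" by (intro card_mono) auto
    then have cb: "r ''c'' < W" using sf k n_less_W by (simp add: sinks_found_def)
    have Wb: "k \<le> W" "Suc 0 \<le> W" "2 \<le> W" "a0 ''D'' k \<le> W" "r ''w'' \<le> W" "Suc (r ''c'') \<le> W" "r ''c'' \<le> W"
      using k n_less_W n_ge_3 D[OF k(1)] sf cb by (auto simp: sinks_found_def)
    have Rw: "k \<in> C \<Longrightarrow> a0 ''R'' k \<le> W" using Rk(2) Wb(3) by (meson order_trans)
    have ins: "S \<inter> {..<Suc k} = (if k \<in> S then insert k (S \<inter> {..<k}) else S \<inter> {..<k})" for S
      by (auto simp: less_Suc_eq)
    have sC: "k \<in> sinks \<Longrightarrow> k \<in> C" by (simp add: sinks_in_def)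
    have cs: "card (sinks \<inter> {..<Suc k}) = (if k \<in> sinks then Suc (card (sinks \<inter> {..<k})) else card (sinks \<inter> {..<k}))"
      unfolding ins[of sinks] by simp
    have wk: "1 \<le> r ''c'' \<Longrightarrow> r ''w'' \<noteq> k" using sf by (auto simp: sinks_found_def)
    show "wp W scan_sinks (\<lambda>r' a'. r' ''v'' = k \<and> r' ''n'' = n \<and> ?I (Suc k) (r'(''v'' := Suc k)) a') r a"
    proof (cases "k \<in> C")
      case False
      then have "sinks_found B (Suc k) (r(''v'' := Suc k))"
        using sf sC unfolding sinks_found_def cs by (auto simp: ins less_Suc_eq)
      then show ?thesis unfolding scan_sinks_def using False a I k D[OF k(1)] Wb by auto
    next
      case True
      let ?r1 = "r(''z'' := k)"
      let ?r2 = "if k \<in> B then ?r1(''h'' := Suc 0) else ?r1"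
      \<comment> \<open>The old \<open>w\<close> moves to \<open>y\<close>. At the first sink this
        is the initial \<open>0\<close>, so \<open>y\<close> is meaningful from the second sink on
        only.\<close>
      let ?r3 = "if k \<in> sinks then ?r2(''y'' := r ''w'', ''w'' := k, ''c'' := Suc (r ''c'')) else ?r2"
      have "sinks_found B (Suc k) (?r3(''v'' := Suc k))"
        using sf True k wk unfolding sinks_found_def cs
        by (auto simp: ins less_Suc_eq)
      then show ?thesis unfolding scan_sinks_def
        using True a I k D[OF k(1)] Wb Xk Rk(1)[OF True] Rw[OF True]
        by (cases "k \<in> B"; cases "k \<in> sinks") (simp_all add: fun_upd_twist)
    qed
  qed simp
  then have "lin (For ''v'' ''n'' scan_sinks) r0 a0 (tm scan_sinks + 10) (\<lambda>r a. ?I n r a \<and> r ''v'' = n)"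
    by (rule lin_of_runs) simp
  then show ?thesis by (elim lin_mono) auto
qed

definition ring_preds :: "(string \<Rightarrow> nat \<Rightarrow> nat) \<Rightarrow> bool" where
  "ring_preds a \<longleftrightarrow> (\<forall>v<n. a ''A'' v \<le> n \<and> a ''B'' v \<le> n \<and> a ''R'' v \<le> 2) \<and>
     (\<forall>v\<in>C. a ''R'' v = card (preds A v \<inter> C) \<and> (a ''R'' v = 1 \<longrightarrow> preds A v \<inter> C = {a ''A'' v}) \<and>
        (a ''R'' v = 2 \<longrightarrow> preds A v \<inter> C = {a ''A'' v, a ''B'' v} \<and> a ''A'' v \<noteq> a ''B'' v))"

definition surveyed :: "nat set \<Rightarrow> (string \<Rightarrow> nat) \<Rightarrow> bool" where
  "surveyed B r \<longleftrightarrow> r ''e'' = card (entries A C) \<and> (0 < r ''e'' \<longrightarrow> r ''a'' \<in> entries A C) \<and> r ''a'' \<le> n \<and>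
     r ''h'' = (if B \<inter> C = {} then 0 else 1) \<and> r ''c'' = card sinks \<and>
     (1 \<le> r ''c'' \<longrightarrow> r ''w'' \<in> sinks) \<and> (2 \<le> r ''c'' \<longrightarrow> r ''y'' \<in> sinks \<and> r ''y'' \<noteq> r ''w'') \<and>
     r ''z'' \<in> C \<and> r ''w'' \<le> n \<and> r ''y'' \<le> n"

lemma ring_scanned_preds:
  assumes "ring_scanned A r a"
  shows "ring_preds a"
proof -
  have "(a ''R'' v = 1 \<longrightarrow> preds A v \<inter> C = {a ''A'' v}) \<and>
     (a ''R'' v = 2 \<longrightarrow> preds A v \<inter> C = {a ''A'' v, a ''B'' v} \<and> a ''A'' v \<noteq> a ''B'' v)" if v: "v \<in> C" for v
  proof -
    have s: "a ''R'' v = card (preds A v \<inter> C)" "1 \<le> a ''R'' v \<longrightarrow> a ''A'' v \<in> preds A v \<inter> C"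
      "2 \<le> a ''R'' v \<longrightarrow> a ''B'' v \<in> preds A v \<inter> C \<and> a ''A'' v \<noteq> a ''B'' v"
      using assms v unfolding ring_scanned_def by blast+
    have fin: "finite (preds A v \<inter> C)" using preds_bound(3)[of A v] by simp
    have 1: "preds A v \<inter> C = {a ''A'' v}" if "a ''R'' v = 1"
      using s that by (metis card_1_singletonE order_refl singletonD)
    have 2: "preds A v \<inter> C = {a ''A'' v, a ''B'' v} \<and> a ''A'' v \<noteq> a ''B'' v" if "a ''R'' v = 2"
    proof -
      have ab: "a ''A'' v \<noteq> a ''B'' v" "{a ''A'' v, a ''B'' v} \<subseteq> preds A v \<inter> C" using s that by auto
      then have "{a ''A'' v, a ''B'' v} = preds A v \<inter> C"
        using fin s(1) that by (intro card_subset_eq) auto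
      then show ?thesis using ab by simp
    qed
    show ?thesis using 1 2 by blast
  qed
  moreover have "a ''R'' v \<le> 2" if "v < n" for v
    using assms that card_ring_preds[of v] by (cases "v \<in> C") (auto simp: ring_scanned_def)
  ultimately show ?thesis using assms unfolding ring_preds_def ring_scanned_def by blast
qed

definition k_survey :: nat where
  "k_survey = (tm scan_ring + 10) + ((tm scan_sinks + 10) + 1)"

lemma runs_survey_ring:
  assumes inp: "inp r0 a0" and T: "tables B a0" and X: "marked B a0"
    and zero: "\<And>v. a0 ''A'' v = 0" "\<And>v. a0 ''B'' v = 0" "\<And>v. a0 ''R'' v = 0"
      "r0 ''e'' = 0" "r0 ''a'' = 0" "r0 ''h'' = 0" "r0 ''c'' = 0" "r0 ''w'' = 0" "r0 ''y'' = 0"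
  shows "lin survey_ring r0 a0 k_survey
    (\<lambda>r a. inp r a \<and> ring_preds a \<and> surveyed B r \<and> tables B a \<and> marked B a \<and> r ''k'' = r0 ''k'')"
proof -
  have D: "(0 < a0 ''D'' v \<longleftrightarrow> v \<in> C) \<and> a0 ''D'' v \<le> n" if "v < n" for v
    using T that by (simp add: tables_def)
  let ?Q1 = "\<lambda>r a. inp r a \<and> ring_scanned A r a \<and> eq_off {''A'', ''B'', ''R''} a0 a \<and> eq_off {''i'', ''u'', ''v'', ''e'', ''a''} r0 r"
  let ?Q2 = "\<lambda>r a. inp r a \<and> ring_preds a \<and> surveyed B r \<and> tables B a \<and> marked B a \<and> r ''k'' = r0 ''k''"
  have 1: "lin (For ''i'' ''m'' scan_ring) r0 a0 (tm scan_ring + 10) ?Q1"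
    by (rule runs_scan_ring[OF inp D zero(1-5)])
  have 2: "lin (For ''v'' ''n'' scan_sinks) r1 a1 (tm scan_sinks + 10) ?Q2" if I: "?Q1 r1 a1" for r1 a1
  proof -
    have same: "a1 ''D'' = a0 ''D''" "a1 ''X'' = a0 ''X''" "a1 ''H'' = a0 ''H''" "a1 ''L'' = a0 ''L''" "a1 ''G'' = a0 ''G''"
      "r1 ''h'' = 0" "r1 ''c'' = 0" "r1 ''w'' = 0" "r1 ''y'' = 0" "r1 ''k'' = r0 ''k''"
      using I zero by (auto simp: eq_off_def)
    have X1: "marked B a1" "tables B a1" using X T same by (simp_all add: marked_def tables_def)
    have R1: "ring_scanned A r1 a1" using I by blast
    show ?thesis
    proof (rule lin_mono[OF runs_scan_sinks[OF _ _ X1(1) R1 same(6-9)] order_refl])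
      show "inp r1 a1" using I by blast
      show "(0 < a1 ''D'' v \<longleftrightarrow> v \<in> C) \<and> a1 ''D'' v \<le> n" if "v < n" for v using D[OF that] same by simp
    next
      fix r a
      assume post: "inp r a \<and> a = a1 \<and> sinks_found B n r \<and> eq_off {''v'', ''z'', ''h'', ''y'', ''w'', ''c''} r1 r"
      have Cn: "C \<inter> {..<n} = C" "sinks \<inter> {..<n} = sinks" "B \<inter> C \<inter> {..<n} = B \<inter> C"
        using C_V V by (auto simp: sinks_in_def)
      have "C \<noteq> {}" using c_C[of 0] by blast
      moreover have "r ''e'' = r1 ''e''" "r ''a'' = r1 ''a''" "r ''k'' = r1 ''k''" using post by (auto simp: eq_off_def)
      moreover have "a = a1" "inp r a1" using post by auto
      ultimately show "?Q2 r a"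
        using post R1 X1 same ring_scanned_preds[OF R1] card_entering
        unfolding surveyed_def sinks_found_def Cn by (simp add: ring_scanned_def)
    qed
  qed
  show ?thesis
    unfolding survey_ring_def block.simps k_survey_def
    by (rule lin_Seq[OF 1], rule lin_Seq[OF 2], assumption, rule lin_Skip)
qed

end

section \<open>Testing a sink\<close>

text \<open>
  Follows a side of the sink \<open>s\<close> from \<open>u\<close> to its end: \<open>l\<close> is the length, \<open>g\<close> the last vertex but
  one, and \<open>o\<close> tells whether the side is clean.
\<close>

definition walk_step :: com where
  "walk_step = block [
     Branch (Conj (Eq (cell ''G'' ''u'') one) (Less (cell ''X'' ''u'') one)) Skip (Assign ''o'' (Num 0)),
     Assign ''g'' (Reg ''u''), Assign ''u'' (cell ''A'' ''u''), Assign ''l'' (Plus (Reg ''l'') one)]"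

text \<open>The walk begins at a neighbour of \<open>s\<close>, hence the length \<open>1\<close>
  and \<open>s\<close> as the last vertex but one.\<close>

definition start_walk :: com where
  "start_walk = block [Assign ''l'' one, Assign ''g'' (Reg ''s''), Assign ''o'' one]"

text \<open>Inside a side there is exactly one ring predecessor, stored in \<open>A\<close>; the
  source has none and stops the loop.\<close>

definition walk :: com where
  "walk = Seq start_walk (While (Eq (cell ''R'' ''u'') one) walk_step)"

definition save_walk :: com where
  "save_walk = block [Assign ''u1'' (Reg ''u''), Assign ''l1'' (Reg ''l''), Assign ''g1'' (Reg ''g''),
     Assign ''o1'' (Reg ''o''), Assign ''u'' (cell ''B'' ''s'')]"

definition walk_both :: com where
  "walk_both = Seq (Assign ''u'' (cell ''A'' ''s'')) (Seq walk (Seq save_walk walk))"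

text \<open>Walks ending at the same vertex express \<open>L1 + L2 = N\<close>. The side begun at
  \<open>A s\<close> is judged together with the sole successors of \<open>B s\<close>, and
  conversely. For a base set a positive entry of \<open>L\<close> already means that one of them is
  left out.\<close>

definition judge_single :: com where
  "judge_single = block [Assign ''b'' (Num 0), Branch (Eq (Reg ''u1'') (Reg ''u''))
     (block [
       Branch (Conj (Neg (Less (Reg ''l1'') (Reg ''l''))) (Conj (Eq (Reg ''o1'') one)
         (Less (Num 0) (Read ''L'' (cell ''B'' ''s''))))) (Assign ''b'' one) Skip,
       Branch (Conj (Neg (Less (Reg ''l'') (Reg ''l1''))) (Conj (Eq (Reg ''o'') one)
         (Less (Num 0) (Read ''L'' (cell ''A'' ''s''))))) (Assign ''b'' one) Skip]) Skip]"

text \<open>A trail of length \<open>l - 1\<close> must exist below \<open>t\<close>, hence the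
  comparison of \<open>l\<close> with \<open>H t + 1\<close>. \<open>G t = 2\<close> says that only
  the ring enters \<open>t\<close>. The order in which its two predecessors were scanned is
  arbitrary, so both are tried.\<close>

definition judge_double :: com where
  "judge_double = block [Assign ''b'' (Num 0),
     Branch (Conj (Eq (Reg ''l'') (Reg ''l1'')) (Conj (Conj (Eq (Reg ''o'') one) (Eq (Reg ''o1'') one))
       (Conj (Eq (cell ''G'' ''t'') (Num 2)) (Neg (Less (Plus (cell ''H'' ''t'') one) (Reg ''l''))))))
       (Branch (Conj (Eq (cell ''A'' ''t'') (Reg ''u1'')) (Eq (cell ''B'' ''t'') (Reg ''u''))) (Assign ''b'' one)
         (Branch (Conj (Eq (cell ''A'' ''t'') (Reg ''u'')) (Eq (cell ''B'' ''t'') (Reg ''u1''))) (Assign ''b'' one) Skip))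
       Skip]"

definition test_single :: com where "test_single = Seq walk_both judge_single"

definition test_double :: com where "test_double = Seq walk_both judge_double"

section \<open>Correctness of the sink tests\<close>

context ring_input
begin

text \<open>Apart from the marks, only facts that survive a change of \<open>X\<close>, so that the
  test can be repeated after an exchange.\<close>

definition known :: "nat set \<Rightarrow> (string \<Rightarrow> nat \<Rightarrow> nat) \<Rightarrow> bool" where
  "known B a \<longleftrightarrow> marked B a \<and> ring_preds a \<and> (\<forall>v<n. a ''G'' v = card (preds A v) \<and>
     (a ''L'' v = 0 \<longleftrightarrow> sole_succs A v = {}) \<and> a ''L'' v \<le> n \<and> a ''H'' v \<le> n)"

lemma N_le_n: "N \<le> n"
proof -
  have "card (c ` {..<N}) \<le> card V" using c_V finite_V by (rule card_mono[rotated])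
  then show ?thesis using card_image[OF c_inj] V by simp
qed

lemma C_less: "v \<in> C \<Longrightarrow> v < n" using C_V V by auto

definition k_walk :: nat where
  "k_walk = tm start_walk + (tm walk_step + cond_cost (Eq (cell ''R'' ''u'') one) + 1)"

lemma runs_walk:
  assumes d: "coords d" and s: "side A d L" "0 < L" "L < N" and K: "known B a0"
    and r0: "r0 ''u'' = d 1" "r0 ''s'' = d 0"
  shows "lin walk r0 a0 k_walk (\<lambda>r a. a = a0 \<and> r ''l'' = L \<and> r ''u'' = d L \<and> r ''g'' = d (L - 1) \<and>
    r ''o'' = (if clean A B d L then 1 else 0) \<and> eq_off {''l'', ''u'', ''g'', ''o''} r0 r)"
proof -
  interpret d: oriented_ring V A f N d using d by (simp add: coords_def)
  have dC: "d.C = C" using coords_C[OF d] .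
  have din: "d i \<in> C" "d i < n" if "i \<le> N" for i using dC d.c_C[OF that] C_less by auto
  let ?cl = "\<lambda>l. \<forall>i. 0 < i \<and> i < l \<longrightarrow> d i \<notin> B \<and> preds A (d i) = {d (Suc i)}"
  let ?I = "\<lambda>r a. a = a0 \<and> 0 < r ''l'' \<and> r ''l'' \<le> L \<and> r ''u'' = d (r ''l'') \<and> r ''g'' = d (r ''l'' - 1) \<and>
    r ''o'' = (if ?cl (r ''l'') then 1 else 0) \<and> eq_off {''l'', ''u'', ''g'', ''o''} r0 r"
  have K': "marked B a0" "ring_preds a0" "\<And>v. v < n \<Longrightarrow> a0 ''G'' v = card (preds A v)"
    using K by (auto simp: known_def)
  have RC: "a0 ''R'' v = card (preds A v \<inter> C)" "a0 ''R'' v = 1 \<Longrightarrow> preds A v \<inter> C = {a0 ''A'' v}" if "v \<in> C" for v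
    using K'(2) that unfolding ring_preds_def by blast+
  have inner: "preds A (d i) \<inter> C = {d (Suc i)}" if "0 < i" "i < L" for i
  proof -
    have "(d i, d (i - 1)) \<in> A" using s(1) that by (metis side_def Suc_diff_1 less_imp_diff_less)
    then have no: "(d (i - 1), d i) \<notin> A" using arc_asym by blast
    have "u = d (Suc i)" if "(u, d i) \<in> A" "u \<in> C" for u
      using d.pred_of_ring[OF that(1)] \<open>0 < i\<close> \<open>i < L\<close> s(3) that dC no by auto
    moreover have "(d (Suc i), d i) \<in> A" using s(1) that by (simp add: side_def)
    moreover have "d (Suc i) \<in> C" using din that s(3) by simp
    ultimately show ?thesis by blast
  qed
  have last: "preds A (d L) \<inter> C = {}"
  proof -
    have "(d L, d (L - 1)) \<in> A" using s by (metis side_def Suc_diff_1 diff_less zero_less_one)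
    then have "(d (L - 1), d L) \<notin> A" using arc_asym by blast
    moreover have "(d (Suc L), d L) \<notin> A" using s(1) arc_asym by (auto simp: side_def)
    ultimately show ?thesis using d.pred_of_ring[of _ L] s dC by blast
  qed
  \<comment> \<open>The loop test holds exactly before the end of the side.\<close>
  have R1: "a0 ''R'' (d i) = 1 \<longleftrightarrow> i < L" if "0 < i" "i \<le> L" for i
  proof (cases "i < L")
    case True
    then show ?thesis using RC(1)[OF din(1), of i] inner[of i] that s by simp
  next
    case False
    then show ?thesis using RC(1)[OF din(1), of i] last that s by simp
  qed
  have A1: "a0 ''A'' (d i) = d (Suc i)" if "0 < i" "i < L" for i
  proof -
    have "preds A (d i) \<inter> C = {a0 ''A'' (d i)}" by (rule RC(2)[OF din(1)]) (use R1[of i] that s in auto)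
    then show ?thesis using inner[OF that] by simp
  qed
  have good: "a0 ''G'' (d i) = Suc 0 \<and> a0 ''X'' (d i) = 0 \<longleftrightarrow> d i \<notin> B \<and> preds A (d i) = {d (Suc i)}" if i: "0 < i" "i < L" for i
  proof -
    have lt: "d i < n" using din i s by simp
    have "card (preds A (d i)) = 1 \<longleftrightarrow> preds A (d i) = {d (Suc i)}"
    proof
      assume "card (preds A (d i)) = 1"
      moreover have "d (Suc i) \<in> preds A (d i)" using inner[OF i] by blast
      ultimately show "preds A (d i) = {d (Suc i)}" by (metis card_1_singletonE singletonD)
    qed simp
    then show ?thesis using K'(1) K'(3)[OF lt] lt by (auto simp: marked_def)
  qed
  have XW: "a0 ''X'' v \<le> W" "a0 ''G'' v \<le> W" "a0 ''R'' v \<le> W" "a0 ''A'' v \<le> W" if "v < n" for v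
    using that K' preds_bound(2)[of A v] n_less_W n_ge_3 by (auto simp: marked_def ring_preds_def intro: order_trans)
  have 1: "lin start_walk r0 a0 (tm start_walk) ?I"
    by (rule lin_wp) (use r0 s(2,3) din[of 0] n_less_W n_ge_3 in \<open>auto simp: start_walk_def\<close>)
  have 2: "lin (While (Eq (cell ''R'' ''u'') one) walk_step) r1 a1
     (tm walk_step + cond_cost (Eq (cell ''R'' ''u'') one) + 1)
     (\<lambda>r a. ?I r a \<and> \<not> holds (mem r a) (Eq (cell ''R'' ''u'') one))" if I1: "?I r1 a1" for r1 a1
  proof (rule lin_of_runs[OF runs_While[where I = ?I and \<mu> = "\<lambda>r a. L - r ''l''"]])
    show "?I r1 a1" by (rule I1)
    show "L - r1 ''l'' \<le> n + length as" using s N_le_n by simp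
  next
    fix r a assume I: "?I r a"
    then have "r ''u'' < n" using din s by auto
    then show "cond_fits W (mem r a) (Eq (cell ''R'' ''u'') one)" using I XW[of "r ''u''"] n_less_W n_ge_3 by auto
  next
    fix r a assume I: "?I r a" and h: "holds (mem r a) (Eq (cell ''R'' ''u'') one)"
    define l where "l = r ''l''"
    have l: "0 < l" "l \<le> L" "r ''l'' = l" "r ''u'' = d l" "r ''g'' = d (l - 1)" "a = a0"
      "r ''o'' = (if ?cl l then 1 else 0)" "eq_off {''l'', ''u'', ''g'', ''o''} r0 r" using I by (auto simp: l_def)
    have "a0 ''R'' (d l) = 1" using h l by simp
    then have lL: "l < L" using R1 l by simp
    have ul: "d l < n" using din l s by simp
    have cl: "?cl (Suc l) \<longleftrightarrow> ?cl l \<and> d l \<notin> B \<and> preds A (d l) = {d (Suc l)}"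
      using l(1) by (auto simp: less_Suc_eq)
    have Wb: "Suc l \<le> W" "l \<le> W" "d l \<le> W" "Suc 0 \<le> W" "d (Suc l) \<le> W"
      using lL s N_le_n n_less_W ul n_ge_3 din[of "Suc l"] by auto
    show "wp W walk_step (\<lambda>r' a'. ?I r' a' \<and> L - r' ''l'' < L - r ''l'') r a"
    proof (cases "d l \<notin> B \<and> preds A (d l) = {d (Suc l)}")
      case True
      then have g: "a0 ''G'' (d l) = Suc 0" "a0 ''X'' (d l) = 0" using good[of l] l(1) lL by auto
      have "?cl (Suc l) = ?cl l" using cl True by blast
      then show ?thesis
        unfolding walk_step_def using l lL A1[of l] Wb XW[OF ul] g by simp
    next
      case False
      then have g: "\<not> (a0 ''G'' (d l) = Suc 0 \<and> a0 ''X'' (d l) = 0)" using good[of l] l(1) lL by blast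
      have nc: "\<not> ?cl (Suc l)" using cl False by blast
      show ?thesis
        unfolding walk_step_def using l(1-6,8) lL A1[of l] Wb XW[OF ul] g nc by auto
    qed
  qed
  have "lin walk r0 a0 k_walk (\<lambda>r a. ?I r a \<and> \<not> holds (mem r a) (Eq (cell ''R'' ''u'') one))"
    unfolding walk_def k_walk_def by (rule lin_Seq[OF 1], rule 2)
  then show ?thesis
  proof (rule lin_mono[OF _ order_refl])
    fix r a assume I: "?I r a \<and> \<not> holds (mem r a) (Eq (cell ''R'' ''u'') one)"
    then have h: "\<not> holds (mem r a) (Eq (cell ''R'' ''u'') one)" by blast
    have "a = a0" "r ''u'' = d (r ''l'')" using I by blast+
    with h have "a0 ''R'' (d (r ''l'')) \<noteq> 1" by simp
    then have "r ''l'' = L" using R1[of "r ''l''"] I by auto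
    then show "a = a0 \<and> r ''l'' = L \<and> r ''u'' = d L \<and> r ''g'' = d (L - 1) \<and>
      r ''o'' = (if clean A B d L then 1 else 0) \<and> eq_off {''l'', ''u'', ''g'', ''o''} r0 r"
      using I by (simp add: clean_def)
  qed
qed

text \<open>Coordinates of the ring in which the walks from \<open>s\<close> follow the two sides.\<close>

definition frame :: "(nat \<Rightarrow> nat) \<Rightarrow> nat \<Rightarrow> nat \<Rightarrow> nat \<Rightarrow> (string \<Rightarrow> nat \<Rightarrow> nat) \<Rightarrow> bool" where
  "frame d L1 L2 s a \<longleftrightarrow> coords d \<and> d 0 = s \<and> oriented_ring.ring_sink A N d L1 L2 \<and>
     d 1 = a ''A'' s \<and> d (N - 1) = a ''B'' s"

text \<open>\<open>A s\<close> and \<open>B s\<close> appear in the order of the arc list. If this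
  disagrees with the coordinates, the reflected ones fit.\<close>

lemma frame_exists:
  assumes s: "s \<in> sinks" "preds A s \<subseteq> C" and rp: "ring_preds a"
  obtains d L1 L2 where "frame d L1 L2 s a"
proof -
  have sC: "s \<in> C" using s by (simp add: sinks_in_def)
  obtain d L1 L2 where d: "coords d" "d 0 = s" "oriented_ring.ring_sink A N d L1 L2"
    using coords_sides_exist[OF s] by blast
  interpret d: oriented_ring V A f N d using d(1) by (simp add: coords_def)
  have "card (preds A s \<inter> C) = 2" using sinks_iff[OF sC] s(1) by blast
  moreover have "a ''R'' s = card (preds A s \<inter> C)" using rp sC unfolding ring_preds_def by blast
  ultimately have "a ''R'' s = 2" by simp
  then have "preds A s \<inter> C = {a ''A'' s, a ''B'' s} \<and> a ''A'' s \<noteq> a ''B'' s"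
    using rp sC unfolding ring_preds_def by blast
  moreover have "preds A s = {d 1, d (N - 1)}" using d(2,3) by (simp add: d.ring_sink_def)
  ultimately have "{d 1, d (N - 1)} = {a ''A'' s, a ''B'' s}" using s(2) by (simp add: Int_absorb2)
  then consider "d 1 = a ''A'' s" "d (N - 1) = a ''B'' s" | "d 1 = a ''B'' s" "d (N - 1) = a ''A'' s"
    by (auto simp: doubleton_eq_iff)
  then show thesis
  proof cases
    case 1
    then show ?thesis using that d by (simp add: frame_def)
  next
    case 2
    have "coords d.c'" using d.reflect coords_C[OF d(1)] by (simp add: coords_def)
    moreover have "d.c' 0 = s" "d.c' 1 = a ''A'' s" "d.c' (N - 1) = a ''B'' s"
      using d(2) d.c_closed 2 N_ge_3 by (auto simp: d.reflect_fun)
    ultimately show ?thesis using that[of d.c' L2 L1] d.ring_sink_reflect[OF d(3)] by (simp add: frame_def)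
  qed
qed

definition walked :: "(nat \<Rightarrow> nat) \<Rightarrow> nat \<Rightarrow> nat \<Rightarrow> nat set \<Rightarrow> (string \<Rightarrow> nat) \<Rightarrow> bool" where
  "walked d L1 L2 B r \<longleftrightarrow>
     r ''l1'' = L1 \<and> r ''u1'' = d L1 \<and> r ''g1'' = d (L1 - 1) \<and> r ''o1'' = (if clean A B d L1 then 1 else 0) \<and>
     r ''l'' = L2 \<and> r ''u'' = d (N - L2) \<and> r ''g'' = d (N - (L2 - 1)) \<and>
     r ''o'' = (if clean A B (\<lambda>i. d (N - i)) L2 then 1 else 0)"

definition walk_regs :: "string set" where
  "walk_regs = {''l'', ''u'', ''g'', ''o'', ''l1'', ''u1'', ''g1'', ''o1'', ''b''}"

definition k_walk_both :: nat where
  "k_walk_both = tm (Assign ''u'' (cell ''A'' ''s'')) + (k_walk + (tm save_walk + k_walk))"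

lemma runs_walk_both:
  assumes fr: "frame d L1 L2 s a0" and K: "known B a0" and s: "r0 ''s'' = s"
  shows "lin walk_both r0 a0 k_walk_both (\<lambda>r a. a = a0 \<and> walked d L1 L2 B r \<and> eq_off walk_regs r0 r)"
proof -
  have d: "coords d" "d 0 = s" "oriented_ring.ring_sink A N d L1 L2" "d 1 = a0 ''A'' s" "d (N - 1) = a0 ''B'' s"
    using fr by (auto simp: frame_def)
  interpret d: oriented_ring V A f N d using d(1) by (simp add: coords_def)
  have dC: "d.C = C" using coords_C[OF d(1)] .
  have din: "d i < n" if "i \<le> N" for i using dC d.c_C[OF that] C_less by auto
  have L: "side A d L1" "0 < L1" "L1 < N" "side A d.c' L2" "0 < L2" "L2 < N"
    using d(3) by (auto simp: d.ring_sink_def)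
  have cd': "coords d.c'" using d.reflect dC by (simp add: coords_def)
  have "L1 - 1 \<le> N" using L by simp
  then have Wb: "s \<le> W" "a0 ''A'' s \<le> W" "a0 ''B'' s \<le> W" "d L1 \<le> W" "d (L1 - 1) \<le> W" "L1 \<le> W" "Suc 0 \<le> W"
    using din[of 0] din[of 1] din[of "N - 1"] din[of L1] din[of "L1 - 1"] d L N_le_n N_ge_3 n_less_W by auto
  let ?Q1 = "\<lambda>r a. a = a0 \<and> r ''u'' = d 1 \<and> r ''s'' = d 0 \<and> eq_off walk_regs r0 r"
  let ?Q2 = "\<lambda>r a. a = a0 \<and> r ''l'' = L1 \<and> r ''u'' = d L1 \<and> r ''g'' = d (L1 - 1) \<and>
    r ''o'' = (if clean A B d L1 then 1 else 0) \<and> r ''s'' = d 0 \<and> eq_off walk_regs r0 r"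
  let ?Q3 = "\<lambda>r a. a = a0 \<and> r ''l1'' = L1 \<and> r ''u1'' = d L1 \<and> r ''g1'' = d (L1 - 1) \<and>
    r ''o1'' = (if clean A B d L1 then 1 else 0) \<and> r ''u'' = d.c' 1 \<and> r ''s'' = d.c' 0 \<and> eq_off walk_regs r0 r"
  have 1: "lin (Assign ''u'' (cell ''A'' ''s'')) r0 a0 (tm (Assign ''u'' (cell ''A'' ''s''))) ?Q1"
    by (rule lin_wp) (use s d Wb in \<open>simp add: walk_regs_def\<close>)
  have 2: "lin walk r1 a1 k_walk ?Q2" if I: "?Q1 r1 a1" for r1 a1
  proof -
    have a1: "a1 = a0" using I by blast
    show ?thesis unfolding a1
      by (rule lin_mono[OF runs_walk[OF d(1) L(1-3) K] order_refl])
        (use I in \<open>auto simp: eq_off_def walk_regs_def\<close>)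
  qed
  have 3: "lin save_walk r1 a1 (tm save_walk) ?Q3" if I: "?Q2 r1 a1" for r1 a1
    by (rule lin_wp) (use I s d Wb d.c_closed in \<open>auto simp: save_walk_def walk_regs_def\<close>)
  have 4: "lin walk r1 a1 k_walk (\<lambda>r a. a = a0 \<and> walked d L1 L2 B r \<and> eq_off walk_regs r0 r)" if I: "?Q3 r1 a1" for r1 a1
  proof -
    have a1: "a1 = a0" using I by blast
    show ?thesis unfolding a1
      by (rule lin_mono[OF runs_walk[OF cd' L(4-6) K] order_refl])
        (use I in \<open>auto simp: eq_off_def walk_regs_def walked_def\<close>)
  qed
  show ?thesis
    unfolding walk_both_def k_walk_both_def
    by (rule lin_Seq[OF 1], rule lin_Seq[OF 2], assumption, rule lin_Seq[OF 3], assumption, rule 4)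
qed

lemma runs_test_single:
  assumes fr: "frame d L1 L2 s a0" and K: "known B a0" and s: "r0 ''s'' = s" and B: "base_set V A B"
  shows "lin test_single r0 a0 (k_walk_both + tm judge_single) (\<lambda>r a. a = a0 \<and> walked d L1 L2 B r \<and>
    eq_off walk_regs r0 r \<and> r ''b'' = (if oriented_ring.blind_single A N d B L1 L2 then 1 else 0))"
  unfolding test_single_def
proof (rule lin_Seq[OF runs_walk_both[of d L1 L2 s a0 B r0, OF fr K s]], rule lin_wp)
  fix r a assume I: "a = a0 \<and> walked d L1 L2 B r \<and> eq_off walk_regs r0 r"
  have d: "coords d" "d 0 = s" "oriented_ring.ring_sink A N d L1 L2" "d 1 = a0 ''A'' s" "d (N - 1) = a0 ''B'' s"
    using fr by (auto simp: frame_def)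
  interpret d: oriented_ring V A f N d using d(1) by (simp add: coords_def)
  have din: "d i < n" if "i \<le> N" for i using coords_C[OF d(1)] d.c_C[OF that] C_less by auto
  have L: "0 < L1" "L1 < N" "0 < L2" "L2 < N" "preds A (d 0) = {d 1, d (N - 1)}"
    using d(3) by (auto simp: d.ring_sink_def)
  have y: "d 0 \<notin> B" using sink_notin_base[OF B, of "d 1" "d 0" "d (N - 1)"] L(5) d.c1_neq by blast
  have eqN: "d L1 = d (N - L2) \<longleftrightarrow> L1 + L2 = N" using d.c_eq_iff[of L1 "N - L2"] L by auto
  have Kv: "a0 ''L'' v = 0 \<longleftrightarrow> sole_succs A v = {}" "a0 ''L'' v \<le> n" if "v < n" for v
    using K that by (auto simp: known_def)
  have l: "0 < a0 ''L'' (d i) \<longleftrightarrow> sole_succs A (d i) - B \<noteq> {}" if "i \<le> N" for i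
    using Kv(1)[OF din[OF that]] base_set_sole_nonempty[OF B] by auto
  have lA: "0 < a0 ''L'' (a0 ''A'' s) \<longleftrightarrow> sole_succs A (d 1) - B \<noteq> {}"
    and lB: "0 < a0 ''L'' (a0 ''B'' s) \<longleftrightarrow> sole_succs A (d (N - 1)) - B \<noteq> {}"
    using l[of 1] l[of "N - 1"] d N_ge_3 by auto
  have Wb: "s \<le> W" "a0 ''A'' s \<le> W" "a0 ''B'' s \<le> W" "d L1 \<le> W" "d (N - L2) \<le> W" "L1 \<le> W" "L2 \<le> W" "Suc 0 \<le> W"
    "a0 ''L'' (a0 ''A'' s) \<le> W" "a0 ''L'' (a0 ''B'' s) \<le> W"
    using din[of 0] din[of 1] din[of "N - 1"] din[of L1] din[of "N - L2"] d L N_le_n N_ge_3 n_less_W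
      Kv(2)[of "d 1"] Kv(2)[of "d (N - 1)"] by auto
  have rs: "r ''s'' = s" using I s by (auto simp: eq_off_def walk_regs_def)
  have bs: "d.blind_single B L1 L2 \<longleftrightarrow> d L1 = d (N - L2) \<and>
      (L2 \<le> L1 \<and> clean A B d L1 \<and> 0 < a0 ''L'' (a0 ''B'' s) \<or> L1 \<le> L2 \<and> clean A B d.c' L2 \<and> 0 < a0 ''L'' (a0 ''A'' s))"
    unfolding d.blind_single_def eqN lA lB using y by simp
  show "wp W judge_single (\<lambda>r a. a = a0 \<and> walked d L1 L2 B r \<and>
    eq_off walk_regs r0 r \<and> r ''b'' = (if d.blind_single B L1 L2 then 1 else 0)) r a"
    unfolding judge_single_def bs using I Wb rs
    by (auto simp: walked_def walk_regs_def not_less)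
qed

lemma runs_test_double:
  assumes fr: "frame d L1 L2 s a0" and K: "known B a0" and s: "r0 ''s'' = s" and B: "base_set V A B"
    and t: "t \<in> sinks" "t \<noteq> s" "r0 ''t'' = t" and H: "heights B (a0 ''H'')"
  shows "lin test_double r0 a0 (k_walk_both + tm judge_double) (\<lambda>r a. a = a0 \<and>
    eq_off walk_regs r0 r \<and> r ''b'' = (if oriented_ring.blind_double A N d B L1 L2 then 1 else 0))"
  unfolding test_double_def
proof (rule lin_Seq[OF runs_walk_both[of d L1 L2 s a0 B r0, OF fr K s]], rule lin_wp)
  fix r a assume I: "a = a0 \<and> walked d L1 L2 B r \<and> eq_off walk_regs r0 r"
  have d: "coords d" "d 0 = s" "oriented_ring.ring_sink A N d L1 L2" "d 1 = a0 ''A'' s" "d (N - 1) = a0 ''B'' s"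
    using fr by (auto simp: frame_def)
  interpret d: oriented_ring V A f N d using d(1) by (simp add: coords_def)
  have dC: "d.C = C" using coords_C[OF d(1)] .
  have din: "d i \<in> C" "d i < n" if "i \<le> N" for i using dC d.c_C[OF that] C_less by auto
  have L: "0 < L1" "L1 < N" "0 < L2" "L2 < N" "preds A (d 0) = {d 1, d (N - 1)}" "side A d L1"
    using d(3) by (auto simp: d.ring_sink_def)
  have y: "d 0 \<notin> B" using sink_notin_base[OF B, of "d 1" "d 0" "d (N - 1)"] L(5) d.c1_neq by blast
  have tC: "t \<in> C" "t < n" using t C_less by (auto simp: sinks_in_def)
  have Kt: "a0 ''G'' t = card (preds A t)" "a0 ''H'' t \<le> n" "a0 ''A'' t \<le> n" "a0 ''B'' t \<le> n"
    using K tC by (auto simp: known_def ring_preds_def)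
  have rp: "ring_preds a0" using K by (simp add: known_def)
  have c2: "card (preds A t \<inter> C) = 2" using sinks_iff[OF tC(1)] t(1) by blast
  moreover have "a0 ''R'' t = card (preds A t \<inter> C)" using rp tC unfolding ring_preds_def by blast
  ultimately have "a0 ''R'' t = 2" by simp
  then have tAB: "preds A t \<inter> C = {a0 ''A'' t, a0 ''B'' t}" "a0 ''A'' t \<noteq> a0 ''B'' t"
    using rp tC unfolding ring_preds_def by blast+
  have t2: "a0 ''G'' t = 2 \<longleftrightarrow> preds A t \<subseteq> C"
  proof
    assume "a0 ''G'' t = 2"
    then have "card (preds A t \<inter> C) = card (preds A t)" using Kt(1) c2 by simp
    then have "preds A t \<inter> C = preds A t" using preds_bound(3)[of A t] by (intro card_subset_eq) auto
    then show "preds A t \<subseteq> C" by blast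
  next
    assume "preds A t \<subseteq> C"
    then have "preds A t = preds A t \<inter> C" by blast
    then show "a0 ''G'' t = 2" using Kt(1) c2 by simp
  qed
  obtain j where j: "j < N" "t = d j" using d.C_cases tC(1) dC by metis
  have j0: "0 < j" using j t(2) d(2) by (cases "j = 0") auto
  \<comment> \<open>The program never locates \<open>t\<close> on the ring. That its ring
    predecessors are the ends of both walks already places it between them, next to each.\<close>
  have bd: "d.blind_double B L1 L2 \<longleftrightarrow> L2 = L1 \<and> clean A B d L1 \<and> clean A B d.c' L2 \<and> preds A t \<subseteq> C \<and>
      {a0 ''A'' t, a0 ''B'' t} = {d L1, d (N - L2)} \<and> L2 \<le> Suc (a0 ''H'' t)" (is "_ \<longleftrightarrow> ?R")
  proof
    assume b: "d.blind_double B L1 L2"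
    then have "sinks = {d 0, d (Suc L1)}" using d.blind_double_sinks[OF d(3)] dC by simp
    then have td: "t = d (Suc L1)" using t d(2) by auto
    have bb: "L1 = L2" "clean A B d L1" "clean A B d.c' L2" "preds A t = {d L1, d (N - L2)}"
      "trail A B t (L1 - 1) \<noteq> {}" using b td by (auto simp: d.blind_double_def)
    have sub: "preds A t \<subseteq> C" unfolding bb(4) using din L by auto
    have "L1 - 1 \<le> a0 ''H'' t" by (rule heights_upper[OF H below_sink[OF t(1) sub] bb(5)])
    moreover have "{a0 ''A'' t, a0 ''B'' t} = {d L1, d (N - L2)}" using tAB(1) bb(4) sub by (simp add: Int_absorb2)
    ultimately show ?R using bb sub by simp
  next
    assume R: ?R
    then have pt: "preds A t = {d L1, d (N - L2)}" using tAB(1) by (simp add: Int_absorb2)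
    then have arcs: "(d L1, t) \<in> A" "(d (N - L2), t) \<in> A" by blast+
    have sj: "(d (j - 1), d j) \<in> A \<and> (d (Suc j), d j) \<in> A"
      using d.sink_ci[OF j0 j(1)] t(1) j(2) dC by simp
    note ra = d.ring_sink_arcs[OF d(3)]
    have notL: "\<not> j \<le> L1"
    proof
      assume "j \<le> L1"
      then have "(d j, d (j - 1)) \<in> A" using ra(1)[of "j - 1"] j0 by simp
      then show False using sj arc_asym by blast
    qed
    have notR: "\<not> N - L2 \<le> j"
    proof
      assume "N - L2 \<le> j"
      then have "(d j, d (Suc j)) \<in> A" using ra(2)[of j] j by simp
      then show False using sj arc_asym by blast
    qed
    have "d j = d (L1 - 1) \<or> d j = d (Suc L1)" using d.ring_succ[OF arcs(1)] tC(1) dC L j(2) by simp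
    then have j1: "j = Suc L1"
    proof
      assume "d j = d (L1 - 1)"
      then have "j = L1 - 1" using d.c_eq_iff[of j "L1 - 1"] j L by simp
      then show ?thesis using notL by simp
    next
      assume "d j = d (Suc L1)"
      then show ?thesis using d.c_eq_iff'[of j "Suc L1"] j j0 L by simp
    qed
    have "d j = d (N - L2 - 1) \<or> d j = d (Suc (N - L2))" using d.ring_succ[OF arcs(2)] tC(1) dC L j(2) by simp
    then have j2: "Suc j = N - L2"
    proof
      assume e: "d j = d (N - L2 - 1)"
      then have "j = N - L2 - 1" using d.c_eq_iff[of j "N - L2 - 1"] j L by simp
      then show ?thesis using L by simp
    next
      assume e: "d j = d (Suc (N - L2))"
      then have "j = Suc (N - L2)" using d.c_eq_iff'[of j "Suc (N - L2)"] j j0 L by simp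
      then show ?thesis using notR by simp
    qed
    have nn: "L1 + L2 + 2 = N" using j1 j2 L by linarith
    have neq: "d L1 \<noteq> d (N - L2)" using d.c_eq_iff[of L1 "N - L2"] nn L by auto
    have "t \<notin> B" by (rule sink_notin_base[OF B arcs neq])
    moreover have "trail A B t (L1 - 1) \<noteq> {}"
      using R by (intro heights_lower[OF H B below_sink[OF t(1)]]) auto
    ultimately show "d.blind_double B L1 L2"
      unfolding d.blind_double_def using R nn y pt j(2) j1 by auto
  qed
  have rs: "r ''s'' = s" "r ''t'' = t" using I s t by (auto simp: eq_off_def walk_regs_def)
  have Gb: "a0 ''G'' t \<le> W" using Kt(1) preds_bound(2)[of A t] n_less_W by simp
  have Wb: "s \<le> W" "t \<le> W" "a0 ''A'' t \<le> W" "a0 ''B'' t \<le> W" "d L1 \<le> W" "d (N - L2) \<le> W" "L1 \<le> W" "L2 \<le> W" "Suc 0 \<le> W" "2 \<le> W"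
    "Suc (a0 ''H'' t) \<le> W" "a0 ''H'' t \<le> W"
    using din(2)[of 0] din(2)[of L1] din(2)[of "N - L2"] d L N_le_n N_ge_3 n_less_W n_ge_3 tC Kt by auto
  have a: "a = a0" and rw: "r ''l'' = L2" "r ''l1'' = L1" "r ''u1'' = d L1" "r ''u'' = d (N - L2)"
    "r ''o1'' = (if clean A B d L1 then 1 else 0)" "r ''o'' = (if clean A B d.c' L2 then 1 else 0)"
    using I by (simp_all add: walked_def)
  have upd: "eq_off walk_regs r0 (r(''b'' := x))" "eq_off walk_regs r0 (r(''b'' := x, ''b'' := y))" for x y
    using I by (simp_all add: walk_regs_def)
  have dW: "d (N - i) \<le> W" for i using din(2)[of "N - i"] n_less_W by simp
  show "wp W judge_double (\<lambda>r a. a = a0 \<and> eq_off walk_regs r0 r \<and> r ''b'' = (if d.blind_double B L1 L2 then 1 else 0)) r a"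
    unfolding judge_double_def bd t2[symmetric] doubleton_eq_iff a
    by (simp add: rw rs Wb Gb upd dW) (simp add: not_le)
qed

end

section \<open>The algorithm\<close>

definition mark :: "string \<Rightarrow> com" where "mark x = Write ''X'' (Reg x) one"

definition decide_cycle :: com where
  "decide_cycle = Branch (Eq (Reg ''h'') (Num 0))
     (Branch (Eq (Reg ''e'') (Num 0)) (mark ''z'')
       (Branch (Eq (Reg ''e'') one) (Branch (Less (Num 0) (cell ''L'' ''a'')) (mark ''z'') Skip) Skip)) Skip"

text \<open>Subtraction from \<open>1\<close> flips a mark. \<open>g1\<close> and \<open>g\<close>
  are the neighbours of the common source on its two sides.\<close>

definition swap_marks :: com where
  "swap_marks = block [Write ''X'' (Reg ''g1'') (Minus one (cell ''X'' ''g1'')),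
     Write ''X'' (Reg ''g'') (Minus one (cell ''X'' ''g''))]"

text \<open>Both vertices are successors of the common source, so in-degree \<open>1\<close> makes
  it their sole predecessor. The exchanged marks are kept: if the set is no longer blind it is the
  answer, and otherwise it serves as well as the original one for adding the sink.\<close>

definition retry_single :: com where
  "retry_single = Branch (Conj (Eq (cell ''G'' ''g1'') one) (Eq (cell ''G'' ''g'') one)) (Seq swap_marks test_single) Skip"

definition decide_single :: com where
  "decide_single = Seq (Assign ''s'' (Reg ''w'')) (Branch (Eq (cell ''G'' ''s'') (Num 2))
     (Seq test_single (Branch (Eq (Reg ''b'') one)
       (Seq retry_single (Branch (Eq (Reg ''b'') one) (mark ''s'') Skip)) Skip)) Skip)"

definition try_double :: "string \<Rightarrow> string \<Rightarrow> com" where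
  "try_double x y = Seq (block [Assign ''s'' (Reg x), Assign ''t'' (Reg y), Assign ''b'' (Num 0)])
     (Seq (Branch (Eq (cell ''G'' ''s'') (Num 2)) test_double Skip) (Branch (Eq (Reg ''b'') one) (mark ''s'') Skip))"

text \<open>\<open>blind_double\<close> distinguishes the sink from its opposite, so both roles are
  tried.\<close>

definition decide_double :: com where
  "decide_double = Seq (try_double ''y'' ''w'') (Branch (Eq (Reg ''b'') one) Skip (try_double ''w'' ''y''))"

definition decide :: com where
  "decide = Branch (Eq (Reg ''c'') (Num 0)) decide_cycle
     (Branch (Eq (Reg ''c'') one) decide_single (Branch (Eq (Reg ''c'') (Num 2)) decide_double Skip))"

definition emit :: com where
  "emit = Branch (Eq (cell ''X'' ''v'') one)
     (block [Write ''out'' (Reg ''k'') (Reg ''v''), Assign ''k'' (Plus (Reg ''k'') one)]) Skip"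

definition basis_program :: com where
  "basis_program = Seq find_ring (Seq choose_base (Seq survey_ring (Seq decide (For ''v'' ''n'' emit))))"

section \<open>Correctness of the decision and of the whole program\<close>

context ring_input
begin

lemma marked_insert: "marked B a \<Longrightarrow> v \<in> V \<Longrightarrow> marked (insert v B) (a(''X'' := (a ''X'')(v := Suc 0)))"
  by (auto simp: marked_def)

lemma known_remark:
  assumes K: "known B a" and X: "marked B' (a(''X'' := h))"
  shows "known B' (a(''X'' := h))"
proof -
  have "ring_preds (a(''X'' := h)) = ring_preds a" by (simp add: ring_preds_def)
  moreover have "(a(''X'' := h)) ''G'' = a ''G''" "(a(''X'' := h)) ''L'' = a ''L''" "(a(''X'' := h)) ''H'' = a ''H''"
    by simp_all
  ultimately show ?thesis using K X unfolding known_def by (elim conjE) (intro conjI, assumption, simp only:, simp only:)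
qed

definition decided :: "(string \<Rightarrow> nat) \<Rightarrow> (string \<Rightarrow> nat \<Rightarrow> nat) \<Rightarrow> bool" where
  "decided r a \<longleftrightarrow> inp r a \<and> r ''k'' = 0 \<and> (\<exists>S. marked S a \<and> basis V A S)"

lemma runs_decide_cycle:
  assumes inp: "inp r0 a0" "r0 ''k'' = 0" and T: "tables B a0" and X: "marked B a0" and S: "surveyed B r0"
    and B: "base_set V A B" "ring_averse A C B" and no: "sinks = {}"
  shows "lin decide_cycle r0 a0 (tm decide_cycle) decided"
proof (rule lin_wp)
  have z: "r0 ''z'' \<in> C" using S by (simp add: surveyed_def)
  then have z': "r0 ''z'' \<in> V" "r0 ''z'' \<le> W" using C_V C_less n_less_W by (blast, fastforce)
  have "card (entries A C) \<le> card {..<n}"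
    by (rule card_mono) (use arc_less in \<open>auto simp: entries_def\<close>)
  then have e: "r0 ''e'' \<le> W" "r0 ''e'' = card (entries A C)" using S n_less_W by (auto simp: surveyed_def)
  have e0: "r0 ''e'' = 0 \<longleftrightarrow> entries A C = {}" using e finite_entries by simp
  have e1: "entries A C = {r0 ''a''}" if "r0 ''e'' = Suc 0"
  proof -
    have "card (entries A C) = 1" using e(2) that by simp
    then obtain b where "entries A C = {b}" by (rule card_1_singletonE)
    moreover have "r0 ''a'' \<in> entries A C" using S that by (simp add: surveyed_def)
    ultimately show ?thesis by simp
  qed
  have a: "r0 ''a'' < n" if "r0 ''e'' = Suc 0"
    using e1[OF that] arc_less unfolding entries_def by blast
  have L: "0 < a0 ''L'' (r0 ''a'') \<longleftrightarrow> sole_succs A (r0 ''a'') \<noteq> {}" "a0 ''L'' (r0 ''a'') \<le> W" "r0 ''a'' \<le> W"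
    if "r0 ''e'' = Suc 0" using T a[OF that] n_less_W by (auto simp: tables_def)
  have h: "r0 ''h'' = (if B \<inter> C = {} then 0 else 1)" using S by (simp add: surveyed_def)
  have mark: "decided r0 (a0(''X'' := (a0 ''X'')(r0 ''z'' := Suc 0)))" if "bad_cycle B"
    using basis_bad_cycle[OF B no that z] marked_insert[OF X z'(1)] inp by (auto simp: decided_def)
  have skip: "decided r0 a0" if "\<not> bad_cycle B"
    using basis_cycle[OF B(1) no that] X inp by (auto simp: decided_def)
  have Wb: "Suc 0 \<le> W" using n_less_W n_ge_3 by simp
  show "wp W decide_cycle decided r0 a0"
  proof (cases "B \<inter> C = {}")
    case False
    then have "\<not> bad_cycle B" by (simp add: bad_cycle_def)
    then show ?thesis unfolding decide_cycle_def using False h skip Wb by simp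
  next
    case True
    consider "r0 ''e'' = 0" | "r0 ''e'' = Suc 0" | "r0 ''e'' \<noteq> 0" "r0 ''e'' \<noteq> Suc 0" by blast
    then show ?thesis
    proof cases
      case 1
      then have "bad_cycle B" using True e0 by (simp add: bad_cycle_def)
      then show ?thesis unfolding decide_cycle_def mark_def using True h mark Wb 1 z'(2) by simp
    next
      case 2
      then have "bad_cycle B \<longleftrightarrow> 0 < a0 ''L'' (r0 ''a'')" using True e1[OF 2] L[OF 2] by (simp add: bad_cycle_def)
      then show ?thesis unfolding decide_cycle_def mark_def
        using True h mark skip Wb 2 z'(2) L(2,3)[OF 2] by auto
    next
      case 3
      have "\<not> bad_cycle B"
      proof
        assume "bad_cycle B"
        then consider "entries A C = {}" | b where "entries A C = {b}" unfolding bad_cycle_def by blast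
        then show False using 3 e(2) by cases auto
      qed
      then show ?thesis unfolding decide_cycle_def using True h skip Wb 3 e(1) by simp
    qed
  qed
qed

text \<open>A clean longer side means that \<open>B\<close> leaves out one of the two neighbours of
  the source. As \<open>B\<close> is ring averse, the source then has no sole successors off the
  ring, so the two neighbours are all there are.\<close>

lemma swapped_base:
  assumes sink: "ring_sink L1 L2" and bl: "blind_single B L1 L2" and B: "base_set V A B" "ring_averse A C B"
    and ss: "{c (L1 - 1), c (Suc L1)} \<subseteq> sole_succs A (c L1)"
  shows "base_set V A (swap (c (L1 - 1)) (c (Suc L1)) B)"
proof -
  let ?s = "c (L1 - 1)" and ?t = "c (Suc L1)"
  have L: "L1 + L2 = N" "0 < L1" "L1 < N" "0 < L2" "L2 < N" using bl sink by (auto simp: blind_single_def ring_sink_def)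
  have C: "?s \<in> C" "?t \<in> C" using L by auto
  have st: "?s \<noteq> ?t"
  proof (cases "Suc L1 = N")
    case True
    then have "?t = c 0" using c_closed by simp
    then show ?thesis using c_eq_iff[of "L1 - 1" 0] True N_ge_3 by auto
  next
    case False
    then show ?thesis using c_eq_iff[of "L1 - 1" "Suc L1"] L by auto
  qed
  have "?s \<notin> B \<or> ?t \<notin> B"
  proof -
    consider "L2 \<le> L1" "clean A B c L1" | "L1 \<le> L2" "clean A B c' L2" using bl by (auto simp: blind_single_def)
    then show ?thesis
    proof cases
      case 1
      then have "1 < L1" using L N_ge_3 by linarith
      then show ?thesis using 1(2) by (auto simp: clean_def)
    next
      case 2
      then have "1 < L2" using L N_ge_3 by linarith
      then have "0 < L2 - 1 \<and> L2 - 1 < L2" by simp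
      then have "c' (L2 - 1) \<notin> B" using 2(2) unfolding clean_def by blast
      moreover have "N - (L2 - 1) = Suc L1" using L by linarith
      ultimately show ?thesis by simp
    qed
  qed
  then have "sole_succs A (c L1) \<subseteq> C" using B(2) ss C unfolding ring_averse_def by blast
  moreover have "v = ?s \<or> v = ?t" if "v \<in> sole_succs A (c L1)" "v \<in> C" for v
  proof -
    have "(c L1, v) \<in> A" using that unfolding sole_succs_def by blast
    then show ?thesis using ring_succ[of L1 v] that L by auto
  qed
  ultimately have "sole_succs A (c L1) = {?s, ?t}" using ss by blast
  then show ?thesis using base_set_swap[OF B(1) _ st] by simp
qed

lemma marked_swap:
  assumes X: "marked B a" and st: "s \<in> V" "t \<in> V" "s \<noteq> t"
  shows "marked (swap s t B) (a(''X'' := (a ''X'')(s := Suc 0 - a ''X'' s, t := Suc 0 - a ''X'' t)))"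
  using assms V unfolding marked_def swap_def by auto

definition k_single :: nat where
  "k_single = tm (Assign ''s'' (Reg ''w'')) + (1 + cond_cost (Eq (cell ''G'' ''s'') (Num 2)) +
     ((k_walk_both + tm judge_single) + (1 + cond_cost (Eq (Reg ''b'') one) +
       ((1 + cond_cost (Conj (Eq (cell ''G'' ''g1'') one) (Eq (cell ''G'' ''g'') one)) +
          (tm swap_marks + (k_walk_both + tm judge_single)) + 1) +
        tm (Branch (Eq (Reg ''b'') one) (mark ''s'') Skip)) + 1)) + 1)"

lemma runs_decide_single:
  assumes inp: "inp r0 a0" "r0 ''k'' = 0" and K: "known B a0"
    and B: "base_set V A B" "ring_averse A C B" and w: "sinks = {r0 ''w''}"
  shows "lin decide_single r0 a0 k_single decided"
proof -
  let ?s = "r0 ''w''"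
  have sC: "?s \<in> C" "?s < n" "?s \<in> V" "?s \<in> sinks" using w C_less C_V by (auto simp: sinks_in_def)
  have X: "marked B a0" and rp: "ring_preds a0" and G: "\<And>v. v < n \<Longrightarrow> a0 ''G'' v = card (preds A v)"
    using K by (auto simp: known_def)
  have c2: "card (preds A ?s \<inter> C) = 2" using sinks_iff[OF sC(1)] sC(4) by blast
  have g2: "a0 ''G'' ?s = 2 \<longleftrightarrow> preds A ?s \<subseteq> C"
  proof
    assume "a0 ''G'' ?s = 2"
    then have "card (preds A ?s \<inter> C) = card (preds A ?s)" using G[OF sC(2)] c2 by simp
    then have "preds A ?s \<inter> C = preds A ?s" using preds_bound(3)[of A ?s] by (intro card_subset_eq) auto
    then show "preds A ?s \<subseteq> C" by blast
  next
    assume "preds A ?s \<subseteq> C"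
    then have "preds A ?s = preds A ?s \<inter> C" by blast
    then show "a0 ''G'' ?s = 2" using G[OF sC(2)] c2 by simp
  qed
  have GW: "a0 ''G'' v \<le> W" if "v < n" for v using G[OF that] preds_bound(2)[of A v] n_less_W by simp
  have Wb: "Suc 0 \<le> W" "2 \<le> W" "?s \<le> W" using n_less_W n_ge_3 sC by auto
  let ?r1 = "r0(''s'' := ?s)"
  have 1: "lin (Assign ''s'' (Reg ''w'')) r0 a0 (tm (Assign ''s'' (Reg ''w''))) (\<lambda>r a. r = ?r1 \<and> a = a0)"
    by (rule lin_wp) (use Wb in simp)
  show ?thesis
    unfolding decide_single_def k_single_def
  proof (rule lin_Seq[OF 1], elim conjE, hypsubst, rule lin_Branch)
    show "cond_fits W (mem ?r1 a0) (Eq (cell ''G'' ''s'') (Num 2))" using Wb GW[OF sC(2)] by simp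
  next
    assume "\<not> holds (mem ?r1 a0) (Eq (cell ''G'' ''s'') (Num 2))"
    then have "\<not> preds A ?s \<subseteq> C" using g2 by simp
    then have "basis V A B" using basis_entered_sink[OF B(1) w] by blast
    then show "lin Skip ?r1 a0 1 decided" using inp X by (intro lin_Skip) (auto simp: decided_def)
  next
    assume "holds (mem ?r1 a0) (Eq (cell ''G'' ''s'') (Num 2))"
    then have sub: "preds A ?s \<subseteq> C" using g2 by simp
    obtain d L1 L2 where fr: "frame d L1 L2 ?s a0" by (rule frame_exists[OF sC(4) sub rp])
    have d: "coords d" "d 0 = ?s" "oriented_ring.ring_sink A N d L1 L2" using fr by (auto simp: frame_def)
    interpret d: oriented_ring V A f N d using d(1) by (simp add: coords_def)
    have dC: "d.C = C" using coords_C[OF d(1)] .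
    \<comment> \<open>\<open>swapped_base\<close> is needed in the coordinates of the frame.\<close>
    interpret d: ring_input V A f N d n W as
      by unfold_locales (use V distinct_as set_as W in auto)
    have din: "d i \<in> C" "d i < n" "d i \<in> V" if "i \<le> N" for i using dC d.c_C[OF that] C_less C_V by auto
    have L: "0 < L1" "L1 < N" "0 < L2" "L2 < N" using d(3) by (auto simp: d.ring_sink_def)
    have ds: "d.sinks = {d 0}" using w d(2) dC by simp
    let ?Q1 = "\<lambda>r a. a = a0 \<and> walked d L1 L2 B r \<and> eq_off walk_regs ?r1 r \<and>
      r ''b'' = (if d.blind_single B L1 L2 then 1 else 0)"
    have t1: "lin test_single ?r1 a0 (k_walk_both + tm judge_single) ?Q1"
      by (rule runs_test_single[OF fr K _ B(1)]) simp
    have base: "inp r a0" "r ''k'' = 0" "r ''s'' = ?s" if "eq_off walk_regs ?r1 r" for r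
      using that inp by (auto simp: eq_off_def walk_regs_def inp_def)
    show "lin (Seq test_single (Branch (Eq (Reg ''b'') one)
       (Seq retry_single (Branch (Eq (Reg ''b'') one) (mark ''s'') Skip)) Skip)) ?r1 a0
       ((k_walk_both + tm judge_single) + (1 + cond_cost (Eq (Reg ''b'') one) +
       ((1 + cond_cost (Conj (Eq (cell ''G'' ''g1'') one) (Eq (cell ''G'' ''g'') one)) +
          (tm swap_marks + (k_walk_both + tm judge_single)) + 1) +
        tm (Branch (Eq (Reg ''b'') one) (mark ''s'') Skip)) + 1)) decided"
    proof (rule lin_Seq[OF t1], rule lin_Branch)
      fix r a assume I: "?Q1 r a"
      then show "cond_fits W (mem r a) (Eq (Reg ''b'') one)" using Wb by simp
    next
      fix r a assume I: "?Q1 r a" and "\<not> holds (mem r a) (Eq (Reg ''b'') one)"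
      then have "\<not> d.blind_single B L1 L2" by auto
      then have "basis V A B" using d.basis_single_sink[OF d(3) ds B(1)] by blast
      then show "lin Skip r a 1 decided" using I base X by (intro lin_Skip) (auto simp: decided_def)
    next
      fix r a assume I: "?Q1 r a" and "holds (mem r a) (Eq (Reg ''b'') one)"
      then have b1: "r ''b'' = 1" by simp
      moreover have "r ''b'' = (if d.blind_single B L1 L2 then 1 else 0)" using I by blast
      ultimately have bl: "d.blind_single B L1 L2" by (cases "d.blind_single B L1 L2") simp_all
      have a: "a = a0" using I by blast
      have NN: "L1 + L2 = N" using bl by (simp add: d.blind_single_def)
      let ?g = "d (L1 - 1)" and ?h = "d (Suc L1)"
      have idx: "N - (L2 - 1) = Suc L1" using NN L by linarith
      have rg: "r ''g1'' = ?g" "r ''g'' = ?h" using I idx by (auto simp: walked_def)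
      have gh: "?g < n" "?h < n" "?g \<in> V" "?h \<in> V" using din[of "L1 - 1"] din[of "Suc L1"] L by auto
      have sd: "side A d L1" using d(3) by (simp add: d.ring_sink_def)
      have "(d L1, ?g) \<in> A" using sd L by (metis side_def Suc_diff_1 diff_less zero_less_one)
      moreover have "(d L1, ?h) \<in> A" using sd by (simp add: side_def)
      ultimately have sole: "{?g, ?h} \<subseteq> sole_succs A (d L1) \<longleftrightarrow> a0 ''G'' ?g = 1 \<and> a0 ''G'' ?h = 1"
      proof -
        have *: "v \<in> sole_succs A (d L1) \<longleftrightarrow> card (preds A v) = 1" if "(d L1, v) \<in> A" for v
        proof
          assume "card (preds A v) = 1"
          then obtain u where "preds A v = {u}" by (rule card_1_singletonE)
          moreover have "d L1 \<in> preds A v" using that by simp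
          ultimately show "v \<in> sole_succs A (d L1)" using that by (simp add: sole_succs_def)
        qed (simp add: sole_succs_def)
        show ?thesis using *[OF \<open>(d L1, ?g) \<in> A\<close>] *[OF \<open>(d L1, ?h) \<in> A\<close>] G[OF gh(1)] G[OF gh(2)] by simp
      qed
      let ?all = "\<lambda>S a. marked S a \<and> base_set V A S \<and> (\<forall>B'. base_set V A B' \<longrightarrow> d.blind_single B' L1 L2)"
      \<comment> \<open>Either every base set is blind, and the marked one is to be completed by the
        sink, or the marked set is already a basis.\<close>
      let ?Q2 = "\<lambda>r a. inp r a \<and> r ''k'' = 0 \<and> r ''s'' = ?s \<and> (r ''b'' = 1 \<and> (\<exists>S. ?all S a) \<or>
        r ''b'' = 0 \<and> (\<exists>S. marked S a \<and> basis V A S))"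
      have retry: "lin retry_single r a (1 + cond_cost (Conj (Eq (cell ''G'' ''g1'') one) (Eq (cell ''G'' ''g'') one)) +
          (tm swap_marks + (k_walk_both + tm judge_single)) + 1) ?Q2"
        unfolding retry_single_def
      proof (rule lin_Branch)
        show "cond_fits W (mem r a) (Conj (Eq (cell ''G'' ''g1'') one) (Eq (cell ''G'' ''g'') one))"
          using rg gh GW[OF gh(1)] GW[OF gh(2)] n_less_W Wb a by simp
      next
        assume "\<not> holds (mem r a) (Conj (Eq (cell ''G'' ''g1'') one) (Eq (cell ''G'' ''g'') one))"
        then have "\<not> {?g, ?h} \<subseteq> sole_succs A (d L1)" using sole rg a by auto
        then have "\<forall>B'. base_set V A B' \<longrightarrow> d.blind_single B' L1 L2"
          using d.blind_single_all[OF d(3) bl B(1)] B(2) dC by auto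
        then show "lin Skip r a 1 ?Q2" using base I X B(1) b1 a by (intro lin_Skip) auto
      next
        assume "holds (mem r a) (Conj (Eq (cell ''G'' ''g1'') one) (Eq (cell ''G'' ''g'') one))"
        then have ss: "{?g, ?h} \<subseteq> sole_succs A (d L1)" using sole rg a by auto
        let ?B' = "swap ?g ?h B"
        have B': "base_set V A ?B'" using d.swapped_base[OF d(3) bl B(1) _ ss] B(2) dC by simp
        have ne: "?g \<noteq> ?h"
        proof (cases "Suc L1 = N")
          case True
          then have "?h = d 0" using d.c_closed by simp
          then show ?thesis using d.c_eq_iff[of "L1 - 1" 0] True N_ge_3 by auto
        next
          case False
          then show ?thesis using d.c_eq_iff[of "L1 - 1" "Suc L1"] L by auto
        qed
        let ?a' = "a0(''X'' := (a0 ''X'')(?g := Suc 0 - a0 ''X'' ?g, ?h := Suc 0 - a0 ''X'' ?h))"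
        have X': "marked ?B' ?a'" by (rule marked_swap[OF X gh(3,4) ne])
        have K': "known ?B' ?a'" by (rule known_remark[OF K X'])
        have fr': "frame d L1 L2 ?s ?a'" using fr by (simp add: frame_def)
        have XW: "a0 ''X'' ?g \<le> W" "a0 ''X'' ?h \<le> W" using X gh Wb by (auto simp: marked_def)
        have sw: "lin swap_marks r a (tm swap_marks) (\<lambda>r' a'. r' = r \<and> a' = ?a')"
          by (rule lin_wp) (use rg gh n_less_W XW a ne Wb in \<open>simp add: swap_marks_def\<close>)
        have rs: "r ''s'' = ?s" using base I by blast
        have all: "\<forall>B''. base_set V A B'' \<longrightarrow> d.blind_single B'' L1 L2" if "d.blind_single ?B' L1 L2"
          using d.blind_single_all[OF d(3) bl B(1)] B(2) dC that by auto
        have good: "basis V A ?B'" if "\<not> d.blind_single ?B' L1 L2"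
          using d.basis_single_sink[OF d(3) ds B' that] .
        have "lin test_single r ?a' (k_walk_both + tm judge_single) ?Q2"
        proof (rule lin_mono[OF runs_test_single[where d = d and ?L1.0 = L1 and ?L2.0 = L2 and s = ?s and B = ?B' and ?r0.0 = r, OF fr' K' rs B'] order_refl])
          fix r2 a2
          assume J: "a2 = ?a' \<and> walked d L1 L2 ?B' r2 \<and> eq_off walk_regs r r2 \<and>
            r2 ''b'' = (if d.blind_single ?B' L1 L2 then 1 else 0)"
          have "inp r2 a0" "r2 ''k'' = 0" "r2 ''s'' = ?s"
            using base[of r] I J by (auto simp: eq_off_def walk_regs_def inp_def)
          then show "?Q2 r2 a2" using J X' B' all good by auto
        qed
        then show "lin (Seq swap_marks test_single) r a (tm swap_marks + (k_walk_both + tm judge_single)) ?Q2"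
          by (intro lin_Seq[OF sw]) simp
      qed
      show "lin (Seq retry_single (Branch (Eq (Reg ''b'') one) (mark ''s'') Skip)) r a
        ((1 + cond_cost (Conj (Eq (cell ''G'' ''g1'') one) (Eq (cell ''G'' ''g'') one)) +
          (tm swap_marks + (k_walk_both + tm judge_single)) + 1) +
        tm (Branch (Eq (Reg ''b'') one) (mark ''s'') Skip)) decided"
      proof (rule lin_Seq[OF retry], rule lin_wp)
        fix r a assume J: "?Q2 r a"
        have ins: "decided r (a(''X'' := (a ''X'')(?s := Suc 0)))" if S: "?all S a" for S
        proof -
          have "basis V A (insert ?s S)" using d.basis_sink[OF d(3)] S d(2) by auto
          then show ?thesis using J marked_insert[of S a ?s] S sC(3) by (auto simp: decided_def)
        qed
        show "wp W (Branch (Eq (Reg ''b'') one) (mark ''s'') Skip) decided r a"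
          using J ins Wb by (auto simp: mark_def decided_def)
      qed
    qed
  qed
qed

definition k_double :: nat where
  "k_double = tm (block [Assign ''s'' (Reg ''y''), Assign ''t'' (Reg ''w''), Assign ''b'' (Num 0)]) +
    ((1 + cond_cost (Eq (cell ''G'' ''s'') (Num 2)) + (k_walk_both + tm judge_double) + 1) +
      tm (Branch (Eq (Reg ''b'') one) (mark ''s'') Skip))"

lemma runs_try_double:
  assumes K: "known B a0" and B: "base_set V A B" and H: "heights B (a0 ''H'')"
    and st: "r0 x = s" "r0 y = t" "s \<in> sinks" "t \<in> sinks" "s \<noteq> t"
    and xy: "x \<notin> {''s'', ''t'', ''b''}" "y \<notin> {''s'', ''t'', ''b''}"
  shows "lin (try_double x y) r0 a0 k_double (\<lambda>r a. eq_off (walk_regs \<union> {''s'', ''t''}) r0 r \<and>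
    (r ''b'' = 1 \<and> a = a0(''X'' := (a0 ''X'')(s := Suc 0)) \<and>
      (\<exists>d L1 L2. frame d L1 L2 s a0 \<and> oriented_ring.blind_double A N d B L1 L2) \<or>
     r ''b'' = 0 \<and> a = a0 \<and> (preds A s \<subseteq> C \<longrightarrow>
      (\<exists>d L1 L2. frame d L1 L2 s a0 \<and> \<not> oriented_ring.blind_double A N d B L1 L2))))"
proof -
  have sC: "s \<in> C" "s < n" "t \<in> C" "t < n" using st C_less by (auto simp: sinks_in_def)
  have rp: "ring_preds a0" and G: "a0 ''G'' s = card (preds A s)" using K sC by (auto simp: known_def)
  have c2: "card (preds A s \<inter> C) = 2" using sinks_iff[OF sC(1)] st(3) by blast
  have g2: "a0 ''G'' s = 2 \<longleftrightarrow> preds A s \<subseteq> C"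
  proof
    assume "a0 ''G'' s = 2"
    then have "card (preds A s \<inter> C) = card (preds A s)" using G c2 by simp
    then have "preds A s \<inter> C = preds A s" using preds_bound(3)[of A s] by (intro card_subset_eq) auto
    then show "preds A s \<subseteq> C" by blast
  next
    assume "preds A s \<subseteq> C"
    then have "preds A s = preds A s \<inter> C" by blast
    then show "a0 ''G'' s = 2" using G c2 by simp
  qed
  have Wb: "Suc 0 \<le> W" "2 \<le> W" "s \<le> W" "t \<le> W" "a0 ''G'' s \<le> W"
    using n_less_W n_ge_3 sC G preds_bound(2)[of A s] by auto
  let ?E = "\<lambda>r. eq_off (walk_regs \<union> {''s'', ''t''}) r0 r"
  let ?Q1 = "\<lambda>r a. a = a0 \<and> ?E r \<and> r ''s'' = s \<and> r ''t'' = t \<and> r ''b'' = 0"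
  let ?yes = "\<exists>d L1 L2. frame d L1 L2 s a0 \<and> oriented_ring.blind_double A N d B L1 L2"
  let ?no = "preds A s \<subseteq> C \<longrightarrow> (\<exists>d L1 L2. frame d L1 L2 s a0 \<and> \<not> oriented_ring.blind_double A N d B L1 L2)"
  let ?Q2 = "\<lambda>r a. a = a0 \<and> ?E r \<and> r ''s'' = s \<and> (r ''b'' = 1 \<and> ?yes \<or> r ''b'' = 0 \<and> ?no)"
  \<comment> \<open>Costs do not depend on register names, so both calls share
    \<open>k_double\<close>.\<close>
  have tmb: "tm (block [Assign ''s'' (Reg x), Assign ''t'' (Reg y), Assign ''b'' (Num 0)]) =
      tm (block [Assign ''s'' (Reg ''y''), Assign ''t'' (Reg ''w''), Assign ''b'' (Num 0)])" by simp
  have 1: "lin (block [Assign ''s'' (Reg x), Assign ''t'' (Reg y), Assign ''b'' (Num 0)]) r0 a0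
      (tm (block [Assign ''s'' (Reg ''y''), Assign ''t'' (Reg ''w''), Assign ''b'' (Num 0)])) ?Q1"
    unfolding tmb[symmetric] by (rule lin_wp) (use st xy Wb in \<open>simp add: walk_regs_def\<close>)
  have 2: "lin (Branch (Eq (cell ''G'' ''s'') (Num 2)) test_double Skip) r a
      (1 + cond_cost (Eq (cell ''G'' ''s'') (Num 2)) + (k_walk_both + tm judge_double) + 1) ?Q2" if I: "?Q1 r a" for r a
  proof (rule lin_Branch)
    show "cond_fits W (mem r a) (Eq (cell ''G'' ''s'') (Num 2))" using I Wb by simp
  next
    assume "\<not> holds (mem r a) (Eq (cell ''G'' ''s'') (Num 2))"
    then have "\<not> preds A s \<subseteq> C" using g2 I by simp
    then show "lin Skip r a 1 ?Q2" using I by (intro lin_Skip) simp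
  next
    assume "holds (mem r a) (Eq (cell ''G'' ''s'') (Num 2))"
    then have sub: "preds A s \<subseteq> C" using g2 I by simp
    obtain d L1 L2 where fr: "frame d L1 L2 s a0" by (rule frame_exists[OF st(3) sub rp])
    have a: "a = a0" "r ''s'' = s" "r ''t'' = t" using I by auto
    show "lin test_double r a (k_walk_both + tm judge_double) ?Q2" unfolding a(1)
    proof (rule lin_mono[OF runs_test_double[OF fr K a(2) B st(4) _ a(3) H] order_refl])
      fix r' a'
      assume J: "a' = a0 \<and> eq_off walk_regs r r' \<and> r' ''b'' = (if oriented_ring.blind_double A N d B L1 L2 then 1 else 0)"
      have "?E r'" "r' ''s'' = s" using I J by (auto simp: eq_off_def walk_regs_def)
      then show "?Q2 r' a'" using J fr by (cases "oriented_ring.blind_double A N d B L1 L2") auto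
    qed (use st in simp)
  qed
  show ?thesis
    unfolding try_double_def k_double_def
  proof (rule lin_Seq[OF 1], rule lin_Seq[OF 2], assumption, rule lin_wp)
    fix r a assume "?Q2 r a"
    then show "wp W (Branch (Eq (Reg ''b'') one) (mark ''s'') Skip) (\<lambda>r a. ?E r \<and>
      (r ''b'' = 1 \<and> a = a0(''X'' := (a0 ''X'')(s := Suc 0)) \<and> ?yes \<or> r ''b'' = 0 \<and> a = a0 \<and> ?no)) r a"
      using Wb by (auto simp: mark_def)
  qed
qed

lemma runs_decide_double:
  assumes inp: "inp r0 a0" "r0 ''k'' = 0" and K: "known B a0" and H: "heights B (a0 ''H'')"
    and B: "base_set V A B" "ring_averse A C B" and yw: "sinks = {r0 ''y'', r0 ''w''}" "r0 ''y'' \<noteq> r0 ''w''"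
  shows "lin decide_double r0 a0 (k_double + (1 + cond_cost (Eq (Reg ''b'') one) + 1 + k_double)) decided"
proof -
  let ?y = "r0 ''y''" and ?w = "r0 ''w''"
  have s: "?y \<in> sinks" "?w \<in> sinks" using yw by auto
  have sV: "?y \<in> V" "?w \<in> V" using s C_V by (auto simp: sinks_in_def)
  have X: "marked B a0" using K by (simp add: known_def)
  let ?E = "\<lambda>r. eq_off (walk_regs \<union> {''s'', ''t''}) r0 r"
  let ?yes = "\<lambda>s. \<exists>d L1 L2. frame d L1 L2 s a0 \<and> oriented_ring.blind_double A N d B L1 L2"
  let ?no = "\<lambda>s. preds A s \<subseteq> C \<longrightarrow> (\<exists>d L1 L2. frame d L1 L2 s a0 \<and> \<not> oriented_ring.blind_double A N d B L1 L2)"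
  have base: "inp r a" "r ''k'' = 0" "r ''y'' = ?y" "r ''w'' = ?w" if E: "?E r" and "a = a0 \<or> a = a0(''X'' := h)" for r a h
  proof -
    have "inp r a0" using inp eq_offD[OF E] by (simp add: inp_def walk_regs_def)
    then show "inp r a" using that(2) by auto
    show "r ''k'' = 0" "r ''y'' = ?y" "r ''w'' = ?w" using inp(2) eq_offD[OF E] by (simp_all add: walk_regs_def)
  qed
  have yes: "decided r (a0(''X'' := (a0 ''X'')(s := Suc 0)))" if E: "?E r" and yes: "?yes s" and sV: "s \<in> V" for r s
  proof -
    obtain d L1 L2 where d: "frame d L1 L2 s a0" "oriented_ring.blind_double A N d B L1 L2" using yes by blast
    then have d': "coords d" "d 0 = s" "oriented_ring.ring_sink A N d L1 L2" by (auto simp: frame_def)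
    interpret d: oriented_ring V A f N d using d'(1) by (simp add: coords_def)
    have dC: "d.C = C" using coords_C[OF d'(1)] .
    \<comment> \<open>\<open>below\<close> refers to the ring only as a set, so heights computed
      once are valid in every frame.\<close>
    have "d.below = below"
      unfolding d.below_def below_def fun_eq_iff dC by simp
    then have Hd: "d.heights B (a0 ''H'')" using H by (simp add: d.heights_def heights_def)
    have "basis V A (insert s B)"
      using d.basis_sink[OF d'(3) B(1)] d.blind_double_all[OF d'(3) d(2) B(1) _ _ Hd] B(2) dC d'(2) by simp
    then show ?thesis using base[OF E, of "a0(''X'' := (a0 ''X'')(s := Suc 0))"] marked_insert[OF X sV]
      by (auto simp: decided_def)
  qed
  have no: "decided r a0" if "?E r" "?no ?y" "?no ?w" for r
  proof -
    have "basis V A B"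
      by (rule basis_two_sinks[OF B(1) yw]) (use that(2,3) in \<open>unfold frame_def, blast\<close>)
    then show ?thesis using base[OF that(1), of a0] X by (auto simp: decided_def)
  qed
  let ?Q1 = "\<lambda>r a. ?E r \<and> (r ''b'' = 1 \<and> a = a0(''X'' := (a0 ''X'')(?y := Suc 0)) \<and> ?yes ?y \<or>
     r ''b'' = 0 \<and> a = a0 \<and> ?no ?y)"
  have 1: "lin (try_double ''y'' ''w'') r0 a0 k_double ?Q1"
    by (rule runs_try_double[OF K B(1) H]) (use s yw in auto)
  show ?thesis
    unfolding decide_double_def
  proof (rule lin_Seq[OF 1], rule lin_Branch)
    fix r a assume I: "?Q1 r a"
    show "cond_fits W (mem r a) (Eq (Reg ''b'') one)" using I n_less_W n_ge_3 by auto
    show "lin Skip r a 1 decided" if "holds (mem r a) (Eq (Reg ''b'') one)"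
      by (rule lin_Skip) (use I that yes[of r ?y] sV in auto)
    show "lin (try_double ''w'' ''y'') r a k_double decided" if "\<not> holds (mem r a) (Eq (Reg ''b'') one)"
    proof -
      have J: "?E r" "a = a0" "?no ?y" using I that by auto
      have rb: "r ''w'' = ?w" "r ''y'' = ?y" using base[OF J(1), of a0] by auto
      show ?thesis unfolding J(2)
      proof (rule lin_mono[OF runs_try_double[OF K B(1) H rb(1) rb(2) s(2) s(1)] order_refl])
        fix r' a'
        assume P: "eq_off (walk_regs \<union> {''s'', ''t''}) r r' \<and>
          (r' ''b'' = 1 \<and> a' = a0(''X'' := (a0 ''X'')(?w := Suc 0)) \<and> ?yes ?w \<or> r' ''b'' = 0 \<and> a' = a0 \<and> ?no ?w)"
        have "?E r'" using J(1) P by (simp add: eq_off_def)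
        then show "decided r' a'" using P yes[of r' ?w] no[of r'] J(3) sV by blast
      qed (use yw in auto)
    qed
  qed
qed

definition k_decide :: nat where
  "k_decide = 1 + cond_cost (Eq (Reg ''c'') (Num 0)) + tm decide_cycle +
     (1 + cond_cost (Eq (Reg ''c'') one) + k_single +
       (1 + cond_cost (Eq (Reg ''c'') (Num 2)) + (k_double + (1 + cond_cost (Eq (Reg ''b'') one) + 1 + k_double)) + 1))"

lemma runs_decide:
  assumes inp: "inp r0 a0" "r0 ''k'' = 0" and T: "tables B a0" and X: "marked B a0" and S: "surveyed B r0"
    and rp: "ring_preds a0" and B: "base_set V A B" "ring_averse A C B"
  shows "lin decide r0 a0 k_decide decided"
proof -
  have K: "known B a0" using T X rp by (simp add: known_def tables_def)
  have H: "heights B (a0 ''H'')" using T by (simp add: tables_def)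
  have c: "r0 ''c'' = card sinks" using S by (simp add: surveyed_def)
  have fin: "finite sinks" by (rule finite_subset[OF _ finite_V]) (use C_V in \<open>auto simp: sinks_in_def\<close>)
  have "card sinks \<le> card V" using finite_V C_V by (intro card_mono) (auto simp: sinks_in_def)
  then have cW: "r0 ''c'' \<le> W" "Suc 0 \<le> W" "2 \<le> W" using c V n_less_W n_ge_3 by auto
  show ?thesis
    unfolding decide_def k_decide_def
  proof (intro lin_Branch)
    assume "holds (mem r0 a0) (Eq (Reg ''c'') (Num 0))"
    then have "sinks = {}" using c fin by simp
    then show "lin decide_cycle r0 a0 (tm decide_cycle) decided" by (rule runs_decide_cycle[OF inp T X S B])
  next
    assume "holds (mem r0 a0) (Eq (Reg ''c'') one)"
    then have "card sinks = 1" "r0 ''w'' \<in> sinks" using c S by (auto simp: surveyed_def)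
    then have "sinks = {r0 ''w''}" by (metis card_1_singletonE singletonD)
    then show "lin decide_single r0 a0 k_single decided" by (rule runs_decide_single[OF inp K B])
  next
    assume "holds (mem r0 a0) (Eq (Reg ''c'') (Num 2))"
    then have c2: "card sinks = 2" "r0 ''w'' \<in> sinks" "r0 ''y'' \<in> sinks" "r0 ''y'' \<noteq> r0 ''w''"
      using c S by (auto simp: surveyed_def)
    then have "{r0 ''y'', r0 ''w''} = sinks" using fin by (intro card_subset_eq) auto
    then show "lin decide_double r0 a0 (k_double + (1 + cond_cost (Eq (Reg ''b'') one) + 1 + k_double)) decided"
      using runs_decide_double[OF inp K H B] c2(4) by simp
  next
    assume "\<not> holds (mem r0 a0) (Eq (Reg ''c'') (Num 0))" "\<not> holds (mem r0 a0) (Eq (Reg ''c'') one)"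
      "\<not> holds (mem r0 a0) (Eq (Reg ''c'') (Num 2))"
    then have "3 \<le> card sinks" using c by simp
    then have "basis V A B" using basis_many_sinks[OF B(1)] by blast
    then show "lin Skip r0 a0 1 decided" using inp X by (intro lin_Skip) (auto simp: decided_def)
  qed (use cW in simp_all)
qed

lemma runs_emit:
  assumes inp: "inp r0 a0" "r0 ''k'' = 0" and X: "marked S a0"
  shows "lin (For ''v'' ''n'' emit) r0 a0 (tm emit + 10)
    (\<lambda>r a. map (a ''out'') [0..<r ''k''] = filter (\<lambda>v. v \<in> S) [0..<n])"
proof -
  let ?q = "\<lambda>k. filter (\<lambda>v. v \<in> S) [0..<k]"
  let ?I = "\<lambda>k r a. inp r a \<and> a ''X'' = a0 ''X'' \<and> r ''k'' = length (?q k) \<and> (\<forall>j<length (?q k). a ''out'' j = ?q k ! j)"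
  have "runs W (For ''v'' ''n'' emit) r0 a0 ((tm emit + 10) * Suc n) (\<lambda>r a. ?I n r a \<and> r ''v'' = n)"
  proof (rule runs_For[where I = ?I])
    show "r0 ''n'' = n" using inp by (simp add: inp_def)
    show "n < W" by (rule n_less_W)
    show "?I 0 (r0(''v'' := 0)) a0" using inp by simp
  next
    fix k r a assume k: "k < n" "r ''v'' = k" "r ''n'' = n" and I: "?I k r a"
    have "length (?q k) \<le> k" using length_filter_le[of _ "[0..<k]"] by simp
    then have Wb: "length (?q k) \<le> W" "Suc (length (?q k)) \<le> W" "k \<le> W" "Suc 0 \<le> W" using k n_less_W by auto
    have Xk: "a ''X'' k = Suc 0 \<longleftrightarrow> k \<in> S" "a ''X'' k \<le> W" using X I k Wb by (auto simp: marked_def)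
    show "wp W emit (\<lambda>r' a'. r' ''v'' = k \<and> r' ''n'' = n \<and> ?I (Suc k) (r'(''v'' := Suc k)) a') r a"
      unfolding emit_def using k I Xk Wb by (auto simp: nth_append less_Suc_eq)
  qed simp
  then have "lin (For ''v'' ''n'' emit) r0 a0 (tm emit + 10) (\<lambda>r a. ?I n r a \<and> r ''v'' = n)"
    by (rule lin_of_runs) simp
  then show ?thesis
  proof (rule lin_mono[OF _ order_refl])
    fix r a assume "?I n r a \<and> r ''v'' = n"
    then show "map (a ''out'') [0..<r ''k''] = filter (\<lambda>v. v \<in> S) [0..<n]"
      by (intro nth_equalityI) auto
  qed
qed

end

text \<open>The constants of the locale mention none of its parameters. They export without
  arguments and are fixed before the input, which makes the time bound uniform.\<close>

definition k_total :: nat where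
  "k_total = ring_input.k_find + (ring_input.k_base + (ring_input.k_survey + (ring_input.k_decide + (tm emit + 10))))"

lemma (in ring_input) runs_basis_program:
  assumes inp: "inp r0 a0" and reg0: "\<And>x. x \<noteq> ''n'' \<Longrightarrow> x \<noteq> ''m'' \<Longrightarrow> r0 x = 0"
    and arr0: "\<And>x v. x \<noteq> ''tail'' \<Longrightarrow> x \<noteq> ''head'' \<Longrightarrow> a0 x v = 0"
  shows "lin basis_program r0 a0 k_total
    (\<lambda>r a. \<exists>S. basis V A S \<and> map (a ''out'') [0..<r ''k''] = filter (\<lambda>v. v \<in> S) [0..<n])"
proof -
  let ?X1 = "{''D'', ''M'', ''G'', ''P'', ''O''}" and ?Y1 = "{''i'', ''u'', ''v'', ''x'', ''r'', ''p''}"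
  let ?X2 = "{''L'', ''H'', ''X''}" and ?Y2 = "{''i'', ''v'', ''u'', ''q''}"
  let ?Q1 = "\<lambda>r a. inp r a \<and> (\<exists>q. ring_found q r a) \<and> in_arcs a \<and> eq_off ?X1 a0 a \<and> eq_off ?Y1 r0 r"
  let ?B = "\<lambda>B r a. inp r a \<and> base_set V A B \<and> ring_averse A C B \<and> marked B a \<and> tables B a"
  let ?Q2 = "\<lambda>r a. (\<exists>B. ?B B r a) \<and> eq_off (?X1 \<union> ?X2) a0 a \<and> eq_off (?Y1 \<union> ?Y2) r0 r"
  let ?Q3 = "\<lambda>r a. r ''k'' = 0 \<and> (\<exists>B. ?B B r a \<and> ring_preds a \<and> surveyed B r)"
  let ?Q4 = "\<lambda>r a. \<exists>S. basis V A S \<and> map (a ''out'') [0..<r ''k''] = filter (\<lambda>v. v \<in> S) [0..<n]"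
  have 1: "lin find_ring r0 a0 k_find ?Q1"
    by (rule runs_find_ring[OF inp]) (simp_all add: reg0 arr0)
  have 2: "lin choose_base r a k_base ?Q2" if I: "?Q1 r a" for r a
  proof -
    have a: "eq_off ?X1 a0 a" and r: "eq_off ?Y1 r0 r" using I by blast+
    obtain q where q: "ring_found q r a" using I by blast
    show ?thesis
    proof (rule lin_mono[OF runs_choose_base[OF _ q] order_refl])
      fix r' a'
      assume J: "inp r' a' \<and> eq_off ?X2 a a' \<and> eq_off ?Y2 r r' \<and>
        (\<exists>B. base_set V A B \<and> ring_averse A C B \<and> marked B a' \<and> tables B a')"
      moreover have "eq_off (?X1 \<union> ?X2) a0 a'" "eq_off (?Y1 \<union> ?Y2) r0 r'"
        using I J unfolding eq_off_def by (metis UnI1 UnI2)+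
      ultimately show "?Q2 r' a'" by blast
    qed (use I in \<open>simp_all add: eq_offD[OF a] arr0\<close>)
  qed
  have 3: "lin survey_ring r a k_survey ?Q3" if I: "?Q2 r a" for r a
  proof -
    obtain B where B: "?B B r a" using I by blast
    have a: "eq_off (?X1 \<union> ?X2) a0 a" and r: "eq_off (?Y1 \<union> ?Y2) r0 r" using I by blast+
    have k: "r ''k'' = 0" using eq_offD[OF r, of "''k''"] reg0 by simp
    show ?thesis
    proof (rule lin_mono[OF runs_survey_ring[of r a B] order_refl])
      fix r' a'
      assume "inp r' a' \<and> ring_preds a' \<and> surveyed B r' \<and> tables B a' \<and> marked B a' \<and> r' ''k'' = r ''k''"
      then show "?Q3 r' a'" using B k by auto
    qed (use B in \<open>simp_all add: eq_offD[OF a] eq_offD[OF r] arr0 reg0\<close>)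
  qed
  have 4: "lin decide r a k_decide decided" if "?Q3 r a" for r a
    using that runs_decide by blast
  have 5: "lin (For ''v'' ''n'' emit) r a (tm emit + 10) ?Q4" if I: "decided r a" for r a
  proof -
    obtain S where S: "inp r a" "r ''k'' = 0" "marked S a" "basis V A S" using I unfolding decided_def by blast
    show ?thesis by (rule lin_mono[OF runs_emit[OF S(1-3)] order_refl]) (use S(4) in blast)
  qed
  show ?thesis
    unfolding basis_program_def k_total_def
    by (rule lin_Seq[OF 1], rule lin_Seq[OF 2], assumption, rule lin_Seq[OF 3], assumption,
        rule lin_Seq[OF 4], assumption, erule 5)
qed

theorem theorem7:
  shows "\<exists>(P :: com) (c :: nat).
    \<forall>(n :: nat) (U :: nat pair_pre_digraph) (D :: nat pair_pre_digraph) (as :: (nat \<times> nat) list).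
      unicyclic U \<and> orientation U D \<and> pverts D = {..<n} \<and> distinct as \<and> set as = parcs D \<longrightarrow>
      (\<exists>t s. exec (c * (n + length as)) P (ram_input n as) t s \<and>
             t \<le> c * (n + length as) \<and>
             distinct (ram_output s) \<and> metric_basis D (set (ram_output s)))"
proof (rule exI[of _ basis_program], rule exI[of _ "2 * k_total + 10"], intro allI impI)
  fix n :: nat and U D :: "nat pair_pre_digraph" and as :: "(nat \<times> nat) list"
  \<comment> \<open>The same number bounds words and time. Doubling \<open>k_total\<close> absorbs
    the \<open>Suc\<close> in the multiples of \<open>Suc (n + length as)\<close>, and the
    \<open>10\<close> meets the demand of \<open>ring_input\<close> on the word size.\<close>
  let ?W = "(2 * k_total + 10) * (n + length as)"
  assume *: "unicyclic U \<and> orientation U D \<and> pverts D = {..<n} \<and> distinct as \<and> set as = parcs D"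
  then have D: "pair_wf_digraph D" and "\<exists>f N c. oriented_ring (pverts D) (parcs D) f N c"
    using unicyclic_orientation_ring by blast+
  then obtain f N c where "oriented_ring (pverts D) (parcs D) f N c" by blast
  then interpret oriented_ring "pverts D" "parcs D" f N c .
  interpret ring_input "pverts D" "parcs D" f N c n ?W as
    by unfold_locales (use * in \<open>auto simp: add_mult_distrib\<close>)
  let ?s = "ram_input n as"
  have s: "?s = mem (reg ?s) (arr ?s)" by simp
  have "runs ?W basis_program (reg ?s) (arr ?s) (k_total * Suc (n + length as))
    (\<lambda>r a. \<exists>S. basis (pverts D) (parcs D) S \<and> map (a ''out'') [0..<r ''k''] = filter (\<lambda>v. v \<in> S) [0..<n])"
    by (rule runs_basis_program) (simp_all add: inp_def ram_input_def)
  then obtain t r a S where run: "exec ?W basis_program ?s t (mem r a)" "t \<le> k_total * Suc (n + length as)"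
    and S: "basis (pverts D) (parcs D) S" "map (a ''out'') [0..<r ''k''] = filter (\<lambda>v. v \<in> S) [0..<n]"
    unfolding runs_def using s by auto
  have "Suc (n + length as) \<le> 2 * (n + length as)" using n_ge_3 by simp
  then have "k_total * Suc (n + length as) \<le> k_total * (2 * (n + length as))" by (rule mult_le_mono2)
  also have "\<dots> \<le> ?W" by (simp add: algebra_simps)
  finally have t: "t \<le> ?W" using run(2) by simp
  have "S \<subseteq> {..<n}" using S(1) V by (simp add: basis_def resolves_def)
  then have "set (ram_output (mem r a)) = S" "distinct (ram_output (mem r a))"
    unfolding ram_output_def using S(2) by auto
  moreover have "metric_basis D S"
    using S(1) resolving_set_iff_resolves[OF D] by (simp add: basis_def metric_basis_def)
  ultimately show "\<exists>t s. exec ?W basis_program (ram_input n as) t s \<and> t \<le> ?W \<and>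
      distinct (ram_output s) \<and> metric_basis D (set (ram_output s))"
    using run(1) t by auto
qed

end
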